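(* (1) Let $n\in\mathbb{N}_0$ and $\alpha>0$. If $F\in\mathcal{W}_{\psi_n^\alpha}$, then $\tau_n^\alpha(g)F\in\mathcal{W}_{\psi_n^\alpha}$ for every $g\in PSL(2,\mathbb{R})$. (2) Conversely, let $s\in\mathbb{R}$ and let $\sigma_s$ be the projective unitary group representation of $PSL(2,\mathbb{R})$ on $L^2(\mathbb{C}^+,\mu)$ of the form $$\sigma_s(g)F(z)=\left(\frac{|cz+d|}{cz+d}\right)^sF(g(z)).$$ If $\psi\in\mathcal{A}$ is a nonzero admissible function and $\sigma_s$ leaves $\mathcal{W}_\psi$ invariant, then for some $n\in\mathbb{N}_0$ and $C\in\mathbb{C}\setminus\{0\}$ we have $$\psi=C\psi_n^\alpha,\qquad\text{where }\alpha=s-2n-1.$$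
   Context: $\mathbb{C}^+=\{z=x+iy: x\in\mathbb{R},\,y>0\}$ with the measure $d\mu(z)=y^{-2}\,dx\,dy$. An element $g\in PSL(2,\mathbb{R})=SL(2,\mathbb{R})/\{\pm I\}$, represented by a matrix with rows $(a,b)$ and $(c,d)$, acts on $\mathbb{C}^+$ by $g(z)=\frac{az+b}{cz+d}$. $\mathcal{H}^2(\mathbb{C}^+)$ is the Hardy space of analytic functions on $\mathbb{C}^+$ with norm $\|f\|_2=\sup_{y>0}(\int_{\mathbb{R}}|f(x+iy)|^2dx)^{1/2}<\infty$, identified via boundary values with the $f\in L^2(\mathbb{R})$ whose Fourier transform $\widehat f(\xi)=\mathcal{F}f(\xi)=\int_{\mathbb{R}}f(t)e^{-i\xi t}dt$ vanishes for $\xi<0$. For $z=x+iy\in\mathbb{C}^+$, $\pi(z)\psi(t)=y^{-1/2}\psi((t-x)/y)$. For $\psi\in\mathcal{H}^2(\mathbb{C}^+)$, $C_\psi=\int_0^\infty|\widehat\psi(\omega)|^2\frac{d\omega}{\omega}$, and $\psi$ is admissible if $C_\psi<\infty$. The wavelet transform is $W_\psi f(z)=\langle f,\pi(z)\psi\rangle_{L^2(\mathbb{R})}$, and $\mathcal{W}_\psi=W_\psi(\mathcal{H}^2(\mathbb{C}^+))\subset L^2(\mathbb{C}^+,\mu)$. $\mathcal{A}$ is the set of $f\in\mathcal{H}^2(\mathbb{C}^+)$ such that $\widehat f(\xi)\in\mathbb{R}$ for all $\xi$, and $\widehat f\,\widehat f\,'\in L^1(\mathbb{R}^+)$ and $\xi\,\widehat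 f\,\widehat f\,''\in L^1(\mathbb{R}^+)$. $\psi_n^\alpha\in\mathcal{H}^2(\mathbb{C}^+)$ is defined by $(\mathcal{F}\psi_n^\alpha)(\xi)=\xi^{\alpha/2}e^{-\xi}L_n^\alpha(2\xi)$ for $\xi>0$, where $L_n^\alpha(t)=\sum_{k=0}^n(-1)^k\binom{n+\alpha}{n-k}\frac{t^k}{k!}$. For $g\in PSL(2,\mathbb{R})$ and $F\in L^2(\mathbb{C}^+,\mu)$, $\tau_n^\alpha(g)F(z)=\left(\frac{|cz+d|}{cz+d}\right)^{2n+\alpha+1}F(g(z))$. Powers are defined by the principal branch (argument in $(-\pi,\pi]$); another choice of the matrix representing $g$ changes $\tau_n^\alpha(g)$ and $\sigma_s(g)$ only by a unimodular constant. "$\sigma_s$ leaves $\mathcal{W}_\psi$ invariant" means $\sigma_s(g)F\in\mathcal{W}_\psi$ for all $F\in\mathcal{W}_\psi$ and $g\in PSL(2,\mathbb{R})$. *)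

theory Defs
  imports "HOL-Analysis.Analysis"
begin

text \<open>
  Elements of an \<open>L\<^sup>2\<close> space are represented by functions; equality of elements is always
  written out as equality almost everywhere.
\<close>

definition L2_space :: "'a measure \<Rightarrow> ('a \<Rightarrow> complex) set" where
  "L2_space M = {f \<in> borel_measurable M. integrable M (\<lambda>x. (cmod (f x))\<^sup>2)}"

definition L2_inner :: "(real \<Rightarrow> complex) \<Rightarrow> (real \<Rightarrow> complex) \<Rightarrow> complex" where
  "L2_inner f g = (LINT t|lborel. f t * cnj (g t))"

definition upper :: "complex set" where
  "upper = {z. 0 < Im z}"

definition mu :: "complex measure" where
  "mu = density (restrict_space lborel upper) (\<lambda>z. ennreal (1 / (Im z)\<^sup>2))"


text \<open>
  The Fourier transform on \<open>L\<^sup>2\<close>: the (by Plancherel existing, almost everywhere unique)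
  \<open>L\<^sup>2\<close> limit of the truncated Fourier integrals.
\<close>

definition truncated_fourier :: "real \<Rightarrow> (real \<Rightarrow> complex) \<Rightarrow> real \<Rightarrow> complex" where
  "truncated_fourier R f \<xi> = (LINT t:{-R..R}|lborel. f t * exp (- (\<i> * of_real (\<xi> * t))))"

definition is_fourier :: "(real \<Rightarrow> complex) \<Rightarrow> (real \<Rightarrow> complex) \<Rightarrow> bool" where
  "is_fourier f g \<longleftrightarrow> g \<in> L2_space lborel \<and>
     ((\<lambda>R. \<integral>\<^sup>+ \<xi>. ennreal ((cmod (g \<xi> - truncated_fourier R f \<xi>))\<^sup>2) \<partial>lborel) \<longlongrightarrow> 0) at_top"

definition fourier :: "(real \<Rightarrow> complex) \<Rightarrow> real \<Rightarrow> complex" where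
  "fourier f = (SOME g. is_fourier f g)"


text \<open>
  The Hardy space, in terms of boundary values: \<open>f\<close> is the \<open>L\<^sup>2\<close> boundary value of an analytic
  function \<open>F\<close> of finite Hardy norm, and its Fourier transform vanishes on the negative half-line.
  By the Paley--Wiener theorem each of the two conditions implies the other; both are recorded, so
  that this is the Hardy space together with its identification with a subspace of \<open>L\<^sup>2\<close>.
\<close>

definition analytic_hardy :: "(complex \<Rightarrow> complex) set" where
  "analytic_hardy = {F. F holomorphic_on upper \<and>
     (SUP y\<in>{0<..}. \<integral>\<^sup>+ x. ennreal ((cmod (F (Complex x y)))\<^sup>2) \<partial>lborel) < \<infinity>}"

definition has_boundary_value :: "(complex \<Rightarrow> complex) \<Rightarrow> (real \<Rightarrow> complex) \<Rightarrow> bool" where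
  "has_boundary_value F f \<longleftrightarrow>
     ((\<lambda>y. \<integral>\<^sup>+ x. ennreal ((cmod (F (Complex x y) - f x))\<^sup>2) \<partial>lborel) \<longlongrightarrow> 0) (at_right 0)"

definition H2 :: "(real \<Rightarrow> complex) set" where
  "H2 = {f \<in> L2_space lborel. (\<exists>F\<in>analytic_hardy. has_boundary_value F f) \<and>
                              (AE \<xi> in lborel. \<xi> < 0 \<longrightarrow> fourier f \<xi> = 0)}"


definition wavelet_rep :: "complex \<Rightarrow> (real \<Rightarrow> complex) \<Rightarrow> real \<Rightarrow> complex" where
  "wavelet_rep z \<psi> t = of_real ((Im z) powr (- 1 / 2)) * \<psi> ((t - Re z) / Im z)"

definition wavelet_transform :: "(real \<Rightarrow> complex) \<Rightarrow> (real \<Rightarrow> complex) \<Rightarrow> complex \<Rightarrow> complex" where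
  "wavelet_transform \<psi> f z = L2_inner f (wavelet_rep z \<psi>)"

definition admissibility_const :: "(real \<Rightarrow> complex) \<Rightarrow> ennreal" where
  "admissibility_const \<psi> = (\<integral>\<^sup>+ \<omega>\<in>{0<..}. ennreal ((cmod (fourier \<psi> \<omega>))\<^sup>2 / \<omega>) \<partial>lborel)"

definition admissible :: "(real \<Rightarrow> complex) \<Rightarrow> bool" where
  "admissible \<psi> \<longleftrightarrow> \<psi> \<in> H2 \<and> admissibility_const \<psi> < \<infinity>"

text \<open>The values of the representatives outside \<^const>\<open>upper\<close> play no role.\<close>

definition wavelet_space :: "(real \<Rightarrow> complex) \<Rightarrow> (complex \<Rightarrow> complex) set" where
  "wavelet_space \<psi> = {F \<in> L2_space mu. \<exists>f\<in>H2. AE z in mu. F z = wavelet_transform \<psi> f z}"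


text \<open>
  The derivatives of a Fourier transform, which is only determined almost everywhere, are taken
  in the weak sense on the positive half-line: \<open>h\<close> is the locally absolutely continuous
  representative and \<open>h'\<close> its (locally integrable) derivative.
\<close>

definition weak_deriv_pos :: "(real \<Rightarrow> real) \<Rightarrow> (real \<Rightarrow> real) \<Rightarrow> bool" where
  "weak_deriv_pos h h' \<longleftrightarrow>
     (\<forall>a b. 0 < a \<and> a < b \<longrightarrow>
        set_integrable lborel {a..b} h' \<and> h b - h a = (LINT x:{a..b}|lborel. h' x))"

definition class_A :: "(real \<Rightarrow> complex) set" where
  "class_A = {f \<in> H2. \<exists>h h' h''.
     (AE \<xi> in lborel. 0 < \<xi> \<longrightarrow> fourier f \<xi> = of_real (h \<xi>)) \<and>
     weak_deriv_pos h h' \<and> weak_deriv_pos h' h'' \<and>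
     set_integrable lborel {0<..} (\<lambda>\<xi>. h \<xi> * h' \<xi>) \<and>
     set_integrable lborel {0<..} (\<lambda>\<xi>. \<xi> * h \<xi> * h'' \<xi>)}"


definition laguerre :: "nat \<Rightarrow> real \<Rightarrow> real \<Rightarrow> real" where
  "laguerre n \<alpha> t =
     (\<Sum>k=0..n. (-1) ^ k * ((of_nat n + \<alpha>) gchoose (n - k)) * t ^ k / fact k)"

definition is_psi :: "nat \<Rightarrow> real \<Rightarrow> (real \<Rightarrow> complex) \<Rightarrow> bool" where
  "is_psi n \<alpha> p \<longleftrightarrow> p \<in> H2 \<and>
     (AE \<xi> in lborel. 0 < \<xi> \<longrightarrow>
        fourier p \<xi> = of_real (\<xi> powr (\<alpha> / 2) * exp (- \<xi>) * laguerre n \<alpha> (2 * \<xi>)))"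

text \<open>
  The function below is meaningful only if \<^const>\<open>is_psi\<close> is satisfiable, which is the case for
  \<open>\<alpha> > -1\<close>, but not for every real \<open>\<alpha>\<close>.
\<close>

definition psi :: "nat \<Rightarrow> real \<Rightarrow> real \<Rightarrow> complex" where
  "psi n \<alpha> = (SOME p. is_psi n \<alpha> p)"


text \<open>
  \<open>PSL(2,\<real>)\<close> is handled through representing matrices: all matrices of determinant one.
\<close>

definition SL2R :: "(real^2^2) set" where
  "SL2R = {g. det g = 1}"

definition mob :: "real^2^2 \<Rightarrow> complex \<Rightarrow> complex" where
  "mob g = moebius (of_real (g$1$1)) (of_real (g$1$2)) (of_real (g$2$1)) (of_real (g$2$2))"

definition cocycle_denom :: "real^2^2 \<Rightarrow> complex \<Rightarrow> complex" where
  "cocycle_denom g z = of_real (g$2$1) * z + of_real (g$2$2)"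

text \<open>Complex \<open>powr\<close> is the principal branch, with argument in \<open>(-\<pi>, \<pi>]\<close>.\<close>

definition sigma :: "real \<Rightarrow> real^2^2 \<Rightarrow> (complex \<Rightarrow> complex) \<Rightarrow> complex \<Rightarrow> complex" where
  "sigma s g F z =
     (of_real (cmod (cocycle_denom g z)) / cocycle_denom g z) powr of_real s * F (mob g z)"

definition tau :: "nat \<Rightarrow> real \<Rightarrow> real^2^2 \<Rightarrow> (complex \<Rightarrow> complex) \<Rightarrow> complex \<Rightarrow> complex" where
  "tau n \<alpha> = sigma (2 * of_nat n + \<alpha> + 1)"

definition sigma_invariant :: "real \<Rightarrow> (complex \<Rightarrow> complex) set \<Rightarrow> bool" where
  "sigma_invariant s W \<longleftrightarrow> (\<forall>F\<in>W. \<forall>g\<in>SL2R. sigma s g F \<in> W)"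

end

theory Submission
  imports Defs "HOL-Probability.Probability" "HOL-Complex_Analysis.Complex_Analysis"
begin

text \<open>
  The Fourier transform identifies the Hardy space with \<open>L\<^sup>2(0,\<infinity>)\<close>, and the whole argument takes place
  there. For a wavelet with transform \<open>h\<close> the wavelet space consists of the functions \<open>wt h \<phi>\<close>, where
  \<open>wt h \<phi> (x + iy)\<close> is \<open>\<surd>y / 2\<pi>\<close> times the integral of \<open>\<phi>(\<xi>) h(y\<xi>)\<^sup>* e\<^bsup>ix\<xi>\<^esup>\<close> over the half-line. If \<open>h\<close> is
  admissible, \<open>wt h\<close> is an isometry into \<open>L\<^sup>2(\<mu>)\<close> up to a constant (\<open>wt_isometry\<close>), and its values are
  continuous functions, so that identities between them hold everywhere as soon as they hold almost
  everywhere.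

  Invariance for the Laguerre wavelets. For \<open>\<phi>(\<xi>) = \<xi>\<^bsup>\<alpha>/2\<^esup> e\<^bsup>-i w\<^sup>* \<xi>\<^esup>\<close> with \<open>w\<close> in the upper half-plane the
  transform is elementary: a product of powers of \<open>Im z\<close>, of \<open>(z - w)\<^sup>*\<close> and of \<open>z - w\<^sup>*\<close>. These three
  expressions transform by factors under a simultaneous fractional linear change of \<open>z\<close> and \<open>w\<close>, whence
  the operator belonging to \<open>g\<close> sends the function belonging to \<open>g(w)\<close> to a multiple of the one
  belonging to \<open>w\<close> (\<open>wt_lagf_exponential_covariant\<close>). The functions \<open>\<phi>\<close> span a dense subspace, and the wavelet
  space is closed; this gives \<open>tau_invariant\<close>.

  The converse. Put \<open>F = wt h h\<close>. For a rotation \<open>g\<close> about \<open>i\<close> invariance gives \<open>\<sigma>\<^sub>s(g) F = wt h \<phi>\<close> with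
  \<open>\<parallel>\<phi>\<parallel> = \<parallel>h\<parallel>\<close>, and the value at \<open>i\<close> shows that the inner product of \<open>\<phi>\<close> and \<open>h\<close> is as large as the
  Cauchy--Schwarz inequality permits. So \<open>\<phi>\<close> is a multiple of \<open>h\<close>, and \<open>F\<close> is an eigenvector of all rotations
  (\<open>stabilizer_eigenvector\<close>): up to an explicit phase it depends only on the hyperbolic distance to \<open>i\<close>.
  Such a function integrates to zero against every divergence along the field that generates
  the rotations (\<open>radial_orthogonal\<close>). For suitable densities along this field this is a linear relation
  between three integrals of \<open>F(x + iy)\<close> against \<open>y\<^bsup>b-3/2\<^esup> (1 + y + ix)\<^bsup>-a-b\<^esup>\<close> (\<open>Jint_relation\<close>). By Fourier inversion in \<open>x\<close> such an
  integral is \<open>m(a) m(b)\<^sup>* / \<Gamma>(a + b)\<close>, where \<open>m\<close> is the Mellin transform of \<open>h(\<xi>) e\<^bsup>-\<xi>\<^esup>\<close> (\<open>Jint_wt\<close>). Since \<open>h\<close> is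
  real, \<open>m(b)\<close> is real, and fixing one \<open>b\<close> with \<open>m(b) \<noteq> 0\<close> leaves a recurrence

    \<open>(a\<^sup>2 - \<nu>\<^sup>2) m(a) = (2a + 1 - s) m(a + 1)\<close>  with \<open>Re \<nu> \<ge> 0\<close>,

  for real \<open>a \<ge> 3\<close> and then, by analytic continuation, for \<open>Re a > 0\<close>. In the limit \<open>a \<rightarrow> \<nu>\<close> the left-hand side
  disappears (\<open>recurrence_at_exponent\<close>), so that the numbers \<open>m(\<nu> + j)\<close> for \<open>j \<ge> 1\<close> are determined by
  the recurrence. Unless \<open>s = 2\<nu> + 2n + 1\<close> for some \<open>n\<close> they all vanish, and then \<open>h = 0\<close>, since these moments
  determine \<open>h\<close> (\<open>moments_complete\<close>). In the remaining case they are determined up to one factor, and the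
  moments of the Laguerre function with \<open>\<alpha> = 2\<nu>\<close> obey the same recurrence, by Vandermonde's
  convolution (\<open>mom_lagf\<close>). Hence \<open>h\<close> is a multiple of that function.
\<close>

no_notation fps_nth (infixl "$" 75)

section \<open>Square-integrable functions\<close>

definition nrm2 :: "'a measure \<Rightarrow> ('a \<Rightarrow> complex) \<Rightarrow> real" where
  "nrm2 M f = (LINT x|M. (cmod (f x))\<^sup>2)"

definition ip :: "'a measure \<Rightarrow> ('a \<Rightarrow> complex) \<Rightarrow> ('a \<Rightarrow> complex) \<Rightarrow> complex" where
  "ip M f g = (LINT x|M. f x * cnj (g x))"

lemma L2_measurable: "f \<in> L2_space M \<Longrightarrow> f \<in> borel_measurable M"
  by (simp add: L2_space_def)

lemma L2_integrable_square: "f \<in> L2_space M \<Longrightarrow> integrable M (\<lambda>x. (cmod (f x))\<^sup>2)"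
  by (simp add: L2_space_def)

lemma nrm2_nonneg [simp]: "0 \<le> nrm2 M f"
  by (simp add: nrm2_def)

lemma L2_nn_integral:
  assumes "f \<in> L2_space M"
  shows "(\<integral>\<^sup>+x. ennreal ((cmod (f x))\<^sup>2) \<partial>M) = ennreal (nrm2 M f)"
  unfolding nrm2_def by (intro nn_integral_eq_integral L2_integrable_square assms) auto

lemma L2_spaceI:
  assumes "f \<in> borel_measurable M" "(\<integral>\<^sup>+x. ennreal ((cmod (f x))\<^sup>2) \<partial>M) < \<infinity>"
  shows "f \<in> L2_space M"
proof -
  have "integrable M (\<lambda>x. (cmod (f x))\<^sup>2)"
    using assms by (intro integrableI_bounded) auto
  then show ?thesis using assms by (simp add: L2_space_def)
qed

lemma nrm2_eqI:
  assumes "(\<integral>\<^sup>+x. ennreal ((cmod (f x))\<^sup>2) \<partial>M) = ennreal c" "0 \<le> c" "f \<in> borel_measurable M"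
  shows "nrm2 M f = c"
  using assms unfolding nrm2_def by (subst integral_eq_nn_integral) auto

lemma L2_cong_AE:
  assumes "f \<in> L2_space M" "g \<in> borel_measurable M" "AE x in M. f x = g x"
  shows "g \<in> L2_space M"
proof -
  have "integrable M (\<lambda>x. (cmod (g x))\<^sup>2)"
    by (rule integrable_cong_AE_imp[OF L2_integrable_square[OF assms(1)]]) (use assms in auto)
  then show ?thesis using assms by (simp add: L2_space_def)
qed

lemma nrm2_cong_AE:
  assumes "f \<in> borel_measurable M" "g \<in> borel_measurable M" "AE x in M. f x = g x"
  shows "nrm2 M f = nrm2 M g"
  unfolding nrm2_def by (rule integral_cong_AE) (use assms in auto)

lemma L2_integrable_mult:
  assumes "f \<in> L2_space M" "g \<in> L2_space M"
  shows "integrable M (\<lambda>x. f x * g x)"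
proof (rule Bochner_Integration.integrable_bound)
  show "integrable M (\<lambda>x. (cmod (f x))\<^sup>2 + (cmod (g x))\<^sup>2)"
    by (intro Bochner_Integration.integrable_add L2_integrable_square assms)
  show "(\<lambda>x. f x * g x) \<in> borel_measurable M"
    using assms[THEN L2_measurable] by measurable
  show "AE x in M. norm (f x * g x) \<le> norm ((cmod (f x))\<^sup>2 + (cmod (g x))\<^sup>2)"
  proof (intro AE_I2)
    fix x
    have "2 * (cmod (f x) * cmod (g x)) \<le> (cmod (f x))\<^sup>2 + (cmod (g x))\<^sup>2"
      using sum_squares_bound[of "cmod (f x)" "cmod (g x)"] by (simp add: mult.assoc)
    moreover have "0 \<le> cmod (f x) * cmod (g x)" by simp
    ultimately show "norm (f x * g x) \<le> norm ((cmod (f x))\<^sup>2 + (cmod (g x))\<^sup>2)"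
      unfolding norm_mult real_norm_def by linarith
  qed
qed

lemma borel_measurable_cnj [measurable (raw)]:
  "f \<in> borel_measurable M \<Longrightarrow> (\<lambda>x. cnj (f x)) \<in> borel_measurable M"
  by (rule measurable_compose[OF _ borel_measurable_continuous_onI]) (auto intro: continuous_intros)

lemma L2_cnj: "f \<in> L2_space M \<Longrightarrow> (\<lambda>x. cnj (f x)) \<in> L2_space M"
  by (auto simp: L2_space_def)

lemma nrm2_cnj [simp]: "nrm2 M (\<lambda>x. cnj (f x)) = nrm2 M f"
  by (simp add: nrm2_def)

lemma L2_integrable_ip:
  assumes "f \<in> L2_space M" "g \<in> L2_space M"
  shows "integrable M (\<lambda>x. f x * cnj (g x))"
  by (rule L2_integrable_mult[OF assms(1) L2_cnj[OF assms(2)]])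

lemma cmod_add_squared_le: "(cmod (a + b))\<^sup>2 \<le> 2 * (cmod a)\<^sup>2 + 2 * (cmod b)\<^sup>2"
proof -
  have "(cmod (a + b))\<^sup>2 \<le> (cmod a + cmod b)\<^sup>2"
    by (intro power_mono norm_triangle_ineq) auto
  also have "\<dots> \<le> 2 * (cmod a)\<^sup>2 + 2 * (cmod b)\<^sup>2"
    using sum_squares_bound[of "cmod a" "cmod b"] by (simp add: power2_sum)
  finally show ?thesis .
qed

lemma L2_add:
  assumes "f \<in> L2_space M" "g \<in> L2_space M"
  shows "(\<lambda>x. f x + g x) \<in> L2_space M"
proof -
  have "integrable M (\<lambda>x. (cmod (f x + g x))\<^sup>2)"
  proof (rule Bochner_Integration.integrable_bound)
    show "integrable M (\<lambda>x. 2 * (cmod (f x))\<^sup>2 + 2 * (cmod (g x))\<^sup>2)"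
      by (intro Bochner_Integration.integrable_add integrable_mult_right L2_integrable_square assms)
    show "(\<lambda>x. (cmod (f x + g x))\<^sup>2) \<in> borel_measurable M"
      using assms[THEN L2_measurable] by measurable
    show "AE x in M. norm ((cmod (f x + g x))\<^sup>2) \<le> norm (2 * (cmod (f x))\<^sup>2 + 2 * (cmod (g x))\<^sup>2)"
      by (intro AE_I2, simp only: real_norm_def abs_power2, rule order_trans[OF cmod_add_squared_le abs_ge_self])
  qed
  then show ?thesis using assms by (auto simp: L2_space_def)
qed

lemma L2_scale:
  assumes "f \<in> L2_space M"
  shows "(\<lambda>x. c * f x) \<in> L2_space M"
  using assms by (auto simp: L2_space_def norm_mult power_mult_distrib)

lemma L2_zero: "(\<lambda>x. 0) \<in> L2_space M"
  by (auto simp: L2_space_def)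

lemma L2_diff:
  assumes "f \<in> L2_space M" "g \<in> L2_space M"
  shows "(\<lambda>x. f x - g x) \<in> L2_space M"
  using L2_add[OF assms(1) L2_scale[OF assms(2), of "-1"]] by simp

lemma nrm2_scale: "nrm2 M (\<lambda>x. c * f x) = (cmod c)\<^sup>2 * nrm2 M f"
  by (simp add: nrm2_def norm_mult power_mult_distrib)

lemma nrm2_minus_commute: "nrm2 M (\<lambda>x. f x - g x) = nrm2 M (\<lambda>x. g x - f x)"
  by (simp add: nrm2_def norm_minus_commute)

lemma ip_self: "ip M f f = of_real (nrm2 M f)"
  unfolding ip_def nrm2_def by (simp flip: integral_complex_of_real complex_norm_square)

lemma ip_cnj: "ip M g f = cnj (ip M f g)"
  using Bochner_Integration.integral_cnj[of M "\<lambda>x. f x * cnj (g x)"]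
  by (simp add: ip_def mult.commute)

lemma ip_add_left:
  assumes "f \<in> L2_space M" "g \<in> L2_space M" "k \<in> L2_space M"
  shows "ip M (\<lambda>x. f x + g x) k = ip M f k + ip M g k"
  unfolding ip_def
  by (simp add: distrib_right Bochner_Integration.integral_add L2_integrable_ip assms)

lemma ip_diff_left:
  assumes "f \<in> L2_space M" "g \<in> L2_space M" "k \<in> L2_space M"
  shows "ip M (\<lambda>x. f x - g x) k = ip M f k - ip M g k"
  unfolding ip_def
  by (simp add: left_diff_distrib Bochner_Integration.integral_diff L2_integrable_ip assms)

lemma ip_scale_right: "ip M f (\<lambda>x. c * k x) = cnj c * ip M f k"
  unfolding ip_def by (simp add: mult.left_commute)

lemma ip_add_right:
  assumes "f \<in> L2_space M" "g \<in> L2_space M" "k \<in> L2_space M"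
  shows "ip M k (\<lambda>x. f x + g x) = ip M k f + ip M k g"
  using ip_add_left[OF assms] by (metis complex_cnj_add ip_cnj)

lemma ip_diff_right:
  assumes "f \<in> L2_space M" "g \<in> L2_space M" "k \<in> L2_space M"
  shows "ip M k (\<lambda>x. f x - g x) = ip M k f - ip M k g"
  using ip_diff_left[OF assms] by (metis complex_cnj_diff ip_cnj)

lemma ip_cong_AE:
  assumes "f \<in> borel_measurable M" "g \<in> borel_measurable M" "f' \<in> borel_measurable M"
    "g' \<in> borel_measurable M" "AE x in M. f x = f' x" "AE x in M. g x = g' x"
  shows "ip M f g = ip M f' g'"
  unfolding ip_def by (rule integral_cong_AE) (use assms in auto)

lemma nrm2_add:
  assumes "f \<in> L2_space M" "g \<in> L2_space M"
  shows "nrm2 M (\<lambda>x. f x + g x) = nrm2 M f + 2 * Re (ip M f g) + nrm2 M g"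
proof -
  have "complex_of_real (nrm2 M (\<lambda>x. f x + g x)) = ip M f f + ip M f g + (ip M g f + ip M g g)"
    using assms by (simp add: ip_add_left ip_add_right L2_add flip: ip_self)
  then have "nrm2 M (\<lambda>x. f x + g x) = Re (ip M f f + ip M f g + (ip M g f + ip M g g))"
    by (metis Re_complex_of_real)
  then show ?thesis by (simp add: ip_self ip_cnj[of M g f])
qed

lemma nrm2_diff:
  assumes "f \<in> L2_space M" "g \<in> L2_space M"
  shows "nrm2 M (\<lambda>x. f x - g x) = nrm2 M f - 2 * Re (ip M f g) + nrm2 M g"
  using nrm2_add[OF assms(1) L2_scale[OF assms(2), of "-1"]]
    ip_scale_right[of M f "-1" g] nrm2_scale[of M "-1" g] by simp

lemma nrm2_add_le:
  assumes "f \<in> L2_space M" "g \<in> L2_space M"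
  shows "nrm2 M (\<lambda>x. f x + g x) \<le> 2 * nrm2 M f + 2 * nrm2 M g"
proof -
  have "0 \<le> nrm2 M (\<lambda>x. f x - g x)" by simp
  then show ?thesis by (simp add: nrm2_add nrm2_diff assms)
qed

lemma nrm2_triangle:
  assumes "f \<in> L2_space M" "g \<in> L2_space M" "k \<in> L2_space M"
  shows "nrm2 M (\<lambda>x. f x - k x) \<le> 2 * nrm2 M (\<lambda>x. f x - g x) + 2 * nrm2 M (\<lambda>x. g x - k x)"
  using nrm2_add_le[OF L2_diff[OF assms(1,2)] L2_diff[OF assms(2,3)]] by simp

lemma nrm2_eq_0:
  assumes "f \<in> L2_space M" "nrm2 M f = 0"
  shows "AE x in M. f x = 0"
  using assms integral_nonneg_eq_0_iff_AE[OF L2_integrable_square[OF assms(1)]]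
  by (auto simp: nrm2_def)

lemma nrm2_diff_eq_0:
  assumes "f \<in> L2_space M" "g \<in> L2_space M" "nrm2 M (\<lambda>x. f x - g x) = 0"
  shows "AE x in M. f x = g x"
  using nrm2_eq_0[OF L2_diff[OF assms(1,2)] assms(3)] by simp

text \<open>The usual trick: \<open>f\<close> minus its projection to the line of \<open>g\<close> has nonnegative norm.\<close>

lemma L2_Cauchy_Schwarz:
  assumes "f \<in> L2_space M" "g \<in> L2_space M"
  shows "(cmod (ip M f g))\<^sup>2 \<le> nrm2 M f * nrm2 M g"
proof (cases "nrm2 M g = 0")
  case True
  then have "AE x in M. g x = 0" by (rule nrm2_eq_0[OF assms(2)])
  then have "ip M f g = ip M f (\<lambda>_. 0)"
    using assms[THEN L2_measurable] by (intro ip_cong_AE) auto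
  then show ?thesis by (simp add: ip_def)
next
  case False
  define c where "c = ip M f g / of_real (nrm2 M g)"
  have pos: "nrm2 M g > 0" using False by (simp add: order_less_le)
  have 1: "nrm2 M (\<lambda>x. f x - c * g x) =
      nrm2 M f - 2 * Re (cnj c * ip M f g) + (cmod c)\<^sup>2 * nrm2 M g"
    using nrm2_diff[OF assms(1) L2_scale[OF assms(2), of c]] by (simp add: ip_scale_right nrm2_scale)
  have 2: "cnj c * ip M f g = of_real ((cmod (ip M f g))\<^sup>2 / nrm2 M g)"
    unfolding c_def using complex_norm_square[of "ip M f g"] by (simp add: mult.commute)
  have 3: "(cmod c)\<^sup>2 * nrm2 M g = (cmod (ip M f g))\<^sup>2 / nrm2 M g"
    unfolding c_def using pos by (simp add: norm_divide power_divide field_simps power2_eq_square)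
  have "0 \<le> nrm2 M (\<lambda>x. f x - c * g x)" by simp
  then have "(cmod (ip M f g))\<^sup>2 / nrm2 M g \<le> nrm2 M f"
    unfolding 1 2 3 by simp
  then show ?thesis using pos by (simp add: field_simps)
qed

lemma ip_tendsto:
  assumes "\<And>k. f k \<in> L2_space M" "g \<in> L2_space M" "v \<in> L2_space M"
    "((\<lambda>k. nrm2 M (\<lambda>x. f k x - g x)) \<longlongrightarrow> 0) F"
  shows "((\<lambda>k. ip M (f k) v) \<longlongrightarrow> ip M g v) F"
proof -
  have "((\<lambda>k. sqrt (nrm2 M (\<lambda>x. f k x - g x) * nrm2 M v)) \<longlongrightarrow> sqrt (0 * nrm2 M v)) F"
    by (intro tendsto_intros assms)
  then have lim0: "((\<lambda>k. sqrt (nrm2 M (\<lambda>x. f k x - g x) * nrm2 M v)) \<longlongrightarrow> 0) F" by simp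
  have "((\<lambda>k. ip M (f k) v - ip M g v) \<longlongrightarrow> 0) F"
  proof (rule Lim_null_comparison[OF _ lim0], intro always_eventually allI)
    fix k
    have "(cmod (ip M (\<lambda>x. f k x - g x) v))\<^sup>2 \<le> nrm2 M (\<lambda>x. f k x - g x) * nrm2 M v"
      by (intro L2_Cauchy_Schwarz L2_diff assms)
    then show "norm (ip M (f k) v - ip M g v) \<le> sqrt (nrm2 M (\<lambda>x. f k x - g x) * nrm2 M v)"
      using assms by (simp add: ip_diff_left real_le_rsqrt)
  qed
  then show ?thesis by (simp add: LIM_zero_iff)
qed

lemma nrm2_tendsto:
  assumes "\<And>k. f k \<in> L2_space M" "g \<in> L2_space M"
    "((\<lambda>k. nrm2 M (\<lambda>x. f k x - g x)) \<longlongrightarrow> 0) F"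
  shows "((\<lambda>k. nrm2 M (f k)) \<longlongrightarrow> nrm2 M g) F"
proof -
  have e: "nrm2 M (f k) = nrm2 M (\<lambda>x. f k x - g x) + 2 * Re (ip M (f k) g) - nrm2 M g" for k
    by (subst nrm2_diff) (auto simp: assms)
  have "((\<lambda>k. nrm2 M (\<lambda>x. f k x - g x) + 2 * Re (ip M (f k) g) - nrm2 M g) \<longlongrightarrow>
      0 + 2 * Re (ip M g g) - nrm2 M g) F"
    by (intro tendsto_intros assms ip_tendsto)
  then show ?thesis by (simp add: ip_self flip: e)
qed

lemma summable_of_weighted_squares:
  fixes d :: "nat \<Rightarrow> complex"
  assumes "(\<Sum>k. ennreal (2^k * (cmod (d k))\<^sup>2)) \<noteq> \<infinity>"
  shows "summable d"
proof -
  define S where "S = (\<Sum>k. ennreal (2^k * (cmod (d k))\<^sup>2))"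
  define C where "C = enn2real S"
  have "S < top" using assms unfolding S_def by (simp only: less_top infinity_ennreal_def)
  then have C0: "(\<Sum>k. ennreal (2^k * (cmod (d k))\<^sup>2)) = ennreal C" "0 \<le> C"
    unfolding S_def[symmetric] C_def by auto
  have C: "2^k * (cmod (d k))\<^sup>2 \<le> C" for k
  proof -
    have "(\<Sum>i\<in>{k}. ennreal (2^i * (cmod (d i))\<^sup>2)) \<le> (\<Sum>k. ennreal (2^k * (cmod (d k))\<^sup>2))"
      by (rule sum_le_suminf) auto
    then have "ennreal (2^k * (cmod (d k))\<^sup>2) \<le> ennreal C" unfolding C0 by simp
    then show ?thesis using C0 by (simp only: ennreal_le_iff)
  qed
  have bd: "norm (d k) \<le> sqrt C * (1 / sqrt 2)^k" for k
  proof -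
    have "(cmod (d k))\<^sup>2 \<le> C * (1/2)^k"
      using C[of k] by (simp add: field_simps power_divide)
    then have "cmod (d k) \<le> sqrt (C * (1/2)^k)" by (rule real_le_rsqrt)
    then show ?thesis by (simp only: real_sqrt_mult real_sqrt_power real_sqrt_divide real_sqrt_one)
  qed
  have "summable (\<lambda>k. sqrt C * (1 / sqrt 2)^k)"
    by (intro summable_mult summable_geometric) simp
  then show "summable d"
    by (rule summable_comparison_test[rotated]) (intro exI[of _ 0] allI impI bd)
qed

text \<open>
  A subsequence with rapidly decreasing increments converges almost everywhere, and its limit is
  the limit in norm by Fatou's lemma.
\<close>

theorem Riesz_Fischer:
  assumes f: "\<And>k. f k \<in> L2_space M"
    and cauchy: "\<And>e. 0 < e \<Longrightarrow> \<exists>N. \<forall>m\<ge>N. \<forall>n\<ge>N. nrm2 M (\<lambda>x. f m x - f n x) < e"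
  obtains g where "g \<in> L2_space M" "(\<lambda>k. nrm2 M (\<lambda>x. f k x - g x)) \<longlonglongrightarrow> 0"
proof -
  have [measurable]: "f k \<in> borel_measurable M" for k using f by (rule L2_measurable)
  have "\<exists>r::nat\<Rightarrow>nat. \<forall>k. (\<forall>m\<ge>r k. \<forall>n\<ge>r k. nrm2 M (\<lambda>x. f m x - f n x) < (1/4)^k) \<and> r k < r (Suc k)"
  proof (rule dependent_nat_choice)
    show "\<exists>N. \<forall>m\<ge>N. \<forall>n\<ge>N. nrm2 M (\<lambda>x. f m x - f n x) < (1/4)^0"
      by (rule cauchy) simp
    fix N k
    obtain N' where "\<forall>m\<ge>N'. \<forall>n\<ge>N'. nrm2 M (\<lambda>x. f m x - f n x) < (1/4)^Suc k"
      using cauchy[of "(1/4)^Suc k"] by auto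
    then show "\<exists>y. (\<forall>m\<ge>y. \<forall>n\<ge>y. nrm2 M (\<lambda>x. f m x - f n x) < (1/4)^Suc k) \<and> N < y"
      by (intro exI[of _ "max N' (Suc N)"]) auto
  qed
  then obtain r where r: "\<And>k m n. m \<ge> r k \<Longrightarrow> n \<ge> r k \<Longrightarrow> nrm2 M (\<lambda>x. f m x - f n x) < (1/4)^k"
    and rS: "\<And>k. r k < r (Suc k)" by metis
  have mono: "strict_mono r" using rS by (rule strict_monoI_Suc)
  define d where "d k x = f (r (Suc k)) x - f (r k) x" for k x
  have [measurable]: "d k \<in> borel_measurable M" for k unfolding d_def[abs_def] by measurable
  have dL2: "d k \<in> L2_space M" for k unfolding d_def[abs_def] by (intro L2_diff f)
  have dn: "nrm2 M (d k) \<le> (1/4)^k" for k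
    unfolding d_def[abs_def] using r[of k "r (Suc k)" "r k"] rS[of k] by simp
  have "(\<integral>\<^sup>+x. (\<Sum>k. ennreal (2^k * (cmod (d k x))\<^sup>2)) \<partial>M) =
      (\<Sum>k. \<integral>\<^sup>+x. ennreal (2^k * (cmod (d k x))\<^sup>2) \<partial>M)"
    by (rule nn_integral_suminf) measurable
  also have "\<dots> = (\<Sum>k. ennreal (2^k * nrm2 M (d k)))"
    using dL2 by (simp add: ennreal_mult nn_integral_cmult L2_nn_integral)
  also have "\<dots> \<le> (\<Sum>k. ennreal ((1/2)^k))"
  proof (intro suminf_le ennreal_leI)
    fix k show "2^k * nrm2 M (d k) \<le> (1/2)^k"
      using mult_left_mono[OF dn[of k], of "2^k"] by (simp add: power_mult_distrib[symmetric])
  qed auto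
  also have "\<dots> = ennreal 2"
    by (subst suminf_ennreal2) (auto simp: suminf_geometric)
  finally have "(\<integral>\<^sup>+x. (\<Sum>k. ennreal (2^k * (cmod (d k x))\<^sup>2)) \<partial>M) \<noteq> \<infinity>"
    by (auto simp: top_unique)
  then have "AE x in M. (\<Sum>k. ennreal (2^k * (cmod (d k x))\<^sup>2)) \<noteq> \<infinity>"
    by (intro nn_integral_noteq_infinite) measurable
  then have conv: "AE x in M. convergent (\<lambda>k. f (r k) x)"
  proof (rule AE_mp, intro AE_I2 impI)
    fix x assume elim: "(\<Sum>k. ennreal (2^k * (cmod (d k x))\<^sup>2)) \<noteq> \<infinity>"
    have "summable (\<lambda>k. d k x)" by (rule summable_of_weighted_squares[OF elim])
    then have "convergent (\<lambda>n. \<Sum>k<n. d k x)"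
      by (simp add: summable_iff_convergent)
    moreover have "(\<Sum>k<n. d k x) = f (r n) x - f (r 0) x" for n
      unfolding d_def by (rule sum_lessThan_telescope)
    ultimately have "convergent (\<lambda>n. f (r n) x - f (r 0) x)" by simp
    then have "convergent (\<lambda>n. (f (r n) x - f (r 0) x) + f (r 0) x)"
      by (intro convergent_add convergent_const)
    then show "convergent (\<lambda>k. f (r k) x)" by simp
  qed
  define g where "g x = lim (\<lambda>k. f (r k) x)" for x
  have [measurable]: "g \<in> borel_measurable M"
    unfolding g_def[abs_def] by (rule borel_measurable_lim_metric) measurable
  have lim: "AE x in M. (\<lambda>k. f (r k) x) \<longlonglongrightarrow> g x"
    using conv by eventually_elim (simp add: g_def convergent_LIMSEQ_iff)
  have est: "(\<integral>\<^sup>+x. ennreal ((cmod (f m x - g x))\<^sup>2) \<partial>M) \<le> ennreal ((1/4)^k)" if "m \<ge> r k" for m k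
  proof -
    have "(\<integral>\<^sup>+x. ennreal ((cmod (f m x - g x))\<^sup>2) \<partial>M) =
        (\<integral>\<^sup>+x. liminf (\<lambda>j. ennreal ((cmod (f m x - f (r j) x))\<^sup>2)) \<partial>M)"
      using lim
    proof (intro nn_integral_cong_AE, eventually_elim)
      case (elim x)
      have "(\<lambda>j. ennreal ((cmod (f m x - f (r j) x))\<^sup>2)) \<longlonglongrightarrow> ennreal ((cmod (f m x - g x))\<^sup>2)"
        by (intro tendsto_intros elim)
      then show ?case by (intro lim_imp_Liminf[symmetric]) auto
    qed
    also have "\<dots> \<le> liminf (\<lambda>j. \<integral>\<^sup>+x. ennreal ((cmod (f m x - f (r j) x))\<^sup>2) \<partial>M)"
      by (rule nn_integral_liminf) measurable
    also have "\<dots> \<le> ennreal ((1/4)^k)"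
    proof (rule Liminf_le)
      show "\<forall>\<^sub>F j in sequentially. (\<integral>\<^sup>+x. ennreal ((cmod (f m x - f (r j) x))\<^sup>2) \<partial>M) \<le> ennreal ((1/4)^k)"
      proof (rule eventually_mono[OF eventually_ge_at_top[of k]])
        fix j assume "k \<le> j"
        then have "r k \<le> r j" using mono by (simp add: strict_mono_less_eq)
        then show "(\<integral>\<^sup>+x. ennreal ((cmod (f m x - f (r j) x))\<^sup>2) \<partial>M) \<le> ennreal ((1/4)^k)"
          using r[of k m "r j"] that L2_nn_integral[OF L2_diff[OF f[of m] f[of "r j"]]]
          by (simp add: ennreal_leI)
      qed
    qed auto
    finally show ?thesis .
  qed
  have dL: "(\<lambda>x. f m x - g x) \<in> L2_space M" if "m \<ge> r k" for m k
  proof (rule L2_spaceI)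
    show "(\<integral>\<^sup>+x. ennreal ((cmod (f m x - g x))\<^sup>2) \<partial>M) < \<infinity>"
      using est[OF that] by (rule le_less_trans) simp
  qed measurable
  have "(\<lambda>x. f (r 0) x - (f (r 0) x - g x)) \<in> L2_space M"
    by (rule L2_diff[OF f dL[of 0]]) simp
  then have gL: "g \<in> L2_space M" by simp
  have "(\<lambda>k. nrm2 M (\<lambda>x. f k x - g x)) \<longlonglongrightarrow> 0"
  proof (rule LIMSEQ_I)
    fix e :: real assume "0 < e"
    obtain k where k: "(1/4::real)^k < e"
      using real_arch_pow_inv[OF \<open>0 < e\<close>, of "1/4"] by auto
    have "nrm2 M (\<lambda>x. f m x - g x) \<le> (1/4)^k" if "m \<ge> r k" for m
      using est[OF that] unfolding L2_nn_integral[OF dL[OF that]] by (subst (asm) ennreal_le_iff) auto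
    then show "\<exists>no. \<forall>n\<ge>no. norm (nrm2 M (\<lambda>x. f n x - g x) - 0) < e"
      using k by (intro exI[of _ "r k"]) force
  qed
  with gL show ?thesis by (rule that)
qed

lemma nrm2_Cauchy:
  assumes f: "\<And>k. f k \<in> L2_space M" and g: "g \<in> L2_space M"
    and lim: "(\<lambda>k. nrm2 M (\<lambda>x. f k x - g x)) \<longlonglongrightarrow> 0" and e: "0 < e"
  shows "\<exists>N. \<forall>m\<ge>N. \<forall>n\<ge>N. nrm2 M (\<lambda>x. f m x - f n x) < e"
proof -
  obtain N where N: "\<And>k. k \<ge> N \<Longrightarrow> nrm2 M (\<lambda>x. f k x - g x) < e / 4"
    using LIMSEQ_D[OF lim, of "e/4"] e by auto
  have "nrm2 M (\<lambda>x. f m x - f n x) < e" if "m \<ge> N" "n \<ge> N" for m n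
    using nrm2_triangle[OF f[of m] g f[of n]] N[OF that(1)] N[OF that(2)]
      nrm2_minus_commute[of M g "f n"] by linarith
  then show ?thesis by blast
qed

text \<open>
  The projection theorem in the form in which it yields density: a minimising sequence for the
  distance to \<open>f\<close> is Cauchy by the parallelogram law, and its limit differs from \<open>f\<close> by a function
  orthogonal to the subspace.
\<close>

theorem L2_dense_subspace:
  assumes V: "V \<subseteq> L2_space M" "V \<noteq> {}"
    and add: "\<And>u v. u \<in> V \<Longrightarrow> v \<in> V \<Longrightarrow> (\<lambda>x. u x + v x) \<in> V"
    and scale: "\<And>c v. v \<in> V \<Longrightarrow> (\<lambda>x. c * v x) \<in> V"
    and orth: "\<And>g. g \<in> L2_space M \<Longrightarrow> (\<And>v. v \<in> V \<Longrightarrow> ip M g v = 0) \<Longrightarrow> AE x in M. g x = 0"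
    and f: "f \<in> L2_space M"
  obtains v where "\<And>k::nat. v k \<in> V" "(\<lambda>k. nrm2 M (\<lambda>x. v k x - f x)) \<longlonglongrightarrow> 0"
proof -
  define D where "D = (\<lambda>v. nrm2 M (\<lambda>x. f x - v x)) ` V"
  define d where "d = Inf D"
  have D: "D \<noteq> {}" "bdd_below D"
    using V unfolding D_def by (auto intro!: bdd_belowI[of _ 0])
  have VL: "v \<in> L2_space M" if "v \<in> V" for v using V that by auto
  have dle: "d \<le> nrm2 M (\<lambda>x. f x - v x)" if "v \<in> V" for v
    unfolding d_def by (rule cInf_lower) (use that D in \<open>auto simp: D_def\<close>)
  have "\<exists>v\<in>V. nrm2 M (\<lambda>x. f x - v x) < d + 1 / Suc k" for k
  proof -
    have "Inf D < d + 1 / Suc k" by (simp add: d_def)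
    then obtain t where "t \<in> D" "t < d + 1 / Suc k"
      using D by (auto simp: cInf_less_iff)
    then show ?thesis by (auto simp: D_def)
  qed
  then obtain v where v: "\<And>k. v k \<in> V" "\<And>k. nrm2 M (\<lambda>x. f x - v k x) < d + 1 / Suc k"
    by metis
  have vL: "v k \<in> L2_space M" for k using v VL by auto
  have par: "nrm2 M (\<lambda>x. v m x - v n x) \<le> 2 / Suc m + 2 / Suc n" for m n
  proof -
    let ?a = "\<lambda>x. f x - v n x" and ?b = "\<lambda>x. f x - v m x"
    have ab: "?a \<in> L2_space M" "?b \<in> L2_space M" using f vL by (auto intro: L2_diff)
    have 1: "nrm2 M (\<lambda>x. ?a x - ?b x) + nrm2 M (\<lambda>x. ?a x + ?b x) = 2 * nrm2 M ?a + 2 * nrm2 M ?b"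
      using nrm2_add[OF ab] nrm2_diff[OF ab] by simp
    have "(\<lambda>x. 1/2 * (v n x + v m x)) \<in> V" by (intro scale add v)
    from dle[OF this] have "d \<le> nrm2 M (\<lambda>x. (1/2) * (?a x + ?b x))"
      by (simp add: algebra_simps)
    also have "\<dots> = nrm2 M (\<lambda>x. ?a x + ?b x) / 4"
      by (subst nrm2_scale) (simp add: power2_eq_square norm_divide)
    finally have "4 * d \<le> nrm2 M (\<lambda>x. ?a x + ?b x)" by simp
    moreover have "(\<lambda>x. ?a x - ?b x) = (\<lambda>x. v m x - v n x)" by auto
    ultimately have "nrm2 M (\<lambda>x. v m x - v n x) + 4 * d \<le> 2 * nrm2 M ?a + 2 * nrm2 M ?b"
      using 1 by simp
    moreover have "2 * nrm2 M ?a \<le> 2 * d + 2 / Suc n" "2 * nrm2 M ?b \<le> 2 * d + 2 / Suc m"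
      using v(2)[of n] v(2)[of m] by auto
    ultimately show ?thesis by linarith
  qed
  have "\<exists>N. \<forall>m\<ge>N. \<forall>n\<ge>N. nrm2 M (\<lambda>x. v m x - v n x) < e" if "0 < e" for e
  proof -
    obtain N where N: "inverse (real (Suc N)) < e / 4" using reals_Archimedean[of "e/4"] \<open>0 < e\<close> by auto
    have s: "2 / Suc m < e / 2" if "m \<ge> N" for m
    proof -
      have "inverse (real (Suc m)) \<le> inverse (real (Suc N))" using that by (intro le_imp_inverse_le) auto
      moreover have "2 / real (Suc m) = 2 * inverse (real (Suc m))" by (rule divide_inverse)
      ultimately show ?thesis using N by linarith
    qed
    have "nrm2 M (\<lambda>x. v m x - v n x) < e" if "m \<ge> N" "n \<ge> N" for m n
      using par[of m n] s[OF that(1)] s[OF that(2)] by linarith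
    then show ?thesis by blast
  qed
  from Riesz_Fischer[of v M, OF vL this] obtain w where
    w: "w \<in> L2_space M" "(\<lambda>k. nrm2 M (\<lambda>x. v k x - w x)) \<longlonglongrightarrow> 0" by blast
  have "AE x in M. f x - w x = 0"
  proof (rule orth)
    show "(\<lambda>x. f x - w x) \<in> L2_space M" using f w by (intro L2_diff)
    fix u assume u: "u \<in> V"
    note uL = VL[OF u]
    have b: "(cmod (ip M (\<lambda>x. f x - v k x) u))\<^sup>2 \<le> nrm2 M u * (1 / Suc k)" for k
    proof (cases "nrm2 M u = 0")
      case True
      with L2_Cauchy_Schwarz[OF L2_diff[OF f vL] uL, of k] show ?thesis by simp
    next
      case False
      define I where "I = ip M (\<lambda>x. f x - v k x) u"
      define c where "c = I / of_real (nrm2 M u)"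
      have pos: "nrm2 M u > 0" using False by (simp add: order_less_le)
      have 1: "nrm2 M (\<lambda>x. (f x - v k x) - c * u x) =
          nrm2 M (\<lambda>x. f x - v k x) - 2 * Re (cnj c * I) + (cmod c)\<^sup>2 * nrm2 M u"
        using nrm2_diff[OF L2_diff[OF f vL] L2_scale[OF uL, of c], of k]
        by (simp add: ip_scale_right nrm2_scale I_def)
      have 2: "cnj c * I = of_real ((cmod I)\<^sup>2 / nrm2 M u)"
        unfolding c_def using complex_norm_square[of I] by (simp add: mult.commute)
      have 3: "(cmod c)\<^sup>2 * nrm2 M u = (cmod I)\<^sup>2 / nrm2 M u"
        unfolding c_def using pos by (simp add: norm_divide power_divide field_simps power2_eq_square)
      have "(\<lambda>x. v k x + c * u x) \<in> V" by (intro add scale v u)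
      from dle[OF this] have "d \<le> nrm2 M (\<lambda>x. (f x - v k x) - c * u x)"
        by (simp add: algebra_simps)
      with v(2)[of k] have "(cmod I)\<^sup>2 / nrm2 M u \<le> 1 / Suc k"
        unfolding 1 2 3 by simp
      then show ?thesis using pos by (simp add: I_def field_simps)
    qed
    have "(\<lambda>k. ip M (\<lambda>x. f x - v k x) u) \<longlonglongrightarrow> ip M (\<lambda>x. f x - w x) u"
    proof (rule ip_tendsto)
      have e: "nrm2 M (\<lambda>x. (f x - v k x) - (f x - w x)) = nrm2 M (\<lambda>x. v k x - w x)" for k
        by (subst nrm2_minus_commute) simp
      show "(\<lambda>k. nrm2 M (\<lambda>x. (f x - v k x) - (f x - w x))) \<longlonglongrightarrow> 0"
        unfolding e by (rule w)
    qed (use f w vL uL in \<open>auto intro: L2_diff\<close>)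
    then have "(\<lambda>k. (cmod (ip M (\<lambda>x. f x - v k x) u))\<^sup>2) \<longlonglongrightarrow> (cmod (ip M (\<lambda>x. f x - w x) u))\<^sup>2"
      by (intro tendsto_intros)
    moreover have "(\<lambda>k. nrm2 M u * (1 / Suc k)) \<longlonglongrightarrow> nrm2 M u * 0"
      using LIMSEQ_inverse_real_of_nat by (intro tendsto_intros) (simp add: inverse_eq_divide)
    ultimately have "(cmod (ip M (\<lambda>x. f x - w x) u))\<^sup>2 \<le> nrm2 M u * 0"
      by (rule LIMSEQ_le) (use b in blast)
    then show "ip M (\<lambda>x. f x - w x) u = 0" by simp
  qed
  then have "AE x in M. w x = f x" by eventually_elim simp
  then have "nrm2 M (\<lambda>x. v k x - f x) = nrm2 M (\<lambda>x. v k x - w x)" for k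
    using vL[of k, THEN L2_measurable] w(1)[THEN L2_measurable] f[THEN L2_measurable]
    by (intro nrm2_cong_AE) auto
  then have "(\<lambda>k. nrm2 M (\<lambda>x. v k x - f x)) \<longlonglongrightarrow> 0" using w(2) by simp
  with v(1) show ?thesis by (rule that)
qed

corollary L2_closed_subspace:
  assumes V: "V \<subseteq> L2_space M" "V \<noteq> {}"
    and add: "\<And>u v. u \<in> V \<Longrightarrow> v \<in> V \<Longrightarrow> (\<lambda>x. u x + v x) \<in> V"
    and scale: "\<And>c v. v \<in> V \<Longrightarrow> (\<lambda>x. c * v x) \<in> V"
    and orth: "\<And>g. g \<in> L2_space M \<Longrightarrow> (\<And>v. v \<in> V \<Longrightarrow> ip M g v = 0) \<Longrightarrow> AE x in M. g x = 0"
    and closed: "\<And>v f. (\<And>k::nat. v k \<in> V) \<Longrightarrow> f \<in> L2_space M \<Longrightarrow>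
        (\<lambda>k. nrm2 M (\<lambda>x. v k x - f x)) \<longlonglongrightarrow> 0 \<Longrightarrow> f \<in> V"
    and f: "f \<in> L2_space M"
  shows "f \<in> V"
proof (rule L2_dense_subspace[OF V add scale orth f])
  fix v :: "nat \<Rightarrow> 'a \<Rightarrow> complex"
  assume v: "\<And>k. v k \<in> V" "(\<lambda>k. nrm2 M (\<lambda>x. v k x - f x)) \<longlonglongrightarrow> 0"
  show "f \<in> V" by (rule closed[OF v(1) f v(2)])
qed

section \<open>The Fourier transform of square-integrable functions\<close>

lemma AE_zero_if_ray_integrals_zero:
  fixes g :: "real \<Rightarrow> real"
  assumes g: "integrable lborel g"
    and 0: "\<And>x. (LINT t|lborel. g t * indicator {x<..} t) = 0"
  shows "AE t in lborel. g t = 0"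
proof -
  have [measurable]: "g \<in> borel_measurable borel" using borel_measurable_integrable[OF g] by simp
  let ?P = "\<lambda>t. max 0 (g t)" and ?Q = "\<lambda>t. max 0 (- g t)"
  have iP: "integrable lborel (\<lambda>t. ?P t * indicator {x<..} t)" for x
    by (rule Bochner_Integration.integrable_bound[OF g]) (auto simp: indicator_def)
  have iQ: "integrable lborel (\<lambda>t. ?Q t * indicator {x<..} t)" for x
    by (rule Bochner_Integration.integrable_bound[OF g]) (auto simp: indicator_def)
  have PQ: "(LINT t|lborel. ?P t * indicator {x<..} t) = (LINT t|lborel. ?Q t * indicator {x<..} t)" for x
  proof -
    have "(LINT t|lborel. ?P t * indicator {x<..} t) - (LINT t|lborel. ?Q t * indicator {x<..} t)
        = (LINT t|lborel. ?P t * indicator {x<..} t - ?Q t * indicator {x<..} t)"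
      by (rule Bochner_Integration.integral_diff[OF iP iQ, symmetric])
    also have "\<dots> = (LINT t|lborel. g t * indicator {x<..} t)"
      by (intro Bochner_Integration.integral_cong refl) (auto simp: indicator_def)
    finally show ?thesis using 0[of x] by simp
  qed
  have eP: "emeasure (density lborel (\<lambda>t. ennreal (g t))) {x<..} =
      ennreal (LINT t|lborel. ?P t * indicator {x<..} t)" for x
    by (subst emeasure_density; (subst nn_integral_eq_integral[OF iP, symmetric])?)
      (auto intro!: nn_integral_cong simp: indicator_def)
  have eQ: "emeasure (density lborel (\<lambda>t. ennreal (- g t))) {x<..} =
      ennreal (LINT t|lborel. ?Q t * indicator {x<..} t)" for x
    by (subst emeasure_density; (subst nn_integral_eq_integral[OF iQ, symmetric])?)
      (auto intro!: nn_integral_cong simp: indicator_def)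
  have "density lborel (\<lambda>t. ennreal (g t)) = density lborel (\<lambda>t. ennreal (- g t))"
    by (rule measure_eqI_lessThan) (simp_all add: eP eQ PQ)
  then have "AE t in lborel. ennreal (g t) = ennreal (- g t)"
    by (subst (asm) sigma_finite_measure.density_unique_iff[OF lborel.sigma_finite_measure_axioms]) auto
  then show ?thesis
  proof eventually_elim
    case (elim t)
    then show ?case by (cases "0 \<le> g t") (auto simp: ennreal_neg ennreal_eq_0_iff)
  qed
qed

lemma cmod_triangle3: "cmod (a + b + c) \<le> cmod a + cmod b + cmod c"
  using norm_triangle_ineq[of "a + b" c] norm_triangle_ineq[of a b] by linarith

lemma L2_indicator_mult:
  assumes "f \<in> L2_space M" "A \<in> sets M"
  shows "(\<lambda>x. indicator A x * f x) \<in> L2_space M"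
proof -
  have [measurable]: "f \<in> borel_measurable M" "A \<in> sets M" using assms by (auto simp: L2_space_def)
  have "integrable M (\<lambda>x. (cmod (indicator A x * f x))\<^sup>2)"
    by (rule Bochner_Integration.integrable_bound[OF L2_integrable_square[OF assms(1)]])
      (auto simp: indicator_def)
  then show ?thesis by (auto simp: L2_space_def)
qed

lemma L2_indicator:
  fixes A :: "'a set"
  assumes "A \<in> sets M" "emeasure M A < \<infinity>"
  shows "(indicator A :: 'a \<Rightarrow> complex) \<in> L2_space M"
proof (rule L2_spaceI)
  have "(\<integral>\<^sup>+x. ennreal ((cmod (indicator A x))\<^sup>2) \<partial>M) = (\<integral>\<^sup>+x. indicator A x \<partial>M)"
    by (intro nn_integral_cong) (auto simp: indicator_def)
  then show "(\<integral>\<^sup>+x. ennreal ((cmod (indicator A x))\<^sup>2) \<partial>M) < \<infinity>"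
    using assms by simp
qed (use assms in measurable)

lemma integrable_times_indicator:
  fixes f :: "'a \<Rightarrow> complex"
  assumes "integrable M f" "A \<in> sets M"
  shows "integrable M (\<lambda>x. f x * indicator A x)" "integrable M (\<lambda>x. indicator A x * f x)"
proof -
  have [measurable]: "f \<in> borel_measurable M" "A \<in> sets M"
    using assms by (auto dest: borel_measurable_integrable)
  show "integrable M (\<lambda>x. f x * indicator A x)" "integrable M (\<lambda>x. indicator A x * f x)"
    by (rule Bochner_Integration.integrable_bound[OF assms(1)]; auto simp: indicator_def)+
qed

lemma cnj_indicator [simp]: "cnj (indicator A x) = indicator A x"
  by (simp add: indicator_def)

lemma L2_indicator_Icc: "(indicator {a..b} :: real \<Rightarrow> complex) \<in> L2_space lborel"
proof (rule L2_indicator)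
  show "emeasure lborel {a..b} < \<infinity>"
    by (cases "a \<le> b") (simp_all add: emeasure_lborel_Icc_eq)
qed simp

text \<open>
  Localised to a bounded interval the function is integrable, and its integrals over rays vanish.
\<close>

lemma L2_AE_zero_if_interval_integrals_zero:
  fixes g :: "real \<Rightarrow> complex"
  assumes g: "g \<in> L2_space lborel"
    and 0: "\<And>a b. a < b \<Longrightarrow> (LINT t|lborel. g t * indicator {a..b} t) = 0"
  shows "AE t in lborel. g t = 0"
proof -
  have [measurable]: "g \<in> borel_measurable borel" using L2_measurable[OF g] by simp
  have ab: "integrable lborel (\<lambda>t. g t * indicator {a..b} t)" for a b
    by (rule L2_integrable_mult[OF g L2_indicator_Icc])
  have N: "AE t in lborel. t \<in> {- real N..real N} \<longrightarrow> g t = 0" for N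
  proof -
    define G where "G t = g t * indicator {- real N..real N} t" for t
    have G: "integrable lborel G" unfolding G_def[abs_def] by (rule ab)
    have ray: "(LINT t|lborel. G t * indicator {x<..} t) = 0" for x
    proof -
      have "AE t in lborel. t \<noteq> x" by (rule AE_lborel_singleton)
      then have "(LINT t|lborel. G t * indicator {x<..} t) =
          (LINT t|lborel. g t * indicator {max x (- real N)..real N} t)"
        by (intro integral_cong_AE) (auto elim!: eventually_mono simp: G_def indicator_def)
      also have "\<dots> = 0"
      proof (cases "max x (- real N) < real N")
        case True then show ?thesis by (rule 0)
      next
        case False
        have "AE t in lborel. t \<noteq> real N" by (rule AE_lborel_singleton)
        then have "AE t in lborel. g t * indicator {max x (- real N)..real N} t = 0"
          by eventually_elim (use False in \<open>auto simp: indicator_def\<close>)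
        then show ?thesis by (rule integral_eq_zero_AE)
      qed
      finally show ?thesis .
    qed
    have iG: "integrable lborel (\<lambda>t. G t * indicator {x<..} t)" for x
      by (rule integrable_times_indicator[OF G]) simp
    have "AE t in lborel. Re (G t) = 0"
    proof (rule AE_zero_if_ray_integrals_zero)
      show "integrable lborel (\<lambda>t. Re (G t))" using G by simp
      fix x
      have "(LINT t|lborel. Re (G t) * indicator {x<..} t) = (LINT t|lborel. Re (G t * indicator {x<..} t))"
        by (intro Bochner_Integration.integral_cong refl) (auto simp: indicator_def)
      then show "(LINT t|lborel. Re (G t) * indicator {x<..} t) = 0"
        using integral_Re[OF iG, of x] ray[of x] by simp
    qed
    moreover have "AE t in lborel. Im (G t) = 0"
    proof (rule AE_zero_if_ray_integrals_zero)
      show "integrable lborel (\<lambda>t. Im (G t))" using G by simp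
      fix x
      have "(LINT t|lborel. Im (G t) * indicator {x<..} t) = (LINT t|lborel. Im (G t * indicator {x<..} t))"
        by (intro Bochner_Integration.integral_cong refl) (auto simp: indicator_def)
      then show "(LINT t|lborel. Im (G t) * indicator {x<..} t) = 0"
        using integral_Im[OF iG, of x] ray[of x] by simp
    qed
    ultimately show ?thesis
      by eventually_elim (auto simp: G_def complex_eq_iff)
  qed
  then have "AE t in lborel. \<forall>N. t \<in> {- real N..real N} \<longrightarrow> g t = 0"
    by (simp only: AE_all_countable) blast
  then show ?thesis
  proof eventually_elim
    case (elim t)
    obtain N where "\<bar>t\<bar> \<le> real N" using real_arch_simple by blast
    then show ?case using elim by (auto simp: abs_le_iff)
  qed
qed

lemma L2_shift:
  fixes f :: "real \<Rightarrow> complex"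
  assumes "f \<in> L2_space lborel"
  shows "(\<lambda>t. f (t + u)) \<in> L2_space lborel" "nrm2 lborel (\<lambda>t. f (t + u :: real)) = nrm2 lborel f"
proof -
  have [measurable]: "f \<in> borel_measurable borel" using L2_measurable[OF assms] by simp
  have "integrable lborel (\<lambda>t. (cmod (f (u + 1 * t)))\<^sup>2)"
    by (rule lborel_integrable_real_affine) (use L2_integrable_square[OF assms] in auto)
  then show "(\<lambda>t. f (t + u)) \<in> L2_space lborel"
    by (auto simp: L2_space_def add.commute)
  show "nrm2 lborel (\<lambda>t. f (t + u)) = nrm2 lborel f"
    unfolding nrm2_def using lborel_integral_real_affine[of 1 "\<lambda>t. (cmod (f t))\<^sup>2" u]
    by (simp add: add.commute)
qed

text \<open>
  Weak continuity of translations is clear against indicators of intervals, and the functions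
  against which it holds form a closed subspace.
\<close>

lemma translation_weakly_continuous:
  fixes f :: "real \<Rightarrow> complex"
  assumes f: "f \<in> L2_space lborel" "integrable lborel f"
    and u: "u \<longlonglongrightarrow> 0" and v: "v \<in> L2_space lborel"
  shows "(\<lambda>k. ip lborel (\<lambda>t. f (t + u k)) v) \<longlonglongrightarrow> ip lborel f v"
proof -
  have [measurable]: "f \<in> borel_measurable borel" using L2_measurable[OF f(1)] by simp
  define V where "V = {v \<in> L2_space lborel. (\<lambda>k. ip lborel (\<lambda>t. f (t + u k)) v) \<longlonglongrightarrow> ip lborel f v}"
  have "v \<in> V"
  proof (rule L2_closed_subspace[OF _ _ _ _ _ _ v])
    show "V \<subseteq> L2_space lborel" by (auto simp: V_def)
    have "(\<lambda>x. 0) \<in> V" using L2_zero[of lborel] by (simp add: V_def ip_def)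
    then show "V \<noteq> {}" by blast
    show "(\<lambda>x. v x + w x) \<in> V" if "v \<in> V" "w \<in> V" for v w
      using that f L2_shift[OF f(1)] by (auto simp: V_def L2_add ip_add_right intro!: tendsto_intros)
    show "(\<lambda>x. c * v x) \<in> V" if "v \<in> V" for v c
      using that f L2_shift[OF f(1)] by (auto simp: V_def L2_scale ip_scale_right intro!: tendsto_intros)
    have ind: "indicator {a..b} \<in> V" for a b
    proof -
      have "(\<lambda>k. LINT t|lborel. f t * indicator {a..b} (t - u k)) \<longlonglongrightarrow> (LINT t|lborel. f t * indicator {a..b} t)"
      proof (rule integral_dominated_convergence)
        show "integrable lborel (\<lambda>t. norm (f t))" using f by simp
        have "AE t in lborel. t \<noteq> a \<and> t \<noteq> b"
          using AE_lborel_singleton[of a] AE_lborel_singleton[of b] by eventually_elim simp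
        then show "AE t in lborel. (\<lambda>k. f t * indicator {a..b} (t - u k)) \<longlonglongrightarrow> f t * indicator {a..b} t"
        proof eventually_elim
          case (elim t)
          have lim: "(\<lambda>k. t - u k) \<longlonglongrightarrow> t" using tendsto_diff[OF tendsto_const u, of t] by simp
          have "\<forall>\<^sub>F k in sequentially. (indicator {a..b} (t - u k) :: complex) = indicator {a..b} t"
          proof (cases "t \<in> {a<..<b}")
            case True
            have "\<forall>\<^sub>F k in sequentially. t - u k \<in> {a<..<b}"
              by (rule topological_tendstoD[OF lim]) (use True in auto)
            then show ?thesis by eventually_elim (use True in \<open>auto simp: indicator_def\<close>)
          next
            case False
            have "\<forall>\<^sub>F k in sequentially. t - u k \<in> - {a..b}"
              by (rule topological_tendstoD[OF lim]) (use False elim in auto)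
            then show ?thesis by eventually_elim (use False elim in \<open>auto simp: indicator_def\<close>)
          qed
          then show ?case
            by (intro tendsto_mult_left tendsto_eventually)
        qed
      qed (auto simp: indicator_def)
      moreover have "(LINT t|lborel. f t * indicator {a..b} (t - u k)) = ip lborel (\<lambda>t. f (t + u k)) (indicator {a..b})" for k
        unfolding ip_def
        using lborel_integral_real_affine[of 1 "\<lambda>t. f t * indicator {a..b} (t - u k)" "u k"]
        by (simp add: add.commute del: indicator_simps)
      moreover have "(LINT t|lborel. f t * indicator {a..b} t) = ip lborel f (indicator {a..b})"
        unfolding ip_def by simp
      ultimately show ?thesis by (auto simp: V_def intro!: L2_indicator_Icc)
    qed
    show "AE x in lborel. g x = 0" if g: "g \<in> L2_space lborel" and o: "\<And>v. v \<in> V \<Longrightarrow> ip lborel g v = 0" for g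
    proof (rule L2_AE_zero_if_interval_integrals_zero[OF g])
      fix a b :: real
      show "(LINT t|lborel. g t * indicator {a..b} t) = 0"
        using o[OF ind[of a b]] by (simp add: ip_def)
    qed
    fix w h assume w: "\<And>k::nat. w k \<in> V" and h: "h \<in> L2_space lborel"
      and lim: "(\<lambda>k. nrm2 lborel (\<lambda>x. w k x - h x)) \<longlonglongrightarrow> 0"
    have wL: "w k \<in> L2_space lborel" for k using w by (simp add: V_def)
    have est: "cmod (ip lborel (\<lambda>t. f (t + r)) (w k) - ip lborel (\<lambda>t. f (t + r)) h) \<le>
        sqrt (nrm2 lborel f * nrm2 lborel (\<lambda>x. w k x - h x))" for k r
    proof -
      have "(cmod (ip lborel (\<lambda>t. f (t + r)) (\<lambda>x. w k x - h x)))\<^sup>2 \<le>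
          nrm2 lborel f * nrm2 lborel (\<lambda>x. w k x - h x)"
        using L2_Cauchy_Schwarz[OF L2_shift(1)[OF f(1), of r] L2_diff[OF wL h]] L2_shift(2)[OF f(1)] by simp
      then show ?thesis
        by (simp add: real_le_rsqrt ip_diff_right[OF wL h L2_shift(1)[OF f(1)]])
    qed
    have "(\<lambda>j. ip lborel (\<lambda>t. f (t + u j)) h) \<longlonglongrightarrow> ip lborel f h"
    proof (rule LIMSEQ_I)
      fix e :: real assume "0 < e"
      have "(\<lambda>k. sqrt (nrm2 lborel f * nrm2 lborel (\<lambda>x. w k x - h x))) \<longlonglongrightarrow> sqrt (nrm2 lborel f * 0)"
        by (intro tendsto_intros lim)
      then obtain k where k: "sqrt (nrm2 lborel f * nrm2 lborel (\<lambda>x. w k x - h x)) < e / 3"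
        using LIMSEQ_D[of _ _ "e/3"] \<open>0 < e\<close> by fastforce
      obtain J where J: "\<And>j. j \<ge> J \<Longrightarrow> cmod (ip lborel (\<lambda>t. f (t + u j)) (w k) - ip lborel f (w k)) < e / 3"
        using LIMSEQ_D[of "\<lambda>j. ip lborel (\<lambda>t. f (t + u j)) (w k)" "ip lborel f (w k)" "e/3"] w[of k] \<open>0 < e\<close>
        by (auto simp: V_def)
      have "cmod (ip lborel (\<lambda>t. f (t + u j)) h - ip lborel f h) < e" if "j \<ge> J" for j
      proof -
        define a b c where "a = ip lborel (\<lambda>t. f (t + u j)) (w k) - ip lborel (\<lambda>t. f (t + u j)) h"
          and "b = ip lborel (\<lambda>t. f (t + u j)) (w k) - ip lborel f (w k)"
          and "c = ip lborel f (w k) - ip lborel f h"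
        have eq: "ip lborel (\<lambda>t. f (t + u j)) h - ip lborel f h = - a + b + c"
          by (simp add: a_def b_def c_def)
        have "cmod c \<le> sqrt (nrm2 lborel f * nrm2 lborel (\<lambda>x. w k x - h x))"
          using est[of 0 k] by (simp only: add_0_right c_def)
        moreover have "cmod (- a) \<le> sqrt (nrm2 lborel f * nrm2 lborel (\<lambda>x. w k x - h x))"
          using est[of "u j" k] by (simp only: norm_minus_cancel a_def)
        moreover have "cmod b < e / 3" unfolding b_def by (rule J[OF that])
        ultimately show ?thesis
          using cmod_triangle3[of "- a" b c] k unfolding eq by linarith
      qed
      then show "\<exists>no. \<forall>n\<ge>no. norm (ip lborel (\<lambda>t. f (t + u n)) h - ip lborel f h) < e" by blast
    qed
    then show "h \<in> V" using h by (simp add: V_def)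
  qed
  then show ?thesis by (simp add: V_def)
qed

definition FT :: "(real \<Rightarrow> complex) \<Rightarrow> real \<Rightarrow> complex" where
  "FT f \<xi> = (LINT t|lborel. f t * exp (- (\<i> * of_real (\<xi> * t))))"

lemma FT_measurable [measurable]:
  assumes [measurable]: "f \<in> borel_measurable borel"
  shows "FT f \<in> borel_measurable borel"
proof -
  have "(\<lambda>\<xi>. LINT t|lborel. f t * exp (- (\<i> * of_real (\<xi> * t)))) \<in> borel_measurable lborel"
    by (rule lborel.borel_measurable_lebesgue_integral) measurable
  then show ?thesis by (simp add: FT_def[abs_def])
qed

lemma norm_exp_imaginary [simp]: "cmod (exp (- (\<i> * of_real x))) = 1" "cmod (exp (\<i> * of_real x)) = 1"
  by (simp_all add: norm_exp_eq_Re)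

lemma integrable_FT_integrand:
  assumes "integrable lborel f"
  shows "integrable lborel (\<lambda>t. f t * exp (- (\<i> * of_real (\<xi> * t))))"
proof (rule Bochner_Integration.integrable_bound[OF assms])
  show "(\<lambda>t. f t * exp (- (\<i> * of_real (\<xi> * t)))) \<in> borel_measurable lborel"
    using borel_measurable_integrable[OF assms] by measurable
qed (simp add: norm_mult del: of_real_mult)

lemma FT_bounded:
  assumes "integrable lborel f"
  shows "cmod (FT f \<xi>) \<le> (LINT t|lborel. cmod (f t))"
  unfolding FT_def
  by (rule order_trans[OF integral_norm_bound]) (simp add: norm_mult del: of_real_mult)

lemma FT_diff:
  assumes "integrable lborel f" "integrable lborel g"
  shows "FT (\<lambda>t. f t - g t) \<xi> = FT f \<xi> - FT g \<xi>"
  unfolding FT_def left_diff_distrib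
  by (intro Bochner_Integration.integral_diff integrable_FT_integrand assms)

lemma FT_scale: "FT (\<lambda>t. c * f t) \<xi> = c * FT f \<xi>"
  unfolding FT_def by (simp add: mult.assoc)

lemma FT_multiplication_formula:
  assumes f: "integrable lborel f" and g: "integrable lborel g"
  shows "(LINT \<xi>|lborel. FT f \<xi> * g \<xi>) = (LINT t|lborel. f t * FT g t)"
proof -
  have [measurable]: "f \<in> borel_measurable borel" "g \<in> borel_measurable borel"
    using f g by (auto dest: borel_measurable_integrable)
  let ?K = "\<lambda>(t, \<xi>). f t * g \<xi> * exp (- (\<i> * of_real (\<xi> * t)))"
  have i0: "integrable (lborel \<Otimes>\<^sub>M lborel) (\<lambda>(t, \<xi>). f t * g \<xi>)"
  proof (rule lborel_pair.Fubini_integrable)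
    show "integrable lborel (\<lambda>x. LINT y|lborel. norm (case (x, y) of (t, \<xi>) \<Rightarrow> f t * g \<xi>))"
      using f by (simp add: norm_mult)
    show "AE x in lborel. integrable lborel (\<lambda>y. case (x, y) of (t, \<xi>) \<Rightarrow> f t * g \<xi>)"
      using g by simp
  qed measurable
  have i: "integrable (lborel \<Otimes>\<^sub>M lborel) ?K"
    by (rule Bochner_Integration.integrable_bound[OF i0]) (auto simp: norm_mult simp del: of_real_mult)
  have "(LINT \<xi>|lborel. FT f \<xi> * g \<xi>) = (LINT \<xi>|lborel. LINT t|lborel. f t * g \<xi> * exp (- (\<i> * of_real (\<xi> * t))))"
    unfolding FT_def
    by (intro Bochner_Integration.integral_cong refl, subst integral_mult_left_zero[symmetric])
       (simp add: mult_ac)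
  also have "\<dots> = (LINT t|lborel. LINT \<xi>|lborel. f t * g \<xi> * exp (- (\<i> * of_real (\<xi> * t))))"
    by (rule lborel_pair.Fubini_integral[OF i])
  also have "\<dots> = (LINT t|lborel. f t * FT g t)"
    unfolding FT_def
    by (intro Bochner_Integration.integral_cong refl, subst integral_mult_right_zero[symmetric])
       (simp add: mult_ac)
  finally show ?thesis .
qed

lemma FT_std_normal:
  assumes "0 < e"
  shows "FT (\<lambda>x. of_real (std_normal_density (e * x))) u = of_real (sqrt (2 * pi) / e * std_normal_density (u / e))"
proof -
  have "char std_normal_distribution (- (u / e)) = (LINT x|lborel. of_real (std_normal_density x) * iexp (- (u / e) * x))"
    unfolding char_def by (subst integral_density) (auto simp: scaleR_conv_of_real)
  also have "\<dots> = \<bar>e\<bar> *\<^sub>R (LINT x|lborel. of_real (std_normal_density (0 + e * x)) * iexp (- (u / e) * (0 + e * x)))"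
    by (rule lborel_integral_real_affine) (use assms in simp)
  also have "(LINT x|lborel. of_real (std_normal_density (0 + e * x)) * iexp (- (u / e) * (0 + e * x))) =
      FT (\<lambda>x. of_real (std_normal_density (e * x))) u"
    unfolding FT_def using assms by (intro Bochner_Integration.integral_cong refl) (simp add: field_simps)
  finally have "FT (\<lambda>x. of_real (std_normal_density (e * x))) u = of_real (exp (- ((u/e)^2) / 2) / e)"
    using assms by (simp add: char_std_normal_distribution scaleR_conv_of_real field_simps)
  then show ?thesis by (simp add: std_normal_density_def field_simps)
qed

lemma FT_autocorrelation:
  fixes f :: "real \<Rightarrow> complex"
  assumes f: "integrable lborel f"
  defines "A \<equiv> (\<lambda>u. ip lborel (\<lambda>t. f (t + u)) f)"
  shows "integrable lborel A" "FT A \<xi> = of_real ((cmod (FT f \<xi>))\<^sup>2)"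
proof -
  have [measurable]: "f \<in> borel_measurable borel" using borel_measurable_integrable[OF f] by simp
  have sh: "integrable lborel (\<lambda>u. f (t + u))" for t
    using lborel_integrable_real_affine[OF f, of 1 t] by simp
  have shn: "(LINT u|lborel. cmod (f (t + u))) = (LINT u|lborel. cmod (f u))" for t
    using lborel_integral_real_affine[of 1 "\<lambda>u. cmod (f u)" t] by simp
  have K: "integrable (lborel \<Otimes>\<^sub>M lborel) (\<lambda>(t, u). f (t + u) * cnj (f t))"
  proof (rule lborel_pair.Fubini_integrable)
    show "integrable lborel (\<lambda>t. LINT u|lborel. norm (case (t, u) of (t, u) \<Rightarrow> f (t + u) * cnj (f t)))"
      using f by (simp add: norm_mult shn)
    show "AE t in lborel. integrable lborel (\<lambda>u. case (t, u) of (t, u) \<Rightarrow> f (t + u) * cnj (f t))"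
      using sh by (simp add: mult.commute)
  qed measurable
  show "integrable lborel A"
    unfolding A_def ip_def by (rule lborel_pair.integrable_snd[OF K])
  have K': "integrable (lborel \<Otimes>\<^sub>M lborel) (\<lambda>(t, u). f (t + u) * cnj (f t) * exp (- (\<i> * of_real (\<xi> * u))))"
    by (rule Bochner_Integration.integrable_bound[OF K]) (auto simp: norm_mult simp del: of_real_mult)
  have "FT A \<xi> = (LINT u|lborel. LINT t|lborel. f (t + u) * cnj (f t) * exp (- (\<i> * of_real (\<xi> * u))))"
    unfolding FT_def A_def ip_def by simp
  also have "\<dots> = (LINT t|lborel. LINT u|lborel. f (t + u) * cnj (f t) * exp (- (\<i> * of_real (\<xi> * u))))"
    by (rule lborel_pair.Fubini_integral[OF K'])
  also have "\<dots> = (LINT t|lborel. FT f \<xi> * (cnj (f t) * exp (\<i> * of_real (\<xi> * t))))"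
  proof (intro Bochner_Integration.integral_cong refl)
    fix t
    have "FT f \<xi> = (LINT u|lborel. f (t + u) * exp (- (\<i> * of_real (\<xi> * (t + u)))))"
      unfolding FT_def using lborel_integral_real_affine[of 1 "\<lambda>s. f s * exp (- (\<i> * of_real (\<xi> * s)))" t]
      by simp
    also have "\<dots> = (LINT u|lborel. exp (- (\<i> * of_real (\<xi> * t))) * (f (t + u) * exp (- (\<i> * of_real (\<xi> * u)))))"
      by (intro Bochner_Integration.integral_cong refl) (simp only: distrib_left of_real_add minus_add_distrib exp_add mult_ac)
    also have "\<dots> = exp (- (\<i> * of_real (\<xi> * t))) * (LINT u|lborel. f (t + u) * exp (- (\<i> * of_real (\<xi> * u))))"
      by (rule integral_mult_right_zero)
    finally have e: "(LINT u|lborel. f (t + u) * exp (- (\<i> * of_real (\<xi> * u)))) = exp (\<i> * of_real (\<xi> * t)) * FT f \<xi>"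
      by (simp add: exp_minus field_simps)
    have "(LINT u|lborel. f (t + u) * cnj (f t) * exp (- (\<i> * of_real (\<xi> * u)))) =
       cnj (f t) * (LINT u|lborel. f (t + u) * exp (- (\<i> * of_real (\<xi> * u))))"
      by (subst integral_mult_right_zero[symmetric]) (simp add: mult_ac)
    also have "\<dots> = FT f \<xi> * (cnj (f t) * exp (\<i> * of_real (\<xi> * t)))"
      unfolding e by (simp only: mult_ac)
    finally show "(LINT u|lborel. f (t + u) * cnj (f t) * exp (- (\<i> * of_real (\<xi> * u)))) =
       FT f \<xi> * (cnj (f t) * exp (\<i> * of_real (\<xi> * t)))" .
  qed
  also have "\<dots> = FT f \<xi> * (LINT t|lborel. cnj (f t) * exp (\<i> * of_real (\<xi> * t)))"
    by (rule integral_mult_right_zero)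
  also have "(LINT t|lborel. cnj (f t) * exp (\<i> * of_real (\<xi> * t))) = cnj (FT f \<xi>)"
    unfolding FT_def Bochner_Integration.integral_cnj[symmetric] by (simp add: exp_cnj)
  finally show "FT A \<xi> = of_real ((cmod (FT f \<xi>))\<^sup>2)"
    unfolding complex_norm_square .
qed

text \<open>
  Integrating \<open>\<bar>FT f\<bar>\<^sup>2\<close> against a wide Gaussian amounts to integrating the autocorrelation of \<open>f\<close>
  against a narrow one; the autocorrelation is continuous at \<open>0\<close>, where its value is the norm.
\<close>

theorem FT_Plancherel:
  assumes f: "f \<in> L2_space lborel" "integrable lborel f"
  shows "FT f \<in> L2_space lborel" "nrm2 lborel (FT f) = 2 * pi * nrm2 lborel f"
proof -
  have [measurable]: "f \<in> borel_measurable borel" using L2_measurable[OF f(1)] by simp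
  define A where "A = (\<lambda>u. ip lborel (\<lambda>t. f (t + u)) f)"
  have A: "integrable lborel A" "\<And>\<xi>. FT A \<xi> = of_real ((cmod (FT f \<xi>))\<^sup>2)"
    unfolding A_def by (rule FT_autocorrelation[OF f(2)])+
  have [measurable]: "A \<in> borel_measurable borel" using borel_measurable_integrable[OF A(1)] by simp
  define N where "N = nrm2 lborel f"
  have N0: "0 \<le> N" by (simp add: N_def)
  have Ab: "cmod (A u) \<le> N" for u
  proof -
    have "(cmod (A u))\<^sup>2 \<le> N\<^sup>2"
      using L2_Cauchy_Schwarz[OF L2_shift(1)[OF f(1)] f(1), of u] L2_shift(2)[OF f(1), of u]
      by (simp add: A_def N_def power2_eq_square)
    then show ?thesis using N0 by (rule power2_le_imp_le)
  qed
  define e where "e k = inverse (real (Suc k))" for k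
  have e0: "0 < e k" for k by (simp add: e_def)
  have e_lim: "e \<longlonglongrightarrow> 0" unfolding e_def[abs_def] by (rule LIMSEQ_inverse_real_of_nat)
  let ?n = std_normal_density
  define n0 where "n0 = ?n 0"
  have n0: "n0 = 1 / sqrt (2 * pi)" by (simp add: n0_def std_normal_density_def)
  have nn: "?n x \<le> n0" for x unfolding n0 std_normal_density_def by (simp add: field_simps)
  have ni: "integrable lborel (\<lambda>x. ?n (e k * x))" for k
    using lborel_integrable_real_affine[of ?n "e k" 0] e0[of k] by simp
  have Fb: "(cmod (FT f \<xi>))\<^sup>2 \<le> (LINT t|lborel. cmod (f t))\<^sup>2" for \<xi>
    by (intro power_mono FT_bounded f) simp
  define L where "L k = (LINT \<xi>|lborel. (cmod (FT f \<xi>))\<^sup>2 * ?n (e k * \<xi>))" for k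
  have Li: "integrable lborel (\<lambda>\<xi>. (cmod (FT f \<xi>))\<^sup>2 * ?n (e k * \<xi>))" for k
  proof (rule Bochner_Integration.integrable_bound)
    show "integrable lborel (\<lambda>\<xi>. (LINT t|lborel. cmod (f t))\<^sup>2 * ?n (e k * \<xi>))" using ni by simp
    show "AE \<xi> in lborel. norm ((cmod (FT f \<xi>))\<^sup>2 * ?n (e k * \<xi>)) \<le> norm ((LINT t|lborel. cmod (f t))\<^sup>2 * ?n (e k * \<xi>))"
      by (intro AE_I2) (simp add: abs_mult mult_right_mono Fb)
  qed measurable
  have LA: "complex_of_real (L k) = of_real (sqrt (2 * pi)) * (LINT v|lborel. A (e k * v) * of_real (?n v))" for k
  proof -
    have "complex_of_real (L k) = (LINT \<xi>|lborel. FT A \<xi> * of_real (?n (e k * \<xi>)))"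
      unfolding L_def A(2) by (simp flip: integral_complex_of_real)
    also have "\<dots> = (LINT t|lborel. A t * FT (\<lambda>\<xi>. of_real (?n (e k * \<xi>))) t)"
      by (rule FT_multiplication_formula[OF A(1)]) (use ni in simp)
    also have "\<dots> = (LINT t|lborel. A t * of_real (sqrt (2 * pi) / e k * ?n (t / e k)))"
      by (simp add: FT_std_normal[OF e0])
    also have "\<dots> = \<bar>e k\<bar> *\<^sub>R (LINT v|lborel. A (0 + e k * v) * of_real (sqrt (2 * pi) / e k * ?n ((0 + e k * v) / e k)))"
      by (rule lborel_integral_real_affine) (use e0[of k] in simp)
    also have "\<dots> = of_real (e k) * (LINT v|lborel. of_real (sqrt (2 * pi) / e k) * (A (e k * v) * of_real (?n v)))"
      using e0[of k] by (simp add: scaleR_conv_of_real mult_ac)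
    also have "\<dots> = of_real (sqrt (2 * pi)) * (LINT v|lborel. A (e k * v) * of_real (?n v))"
      using e0[of k] by (subst integral_mult_right_zero) simp
    finally show ?thesis .
  qed
  have "(\<lambda>k. LINT v|lborel. A (e k * v) * of_real (?n v)) \<longlonglongrightarrow> (LINT v|lborel. of_real N * of_real (?n v))"
  proof (rule integral_dominated_convergence)
    show "integrable lborel (\<lambda>v. N * ?n v)" by simp
    show "AE v in lborel. norm (A (e k * v) * of_real (?n v)) \<le> N * ?n v" for k
      by (intro AE_I2) (simp add: norm_mult mult_right_mono Ab)
    show "AE v in lborel. (\<lambda>k. A (e k * v) * of_real (?n v)) \<longlonglongrightarrow> of_real N * of_real (?n v)"
    proof (intro AE_I2 tendsto_mult_right)
      fix v
      have "(\<lambda>k. e k * v) \<longlonglongrightarrow> 0" using tendsto_mult_right[OF e_lim, of v] by simp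
      from translation_weakly_continuous[OF f this f(1)]
      show "(\<lambda>k. A (e k * v)) \<longlonglongrightarrow> of_real N" by (simp add: A_def ip_self N_def)
    qed
  qed measurable
  also have "(LINT v|lborel. of_real N * of_real (?n v)) = complex_of_real N"
    by (simp del: of_real_mult)
  finally have "(\<lambda>k. complex_of_real (L k)) \<longlonglongrightarrow> of_real (sqrt (2 * pi)) * of_real N"
    unfolding LA by (intro tendsto_intros)
  then have L_lim: "L \<longlonglongrightarrow> sqrt (2 * pi) * N"
    by (simp only: tendsto_of_real_iff flip: of_real_mult)
  have Lnn: "(\<integral>\<^sup>+\<xi>. ennreal ((cmod (FT f \<xi>))\<^sup>2 * ?n (e k * \<xi>)) \<partial>lborel) = ennreal (L k)" for k
    unfolding L_def by (intro nn_integral_eq_integral Li) auto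
  have "(\<integral>\<^sup>+\<xi>. ennreal ((cmod (FT f \<xi>))\<^sup>2 * n0) \<partial>lborel) =
      (\<integral>\<^sup>+\<xi>. liminf (\<lambda>k. ennreal ((cmod (FT f \<xi>))\<^sup>2 * ?n (e k * \<xi>))) \<partial>lborel)"
  proof (intro nn_integral_cong lim_imp_Liminf[symmetric])
    fix \<xi>
    have "isCont ?n (0 * \<xi>)" unfolding std_normal_density_def by (intro continuous_intros) auto
    then have "(\<lambda>k. ?n (e k * \<xi>)) \<longlonglongrightarrow> ?n (0 * \<xi>)"
      by (rule isCont_tendsto_compose) (intro tendsto_intros e_lim)
    then show "(\<lambda>k. ennreal ((cmod (FT f \<xi>))\<^sup>2 * ?n (e k * \<xi>))) \<longlonglongrightarrow> ennreal ((cmod (FT f \<xi>))\<^sup>2 * n0)"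
      unfolding n0_def by (intro tendsto_intros) simp
  qed auto
  also have "\<dots> \<le> liminf (\<lambda>k. ennreal (L k))"
    unfolding Lnn[symmetric] by (rule nn_integral_liminf) measurable
  also have "\<dots> = ennreal (sqrt (2 * pi) * N)"
    by (rule lim_imp_Liminf) (auto intro!: tendsto_ennrealI L_lim)
  finally have up: "(\<integral>\<^sup>+\<xi>. ennreal ((cmod (FT f \<xi>))\<^sup>2 * n0) \<partial>lborel) \<le> ennreal (sqrt (2 * pi) * N)" .
  have n0pos: "0 < n0" unfolding n0 by simp
  have ce: "(\<integral>\<^sup>+\<xi>. ennreal ((cmod (FT f \<xi>))\<^sup>2 * n0) \<partial>lborel) = ennreal n0 * (\<integral>\<^sup>+\<xi>. ennreal ((cmod (FT f \<xi>))\<^sup>2) \<partial>lborel)"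
    using n0pos by (subst nn_integral_cmult[symmetric]) (auto simp: ennreal_mult' mult.commute intro!: nn_integral_cong)
  have "(\<integral>\<^sup>+\<xi>. ennreal ((cmod (FT f \<xi>))\<^sup>2) \<partial>lborel) \<noteq> \<infinity>"
  proof
    assume "(\<integral>\<^sup>+\<xi>. ennreal ((cmod (FT f \<xi>))\<^sup>2) \<partial>lborel) = \<infinity>"
    with up ce n0pos show False by (simp add: ennreal_mult_top top_unique)
  qed
  then show FL: "FT f \<in> L2_space lborel"
    by (intro L2_spaceI) (auto simp: less_top)
  have "ennreal (n0 * nrm2 lborel (FT f)) \<le> ennreal (sqrt (2 * pi) * N)"
    using up n0pos unfolding ce L2_nn_integral[OF FL] by (simp add: ennreal_mult)
  then have le1: "n0 * nrm2 lborel (FT f) \<le> sqrt (2 * pi) * N"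
    using N0 by (subst (asm) ennreal_le_iff) auto
  have "L k \<le> (LINT \<xi>|lborel. (cmod (FT f \<xi>))\<^sup>2 * n0)" for k
    unfolding L_def
    by (intro integral_mono Li mult_left_mono nn) (use L2_integrable_square[OF FL] in auto)
  then have "sqrt (2 * pi) * N \<le> n0 * nrm2 lborel (FT f)"
    by (intro LIMSEQ_le_const2[OF L_lim]) (auto simp: nrm2_def mult.commute)
  with le1 have eq: "n0 * nrm2 lborel (FT f) = sqrt (2 * pi) * N" by simp
  have "nrm2 lborel (FT f) = sqrt (2 * pi) * (n0 * nrm2 lborel (FT f))" unfolding n0 by simp
  also have "\<dots> = 2 * pi * N" unfolding eq by simp
  finally show "nrm2 lborel (FT f) = 2 * pi * nrm2 lborel f" by (simp add: N_def)
qed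

lemma ip_tendsto2:
  assumes f: "\<And>k. f k \<in> L2_space M" "f0 \<in> L2_space M" "((\<lambda>k. nrm2 M (\<lambda>x. f k x - f0 x)) \<longlongrightarrow> 0) F"
    and g: "\<And>k. g k \<in> L2_space M" "g0 \<in> L2_space M" "((\<lambda>k. nrm2 M (\<lambda>x. g k x - g0 x)) \<longlongrightarrow> 0) F"
  shows "((\<lambda>k. ip M (f k) (g k)) \<longlongrightarrow> ip M f0 g0) F"
proof -
  have "((\<lambda>k. sqrt (nrm2 M (f k) * nrm2 M (\<lambda>x. g k x - g0 x))) \<longlongrightarrow> sqrt (nrm2 M f0 * 0)) F"
    by (intro tendsto_intros nrm2_tendsto f g)
  then have lim0: "((\<lambda>k. sqrt (nrm2 M (f k) * nrm2 M (\<lambda>x. g k x - g0 x))) \<longlongrightarrow> 0) F" by simp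
  have "((\<lambda>k. ip M (f k) (g k) - ip M (f k) g0) \<longlongrightarrow> 0) F"
  proof (rule Lim_null_comparison[OF _ lim0], intro always_eventually allI)
    fix k
    have "(cmod (ip M (f k) (\<lambda>x. g k x - g0 x)))\<^sup>2 \<le> nrm2 M (f k) * nrm2 M (\<lambda>x. g k x - g0 x)"
      by (intro L2_Cauchy_Schwarz L2_diff f g)
    then show "norm (ip M (f k) (g k) - ip M (f k) g0) \<le> sqrt (nrm2 M (f k) * nrm2 M (\<lambda>x. g k x - g0 x))"
      using f g by (simp add: ip_diff_right real_le_rsqrt)
  qed
  from tendsto_add[OF this ip_tendsto[OF f(1) f(2) g(2) f(3)]] show ?thesis by simp
qed

definition cutoff :: "real \<Rightarrow> (real \<Rightarrow> complex) \<Rightarrow> real \<Rightarrow> complex" where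
  "cutoff R f t = indicator {-R..R} t * f t"

lemma truncated_fourier_eq: "truncated_fourier R f = FT (cutoff R f)"
  unfolding truncated_fourier_def[abs_def] FT_def[abs_def] set_lebesgue_integral_def cutoff_def
  by (intro ext Bochner_Integration.integral_cong refl) (auto simp: indicator_def)

lemma cutoff_L2:
  assumes "f \<in> L2_space lborel"
  shows "cutoff R f \<in> L2_space lborel" "integrable lborel (cutoff R f)"
  unfolding cutoff_def[abs_def]
  by (auto intro!: L2_indicator_mult L2_integrable_mult L2_indicator_Icc assms)

lemma cutoff_tendsto:
  assumes f: "f \<in> L2_space lborel"
  shows "((\<lambda>R. nrm2 lborel (\<lambda>t. cutoff R f t - f t)) \<longlongrightarrow> 0) at_top"
proof -
  have [measurable]: "f \<in> borel_measurable borel" using L2_measurable[OF f] by simp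
  have "((\<lambda>R. LINT t|lborel. (cmod (cutoff R f t - f t))\<^sup>2) \<longlongrightarrow> (LINT t::real|lborel. 0)) at_top"
  proof (rule integral_dominated_convergence_at_top)
    show "integrable lborel (\<lambda>t. (cmod (f t))\<^sup>2)" by (rule L2_integrable_square[OF f])
    show "\<forall>\<^sub>F R in at_top. AE t in lborel. norm ((cmod (cutoff R f t - f t))\<^sup>2) \<le> (cmod (f t))\<^sup>2"
      by (intro always_eventually allI AE_I2) (auto simp: cutoff_def indicator_def)
    show "AE t in lborel. ((\<lambda>R. (cmod (cutoff R f t - f t))\<^sup>2) \<longlongrightarrow> 0) at_top"
    proof (intro AE_I2 tendsto_eventually)
      fix t :: real
      show "\<forall>\<^sub>F R in at_top. (cmod (cutoff R f t - f t))\<^sup>2 = 0"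
        using eventually_ge_at_top[of "\<bar>t\<bar>"]
        by eventually_elim (auto simp: cutoff_def indicator_def)
    qed
  qed (auto simp: cutoff_def)
  then show ?thesis by (simp add: nrm2_def)
qed

lemma cutoff_tendsto_seq:
  assumes f: "f \<in> L2_space lborel"
  shows "(\<lambda>k::nat. nrm2 lborel (\<lambda>t. cutoff (real k) f t - f t)) \<longlonglongrightarrow> 0"
  using filterlim_compose[OF cutoff_tendsto[OF f] filterlim_real_sequentially] .

lemma is_fourier_iff:
  assumes f: "f \<in> L2_space lborel"
  shows "is_fourier f g \<longleftrightarrow> g \<in> L2_space lborel \<and>
    ((\<lambda>R. nrm2 lborel (\<lambda>\<xi>. FT (cutoff R f) \<xi> - g \<xi>)) \<longlongrightarrow> 0) at_top"
proof (cases "g \<in> L2_space lborel")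
  case True
  have "(\<integral>\<^sup>+ \<xi>. ennreal ((cmod (g \<xi> - truncated_fourier R f \<xi>))\<^sup>2) \<partial>lborel) =
      ennreal (nrm2 lborel (\<lambda>\<xi>. FT (cutoff R f) \<xi> - g \<xi>))" for R
    unfolding truncated_fourier_eq
    by (subst nrm2_minus_commute, rule L2_nn_integral) (intro L2_diff True FT_Plancherel cutoff_L2 f)
  moreover have "((\<lambda>R. ennreal (nrm2 lborel (\<lambda>\<xi>. FT (cutoff R f) \<xi> - g \<xi>))) \<longlongrightarrow> 0) at_top \<longleftrightarrow>
      ((\<lambda>R. nrm2 lborel (\<lambda>\<xi>. FT (cutoff R f) \<xi> - g \<xi>)) \<longlongrightarrow> 0) at_top"
    using tendsto_ennreal_iff[of "\<lambda>R. nrm2 lborel (\<lambda>\<xi>. FT (cutoff R f) \<xi> - g \<xi>)" at_top 0] by simp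
  ultimately show ?thesis using True by (simp add: is_fourier_def)
qed (simp add: is_fourier_def)

lemma FT_cutoff_diff:
  assumes f: "f \<in> L2_space lborel" and g: "g \<in> L2_space lborel" "integrable lborel g"
  shows "nrm2 lborel (\<lambda>\<xi>. FT (cutoff R f) \<xi> - FT g \<xi>) = 2 * pi * nrm2 lborel (\<lambda>t. cutoff R f t - g t)"
proof -
  have "(\<lambda>\<xi>. FT (cutoff R f) \<xi> - FT g \<xi>) = FT (\<lambda>t. cutoff R f t - g t)"
    by (intro ext FT_diff[symmetric] cutoff_L2 f g)
  then show ?thesis
    using FT_Plancherel(2)[OF L2_diff[OF cutoff_L2(1)[OF f] g(1)]] cutoff_L2(2)[OF f] g(2) by simp
qed

text \<open>
  The transforms of the truncations form a Cauchy sequence, because Plancherel's theorem applies to them.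
\<close>

lemma is_fourier_exists:
  assumes f: "f \<in> L2_space lborel"
  obtains g where "is_fourier f g"
proof -
  have FL: "FT (cutoff R f) \<in> L2_space lborel" for R
    by (intro FT_Plancherel cutoff_L2 f)
  have "\<exists>N. \<forall>m\<ge>N. \<forall>n\<ge>N. nrm2 lborel (\<lambda>\<xi>. FT (cutoff (real m) f) \<xi> - FT (cutoff (real n) f) \<xi>) < e" if "0 < e" for e
    using nrm2_Cauchy[OF cutoff_L2(1)[OF f] f cutoff_tendsto_seq[OF f], of "e / (2 * pi)"] that
    by (simp add: FT_cutoff_diff f cutoff_L2 field_simps)
  from Riesz_Fischer[of "\<lambda>k. FT (cutoff (real k) f)", OF FL this] obtain g where
    g: "g \<in> L2_space lborel" "(\<lambda>k. nrm2 lborel (\<lambda>\<xi>. FT (cutoff (real k) f) \<xi> - g \<xi>)) \<longlonglongrightarrow> 0" by blast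
  have eq: "nrm2 lborel (\<lambda>\<xi>. FT (cutoff R f) \<xi> - g \<xi>) = 2 * pi * nrm2 lborel (\<lambda>t. cutoff R f t - f t)" for R
  proof (rule LIMSEQ_unique)
    have m: "nrm2 lborel (\<lambda>\<xi>. (FT (cutoff R f) \<xi> - FT (cutoff (real k) f) \<xi>) - (FT (cutoff R f) \<xi> - g \<xi>)) =
        nrm2 lborel (\<lambda>\<xi>. FT (cutoff (real k) f) \<xi> - g \<xi>)" for k
      by (subst nrm2_minus_commute) simp
    show "(\<lambda>k. nrm2 lborel (\<lambda>\<xi>. FT (cutoff R f) \<xi> - FT (cutoff (real k) f) \<xi>)) \<longlonglongrightarrow> nrm2 lborel (\<lambda>\<xi>. FT (cutoff R f) \<xi> - g \<xi>)"
      by (rule nrm2_tendsto) (auto simp only: m intro!: L2_diff FL g)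
    have m': "nrm2 lborel (\<lambda>t. (cutoff R f t - cutoff (real k) f t) - (cutoff R f t - f t)) =
        nrm2 lborel (\<lambda>t. cutoff (real k) f t - f t)" for k
      by (subst nrm2_minus_commute) simp
    have "(\<lambda>k. nrm2 lborel (\<lambda>t. cutoff R f t - cutoff (real k) f t)) \<longlonglongrightarrow> nrm2 lborel (\<lambda>t. cutoff R f t - f t)"
      by (rule nrm2_tendsto) (auto simp only: m' intro!: L2_diff cutoff_L2 f cutoff_tendsto_seq)
    then show "(\<lambda>k. nrm2 lborel (\<lambda>\<xi>. FT (cutoff R f) \<xi> - FT (cutoff (real k) f) \<xi>)) \<longlonglongrightarrow>
        2 * pi * nrm2 lborel (\<lambda>t. cutoff R f t - f t)"
      unfolding FT_cutoff_diff[OF f cutoff_L2[OF f]] by (intro tendsto_intros)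
  qed
  have "is_fourier f g"
    unfolding is_fourier_iff[OF f] eq
    using g(1) tendsto_mult_right_zero[OF cutoff_tendsto[OF f], of "2 * pi"] by simp
  then show ?thesis by (rule that)
qed

lemma is_fourier_L2: "is_fourier f g \<Longrightarrow> g \<in> L2_space lborel"
  by (simp add: is_fourier_def)

lemma is_fourier_fourier:
  assumes "f \<in> L2_space lborel"
  shows "is_fourier f (fourier f)"
proof -
  obtain g where "is_fourier f g" using is_fourier_exists[OF assms] .
  then show ?thesis unfolding fourier_def by (rule someI[of "is_fourier f"])
qed

lemma fourier_L2: "f \<in> L2_space lborel \<Longrightarrow> fourier f \<in> L2_space lborel"
  by (rule is_fourier_L2[OF is_fourier_fourier])

lemma fourier_measurable: "f \<in> L2_space lborel \<Longrightarrow> fourier f \<in> borel_measurable borel"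
  using L2_measurable[OF fourier_L2] by simp

lemma is_fourier_nrm2:
  assumes f: "f \<in> L2_space lborel" and g: "is_fourier f g"
  shows "nrm2 lborel g = 2 * pi * nrm2 lborel f"
proof (rule tendsto_unique[OF trivial_limit_at_top_linorder])
  show "((\<lambda>R. nrm2 lborel (FT (cutoff R f))) \<longlongrightarrow> nrm2 lborel g) at_top"
    using g unfolding is_fourier_iff[OF f] by (intro nrm2_tendsto FT_Plancherel cutoff_L2 f) auto
  have "((\<lambda>R. nrm2 lborel (cutoff R f)) \<longlongrightarrow> nrm2 lborel f) at_top"
    by (intro nrm2_tendsto cutoff_L2 f cutoff_tendsto)
  then show "((\<lambda>R. nrm2 lborel (FT (cutoff R f))) \<longlongrightarrow> 2 * pi * nrm2 lborel f) at_top"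
    by (simp add: FT_Plancherel cutoff_L2 f tendsto_mult_left)
qed

lemma is_fourier_diff:
  assumes f: "f \<in> L2_space lborel" "is_fourier f g" and k: "k \<in> L2_space lborel" "is_fourier k l"
  shows "is_fourier (\<lambda>t. f t - k t) (\<lambda>\<xi>. g \<xi> - l \<xi>)"
proof -
  note L2 = is_fourier_L2[OF f(2)] is_fourier_L2[OF k(2)]
  have e: "FT (cutoff R (\<lambda>t. f t - k t)) \<xi> - (g \<xi> - l \<xi>) =
      (FT (cutoff R f) \<xi> - g \<xi>) - (FT (cutoff R k) \<xi> - l \<xi>)" for R \<xi>
    using FT_diff[OF cutoff_L2(2)[OF f(1), of R] cutoff_L2(2)[OF k(1), of R], of \<xi>]
    by (simp add: cutoff_def[abs_def] right_diff_distrib)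
  have z: "((\<lambda>R. 2 * nrm2 lborel (\<lambda>\<xi>. FT (cutoff R f) \<xi> - g \<xi>) + 2 * nrm2 lborel (\<lambda>\<xi>. FT (cutoff R k) \<xi> - l \<xi>)) \<longlongrightarrow> 0) at_top"
    using f(2) k(2) unfolding is_fourier_iff[OF f(1)] is_fourier_iff[OF k(1)]
    by (intro tendsto_add_zero tendsto_mult_right_zero) auto
  have "((\<lambda>R. nrm2 lborel (\<lambda>\<xi>. FT (cutoff R (\<lambda>t. f t - k t)) \<xi> - (g \<xi> - l \<xi>))) \<longlongrightarrow> 0) at_top"
  proof (rule Lim_null_comparison[OF _ z], intro always_eventually allI)
    fix R
    have FL: "(\<lambda>\<xi>. FT (cutoff R f) \<xi> - g \<xi>) \<in> L2_space lborel" "(\<lambda>\<xi>. FT (cutoff R k) \<xi> - l \<xi>) \<in> L2_space lborel"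
      by (intro L2_diff FT_Plancherel cutoff_L2 f k L2)+
    have "nrm2 lborel (\<lambda>\<xi>. (FT (cutoff R f) \<xi> - g \<xi>) - (FT (cutoff R k) \<xi> - l \<xi>)) \<le>
       2 * nrm2 lborel (\<lambda>\<xi>. FT (cutoff R f) \<xi> - g \<xi>) + 2 * nrm2 lborel (\<lambda>\<xi>. FT (cutoff R k) \<xi> - l \<xi>)"
      using nrm2_add[OF FL] nrm2_diff[OF FL]
        nrm2_nonneg[of lborel "\<lambda>\<xi>. (FT (cutoff R f) \<xi> - g \<xi>) + (FT (cutoff R k) \<xi> - l \<xi>)"] by linarith
    then show "norm (nrm2 lborel (\<lambda>\<xi>. FT (cutoff R (\<lambda>t. f t - k t)) \<xi> - (g \<xi> - l \<xi>))) \<le>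
       2 * nrm2 lborel (\<lambda>\<xi>. FT (cutoff R f) \<xi> - g \<xi>) + 2 * nrm2 lborel (\<lambda>\<xi>. FT (cutoff R k) \<xi> - l \<xi>)"
      by (simp only: e real_norm_def abs_of_nonneg[OF nrm2_nonneg])
  qed
  then show ?thesis
    unfolding is_fourier_iff[OF L2_diff[OF f(1) k(1)]] using L2_diff[OF L2] by simp
qed

lemma is_fourier_scale:
  assumes f: "f \<in> L2_space lborel" "is_fourier f g"
  shows "is_fourier (\<lambda>t. c * f t) (\<lambda>\<xi>. c * g \<xi>)"
proof -
  have c: "cutoff R (\<lambda>t. c * f t) = (\<lambda>t. c * cutoff R f t)" for R
    by (simp add: cutoff_def[abs_def] mult.left_commute)
  have "nrm2 lborel (\<lambda>\<xi>. FT (cutoff R (\<lambda>t. c * f t)) \<xi> - c * g \<xi>) =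
      (cmod c)\<^sup>2 * nrm2 lborel (\<lambda>\<xi>. FT (cutoff R f) \<xi> - g \<xi>)" for R
    unfolding c FT_scale nrm2_scale[symmetric] by (simp add: right_diff_distrib)
  then show ?thesis
    using f(2) unfolding is_fourier_iff[OF f(1)] is_fourier_iff[OF L2_scale[OF f(1)]]
    by (auto intro!: L2_scale tendsto_mult_right_zero)
qed

lemma is_fourier_dist:
  assumes "f \<in> L2_space lborel" "is_fourier f g" "k \<in> L2_space lborel" "is_fourier k l"
  shows "nrm2 lborel (\<lambda>\<xi>. g \<xi> - l \<xi>) = 2 * pi * nrm2 lborel (\<lambda>t. f t - k t)"
  by (rule is_fourier_nrm2[OF L2_diff is_fourier_diff]) (rule assms)+

lemma is_fourier_AE_unique:
  assumes f: "f \<in> L2_space lborel" "is_fourier f g" "is_fourier f l"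
  shows "AE \<xi> in lborel. g \<xi> = l \<xi>"
proof (rule nrm2_diff_eq_0)
  show "nrm2 lborel (\<lambda>\<xi>. g \<xi> - l \<xi>) = 0"
    unfolding is_fourier_dist[OF f(1,2) f(1,3)] by (simp add: nrm2_def)
qed (rule is_fourier_L2, fact)+

lemma is_fourier_injective:
  assumes f: "f \<in> L2_space lborel" "is_fourier f g" and k: "k \<in> L2_space lborel" "is_fourier k l"
    and eq: "AE \<xi> in lborel. g \<xi> = l \<xi>"
  shows "AE t in lborel. f t = k t"
proof (rule nrm2_diff_eq_0[OF f(1) k(1)])
  have "nrm2 lborel (\<lambda>\<xi>. g \<xi> - l \<xi>) = nrm2 lborel (\<lambda>\<xi>::real. 0)"
    using eq is_fourier_L2[OF f(2), THEN L2_measurable] is_fourier_L2[OF k(2), THEN L2_measurable]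
    by (intro nrm2_cong_AE) auto
  then show "nrm2 lborel (\<lambda>t. f t - k t) = 0"
    unfolding is_fourier_dist[OF f k] by (simp add: nrm2_def)
qed

lemma is_fourier_cong_AE:
  assumes f: "f \<in> L2_space lborel" "is_fourier f g" and l: "l \<in> borel_measurable lborel" "AE \<xi> in lborel. g \<xi> = l \<xi>"
  shows "is_fourier f l"
proof -
  have lL: "l \<in> L2_space lborel" by (rule L2_cong_AE[OF is_fourier_L2[OF f(2)] l])
  have [measurable]: "f \<in> borel_measurable borel" "g \<in> borel_measurable borel" "l \<in> borel_measurable borel"
    using f(1) is_fourier_L2[OF f(2)] l by (auto simp: L2_space_def)
  have [measurable]: "cutoff R f \<in> borel_measurable borel" for R unfolding cutoff_def[abs_def] by measurable
  have "nrm2 lborel (\<lambda>\<xi>. FT (cutoff R f) \<xi> - g \<xi>) = nrm2 lborel (\<lambda>\<xi>. FT (cutoff R f) \<xi> - l \<xi>)" for R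
    by (rule nrm2_cong_AE) (use l(2) in auto)
  then show ?thesis using f lL by (simp add: is_fourier_iff)
qed

lemma is_fourier_FT:
  assumes f: "f \<in> L2_space lborel" "integrable lborel f"
  shows "is_fourier f (FT f)"
  unfolding is_fourier_iff[OF f(1)] FT_cutoff_diff[OF f(1) f]
  using FT_Plancherel(1)[OF f] tendsto_mult_right_zero[OF cutoff_tendsto[OF f(1)], of "2 * pi"] by simp

lemma fourier_tendsto:
  assumes f: "\<And>k. f k \<in> L2_space lborel" "\<And>k. is_fourier (f k) (g k)" and f0: "f0 \<in> L2_space lborel" "is_fourier f0 g0"
    and lim: "((\<lambda>k. nrm2 lborel (\<lambda>t. f k t - f0 t)) \<longlongrightarrow> 0) F"
  shows "((\<lambda>k. nrm2 lborel (\<lambda>\<xi>. g k \<xi> - g0 \<xi>)) \<longlongrightarrow> 0) F"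
  unfolding is_fourier_dist[OF f f0] using tendsto_mult_right_zero[OF lim] .

lemma is_fourier_multiplication_formula:
  assumes f: "f \<in> L2_space lborel" "is_fourier f g" and k: "k \<in> L2_space lborel" "is_fourier k l"
  shows "(LINT \<xi>|lborel. g \<xi> * k \<xi>) = (LINT t|lborel. f t * l t)"
proof -
  note L2 = is_fourier_L2[OF f(2)] is_fourier_L2[OF k(2)]
  have c: "(\<lambda>x. cnj (cutoff R k x) - cnj (k x)) = (\<lambda>x. cnj (cutoff R k x - k x))"
    "(\<lambda>x. cnj (FT (cutoff R k) x) - cnj (l x)) = (\<lambda>x. cnj (FT (cutoff R k) x - l x))" for R by auto
  have 1: "((\<lambda>R. ip lborel (FT (cutoff R f)) (\<lambda>x. cnj (cutoff R k x))) \<longlongrightarrow> ip lborel g (\<lambda>x. cnj (k x))) at_top"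
  proof (rule ip_tendsto2)
    show "((\<lambda>R. nrm2 lborel (\<lambda>x. FT (cutoff R f) x - g x)) \<longlongrightarrow> 0) at_top"
      using f(2) unfolding is_fourier_iff[OF f(1)] by blast
    show "((\<lambda>R. nrm2 lborel (\<lambda>x. cnj (cutoff R k x) - cnj (k x))) \<longlongrightarrow> 0) at_top"
      unfolding c nrm2_cnj by (rule cutoff_tendsto[OF k(1)])
    show "FT (cutoff R f) \<in> L2_space lborel" for R
      by (rule FT_Plancherel(1)[OF cutoff_L2[OF f(1)]])
    show "(\<lambda>x. cnj (cutoff R k x)) \<in> L2_space lborel" for R
      by (rule L2_cnj[OF cutoff_L2(1)[OF k(1)]])
  qed (rule L2 L2_cnj[OF k(1)])+
  have 2: "((\<lambda>R. ip lborel (cutoff R f) (\<lambda>x. cnj (FT (cutoff R k) x))) \<longlongrightarrow> ip lborel f (\<lambda>x. cnj (l x))) at_top"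
  proof (rule ip_tendsto2)
    show "((\<lambda>R. nrm2 lborel (\<lambda>x. cutoff R f x - f x)) \<longlongrightarrow> 0) at_top"
      by (rule cutoff_tendsto[OF f(1)])
    show "((\<lambda>R. nrm2 lborel (\<lambda>x. cnj (FT (cutoff R k) x) - cnj (l x))) \<longlongrightarrow> 0) at_top"
      unfolding c nrm2_cnj using k(2) unfolding is_fourier_iff[OF k(1)] by blast
    show "cutoff R f \<in> L2_space lborel" for R
      by (rule cutoff_L2(1)[OF f(1)])
    show "(\<lambda>x. cnj (FT (cutoff R k) x)) \<in> L2_space lborel" for R
      by (rule L2_cnj[OF FT_Plancherel(1)[OF cutoff_L2[OF k(1)]]])
  qed (rule f(1) L2_cnj[OF L2(2)])+
  have "ip lborel (FT (cutoff R f)) (\<lambda>x. cnj (cutoff R k x)) = ip lborel (cutoff R f) (\<lambda>x. cnj (FT (cutoff R k) x))" for R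
    unfolding ip_def using FT_multiplication_formula[OF cutoff_L2(2)[OF f(1)] cutoff_L2(2)[OF k(1)]] by simp
  with 1 2 have "ip lborel g (\<lambda>x. cnj (k x)) = ip lborel f (\<lambda>x. cnj (l x))"
    by (intro tendsto_unique[OF trivial_limit_at_top_linorder 1]) simp
  then show ?thesis by (simp add: ip_def)
qed

text \<open>
  By the multiplication formula the conjugate of the transform of the conjugate is the adjoint of the
  Fourier transform; both being isometric up to the factor \<open>2\<pi>\<close>, they are inverse to each other.
\<close>

theorem fourier_inversion:
  assumes g: "g \<in> L2_space lborel" and k: "is_fourier (\<lambda>\<xi>. cnj (g \<xi>)) k"
  shows "is_fourier (\<lambda>t. of_real (1 / (2 * pi)) * cnj (k t)) g"
proof -
  define f where "f t = of_real (1 / (2 * pi)) * cnj (k t)" for t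
  have kL: "k \<in> L2_space lborel" by (rule is_fourier_L2[OF k])
  have fL: "f \<in> L2_space lborel" unfolding f_def[abs_def] by (intro L2_scale L2_cnj kL)
  obtain l where l: "is_fourier f l" using is_fourier_exists[OF fL] .
  have lL: "l \<in> L2_space lborel" by (rule is_fourier_L2[OF l])
  have nk: "nrm2 lborel k = 2 * pi * nrm2 lborel g"
    using is_fourier_nrm2[OF L2_cnj[OF g] k] by simp
  have nf: "nrm2 lborel f = nrm2 lborel g / (2 * pi)"
    unfolding f_def[abs_def] nrm2_scale nrm2_cnj nk norm_of_real by (simp add: power2_eq_square field_simps)
  have nl: "nrm2 lborel l = nrm2 lborel g"
    using is_fourier_nrm2[OF fL l] nf by simp
  have "ip lborel l g = (LINT t|lborel. f t * k t)"
    unfolding ip_def by (rule is_fourier_multiplication_formula[OF fL l L2_cnj[OF g] k])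
  also have "\<dots> = of_real (1 / (2 * pi)) * ip lborel k k"
    unfolding ip_def f_def by (subst integral_mult_right_zero[symmetric]) (simp add: mult_ac)
  also have "\<dots> = of_real (nrm2 lborel g)"
    unfolding ip_self nk by simp
  finally have "nrm2 lborel (\<lambda>x. l x - g x) = 0"
    using nrm2_diff[OF lL g] nl by simp
  then have "AE x in lborel. l x = g x" by (rule nrm2_diff_eq_0[OF lL g])
  from is_fourier_cong_AE[OF fL l L2_measurable[OF g] this] show ?thesis
    by (simp add: f_def[abs_def])
qed

theorem fourier_Parseval:
  assumes f: "f \<in> L2_space lborel" "is_fourier f g" and k: "k \<in> L2_space lborel" "is_fourier k l"
  shows "ip lborel g l = 2 * pi * ip lborel f k"
proof -
  note L2 = is_fourier_L2[OF f(2)] is_fourier_L2[OF k(2)]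
  have re: "Re (ip lborel g l) = 2 * pi * Re (ip lborel f k)"
    if "k \<in> L2_space lborel" "is_fourier k l" for k l
    using is_fourier_dist[OF f that] nrm2_diff[OF f(1) that(1)] nrm2_diff[OF L2(1) is_fourier_L2[OF that(2)]]
      is_fourier_nrm2[OF f] is_fourier_nrm2[OF that] by (simp add: algebra_simps)
  have "Re (ip lborel g (\<lambda>\<xi>. \<i> * l \<xi>)) = 2 * pi * Re (ip lborel f (\<lambda>t. \<i> * k t))"
    by (rule re) (intro L2_scale k is_fourier_scale)+
  then show ?thesis using re[OF k] by (simp add: ip_scale_right complex_eq_iff)
qed

section \<open>Exponential integrals depending on a parameter\<close>

lemma square_le_exp:
  fixes r x :: real
  assumes "0 < r" "0 \<le> x"
  shows "x\<^sup>2 \<le> 2 / r\<^sup>2 * exp (r * x)"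
proof -
  have "1 + r * x + (r * x)\<^sup>2 / 2 \<le> exp (r * x)"
    by (rule exp_lower_Taylor_quadratic) (use assms in simp)
  moreover have "0 \<le> r * x" using assms by simp
  ultimately have "(r * x)\<^sup>2 / 2 \<le> exp (r * x)" by linarith
  then show ?thesis using assms by (simp add: field_simps power_mult_distrib)
qed

text \<open>
  The difference quotient differs from the formal derivative by at most
  \<open>\<bar>h\<bar> \<integral> \<bar>g\<bar> u\<^sup>2 e\<^bsup>-pu+\<bar>hu\<bar>\<^esup>\<close>, and \<open>u\<^sup>2 e\<^bsup>\<bar>hu\<bar>\<^esup>\<close> is dominated by \<open>e\<^bsup>ru\<^esup> + e\<^bsup>-ru\<^esup>\<close>, which
  only moves \<open>p\<close> a little.
\<close>

theorem holomorphic_exponential_integral: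
  fixes g :: "real \<Rightarrow> complex" and u :: "real \<Rightarrow> real"
  assumes [measurable]: "g \<in> borel_measurable M" "u \<in> borel_measurable M"
    and int: "\<And>p. c < Re p \<Longrightarrow> integrable M (\<lambda>x. g x * exp (- (p * of_real (u x))))"
  shows "(\<lambda>p. LINT x|M. g x * exp (- (p * of_real (u x)))) holomorphic_on {p. c < Re p}"
proof -
  define E where "E p x = g x * exp (- (p * of_real (u x)))" for p x
  define \<Phi> where "\<Phi> p = (LINT x|M. E p x)" for p
  have "\<exists>D. (\<Phi> has_field_derivative D) (at p)" if p: "c < Re p" for p
  proof -
    define r where "r = (Re p - c) / 2"
    have r: "0 < r" "c < Re (p - of_real r)" "c < Re (p + of_real r)"
      using p by (auto simp: r_def field_simps)
    have Ei: "integrable M (E q)" if "c < Re q" for q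
      unfolding E_def[abs_def] by (rule int[OF that])
    have Em [measurable]: "E q \<in> borel_measurable M" for q unfolding E_def[abs_def] by measurable
    define B where "B x = cmod (E (p - of_real r) x) + cmod (E (p + of_real r) x)" for x
    have Bi: "integrable M B"
      unfolding B_def[abs_def] by (intro Bochner_Integration.integrable_add integrable_norm Ei r)
    have EB: "cmod (E p x) * exp (r * \<bar>u x\<bar>) \<le> B x" for x
    proof -
      have "cmod (E (p - of_real r) x) = cmod (E p x) * exp (r * u x)"
        "cmod (E (p + of_real r) x) = cmod (E p x) * exp (- (r * u x))"
        unfolding E_def norm_mult norm_exp_eq_Re
        by (simp_all add: algebra_simps flip: exp_add)
      moreover have "cmod (E p x) * exp (r * \<bar>u x\<bar>) \<le> cmod (E p x) * exp (r * u x) + cmod (E p x) * exp (- (r * u x))"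
        unfolding distrib_left[symmetric]
        by (intro mult_left_mono) (auto simp: abs_if)
      ultimately show ?thesis by (simp add: B_def)
    qed
    define D where "D = (LINT x|M. - of_real (u x) * E p x)"
    have Di: "integrable M (\<lambda>x. - of_real (u x) * E p x)"
    proof (rule Bochner_Integration.integrable_bound)
      show "integrable M (\<lambda>x. B x / r)" using Bi by simp
      show "AE x in M. norm (- of_real (u x) * E p x) \<le> norm (B x / r)"
      proof (intro AE_I2)
        fix x
        have "r * \<bar>u x\<bar> \<le> exp (r * \<bar>u x\<bar>)" using exp_ge_add_one_self[of "r * \<bar>u x\<bar>"] by linarith
        then have "r * \<bar>u x\<bar> * cmod (E p x) \<le> exp (r * \<bar>u x\<bar>) * cmod (E p x)"
          by (intro mult_right_mono) auto
        also have "\<dots> \<le> B x" using EB[of x] by (simp add: mult.commute)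
        finally have "\<bar>u x\<bar> * cmod (E p x) \<le> B x / r" using r by (simp add: field_simps)
        also have "\<dots> \<le> norm (B x / r)" by (simp only: real_norm_def abs_ge_self)
        finally show "norm (- of_real (u x) * E p x) \<le> norm (B x / r)" by (simp add: norm_mult)
      qed
    qed measurable
    define K where "K = 2 / (r/2)\<^sup>2 * (LINT x|M. B x)"
    have est: "cmod ((\<Phi> (p + h) - \<Phi> p) / h - D) \<le> cmod h * K" if h: "h \<noteq> 0" "cmod h < r / 2" for h
    proof -
      have ph: "c < Re (p + h)"
        using abs_Re_le_cmod[of h] h r p by (simp add: r_def abs_le_iff)
      have "(\<Phi> (p + h) - \<Phi> p) / h - D = (LINT x|M. (E (p + h) x - E p x) / h - (- of_real (u x) * E p x))"
        unfolding \<Phi>_def D_def using Ei[OF ph] Ei[OF p] Di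
        by (simp add: Bochner_Integration.integral_diff)
      also have "cmod \<dots> \<le> (LINT x|M. cmod h * (2 / (r/2)\<^sup>2) * B x)"
      proof (rule Bochner_Integration.integral_norm_bound_integral)
        show "integrable M (\<lambda>x. (E (p + h) x - E p x) / h - (- of_real (u x) * E p x))"
          using Ei[OF ph] Ei[OF p] Di by simp
        show "integrable M (\<lambda>x. cmod h * (2 / (r/2)\<^sup>2) * B x)" using Bi by simp
        fix x
        define w where "w = - (h * of_real (u x))"
        have E2: "E (p + h) x = E p x * exp w"
          unfolding E_def w_def by (simp add: distrib_right exp_diff exp_minus field_simps)
        have "(E (p + h) x - E p x) / h - (- of_real (u x) * E p x) = E p x * (exp w - (1 + w)) / h"
          using h unfolding E2 by (simp add: w_def field_simps)
        then have "cmod ((E (p + h) x - E p x) / h - (- of_real (u x) * E p x)) =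
            cmod (E p x) * cmod (exp w - (1 + w)) / cmod h"
          by (simp add: norm_mult norm_divide)
        also have "\<dots> \<le> cmod (E p x) * (exp (r/2 * \<bar>u x\<bar>) * (cmod w)\<^sup>2) / cmod h"
        proof (intro divide_right_mono mult_left_mono)
          have "cmod (exp w - (1 + w)) \<le> exp \<bar>Re w\<bar> * (cmod w)\<^sup>2"
            using Taylor_exp[of w 1] by (simp add: power2_eq_square)
          also have "\<dots> \<le> exp (r/2 * \<bar>u x\<bar>) * (cmod w)\<^sup>2"
          proof (intro mult_right_mono)
            have "\<bar>Re w\<bar> \<le> cmod h * \<bar>u x\<bar>"
              using abs_Re_le_cmod[of w] by (simp add: w_def norm_mult)
            also have "\<dots> \<le> r/2 * \<bar>u x\<bar>" using h by (intro mult_right_mono) auto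
            finally show "exp \<bar>Re w\<bar> \<le> exp (r/2 * \<bar>u x\<bar>)" by simp
          qed simp
          finally show "cmod (exp w - (1 + w)) \<le> exp (r/2 * \<bar>u x\<bar>) * (cmod w)\<^sup>2" .
        qed auto
        also have "\<dots> = cmod h * (cmod (E p x) * exp (r/2 * \<bar>u x\<bar>) * \<bar>u x\<bar>\<^sup>2)"
          using h by (simp add: w_def norm_mult power_mult_distrib power2_eq_square)
        also have "\<dots> \<le> cmod h * (cmod (E p x) * exp (r/2 * \<bar>u x\<bar>) * (2 / (r/2)\<^sup>2 * exp (r/2 * \<bar>u x\<bar>)))"
          using r by (intro mult_left_mono square_le_exp) auto
        also have "\<dots> = cmod h * (2 / (r/2)\<^sup>2) * (cmod (E p x) * exp (r * \<bar>u x\<bar>))"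
          by (simp add: mult_ac flip: exp_add)
        also have "\<dots> \<le> cmod h * (2 / (r/2)\<^sup>2) * B x"
          by (intro mult_left_mono EB) auto
        finally show "cmod ((E (p + h) x - E p x) / h - (- of_real (u x) * E p x)) \<le> cmod h * (2 / (r/2)\<^sup>2) * B x" .
      qed
      also have "\<dots> = cmod h * K" by (simp add: K_def)
      finally show ?thesis .
    qed
    have "((\<lambda>h. (\<Phi> (p + h) - \<Phi> p) / h - D) \<longlongrightarrow> 0) (at 0)"
    proof (rule Lim_null_comparison)
      show "\<forall>\<^sub>F h in at 0. norm ((\<Phi> (p + h) - \<Phi> p) / h - D) \<le> cmod h * K"
        unfolding eventually_at using est r(1) by (intro exI[of _ "r/2"]) auto
      show "((\<lambda>h. cmod h * K) \<longlongrightarrow> 0) (at 0)"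
        by (intro tendsto_mult_left_zero tendsto_norm_zero tendsto_ident_at)
    qed
    then have "(\<lambda>h. (\<Phi> (p + h) - \<Phi> p) / h) \<midarrow>0\<rightarrow> D" by (rule LIM_zero_cancel)
    then show ?thesis by (auto simp: DERIV_def)
  qed
  then have "\<Phi> holomorphic_on {p. c < Re p}"
    unfolding holomorphic_on_def field_differentiable_def
    using DERIV_subset by blast
  then show ?thesis by (simp add: \<Phi>_def[abs_def] E_def[abs_def])
qed

section \<open>Functions on the positive half-line\<close>

definition lpos :: "real measure" where
  "lpos = restrict_space lborel {0<..}"

text \<open>
  Through this extension by zero the half-line inherits the theory on the whole line.
\<close>

definition posp :: "(real \<Rightarrow> complex) \<Rightarrow> real \<Rightarrow> complex" where
  "posp \<phi> \<xi> = (if 0 < \<xi> then \<phi> \<xi> else 0)"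

lemma space_lpos [simp]: "space lpos = {0<..}"
  by (simp add: lpos_def space_restrict_space)

lemma measurable_ident_lpos: "(\<lambda>x. x) \<in> borel_measurable lpos"
  by (simp add: lpos_def measurable_restrict_space1)

lemma measurable_lpos: "f \<in> borel_measurable borel \<Longrightarrow> f \<in> borel_measurable lpos"
  by (simp add: lpos_def measurable_restrict_space1)

lemma posp_measurable:
  "posp \<phi> \<in> borel_measurable borel \<longleftrightarrow> \<phi> \<in> borel_measurable lpos"
proof -
  have "\<phi> \<in> borel_measurable lpos \<longleftrightarrow> (\<lambda>x. indicator {0<..} x *\<^sub>R \<phi> x) \<in> borel_measurable lborel"
    unfolding lpos_def by (rule borel_measurable_restrict_space_iff) simp
  also have "(\<lambda>x. indicator {0<..} x *\<^sub>R \<phi> x) = posp \<phi>"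
    by (auto simp: posp_def indicator_def)
  finally show ?thesis by (simp only: measurable_lborel2)
qed

lemma nn_integral_lpos: "(\<integral>\<^sup>+x. f x \<partial>lpos) = (\<integral>\<^sup>+x. f x * indicator {0<..} x \<partial>lborel)"
  by (simp add: lpos_def nn_integral_restrict_space)

lemma integrable_lpos_iff: "integrable lpos \<phi> \<longleftrightarrow> integrable lborel (posp \<phi>)"
proof -
  have "(\<lambda>x. indicator {0<..} x *\<^sub>R \<phi> x) = posp \<phi>"
    by (auto simp: posp_def indicator_def)
  then show ?thesis by (simp add: lpos_def integrable_restrict_space)
qed

lemma integral_lpos: "integral\<^sup>L lpos \<phi> = integral\<^sup>L lborel (posp \<phi>)"
proof -
  have "(\<lambda>x. indicator {0<..} x *\<^sub>R \<phi> x) = posp \<phi>"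
    by (auto simp: posp_def indicator_def)
  then show ?thesis by (simp add: lpos_def integral_restrict_space)
qed

lemma AE_lpos: "(AE x in lpos. P x) \<longleftrightarrow> (AE x in lborel. 0 < x \<longrightarrow> P x)"
  unfolding lpos_def by (subst AE_restrict_space_iff) auto

lemma nn_integral_square_posp:
  "(\<integral>\<^sup>+x. ennreal ((cmod (posp \<phi> x))\<^sup>2) \<partial>lborel) = (\<integral>\<^sup>+x. ennreal ((cmod (\<phi> x))\<^sup>2) \<partial>lpos)"
  unfolding nn_integral_lpos by (intro nn_integral_cong) (auto simp: posp_def indicator_def)

lemma posp_L2: "posp \<phi> \<in> L2_space lborel \<longleftrightarrow> \<phi> \<in> L2_space lpos"
proof
  assume p: "posp \<phi> \<in> L2_space lborel"
  show "\<phi> \<in> L2_space lpos"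
  proof (rule L2_spaceI)
    show "\<phi> \<in> borel_measurable lpos"
      using L2_measurable[OF p] by (simp only: measurable_lborel2 posp_measurable)
    show "(\<integral>\<^sup>+x. ennreal ((cmod (\<phi> x))\<^sup>2) \<partial>lpos) < \<infinity>"
      unfolding nn_integral_square_posp[symmetric] L2_nn_integral[OF p] by simp
  qed
next
  assume p: "\<phi> \<in> L2_space lpos"
  show "posp \<phi> \<in> L2_space lborel"
  proof (rule L2_spaceI)
    show "posp \<phi> \<in> borel_measurable lborel"
      using L2_measurable[OF p] by (simp only: measurable_lborel2 posp_measurable)
    show "(\<integral>\<^sup>+x. ennreal ((cmod (posp \<phi> x))\<^sup>2) \<partial>lborel) < \<infinity>"
      unfolding nn_integral_square_posp L2_nn_integral[OF p] by simp
  qed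
qed

lemma nrm2_posp:
  assumes "\<phi> \<in> L2_space lpos"
  shows "nrm2 lborel (posp \<phi>) = nrm2 lpos \<phi>"
proof (rule nrm2_eqI)
  show "(\<integral>\<^sup>+x. ennreal ((cmod (posp \<phi> x))\<^sup>2) \<partial>lborel) = ennreal (nrm2 lpos \<phi>)"
    unfolding nn_integral_square_posp by (rule L2_nn_integral[OF assms])
  show "posp \<phi> \<in> borel_measurable lborel"
    using assms by (intro L2_measurable) (simp only: posp_L2)
qed simp

lemma L2_lpos_if_L2_lborel: "f \<in> L2_space lborel \<Longrightarrow> f \<in> L2_space lpos"
proof -
  assume "f \<in> L2_space lborel"
  from L2_indicator_mult[OF this, of "{0<..}"] have "(\<lambda>x. indicator {0<..} x * f x) \<in> L2_space lborel" by simp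
  moreover have "(\<lambda>x. indicator {0<..} x * f x) = posp f" by (auto simp: posp_def indicator_def)
  ultimately show ?thesis by (simp add: posp_L2)
qed

text \<open>
  The Fourier transform of the extension by zero vanishes; by Plancherel's theorem so does its norm.
\<close>

lemma lpos_Fourier_unique:
  assumes g: "g \<in> L2_space lpos" "integrable lpos g"
    and 0: "\<And>\<theta>. (LINT \<xi>|lpos. g \<xi> * exp (- (\<i> * of_real (\<theta> * \<xi>)))) = 0"
  shows "AE \<xi> in lpos. g \<xi> = 0"
proof -
  have "FT (posp g) \<theta> = 0" for \<theta>
  proof -
    have "FT (posp g) \<theta> = integral\<^sup>L lborel (posp (\<lambda>\<xi>. g \<xi> * exp (- (\<i> * of_real (\<theta> * \<xi>)))))"
      unfolding FT_def by (intro Bochner_Integration.integral_cong) (auto simp: posp_def)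
    then show ?thesis using 0[of \<theta>] by (simp add: integral_lpos)
  qed
  then have "nrm2 lborel (FT (posp g)) = 0" by (simp add: nrm2_def)
  then have "nrm2 lborel (posp g) = 0"
    using FT_Plancherel(2)[of "posp g"] g by (simp add: posp_L2 integrable_lpos_iff)
  then have "AE \<xi> in lborel. posp g \<xi> = 0"
    by (intro nrm2_eq_0) (simp_all add: posp_L2 g)
  then show ?thesis
    unfolding AE_lpos by eventually_elim (auto simp: posp_def split: if_splits)
qed

section \<open>Gamma and Laplace integrals\<close>

lemma Gamma_integral_lpos_real:
  fixes a :: complex and p :: real
  assumes a: "0 < Re a" and p: "0 < p"
  shows "integrable lpos (\<lambda>\<xi>. of_real \<xi> powr (a - 1) * exp (- (of_real p * of_real \<xi>)))"
    "(LINT \<xi>|lpos. of_real \<xi> powr (a - 1) * exp (- (of_real p * of_real \<xi>))) = Gamma a / of_real p powr a"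
proof -
  let ?f = "\<lambda>t. complex_of_real t powr (a - 1) / of_real (exp t)"
  let ?g = "\<lambda>\<xi>. complex_of_real \<xi> powr (a - 1) * exp (- (of_real p * of_real \<xi>))"
  have ind: "(\<lambda>x. indicator {0<..} x *\<^sub>R ?f x) = posp ?f" by (auto simp: posp_def indicator_def)
  have m: "posp ?f \<in> borel_measurable borel"
    unfolding posp_def[abs_def] by measurable
  have "integrable lebesgue (posp ?f)"
    using absolutely_integrable_Gamma_integral'[OF a] unfolding set_integrable_def ind .
  then have fi: "integrable lborel (posp ?f)"
    by (subst (asm) integrable_completion) (simp_all only: measurable_lborel2 m)
  have "(?f has_integral Gamma a) {0<..}" by (rule Gamma_integral_complex'[OF a])
  moreover have "(?f has_integral (LINT x:{0<..}|lebesgue. ?f x)) {0<..}"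
    by (rule has_integral_set_lebesgue[OF absolutely_integrable_Gamma_integral'[OF a]])
  ultimately have "Gamma a = (LINT x:{0<..}|lebesgue. ?f x)" by (rule has_integral_unique)
  also have "\<dots> = integral\<^sup>L lborel (posp ?f)"
    unfolding set_lebesgue_integral_def ind by (rule integral_completion) (simp only: measurable_lborel2 m)
  finally have fG: "integral\<^sup>L lborel (posp ?f) = Gamma a" ..
  have eq: "posp ?g \<xi> = of_real p powr (1 - a) * posp ?f (0 + p * \<xi>)" for \<xi>
  proof (cases "0 < \<xi>")
    case True
    have "complex_of_real p powr (1 - a) * (complex_of_real p * of_real \<xi>) powr (a - 1) = of_real \<xi> powr (a - 1)"
      using True p by (subst powr_times_real) (auto simp: mult.assoc[symmetric] powr_add[symmetric])
    then show ?thesis using True p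
      by (simp add: posp_def exp_minus field_simps exp_of_real[symmetric] zero_less_mult_iff)
  next
    case False
    then show ?thesis using p by (simp add: posp_def zero_less_mult_iff)
  qed
  have pg: "posp ?g = (\<lambda>\<xi>. of_real p powr (1 - a) * posp ?f (0 + p * \<xi>))" by (rule ext) (rule eq)
  have "integrable lborel (\<lambda>\<xi>. posp ?f (0 + p * \<xi>))"
    by (rule lborel_integrable_real_affine[OF fi]) (use p in simp)
  then show "integrable lpos ?g" unfolding integrable_lpos_iff pg by simp
  have "Gamma a = \<bar>p\<bar> *\<^sub>R (LINT \<xi>|lborel. posp ?f (0 + p * \<xi>))"
    unfolding fG[symmetric] by (rule lborel_integral_real_affine) (use p in simp)
  then have "(LINT \<xi>|lborel. posp ?f (0 + p * \<xi>)) = Gamma a / of_real p"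
    using p by (simp add: scaleR_conv_of_real field_simps)
  then have "integral\<^sup>L lpos ?g = of_real p powr (1 - a) * (Gamma a / of_real p)"
    unfolding integral_lpos pg by simp
  also have "\<dots> = Gamma a / of_real p powr a"
    using p by (simp add: powr_diff)
  finally show "integral\<^sup>L lpos ?g = Gamma a / of_real p powr a" .
qed

lemma norm_powr_real_base:
  assumes "0 < \<xi>"
  shows "cmod (of_real \<xi> powr a) = \<xi> powr Re a"
  using assms by (simp add: norm_powr_real_powr)

theorem Gamma_integral_lpos:
  fixes a p :: complex
  assumes a: "0 < Re a" and p: "0 < Re p"
  shows "integrable lpos (\<lambda>\<xi>. of_real \<xi> powr (a - 1) * exp (- (p * of_real \<xi>)))"
    "(LINT \<xi>|lpos. of_real \<xi> powr (a - 1) * exp (- (p * of_real \<xi>))) = Gamma a / p powr a"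
proof -
  have [measurable]: "(\<lambda>\<xi>. complex_of_real \<xi> powr (a - 1)) \<in> borel_measurable lpos"
    by (rule measurable_lpos) measurable
  have int: "integrable lpos (\<lambda>\<xi>. of_real \<xi> powr (a - 1) * exp (- (p * of_real \<xi>)))" if "0 < Re p" for p
  proof (rule Bochner_Integration.integrable_bound[OF Gamma_integral_lpos_real(1)[OF a that]])
    show "AE \<xi> in lpos. norm (of_real \<xi> powr (a - 1) * exp (- (p * of_real \<xi>))) \<le>
        norm (of_real \<xi> powr (a - 1) * exp (- (complex_of_real (Re p) * of_real \<xi>)))"
      by (intro AE_I2) (simp add: norm_mult norm_exp_eq_Re)
    show "(\<lambda>\<xi>. of_real \<xi> powr (a - 1) * exp (- (p * of_real \<xi>))) \<in> borel_measurable lpos"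
      by (rule measurable_lpos) measurable
  qed
  show "integrable lpos (\<lambda>\<xi>. of_real \<xi> powr (a - 1) * exp (- (p * of_real \<xi>)))"
    by (rule int[OF p])
  define \<Phi> where "\<Phi> p = (LINT \<xi>|lpos. of_real \<xi> powr (a - 1) * exp (- (p * of_real \<xi>)))" for p
  have h1: "\<Phi> holomorphic_on {p. 0 < Re p}"
    unfolding \<Phi>_def[abs_def]
    by (rule holomorphic_exponential_integral[OF _ _ int]) (rule measurable_lpos, measurable)+
  have h2: "(\<lambda>p. Gamma a / p powr a) holomorphic_on {p. 0 < Re p}"
    by (intro holomorphic_intros) (auto simp: complex_nonpos_Reals_iff)
  have cv: "convex {p::complex. 0 < Re p}" by (rule convex_halfspace_Re_gt)
  have "\<Phi> p - Gamma a / p powr a = 0"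
  proof (rule analytic_continuation[of "\<lambda>p. \<Phi> p - Gamma a / p powr a" "{p. 0 < Re p}" "of_real ` {0<..}" 1])
    show "(\<lambda>p. \<Phi> p - Gamma a / p powr a) holomorphic_on {p. 0 < Re p}"
      by (intro holomorphic_intros h1 h2)
    show "open {p. 0 < Re p}" by (rule open_halfspace_Re_gt)
    show "connected {p::complex. 0 < Re p}" by (rule convex_connected[OF cv])
    show "(1::complex) islimpt of_real ` {0<..}"
    proof -
      have "(\<lambda>n. complex_of_real (1 + inverse (real (Suc n)))) \<longlonglongrightarrow> of_real (1 + 0)"
        by (intro tendsto_intros LIMSEQ_inverse_real_of_nat)
      moreover have "complex_of_real (1 + inverse (real (Suc n))) \<in> of_real ` {0<..} - {1}" for n
      proof (intro DiffI imageI)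
        show "1 + inverse (real (Suc n)) \<in> {0<..}" by (simp add: add_pos_pos)
        have "1 + inverse (real (Suc n)) \<noteq> 1" by simp
        then show "complex_of_real (1 + inverse (real (Suc n))) \<notin> {1}"
          by (simp only: singleton_iff of_real_eq_1_iff not_False_eq_True)
      qed
      ultimately show ?thesis
        unfolding islimpt_sequential by (intro exI[of _ "\<lambda>n. complex_of_real (1 + inverse (real (Suc n)))"]) simp
    qed
    fix z :: complex assume "z \<in> of_real ` {0<..}"
    then show "\<Phi> z - Gamma a / z powr a = 0"
      using Gamma_integral_lpos_real(2)[OF a] by (auto simp: \<Phi>_def)
  qed (use p in auto)
  then show "(LINT \<xi>|lpos. of_real \<xi> powr (a - 1) * exp (- (p * of_real \<xi>))) = Gamma a / p powr a"
    by (simp add: \<Phi>_def)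
qed

lemma L2_spaceI_integrable:
  "f \<in> borel_measurable M \<Longrightarrow> integrable M (\<lambda>x. (cmod (f x))\<^sup>2) \<Longrightarrow> f \<in> L2_space M"
  by (simp add: L2_space_def)

lemma power_exp_L2:
  assumes b: "- 1 / 2 < Re b" and p: "0 < Re p"
  shows "(\<lambda>\<xi>. of_real \<xi> powr b * exp (- (p * of_real \<xi>))) \<in> L2_space lpos"
proof -
  define a where "a = complex_of_real (2 * Re b + 1)"
  have "integrable lpos (\<lambda>\<xi>. of_real \<xi> powr (a - 1) * exp (- (of_real (2 * Re p) * of_real \<xi>)))"
    by (rule Gamma_integral_lpos) (use b p in \<open>simp_all add: a_def\<close>)
  then have int0: "integrable lpos (\<lambda>\<xi>. cmod (of_real \<xi> powr (a - 1) * exp (- (of_real (2 * Re p) * of_real \<xi>))))"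
    by (rule integrable_norm)
  have eq: "cmod (of_real \<xi> powr (a - 1) * exp (- (of_real (2 * Re p) * of_real \<xi>))) =
      (cmod (of_real \<xi> powr b * exp (- (p * of_real \<xi>))))\<^sup>2" if "\<xi> \<in> space lpos" for \<xi>
  proof -
    have \<xi>: "0 < \<xi>" using that by simp
    have 1: "cmod (of_real \<xi> powr (a - 1)) = (\<xi> powr Re b)\<^sup>2"
      unfolding norm_powr_real_base[OF \<xi>] using \<xi> by (simp add: a_def power2_eq_square flip: powr_add)
    have 2: "cmod (exp (- (complex_of_real (2 * Re p) * of_real \<xi>))) = (cmod (exp (- (p * of_real \<xi>))))\<^sup>2"
      by (simp add: norm_exp_eq_Re power2_eq_square flip: exp_add)
    show ?thesis
      unfolding norm_mult power_mult_distrib norm_powr_real_base[OF \<xi>, of b] 1 2 ..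
  qed
  have i2: "integrable lpos (\<lambda>\<xi>. (cmod (of_real \<xi> powr b * exp (- (p * of_real \<xi>))))\<^sup>2)"
    by (rule Bochner_Integration.integrable_cong[OF refl eq, THEN iffD1, OF _ int0])
  have "(\<lambda>\<xi>. complex_of_real \<xi> powr b * exp (- (p * of_real \<xi>))) \<in> borel_measurable lpos"
    by (rule measurable_lpos) measurable
  then show ?thesis using i2 by (rule L2_spaceI_integrable)
qed

lemma exp_L2:
  assumes "0 < Re p"
  shows "(\<lambda>\<xi>. exp (- (p * of_real \<xi>))) \<in> L2_space lpos"
proof (rule L2_cong_AE[OF power_exp_L2[of 0 p]])
  show "(\<lambda>\<xi>. exp (- (p * complex_of_real \<xi>))) \<in> borel_measurable lpos"
    by (rule measurable_lpos) measurable
  show "AE \<xi> in lpos. complex_of_real \<xi> powr 0 * exp (- (p * of_real \<xi>)) = exp (- (p * of_real \<xi>))"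
    by (rule AE_I2) simp
qed (use assms in auto)

section \<open>The Hardy space and the wavelet transform on the Fourier side\<close>

lemma L2_affine:
  fixes f :: "real \<Rightarrow> complex"
  assumes f: "f \<in> L2_space lborel" and c: "0 < c"
  shows "(\<lambda>t. f (s + c * t)) \<in> L2_space lborel"
    "nrm2 lborel (\<lambda>t. f (s + c * t)) = nrm2 lborel f / c"
proof -
  have [measurable]: "f \<in> borel_measurable borel" using L2_measurable[OF f] by simp
  have "integrable lborel (\<lambda>t. (cmod (f (s + c * t)))\<^sup>2)"
    by (rule lborel_integrable_real_affine) (use L2_integrable_square[OF f] c in auto)
  then show "(\<lambda>t. f (s + c * t)) \<in> L2_space lborel"
    by (simp add: L2_space_def)
  show "nrm2 lborel (\<lambda>t. f (s + c * t)) = nrm2 lborel f / c"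
    unfolding nrm2_def using lborel_integral_real_affine[of c "\<lambda>t. (cmod (f t))\<^sup>2" s] c
    by simp
qed

lemma L2_unimodular_mult:
  assumes f: "f \<in> L2_space M" and u: "u \<in> borel_measurable M" "\<And>x. cmod (u x) = r"
  shows "(\<lambda>x. u x * f x) \<in> L2_space M" "nrm2 M (\<lambda>x. u x * f x) = r\<^sup>2 * nrm2 M f"
  using assms by (auto simp: L2_space_def nrm2_def norm_mult power_mult_distrib)

lemma FT_affine:
  assumes c: "0 < c"
  shows "FT (\<lambda>t. f (s + c * t)) \<xi> = of_real (1 / c) * exp (\<i> * of_real (s / c * \<xi>)) * FT f (0 + 1 / c * \<xi>)"
proof -
  have "FT f (1 / c * \<xi>) = \<bar>c\<bar> *\<^sub>R (LINT t|lborel. f (s + c * t) * exp (- (\<i> * of_real (1 / c * \<xi> * (s + c * t)))))"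
    unfolding FT_def by (rule lborel_integral_real_affine) (use c in simp)
  also have "(LINT t|lborel. f (s + c * t) * exp (- (\<i> * of_real (1 / c * \<xi> * (s + c * t))))) =
      (LINT t|lborel. exp (- (\<i> * of_real (s / c * \<xi>))) * (f (s + c * t) * exp (- (\<i> * of_real (\<xi> * t)))))"
  proof (intro Bochner_Integration.integral_cong refl)
    fix t
    have "1 / c * \<xi> * (s + c * t) = s / c * \<xi> + \<xi> * t" using c by (simp add: field_simps)
    then have "exp (- (\<i> * of_real (1 / c * \<xi> * (s + c * t)))) =
        exp (- (\<i> * of_real (s / c * \<xi>))) * exp (- (\<i> * complex_of_real (\<xi> * t)))"
      by (simp only: of_real_add distrib_left minus_add_distrib exp_add)
    then show "f (s + c * t) * exp (- (\<i> * of_real (1 / c * \<xi> * (s + c * t)))) =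
      exp (- (\<i> * of_real (s / c * \<xi>))) * (f (s + c * t) * exp (- (\<i> * of_real (\<xi> * t))))"
      by (simp only: mult_ac)
  qed
  also have "\<dots> = exp (- (\<i> * of_real (s / c * \<xi>))) * FT (\<lambda>t. f (s + c * t)) \<xi>"
    unfolding FT_def by (rule integral_mult_right_zero)
  finally have e: "FT f (1 / c * \<xi>) = of_real c * (exp (- (\<i> * of_real (s / c * \<xi>))) * FT (\<lambda>t. f (s + c * t)) \<xi>)"
    using c by (simp only: scaleR_conv_of_real abs_of_pos)
  show ?thesis
    unfolding add_0 e using c by (simp add: exp_minus field_simps)
qed

lemma L2_limit_unique:
  assumes f: "\<And>k. f k \<in> L2_space M" and g: "g \<in> L2_space M" and h: "h \<in> L2_space M"
    and "(\<lambda>k. nrm2 M (\<lambda>x. f k x - g x)) \<longlonglongrightarrow> 0" "(\<lambda>k. nrm2 M (\<lambda>x. f k x - h x)) \<longlonglongrightarrow> 0"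
  shows "AE x in M. g x = h x"
proof (rule nrm2_diff_eq_0[OF g h])
  have "(\<lambda>k. 2 * nrm2 M (\<lambda>x. f k x - g x) + 2 * nrm2 M (\<lambda>x. f k x - h x)) \<longlonglongrightarrow> 2 * 0 + 2 * 0"
    by (intro tendsto_intros assms)
  moreover have "nrm2 M (\<lambda>x. g x - h x) \<le> 2 * nrm2 M (\<lambda>x. f k x - g x) + 2 * nrm2 M (\<lambda>x. f k x - h x)" for k
    using nrm2_triangle[OF g f[of k] h] nrm2_minus_commute[of M g "f k"] by simp
  ultimately have "nrm2 M (\<lambda>x. g x - h x) \<le> 2 * 0 + 2 * 0"
    by (intro LIMSEQ_le_const) auto
  then show "nrm2 M (\<lambda>x. g x - h x) = 0" using nrm2_nonneg[of M "\<lambda>x. g x - h x"] by linarith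
qed

lemma is_fourier_affine:
  assumes f: "f \<in> L2_space lborel" "is_fourier f g" and c: "0 < c"
  shows "is_fourier (\<lambda>t. f (s + c * t)) (\<lambda>\<xi>. of_real (1 / c) * exp (\<i> * of_real (s / c * \<xi>)) * g (0 + 1 / c * \<xi>))"
proof -
  define S :: "(real \<Rightarrow> complex) \<Rightarrow> real \<Rightarrow> complex" where "S f t = f (s + c * t)" for f t
  define T where "T g \<xi> = of_real (1 / c) * exp (\<i> * of_real (s / c * \<xi>)) * g (0 + 1 / c * \<xi>)" for g :: "real \<Rightarrow> complex" and \<xi>
  have gL: "g \<in> L2_space lborel" by (rule is_fourier_L2[OF f(2)])
  have S: "S f \<in> L2_space lborel" "nrm2 lborel (S f) = nrm2 lborel f / c" if "f \<in> L2_space lborel" for f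
    unfolding S_def[abs_def] by (rule L2_affine[OF that c])+
  have T: "T g \<in> L2_space lborel" "nrm2 lborel (T g) = (1 / c)\<^sup>2 * (nrm2 lborel g / (1 / c))"
    if "g \<in> L2_space lborel" for g
  proof -
    have m: "(\<lambda>\<xi>. complex_of_real (1 / c) * exp (\<i> * of_real (s / c * \<xi>))) \<in> borel_measurable lborel" by measurable
    have n: "cmod (complex_of_real (1 / c) * exp (\<i> * of_real (s / c * \<xi>))) = 1 / c" for \<xi>
      unfolding norm_mult norm_exp_imaginary norm_of_real using c by simp
    have c': "0 < 1 / c" using c by simp
    show "T g \<in> L2_space lborel" "nrm2 lborel (T g) = (1 / c)\<^sup>2 * (nrm2 lborel g / (1 / c))"
      unfolding T_def[abs_def]
      using L2_unimodular_mult[OF L2_affine(1)[OF that c', of 0] m n] L2_affine(2)[OF that c', of 0] by simp_all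
  qed
  obtain G where G: "is_fourier (S f) G" using is_fourier_exists[OF S(1)[OF f(1)]] .
  have GL: "G \<in> L2_space lborel" by (rule is_fourier_L2[OF G])
  define fk where "fk k = cutoff (real k) f" for k :: nat
  have fk: "fk k \<in> L2_space lborel" "integrable lborel (fk k)" for k
    unfolding fk_def by (rule cutoff_L2[OF f(1)])+
  have flim: "(\<lambda>k. nrm2 lborel (\<lambda>t. fk k t - f t)) \<longlonglongrightarrow> 0"
    unfolding fk_def by (rule cutoff_tendsto_seq[OF f(1)])
  have FTS: "FT (S (fk k)) = T (FT (fk k))" for k
    unfolding S_def[abs_def] T_def by (rule ext) (rule FT_affine[OF c])
  have Si: "integrable lborel (S (fk k))" for k
    unfolding S_def[abs_def] by (rule lborel_integrable_real_affine[OF fk(2)]) (use c in simp)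
  have FL: "FT (fk k) \<in> L2_space lborel" for k by (rule FT_Plancherel(1)[OF fk])
  have 1: "(\<lambda>k. nrm2 lborel (\<lambda>\<xi>. FT (S (fk k)) \<xi> - G \<xi>)) \<longlonglongrightarrow> 0"
  proof (rule fourier_tendsto[OF _ _ S(1)[OF f(1)] G])
    show "S (fk k) \<in> L2_space lborel" for k by (rule S(1)[OF fk(1)])
    show "is_fourier (S (fk k)) (FT (S (fk k)))" for k by (rule is_fourier_FT[OF S(1)[OF fk(1)] Si])
    have "nrm2 lborel (\<lambda>t. S (fk k) t - S f t) = nrm2 lborel (\<lambda>t. fk k t - f t) / c" for k
      using S(2)[OF L2_diff[OF fk(1) f(1)], of k] by (simp add: S_def[abs_def])
    then show "(\<lambda>k. nrm2 lborel (\<lambda>t. S (fk k) t - S f t)) \<longlonglongrightarrow> 0"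
      using tendsto_divide_zero[OF flim, of c] by simp
  qed
  have glim: "(\<lambda>k. nrm2 lborel (\<lambda>\<xi>. FT (fk k) \<xi> - g \<xi>)) \<longlonglongrightarrow> 0"
    by (rule fourier_tendsto[OF fk(1) is_fourier_FT[OF fk] f flim])
  have 2: "(\<lambda>k. nrm2 lborel (\<lambda>\<xi>. FT (S (fk k)) \<xi> - T g \<xi>)) \<longlonglongrightarrow> 0"
  proof -
    have "nrm2 lborel (\<lambda>\<xi>. FT (S (fk k)) \<xi> - T g \<xi>) = (1 / c)\<^sup>2 * (nrm2 lborel (\<lambda>\<xi>. FT (fk k) \<xi> - g \<xi>) / (1 / c))" for k
      using T(2)[OF L2_diff[OF FL gL], of k] by (simp only: FTS T_def[abs_def] right_diff_distrib)
    then show ?thesis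
      using tendsto_mult_right_zero[OF tendsto_divide_zero[OF glim, of "1/c"], of "(1/c)\<^sup>2"] by simp
  qed
  have "AE \<xi> in lborel. G \<xi> = T g \<xi>"
    by (rule L2_limit_unique[OF _ GL T(1)[OF gL] 1 2]) (simp only: FTS T(1)[OF FL])
  from is_fourier_cong_AE[OF S(1)[OF f(1)] G L2_measurable[OF T(1)[OF gL]] this]
  show ?thesis by (simp only: S_def[abs_def] T_def[abs_def])
qed

text \<open>
  Translation and dilation commute with the limit of truncations that defines the transform.
\<close>

lemma wavelet_rep_fourier:
  assumes f: "f \<in> L2_space lborel" and z: "0 < Im z"
  shows "wavelet_rep z f \<in> L2_space lborel"
    "is_fourier (wavelet_rep z f)
      (\<lambda>\<xi>. of_real (sqrt (Im z)) * (exp (- (\<i> * of_real (Re z * \<xi>))) * fourier f (Im z * \<xi>)))"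
proof -
  have c: "0 < 1 / Im z" using z by simp
  have e: "wavelet_rep z f = (\<lambda>t. of_real (Im z powr (- 1 / 2)) * f (- Re z / Im z + 1 / Im z * t))"
    using z by (auto simp: wavelet_rep_def fun_eq_iff field_simps)
  show "wavelet_rep z f \<in> L2_space lborel"
    unfolding e by (rule L2_scale[OF L2_affine(1)[OF f c]])
  have F: "is_fourier (wavelet_rep z f) (\<lambda>\<xi>. of_real (Im z powr (- 1 / 2)) *
     (of_real (1 / (1 / Im z)) * exp (\<i> * of_real (- Re z / Im z / (1 / Im z) * \<xi>)) * fourier f (0 + 1 / (1 / Im z) * \<xi>)))"
    unfolding e by (rule is_fourier_scale[OF L2_affine(1)[OF f c] is_fourier_affine[OF f is_fourier_fourier[OF f] c]])
  have sq: "Im z powr (- 1 / 2) * Im z = sqrt (Im z)"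
  proof -
    have "Im z powr (- 1 / 2) * Im z powr 1 = Im z powr (1 / 2)"
      unfolding powr_add[symmetric] by simp
    then show ?thesis using z by (simp add: powr_half_sqrt)
  qed
  have E: "complex_of_real (Im z powr (- 1 / 2)) *
     (of_real (1 / (1 / Im z)) * exp (\<i> * of_real (- Re z / Im z / (1 / Im z) * \<xi>)) * fourier f (0 + 1 / (1 / Im z) * \<xi>)) =
    of_real (sqrt (Im z)) * (exp (- (\<i> * of_real (Re z * \<xi>))) * fourier f (Im z * \<xi>))" for \<xi>
  proof -
    have 1: "1 / (1 / Im z) = Im z" "- Re z / Im z / (1 / Im z) * \<xi> = - (Re z * \<xi>)" "0 + Im z * \<xi> = Im z * \<xi>"
      using z by (simp_all add: field_simps)
    have 2: "complex_of_real (Im z powr (- 1 / 2)) * of_real (Im z) = of_real (sqrt (Im z))"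
      unfolding of_real_mult[symmetric] sq ..
    show ?thesis
      unfolding 1 of_real_minus mult_minus_right 2[symmetric] by (simp only: mult_ac)
  qed
  show "is_fourier (wavelet_rep z f)
      (\<lambda>\<xi>. of_real (sqrt (Im z)) * (exp (- (\<i> * of_real (Re z * \<xi>))) * fourier f (Im z * \<xi>)))"
    using F unfolding E .
qed

definition wt :: "(real \<Rightarrow> complex) \<Rightarrow> (real \<Rightarrow> complex) \<Rightarrow> complex \<Rightarrow> complex" where
  "wt h \<phi> z = of_real (sqrt (Im z) / (2 * pi)) *
     (LINT \<xi>|lpos. \<phi> \<xi> * cnj (h (Im z * \<xi>)) * exp (\<i> * of_real (Re z * \<xi>)))"

lemma H2_L2: "f \<in> H2 \<Longrightarrow> f \<in> L2_space lborel"
  by (simp add: H2_def)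

lemma H2_fourier_posp:
  assumes "f \<in> H2"
  shows "AE \<xi> in lborel. fourier f \<xi> = posp (fourier f) \<xi>"
proof -
  have "AE \<xi> in lborel. \<xi> < 0 \<longrightarrow> fourier f \<xi> = 0" using assms by (simp add: H2_def)
  moreover have "AE \<xi> in lborel. \<xi> \<noteq> (0::real)" by (rule AE_lborel_singleton)
  ultimately show ?thesis by eventually_elim (auto simp: posp_def)
qed

lemma wavelet_transform_eq_wt:
  assumes f: "f \<in> H2" and \<psi>: "\<psi> \<in> L2_space lborel" and z: "0 < Im z"
  shows "wavelet_transform \<psi> f z = wt (fourier \<psi>) (fourier f) z"
proof -
  note fL = H2_L2[OF f]
  define G where "G \<xi> = of_real (sqrt (Im z)) * (exp (- (\<i> * of_real (Re z * \<xi>))) * fourier \<psi> (Im z * \<xi>))" for \<xi>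
  have G: "is_fourier (wavelet_rep z \<psi>) G"
    unfolding G_def[abs_def] by (rule wavelet_rep_fourier[OF \<psi> z])
  have GL: "G \<in> L2_space lborel" by (rule is_fourier_L2[OF G])
  have "ip lborel (fourier f) G = 2 * pi * ip lborel f (wavelet_rep z \<psi>)"
    by (rule fourier_Parseval[OF fL is_fourier_fourier[OF fL] wavelet_rep_fourier(1)[OF \<psi> z] G])
  then have "wavelet_transform \<psi> f z = of_real (1 / (2 * pi)) * ip lborel (fourier f) G"
    by (simp add: wavelet_transform_def L2_inner_def ip_def)
  also have "ip lborel (fourier f) G = integral\<^sup>L lborel (posp (\<lambda>\<xi>. of_real (sqrt (Im z)) *
      (fourier f \<xi> * cnj (fourier \<psi> (Im z * \<xi>)) * exp (\<i> * of_real (Re z * \<xi>)))))"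
    unfolding ip_def
  proof (rule integral_cong_AE)
    have [measurable]: "fourier f \<in> borel_measurable borel" "G \<in> borel_measurable borel"
      "fourier \<psi> \<in> borel_measurable borel"
      using L2_measurable[OF fourier_L2[OF fL]] L2_measurable[OF GL] L2_measurable[OF fourier_L2[OF \<psi>]] by simp_all
    show "(\<lambda>x. fourier f x * cnj (G x)) \<in> borel_measurable lborel" by measurable
    show "posp (\<lambda>\<xi>. of_real (sqrt (Im z)) * (fourier f \<xi> * cnj (fourier \<psi> (Im z * \<xi>)) *
        exp (\<i> * of_real (Re z * \<xi>)))) \<in> borel_measurable lborel"
      unfolding posp_def[abs_def] by measurable
    show "AE x in lborel. fourier f x * cnj (G x) = posp (\<lambda>\<xi>. of_real (sqrt (Im z)) *
      (fourier f \<xi> * cnj (fourier \<psi> (Im z * \<xi>)) * exp (\<i> * of_real (Re z * \<xi>)))) x"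
      using H2_fourier_posp[OF f]
      by eventually_elim (auto simp: posp_def G_def exp_cnj split: if_splits)
  qed
  also have "\<dots> = of_real (sqrt (Im z)) * (LINT \<xi>|lpos. fourier f \<xi> * cnj (fourier \<psi> (Im z * \<xi>)) * exp (\<i> * of_real (Re z * \<xi>)))"
    unfolding integral_lpos[symmetric] by (rule integral_mult_right_zero)
  finally show ?thesis by (simp add: wt_def)
qed

lemma wt_cong:
  assumes "AE \<xi> in lpos. \<phi> \<xi> = \<phi>' \<xi>" "\<phi> \<in> borel_measurable lpos" "\<phi>' \<in> borel_measurable lpos"
    "h \<in> borel_measurable borel"
  shows "wt h \<phi> z = wt h \<phi>' z"
proof -
  note [measurable] = assms(2,3,4) measurable_ident_lpos
  have "(LINT \<xi>|lpos. \<phi> \<xi> * cnj (h (Im z * \<xi>)) * exp (\<i> * of_real (Re z * \<xi>))) =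
     (LINT \<xi>|lpos. \<phi>' \<xi> * cnj (h (Im z * \<xi>)) * exp (\<i> * of_real (Re z * \<xi>)))"
    by (rule integral_cong_AE) (measurable, use assms(1) in auto)
  then show ?thesis by (simp add: wt_def)
qed

text \<open>
  Half of the Paley--Wiener theorem: every square-integrable function on the half-line is the Fourier
  transform of an element of the Hardy space. The analytic extension is the Laplace integral, and
  its distance to the boundary value is computed on the Fourier side.
\<close>

theorem H2_surjective:
  assumes \<phi>: "\<phi> \<in> L2_space lpos"
  obtains f where "f \<in> H2" "is_fourier f (posp \<phi>)"
proof -
  define \<Phi> where "\<Phi> = posp \<phi>"
  have \<Phi>: "\<Phi> \<in> L2_space lborel" unfolding \<Phi>_def by (simp only: posp_L2 \<phi>)
  obtain k where k: "is_fourier (\<lambda>\<xi>. cnj (\<Phi> \<xi>)) k" using is_fourier_exists[OF L2_cnj[OF \<Phi>]] .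
  have kL: "k \<in> L2_space lborel" by (rule is_fourier_L2[OF k])
  define f where "f t = of_real (1 / (2 * pi)) * cnj (k t)" for t
  have f: "is_fourier f \<Phi>" unfolding f_def[abs_def] by (rule fourier_inversion[OF \<Phi> k])
  have fL: "f \<in> L2_space lborel" unfolding f_def[abs_def] by (intro L2_scale L2_cnj kL)
  define F where "F z = of_real (1 / (2 * pi)) * (LINT \<xi>|lpos. \<phi> \<xi> * exp (- ((- \<i> * z) * of_real \<xi>)))" for z
  have Li: "integrable lpos (\<lambda>\<xi>. \<phi> \<xi> * exp (- (p * of_real \<xi>)))" if "0 < Re p" for p
    by (rule L2_integrable_mult[OF \<phi> exp_L2[OF that]])
  have "(\<lambda>p. LINT \<xi>|lpos. \<phi> \<xi> * exp (- (p * of_real \<xi>))) holomorphic_on {p. 0 < Re p}"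
    by (rule holomorphic_exponential_integral[OF L2_measurable[OF \<phi>] measurable_ident_lpos Li])
  then have "(\<lambda>p. LINT \<xi>|lpos. \<phi> \<xi> * exp (- (p * of_real \<xi>))) \<circ> (\<lambda>z. - \<i> * z) holomorphic_on upper"
    by (intro holomorphic_on_compose_gen[where t = "{p. 0 < Re p}"] holomorphic_intros) (auto simp: upper_def)
  then have hol: "F holomorphic_on upper"
    unfolding F_def[abs_def] o_def by (intro holomorphic_intros) simp
  define g where "g y = posp (\<lambda>\<xi>. \<phi> \<xi> * exp (- (of_real y * of_real \<xi>)))" for y :: real
  have g: "g y \<in> L2_space lborel" "integrable lborel (g y)" "nrm2 lborel (g y) \<le> nrm2 lborel \<Phi>" if "0 < y" for y
  proof -
    note [measurable] = L2_measurable[OF \<phi>] measurable_ident_lpos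
    have bd: "(cmod (\<phi> \<xi> * exp (- (of_real y * of_real \<xi>))))\<^sup>2 \<le> (cmod (\<phi> \<xi>))\<^sup>2" if "0 < \<xi>" for \<xi>
    proof (intro power_mono)
      have "cmod (exp (- (complex_of_real y * of_real \<xi>))) \<le> 1"
        using \<open>0 < y\<close> that by (simp add: norm_exp_eq_Re)
      then show "cmod (\<phi> \<xi> * exp (- (of_real y * of_real \<xi>))) \<le> cmod (\<phi> \<xi>)"
        unfolding norm_mult by (intro mult_left_le) auto
    qed simp
    have i2: "integrable lpos (\<lambda>\<xi>. (cmod (\<phi> \<xi> * exp (- (of_real y * of_real \<xi>))))\<^sup>2)"
      by (rule Bochner_Integration.integrable_bound[OF L2_integrable_square[OF \<phi>]])
        (measurable, intro AE_I2, use bd in simp)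
    then have gL: "(\<lambda>\<xi>. \<phi> \<xi> * exp (- (of_real y * of_real \<xi>))) \<in> L2_space lpos"
      by (simp add: L2_space_def)
    then show "g y \<in> L2_space lborel" by (simp add: g_def posp_L2)
    have "nrm2 lpos (\<lambda>\<xi>. \<phi> \<xi> * exp (- (of_real y * of_real \<xi>))) \<le> nrm2 lpos \<phi>"
      unfolding nrm2_def by (rule integral_mono[OF i2 L2_integrable_square[OF \<phi>]]) (use bd in simp)
    then show "nrm2 lborel (g y) \<le> nrm2 lborel \<Phi>"
      using nrm2_posp[OF gL] nrm2_posp[OF \<phi>] by (simp add: g_def \<Phi>_def)
    show "integrable lborel (g y)"
      using Li[of "of_real y"] that unfolding g_def integrable_lpos_iff by simp
  qed
  have F_eq: "F (Complex x y) = of_real (1 / (2 * pi)) * cnj (FT (\<lambda>\<xi>. cnj (g y \<xi>)) x)" if "0 < y" for x y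
  proof -
    have "cnj (FT (\<lambda>\<xi>. cnj (g y \<xi>)) x) = (LINT \<xi>|lborel. g y \<xi> * exp (\<i> * of_real (x * \<xi>)))"
      unfolding FT_def Bochner_Integration.integral_cnj[symmetric] by (simp add: exp_cnj)
    also have "\<dots> = integral\<^sup>L lborel (posp (\<lambda>\<xi>. \<phi> \<xi> * exp (- ((- \<i> * Complex x y) * of_real \<xi>))))"
    proof (intro Bochner_Integration.integral_cong refl)
      fix \<xi>
      have "- (complex_of_real y * of_real \<xi>) + \<i> * of_real (x * \<xi>) = - ((- \<i> * Complex x y) * of_real \<xi>)"
        by (simp add: complex_eq_iff)
      then show "g y \<xi> * exp (\<i> * of_real (x * \<xi>)) = posp (\<lambda>\<xi>. \<phi> \<xi> * exp (- ((- \<i> * Complex x y) * of_real \<xi>))) \<xi>"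
        by (simp add: g_def posp_def mult.assoc flip: exp_add)
    qed
    finally show ?thesis by (simp add: F_def integral_lpos)
  qed
  have cg: "(\<lambda>\<xi>. cnj (g y \<xi>)) \<in> L2_space lborel" "integrable lborel (\<lambda>\<xi>. cnj (g y \<xi>))" if "0 < y" for y
    using g[OF that] by (auto intro: L2_cnj)
  note FTg = FT_Plancherel[OF cg]
  have "(\<integral>\<^sup>+ x. ennreal ((cmod (F (Complex x y)))\<^sup>2) \<partial>lborel) \<le> ennreal (nrm2 lborel \<Phi> / (2 * pi))" if "0 < y" for y
  proof -
    have FL: "(\<lambda>x. F (Complex x y)) \<in> L2_space lborel"
      unfolding F_eq[OF that] by (intro L2_scale L2_cnj FTg that)
    have "nrm2 lborel (\<lambda>x. F (Complex x y)) = (1 / (2 * pi))\<^sup>2 * (2 * pi * nrm2 lborel (g y))"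
      unfolding F_eq[OF that] nrm2_scale nrm2_cnj FTg(2)[OF that that] norm_of_real by simp
    also have "\<dots> = nrm2 lborel (g y) / (2 * pi)" by (simp add: power2_eq_square field_simps)
    also have "\<dots> \<le> nrm2 lborel \<Phi> / (2 * pi)" by (intro divide_right_mono g that) simp
    finally show ?thesis unfolding L2_nn_integral[OF FL] by (rule ennreal_leI)
  qed
  then have "(SUP y\<in>{0<..}. \<integral>\<^sup>+ x. ennreal ((cmod (F (Complex x y)))\<^sup>2) \<partial>lborel) \<le> ennreal (nrm2 lborel \<Phi> / (2 * pi))"
    by (intro SUP_least) auto
  then have FA: "F \<in> analytic_hardy"
    using hol by (auto simp: analytic_hardy_def intro: le_less_trans)
  have d: "(\<integral>\<^sup>+ x. ennreal ((cmod (F (Complex x y) - f x))\<^sup>2) \<partial>lborel) = ennreal (nrm2 lborel (\<lambda>\<xi>. g y \<xi> - \<Phi> \<xi>) / (2 * pi))"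
    if "0 < y" for y
  proof -
    have e: "F (Complex x y) - f x = of_real (1 / (2 * pi)) * cnj (FT (\<lambda>\<xi>. cnj (g y \<xi>)) x - k x)" for x
      unfolding F_eq[OF that] f_def by (simp add: right_diff_distrib)
    have L: "(\<lambda>x. F (Complex x y) - f x) \<in> L2_space lborel"
      unfolding e by (intro L2_scale L2_cnj L2_diff FTg kL that)
    have "nrm2 lborel (\<lambda>x. F (Complex x y) - f x) =
        (1 / (2 * pi))\<^sup>2 * nrm2 lborel (\<lambda>x. FT (\<lambda>\<xi>. cnj (g y \<xi>)) x - k x)"
      unfolding e nrm2_scale nrm2_cnj norm_of_real by simp
    also have "nrm2 lborel (\<lambda>x. FT (\<lambda>\<xi>. cnj (g y \<xi>)) x - k x) = 2 * pi * nrm2 lborel (\<lambda>\<xi>. cnj (g y \<xi>) - cnj (\<Phi> \<xi>))"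
      by (rule is_fourier_dist[OF cg(1)[OF that] is_fourier_FT[OF cg(1)[OF that] cg(2)[OF that]] L2_cnj[OF \<Phi>] k])
    also have "nrm2 lborel (\<lambda>\<xi>. cnj (g y \<xi>) - cnj (\<Phi> \<xi>)) = nrm2 lborel (\<lambda>\<xi>. g y \<xi> - \<Phi> \<xi>)"
      unfolding complex_cnj_diff[symmetric] by (rule nrm2_cnj)
    finally show ?thesis
      unfolding L2_nn_integral[OF L] by (simp add: power2_eq_square field_simps)
  qed
  have lim: "((\<lambda>R. LINT \<xi>|lborel. (cmod (g (inverse R) \<xi> - \<Phi> \<xi>))\<^sup>2) \<longlongrightarrow> (LINT \<xi>::real|lborel. 0)) at_top"
  proof (rule integral_dominated_convergence_at_top)
    have [measurable]: "\<Phi> \<in> borel_measurable borel" using L2_measurable[OF \<Phi>] by simp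
    have [measurable]: "\<phi> \<in> borel_measurable lpos" by (rule L2_measurable[OF \<phi>])
    have "g y \<in> borel_measurable borel" for y
    proof -
      note [measurable] = measurable_ident_lpos
      show ?thesis unfolding g_def posp_measurable by measurable
    qed
    then show "(\<lambda>\<xi>. (cmod (g (inverse R) \<xi> - \<Phi> \<xi>))\<^sup>2) \<in> borel_measurable lborel" for R by measurable
    show "integrable lborel (\<lambda>\<xi>. (cmod (\<Phi> \<xi>))\<^sup>2)" by (rule L2_integrable_square[OF \<Phi>])
    show "\<forall>\<^sub>F R in at_top. AE \<xi> in lborel. norm ((cmod (g (inverse R) \<xi> - \<Phi> \<xi>))\<^sup>2) \<le> (cmod (\<Phi> \<xi>))\<^sup>2"
      using eventually_gt_at_top[of "0::real"]
    proof eventually_elim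
      case (elim R)
      show ?case
      proof (intro AE_I2)
        fix \<xi> :: real
        have "cmod (g (inverse R) \<xi> - \<Phi> \<xi>) \<le> cmod (\<Phi> \<xi>)"
        proof (cases "0 < \<xi>")
          case True
          define E where "E = exp (- (inverse R * \<xi>))"
          have E: "0 \<le> E" "E \<le> 1" using elim True by (auto simp: E_def)
          have "g (inverse R) \<xi> - \<Phi> \<xi> = - (\<phi> \<xi> * of_real (1 - E))"
            using True by (simp add: g_def \<Phi>_def posp_def E_def right_diff_distrib exp_of_real[symmetric])
          then have "cmod (g (inverse R) \<xi> - \<Phi> \<xi>) = cmod (\<phi> \<xi>) * (1 - E)"
            using E by (simp only: norm_minus_cancel norm_mult norm_of_real abs_of_nonneg diff_ge_0_iff_ge)
          also have "\<dots> \<le> cmod (\<phi> \<xi>)" using E by (intro mult_left_le) auto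
          finally show ?thesis using True by (simp add: \<Phi>_def posp_def)
        qed (simp add: g_def \<Phi>_def posp_def)
        then show "norm ((cmod (g (inverse R) \<xi> - \<Phi> \<xi>))\<^sup>2) \<le> (cmod (\<Phi> \<xi>))\<^sup>2"
          by (simp add: power_mono)
      qed
    qed
    show "AE \<xi> in lborel. ((\<lambda>R. (cmod (g (inverse R) \<xi> - \<Phi> \<xi>))\<^sup>2) \<longlongrightarrow> 0) at_top"
    proof (intro AE_I2)
      fix \<xi> :: real
      show "((\<lambda>R. (cmod (g (inverse R) \<xi> - \<Phi> \<xi>))\<^sup>2) \<longlongrightarrow> 0) at_top"
      proof (cases "0 < \<xi>")
        case True
        have "((\<lambda>R. (cmod (\<phi> \<xi> * exp (- (complex_of_real (inverse R) * of_real \<xi>)) - \<phi> \<xi>))\<^sup>2) \<longlongrightarrow>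
            (cmod (\<phi> \<xi> * exp (- (complex_of_real 0 * of_real \<xi>)) - \<phi> \<xi>))\<^sup>2) at_top"
          by (intro tendsto_intros tendsto_inverse_0_at_top filterlim_ident)
        then show ?thesis using True by (simp add: g_def \<Phi>_def posp_def)
      qed (simp add: g_def \<Phi>_def posp_def)
    qed
  qed simp
  have "((\<lambda>y. ennreal (nrm2 lborel (\<lambda>\<xi>. g y \<xi> - \<Phi> \<xi>) / (2 * pi))) \<longlongrightarrow> ennreal 0) (at_right 0)"
  proof (intro tendsto_ennrealI tendsto_divide_zero)
    show "((\<lambda>y. nrm2 lborel (\<lambda>\<xi>. g y \<xi> - \<Phi> \<xi>)) \<longlongrightarrow> 0) (at_right 0)"
      unfolding filterlim_at_right_to_top using lim by (simp add: nrm2_def)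
  qed
  then have "((\<lambda>y. \<integral>\<^sup>+ x. ennreal ((cmod (F (Complex x y) - f x))\<^sup>2) \<partial>lborel) \<longlongrightarrow> ennreal 0) (at_right 0)"
  proof (rule Lim_transform_eventually)
    show "\<forall>\<^sub>F y in at_right 0. ennreal (nrm2 lborel (\<lambda>\<xi>. g y \<xi> - \<Phi> \<xi>) / (2 * pi)) =
       (\<integral>\<^sup>+ x. ennreal ((cmod (F (Complex x y) - f x))\<^sup>2) \<partial>lborel)"
      using eventually_at_right_less[of "0::real"] by eventually_elim (simp add: d)
  qed
  then have "has_boundary_value F f" by (simp add: has_boundary_value_def)
  moreover have "AE \<xi> in lborel. \<xi> < 0 \<longrightarrow> fourier f \<xi> = 0"
    using is_fourier_AE_unique[OF fL is_fourier_fourier[OF fL] f]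
    by eventually_elim (simp add: \<Phi>_def posp_def)
  ultimately have "f \<in> H2" using fL FA by (auto simp: H2_def)
  with f show ?thesis unfolding \<Phi>_def by (rule that[rotated])
qed

lemma space_mu [simp]: "space mu = upper"
  by (simp add: mu_def space_restrict_space)

text \<open>
  Parseval's formula and the surjectivity of the Fourier transform onto the square-integrable functions
  on the half-line.
\<close>

theorem wavelet_space_eq:
  assumes \<psi>: "\<psi> \<in> L2_space lborel"
  shows "wavelet_space \<psi> = {F \<in> L2_space mu. \<exists>\<phi>\<in>L2_space lpos. AE z in mu. F z = wt (fourier \<psi>) \<phi> z}"
proof -
  have hm: "fourier \<psi> \<in> borel_measurable borel" using L2_measurable[OF fourier_L2[OF \<psi>]] by simp
  have a: "AE z in mu. F z = wt (fourier \<psi>) (fourier f) z"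
    if f: "f \<in> H2" and F: "AE z in mu. F z = wavelet_transform \<psi> f z" for F f
    using F AE_space[of mu]
  proof eventually_elim
    case (elim z)
    then show ?case using wavelet_transform_eq_wt[OF f \<psi>, of z] by (simp add: upper_def)
  qed
  have b: "\<exists>f\<in>H2. AE z in mu. F z = wavelet_transform \<psi> f z"
    if \<phi>: "\<phi> \<in> L2_space lpos" and F: "AE z in mu. F z = wt (fourier \<psi>) \<phi> z" for F \<phi>
  proof -
    obtain f where f: "f \<in> H2" "is_fourier f (posp \<phi>)" using H2_surjective[OF \<phi>] .
    note fL = H2_L2[OF f(1)]
    have ae: "AE \<xi> in lpos. fourier f \<xi> = \<phi> \<xi>"
      unfolding AE_lpos using is_fourier_AE_unique[OF fL is_fourier_fourier[OF fL] f(2)]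
      by eventually_elim (simp add: posp_def)
    have w: "wt (fourier \<psi>) (fourier f) z = wt (fourier \<psi>) \<phi> z" for z
      by (rule wt_cong[OF ae L2_measurable[OF L2_lpos_if_L2_lborel[OF fourier_L2[OF fL]]] L2_measurable[OF \<phi>] hm])
    have "AE z in mu. F z = wavelet_transform \<psi> f z"
      using F AE_space[of mu]
    proof eventually_elim
      case (elim z)
      then show ?case using wavelet_transform_eq_wt[OF f(1) \<psi>, of z] w[of z] by (simp add: upper_def)
    qed
    with f(1) show ?thesis by blast
  qed
  show ?thesis
    unfolding wavelet_space_def using a b L2_lpos_if_L2_lborel[OF fourier_L2[OF H2_L2]] by blast
qed

section \<open>The hyperbolic measure\<close>

lemma lborel_complex_eq: "(lborel :: complex measure) = distr (lborel \<Otimes>\<^sub>M lborel) borel (\<lambda>(x, y). Complex x y)"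
proof (rule lborel_eqI)
  have m [measurable]: "(\<lambda>(x, y). Complex x y) \<in> borel_measurable (lborel \<Otimes>\<^sub>M lborel)"
  proof -
    have "(\<lambda>p::real \<times> real. of_real (fst p) + \<i> * of_real (snd p)) \<in> borel_measurable (lborel \<Otimes>\<^sub>M lborel)"
      by measurable
    then show ?thesis by (simp add: Complex_eq split_def)
  qed
  fix l u :: complex
  assume lu: "\<And>b. b \<in> Basis \<Longrightarrow> l \<bullet> b \<le> u \<bullet> b"
  have le: "Re l \<le> Re u" "Im l \<le> Im u"
    using lu[of 1] lu[of \<i>] by (simp_all add: Basis_complex_def)
  have "emeasure (distr (lborel \<Otimes>\<^sub>M lborel) borel (\<lambda>(x, y). Complex x y)) (box l u) =
      emeasure (lborel \<Otimes>\<^sub>M lborel) ((\<lambda>(x, y). Complex x y) -` box l u \<inter> space (lborel \<Otimes>\<^sub>M lborel))"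
    by (rule emeasure_distr[OF m]) simp
  also have "(\<lambda>(x, y). Complex x y) -` box l u \<inter> space (lborel \<Otimes>\<^sub>M lborel) = {Re l<..<Re u} \<times> {Im l<..<Im u}"
    by (auto simp: box_def Basis_complex_def space_pair_measure)
  also have "emeasure (lborel \<Otimes>\<^sub>M lborel) \<dots> = emeasure lborel {Re l<..<Re u} * emeasure lborel {Im l<..<Im u}"
    by (rule lborel.emeasure_pair_measure_Times) auto
  also have "\<dots> = ennreal (\<Prod>b\<in>Basis. (u - l) \<bullet> b)"
    using le by (simp add: Basis_complex_def ennreal_mult)
  finally show "emeasure (distr (lborel \<Otimes>\<^sub>M lborel) borel (\<lambda>(x, y). Complex x y)) (box l u) = ennreal (\<Prod>b\<in>Basis. (u - l) \<bullet> b)"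
    by simp
qed simp

lemma measurable_Complex [measurable]:
  assumes [measurable]: "f \<in> borel_measurable M" "g \<in> borel_measurable M"
  shows "(\<lambda>x. Complex (f x) (g x)) \<in> borel_measurable M"
  unfolding Complex_eq by measurable

lemma open_upper: "open upper"
  unfolding upper_def by (rule open_halfspace_Im_gt)

lemma upper_borel [measurable]: "upper \<in> sets borel"
  using open_upper by simp

lemma measurable_mu: "f \<in> borel_measurable borel \<Longrightarrow> f \<in> borel_measurable mu"
  by (simp add: mu_def measurable_restrict_space1)

lemma measurable_mu_iff:
  fixes f :: "complex \<Rightarrow> complex"
  shows "f \<in> borel_measurable mu \<longleftrightarrow> (\<lambda>z. if z \<in> upper then f z else 0) \<in> borel_measurable borel"
proof -
  have "f \<in> borel_measurable (restrict_space lborel upper) \<longleftrightarrow> (\<lambda>x. indicator upper x *\<^sub>R f x) \<in> borel_measurable lborel"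
    by (rule borel_measurable_restrict_space_iff) simp
  also have "(\<lambda>x. indicator upper x *\<^sub>R f x) = (\<lambda>z. if z \<in> upper then f z else 0)"
    by (auto simp: indicator_def)
  finally show ?thesis by (simp add: mu_def)
qed

lemma measurable_mu_ennreal_iff:
  fixes f :: "complex \<Rightarrow> ennreal"
  shows "f \<in> borel_measurable mu \<longleftrightarrow> (\<lambda>z. if z \<in> upper then f z else 0) \<in> borel_measurable borel"
proof -
  have "f \<in> borel_measurable (restrict_space lborel upper) \<longleftrightarrow> (\<lambda>x. f x * indicator upper x) \<in> borel_measurable lborel"
    by (rule borel_measurable_restrict_space_iff_ennreal) simp
  also have "(\<lambda>x. f x * indicator upper x) = (\<lambda>z. if z \<in> upper then f z else 0)"
    by (auto simp: indicator_def)
  finally show ?thesis by (simp add: mu_def)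
qed

lemma nn_integral_mu_borel:
  assumes [measurable]: "G \<in> borel_measurable borel" and 0: "\<And>z. z \<notin> upper \<Longrightarrow> G z = 0"
  shows "(\<integral>\<^sup>+z. G z \<partial>mu) = (\<integral>\<^sup>+y. (\<integral>\<^sup>+x. G (Complex x y) * ennreal (1 / y\<^sup>2) \<partial>lborel) \<partial>lborel)"
proof -
  have "(\<integral>\<^sup>+z. G z \<partial>mu) = (\<integral>\<^sup>+z. ennreal (1 / (Im z)\<^sup>2) * G z \<partial>restrict_space lborel upper)"
    unfolding mu_def by (rule nn_integral_density) (auto intro!: measurable_restrict_space1)
  also have "\<dots> = (\<integral>\<^sup>+z. ennreal (1 / (Im z)\<^sup>2) * G z * indicator upper z \<partial>lborel)"
    by (rule nn_integral_restrict_space) simp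
  also have "\<dots> = (\<integral>\<^sup>+z. G z * ennreal (1 / (Im z)\<^sup>2) \<partial>lborel)"
    by (intro nn_integral_cong) (auto simp: indicator_def 0 mult.commute)
  also have "\<dots> = (\<integral>\<^sup>+p. (case p of (x, y) \<Rightarrow> G (Complex x y) * ennreal (1 / y\<^sup>2)) \<partial>(lborel \<Otimes>\<^sub>M lborel))"
    unfolding lborel_complex_eq by (subst nn_integral_distr) (auto simp: split_def intro!: nn_integral_cong)
  also have "\<dots> = (\<integral>\<^sup>+y. (\<integral>\<^sup>+x. G (Complex x y) * ennreal (1 / y\<^sup>2) \<partial>lborel) \<partial>lborel)"
    by (subst lborel_pair.nn_integral_snd[symmetric]) simp_all
  finally show ?thesis .
qed

lemma nn_integral_mu:
  assumes G: "G \<in> borel_measurable mu"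
  shows "(\<integral>\<^sup>+z. G z \<partial>mu) = (\<integral>\<^sup>+y. (\<integral>\<^sup>+x. G (Complex x y) * ennreal (1 / y\<^sup>2) \<partial>lborel) * indicator {0<..} y \<partial>lborel)"
proof -
  let ?G = "\<lambda>z. if z \<in> upper then G z else 0"
  have "(\<integral>\<^sup>+z. G z \<partial>mu) = (\<integral>\<^sup>+z. ?G z \<partial>mu)"
    by (intro nn_integral_cong) simp
  also have "\<dots> = (\<integral>\<^sup>+y. (\<integral>\<^sup>+x. ?G (Complex x y) * ennreal (1 / y\<^sup>2) \<partial>lborel) \<partial>lborel)"
    by (rule nn_integral_mu_borel) (use G in \<open>simp_all only: measurable_mu_ennreal_iff if_False\<close>)
  also have "\<dots> = (\<integral>\<^sup>+y. (\<integral>\<^sup>+x. G (Complex x y) * ennreal (1 / y\<^sup>2) \<partial>lborel) * indicator {0<..} y \<partial>lborel)"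
    by (intro nn_integral_cong) (auto simp: upper_def indicator_def)
  finally show ?thesis .
qed

lemma indicator_le_if_subset: "A \<subseteq> B \<Longrightarrow> (indicator A x :: ennreal) \<le> indicator B x"
  by (auto simp: indicator_def)

lemma nn_integral_exp_substitution:
  fixes G :: "real \<Rightarrow> ennreal"
  assumes [measurable]: "G \<in> borel_measurable borel"
  shows "(\<integral>\<^sup>+y. G y * ennreal (1 / y) * indicator {0<..} y \<partial>lborel) = (\<integral>\<^sup>+t. G (exp t) \<partial>lborel)"
proof -
  have k: "(\<integral>\<^sup>+y. G y * ennreal (1 / y) * indicator {exp (- real (Suc k))..exp (real (Suc k))} y \<partial>lborel) =
      (\<integral>\<^sup>+t. G (exp t) * indicator {- real (Suc k)..real (Suc k)} t \<partial>lborel)" for k :: nat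
  proof -
    have "(\<integral>\<^sup>+y. G y * ennreal (1 / y) * indicator {exp (- real (Suc k))..exp (real (Suc k))} y \<partial>lborel) =
        (\<integral>\<^sup>+t. G (exp t) * ennreal (1 / exp t) * ennreal (exp t) * indicator {- real (Suc k)..real (Suc k)} t \<partial>lborel)"
      by (rule nn_integral_substitution_aux[where f = "\<lambda>y. G y * ennreal (1 / y)" and g = exp and g' = exp])
        (auto intro!: derivative_eq_intros continuous_intros)
    also have "\<dots> = (\<integral>\<^sup>+t. G (exp t) * indicator {- real (Suc k)..real (Suc k)} t \<partial>lborel)"
      by (intro nn_integral_cong) (simp add: mult.assoc flip: ennreal_mult)
    finally show ?thesis .
  qed
  have "(\<integral>\<^sup>+y. G y * ennreal (1 / y) * indicator {0<..} y \<partial>lborel) =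
      (\<integral>\<^sup>+y. (SUP k. G y * ennreal (1 / y) * indicator {exp (- real (Suc k))..exp (real (Suc k))} y) \<partial>lborel)"
  proof (intro nn_integral_cong)
    fix y :: real
    show "G y * ennreal (1 / y) * indicator {0<..} y = (SUP k. G y * ennreal (1 / y) * indicator {exp (- real (Suc k))..exp (real (Suc k))} y)"
    proof (cases "0 < y")
      case True
      obtain k where "\<bar>ln y\<bar> \<le> real k" using real_arch_simple by blast
      then have k: "\<bar>ln y\<bar> \<le> real (Suc k)" by simp
      have "exp (- real (Suc k)) \<le> exp (ln y)" "exp (ln y) \<le> exp (real (Suc k))"
        using k unfolding exp_le_cancel_iff by linarith+
      then have "exp (- real (Suc k)) \<le> y" "y \<le> exp (real (Suc k))"
        using True by simp_all
      then show ?thesis using True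
        by (intro antisym SUP_upper2[of k] SUP_least) (auto simp: indicator_def)
    next
      case False
      have "y \<notin> {exp (- real (Suc k))..exp (real (Suc k))}" for k
      proof -
        have "y < exp (- real (Suc k))" using False exp_gt_zero[of "- real (Suc k)"] by linarith
        then show ?thesis by (simp only: atLeastAtMost_iff not_le[symmetric] simp_thms)
      qed
      then show ?thesis using False by simp
    qed
  qed
  also have "\<dots> = (SUP k. \<integral>\<^sup>+y. G y * ennreal (1 / y) * indicator {exp (- real (Suc k))..exp (real (Suc k))} y \<partial>lborel)"
  proof (rule nn_integral_monotone_convergence_SUP)
    show "incseq (\<lambda>k y. G y * ennreal (1 / y) * indicator {exp (- real (Suc k))..exp (real (Suc k))} y)"
    proof (intro incseq_SucI le_funI mult_left_mono)
      fix k and y :: real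
      have "exp (- real (Suc (Suc k))) \<le> exp (- real (Suc k))" "exp (real (Suc k)) \<le> exp (real (Suc (Suc k)))"
        by simp_all
      then have "{exp (- real (Suc k))..exp (real (Suc k))} \<subseteq> {exp (- real (Suc (Suc k)))..exp (real (Suc (Suc k)))}"
        by (simp only: atLeastatMost_subset_iff) simp
      then show "(indicator {exp (- real (Suc k))..exp (real (Suc k))} y :: ennreal) \<le>
          indicator {exp (- real (Suc (Suc k)))..exp (real (Suc (Suc k)))} y"
        by (rule indicator_le_if_subset)
    qed simp
  qed measurable
  also have "\<dots> = (SUP k. \<integral>\<^sup>+t. G (exp t) * indicator {- real (Suc k)..real (Suc k)} t \<partial>lborel)"
    unfolding k ..
  also have "\<dots> = (\<integral>\<^sup>+t. (SUP k. G (exp t) * indicator {- real (Suc k)..real (Suc k)} t) \<partial>lborel)"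
    by (rule nn_integral_monotone_convergence_SUP[symmetric])
      (auto intro!: incseq_SucI le_funI mult_left_mono simp: indicator_def)
  also have "\<dots> = (\<integral>\<^sup>+t. G (exp t) \<partial>lborel)"
  proof (intro nn_integral_cong)
    fix t :: real
    obtain k where "\<bar>t\<bar> \<le> real k" using real_arch_simple by blast
    then have "\<bar>t\<bar> \<le> real (Suc k)" by simp
    then show "(SUP k. G (exp t) * indicator {- real (Suc k)..real (Suc k)} t) = G (exp t)"
      by (intro antisym SUP_upper2[of k] SUP_least) (auto simp: indicator_def)
  qed
  finally show ?thesis .
qed

lemma nn_integral_inversion_dy_over_y:
  fixes G :: "real \<Rightarrow> ennreal"
  assumes [measurable]: "G \<in> borel_measurable borel" and c: "0 < c"
  shows "(\<integral>\<^sup>+y. G (c / y) * ennreal (1 / y) * indicator {0<..} y \<partial>lborel) =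
      (\<integral>\<^sup>+y. G y * ennreal (1 / y) * indicator {0<..} y \<partial>lborel)"
proof -
  have "(\<integral>\<^sup>+t. G (exp t) \<partial>lborel) = ennreal \<bar>-1\<bar> * (\<integral>\<^sup>+t. G (exp (ln c + (- 1) * t)) \<partial>lborel)"
    by (rule nn_integral_real_affine) simp_all
  also have "\<dots> = (\<integral>\<^sup>+t. G (c / exp t) \<partial>lborel)"
    using c by (simp add: exp_diff)
  finally show ?thesis
    by (simp add: nn_integral_exp_substitution[of "\<lambda>y. G (c / y)"] nn_integral_exp_substitution)
qed

section \<open>Invariance under fractional linear maps\<close>

text \<open>
  In these coordinates \<open>\<mu>\<close> is the product of the measures \<open>dk\<close> and \<open>dy/y\<close>.
\<close>

definition slope_integral :: "(complex \<Rightarrow> ennreal) \<Rightarrow> ennreal" where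
  "slope_integral G = (\<integral>\<^sup>+k. (\<integral>\<^sup>+y. G (Complex (k * y) y) * ennreal (1 / y) * indicator {0<..} y \<partial>lborel) \<partial>lborel)"

lemma nn_integral_mu_slope:
  assumes [measurable]: "G \<in> borel_measurable borel" and 0: "\<And>z. z \<notin> upper \<Longrightarrow> G z = 0"
  shows "(\<integral>\<^sup>+z. G z \<partial>mu) = slope_integral G"
proof -
  have "(\<integral>\<^sup>+z. G z \<partial>mu) = (\<integral>\<^sup>+y. (\<integral>\<^sup>+x. G (Complex x y) * ennreal (1 / y\<^sup>2) \<partial>lborel) \<partial>lborel)"
    by (rule nn_integral_mu_borel) (use 0 in simp_all)
  also have "\<dots> = (\<integral>\<^sup>+y. (\<integral>\<^sup>+k. G (Complex (k * y) y) * ennreal (1 / y) * indicator {0<..} y \<partial>lborel) \<partial>lborel)"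
  proof (rule nn_integral_cong)
    fix y :: real
    show "(\<integral>\<^sup>+x. G (Complex x y) * ennreal (1 / y\<^sup>2) \<partial>lborel) =
      (\<integral>\<^sup>+k. G (Complex (k * y) y) * ennreal (1 / y) * indicator {0<..} y \<partial>lborel)"
    proof (cases "0 < y")
      case True
      have "(\<integral>\<^sup>+x. G (Complex x y) * ennreal (1 / y\<^sup>2) \<partial>lborel) =
          ennreal \<bar>y\<bar> * (\<integral>\<^sup>+k. G (Complex (0 + y * k) y) * ennreal (1 / y\<^sup>2) \<partial>lborel)"
        by (rule nn_integral_real_affine) (use True in simp_all)
      also have "\<dots> = (\<integral>\<^sup>+k. ennreal \<bar>y\<bar> * (G (Complex (0 + y * k) y) * ennreal (1 / y\<^sup>2)) \<partial>lborel)"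
        by (rule nn_integral_cmult[symmetric]) measurable
      also have "\<dots> = (\<integral>\<^sup>+k. G (Complex (k * y) y) * ennreal (1 / y) * indicator {0<..} y \<partial>lborel)"
      proof (intro nn_integral_cong)
        fix k :: real
        have "ennreal \<bar>y\<bar> * ennreal (1 / y\<^sup>2) = ennreal (1 / y)"
          using True by (simp add: power2_eq_square flip: ennreal_mult)
        moreover have "ennreal \<bar>y\<bar> * (G (Complex (0 + y * k) y) * ennreal (1 / y\<^sup>2)) =
            G (Complex (k * y) y) * (ennreal \<bar>y\<bar> * ennreal (1 / y\<^sup>2))"
          by (simp add: mult_ac)
        ultimately show "ennreal \<bar>y\<bar> * (G (Complex (0 + y * k) y) * ennreal (1 / y\<^sup>2)) =
            G (Complex (k * y) y) * ennreal (1 / y) * indicator {0<..} y"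
          using True by simp
      qed
      finally show ?thesis .
    next
      case False
      then show ?thesis using 0 by (simp add: upper_def)
    qed
  qed
  also have "\<dots> = slope_integral G"
    unfolding slope_integral_def by (rule lborel_pair.Fubini') measurable
  finally show ?thesis .
qed

lemma nn_integral_mu_translate:
  assumes [measurable]: "G \<in> borel_measurable borel" and 0: "\<And>z. z \<notin> upper \<Longrightarrow> G z = 0"
  shows "(\<integral>\<^sup>+z. G (z + of_real b) \<partial>mu) = (\<integral>\<^sup>+z. G z \<partial>mu)"
proof -
  have "(\<integral>\<^sup>+z. G (z + of_real b) \<partial>mu) = (\<integral>\<^sup>+y. (\<integral>\<^sup>+x. G (Complex (b + 1 * x) y) * ennreal (1 / y\<^sup>2) \<partial>lborel) \<partial>lborel)"
  proof (subst nn_integral_mu_borel)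
    have "Complex x y + of_real b = Complex (b + 1 * x) y" for x y
      by (simp add: complex_eq_iff)
    then show "(\<integral>\<^sup>+y. (\<integral>\<^sup>+x. G (Complex x y + of_real b) * ennreal (1 / y\<^sup>2) \<partial>lborel) \<partial>lborel) =
      (\<integral>\<^sup>+y. (\<integral>\<^sup>+x. G (Complex (b + 1 * x) y) * ennreal (1 / y\<^sup>2) \<partial>lborel) \<partial>lborel)" by simp
  qed (auto intro!: 0 simp: upper_def)
  also have "\<dots> = (\<integral>\<^sup>+y. (\<integral>\<^sup>+x. G (Complex x y) * ennreal (1 / y\<^sup>2) \<partial>lborel) \<partial>lborel)"
  proof (rule nn_integral_cong)
    fix y :: real
    show "(\<integral>\<^sup>+x. G (Complex (b + 1 * x) y) * ennreal (1 / y\<^sup>2) \<partial>lborel) = (\<integral>\<^sup>+x. G (Complex x y) * ennreal (1 / y\<^sup>2) \<partial>lborel)"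
      using nn_integral_real_affine[of "\<lambda>x. G (Complex x y) * ennreal (1 / y\<^sup>2)" 1 b] by simp
  qed
  also have "\<dots> = (\<integral>\<^sup>+z. G z \<partial>mu)"
    by (rule nn_integral_mu_borel[symmetric]) (use 0 in simp_all)
  finally show ?thesis .
qed

lemma nn_integral_mu_scale:
  assumes [measurable]: "G \<in> borel_measurable borel" and 0: "\<And>z. z \<notin> upper \<Longrightarrow> G z = 0" and a: "0 < a"
  shows "(\<integral>\<^sup>+z. G (of_real a * z) \<partial>mu) = (\<integral>\<^sup>+z. G z \<partial>mu)"
proof -
  have "(\<integral>\<^sup>+z. G (of_real a * z) \<partial>mu) = slope_integral (\<lambda>z. G (of_real a * z))"
    by (rule nn_integral_mu_slope) (use a in \<open>auto intro!: 0 simp: upper_def zero_less_mult_iff\<close>)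
  also have "\<dots> = slope_integral G"
    unfolding slope_integral_def
  proof (rule nn_integral_cong)
    fix k :: real
    have "of_real a * Complex (k * y) y = Complex (k * (a * y)) (a * y)" for y
      by (simp add: complex_eq_iff)
    moreover have "(\<integral>\<^sup>+y. G (Complex (k * (a * y)) (a * y)) * ennreal (1 / y) * indicator {0<..} y \<partial>lborel) =
      (\<integral>\<^sup>+t. G (Complex (k * (a * exp t)) (a * exp t)) \<partial>lborel)"
      by (rule nn_integral_exp_substitution) measurable
    moreover have "(\<integral>\<^sup>+t. G (Complex (k * exp t) (exp t)) \<partial>lborel) =
        ennreal \<bar>1\<bar> * (\<integral>\<^sup>+t. G (Complex (k * exp (ln a + 1 * t)) (exp (ln a + 1 * t))) \<partial>lborel)"
      by (rule nn_integral_real_affine) simp_all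
    moreover have "(\<integral>\<^sup>+y. G (Complex (k * y) y) * ennreal (1 / y) * indicator {0<..} y \<partial>lborel) =
      (\<integral>\<^sup>+t. G (Complex (k * exp t) (exp t)) \<partial>lborel)"
      by (rule nn_integral_exp_substitution) measurable
    ultimately show "(\<integral>\<^sup>+y. G (of_real a * Complex (k * y) y) * ennreal (1 / y) * indicator {0<..} y \<partial>lborel) =
       (\<integral>\<^sup>+y. G (Complex (k * y) y) * ennreal (1 / y) * indicator {0<..} y \<partial>lborel)"
      using a by (simp add: exp_add)
  qed
  also have "\<dots> = (\<integral>\<^sup>+z. G z \<partial>mu)"
    by (rule nn_integral_mu_slope[symmetric]) (use 0 in simp_all)
  finally show ?thesis .
qed

text \<open>
  In the coordinates slope \<open>k = x/y\<close> and height \<open>y\<close> the inversion \<open>z \<mapsto> -1/z\<close> reflects the slope and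
  sends \<open>y\<close> to \<open>1/((1+k\<^sup>2)y)\<close>, so that its invariance reduces to two one-dimensional ones.
\<close>

lemma nn_integral_mu_inversion:
  assumes [measurable]: "G \<in> borel_measurable borel" and 0: "\<And>z. z \<notin> upper \<Longrightarrow> G z = 0"
  shows "(\<integral>\<^sup>+z. G (- 1 / z) \<partial>mu) = (\<integral>\<^sup>+z. G z \<partial>mu)"
proof -
  have iu: "Im (- 1 / z) = Im z / (cmod z)\<^sup>2" for z
    by (simp add: Im_divide cmod_power2)
  have "(\<integral>\<^sup>+z. G (- 1 / z) \<partial>mu) = slope_integral (\<lambda>z. G (- 1 / z))"
  proof (rule nn_integral_mu_slope)
    fix z assume "z \<notin> upper"
    then have "- 1 / z \<notin> upper"
      unfolding upper_def mem_Collect_eq iu by (auto simp: zero_less_divide_iff)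
    then show "G (- 1 / z) = 0" by (rule 0)
  qed measurable
  also have "\<dots> = (\<integral>\<^sup>+k. (\<integral>\<^sup>+y. G (Complex (- k * y) y) * ennreal (1 / y) * indicator {0<..} y \<partial>lborel) \<partial>lborel)"
    unfolding slope_integral_def
  proof (rule nn_integral_cong)
    fix k :: real
    define c where "c = 1 / (1 + k\<^sup>2)"
    have p: "0 < 1 + k\<^sup>2" by (simp add: add_pos_nonneg)
    have c: "0 < c" unfolding c_def using p by simp
    have "- 1 / Complex (k * y) y = Complex (- k * (c / y)) (c / y)" if "0 < y" for y
    proof -
      have "Complex (- k * (c / y)) (c / y) * Complex (k * y) y = - of_real (c * (1 + k\<^sup>2))"
        using that by (simp add: complex_eq_iff field_simps power2_eq_square)
      then have "Complex (- k * (c / y)) (c / y) * Complex (k * y) y = - 1"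
        using p by (simp add: c_def)
      moreover have "Complex (k * y) y \<noteq> 0" using that by (simp add: complex_eq_iff)
      ultimately show ?thesis by (simp add: field_simps)
    qed
    then have "(\<integral>\<^sup>+y. G (- 1 / Complex (k * y) y) * ennreal (1 / y) * indicator {0<..} y \<partial>lborel) =
       (\<integral>\<^sup>+y. G (Complex (- k * (c / y)) (c / y)) * ennreal (1 / y) * indicator {0<..} y \<partial>lborel)"
      by (intro nn_integral_cong) (auto simp: indicator_def)
    also have "\<dots> = (\<integral>\<^sup>+y. G (Complex (- k * y) y) * ennreal (1 / y) * indicator {0<..} y \<partial>lborel)"
      by (rule nn_integral_inversion_dy_over_y[of "\<lambda>y. G (Complex (- k * y) y)", OF _ c]) measurable
    finally show "(\<integral>\<^sup>+y. G (- 1 / Complex (k * y) y) * ennreal (1 / y) * indicator {0<..} y \<partial>lborel) =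
       (\<integral>\<^sup>+y. G (Complex (- k * y) y) * ennreal (1 / y) * indicator {0<..} y \<partial>lborel)" .
  qed
  also have "\<dots> = slope_integral G"
    unfolding slope_integral_def
    by (subst (2) nn_integral_real_affine[where c = "-1" and t = 0]) simp_all
  also have "\<dots> = (\<integral>\<^sup>+z. G z \<partial>mu)"
    by (rule nn_integral_mu_slope[symmetric]) (use 0 in simp_all)
  finally show ?thesis .
qed

lemma SL2R_det: "g \<in> SL2R \<longleftrightarrow> g$1$1 * g$2$2 - g$1$2 * g$2$1 = 1"
  by (simp add: SL2R_def det_2)

lemma cocycle_denom_nonzero:
  assumes g: "g \<in> SL2R" and z: "z \<in> upper"
  shows "cocycle_denom g z \<noteq> 0"
proof
  assume 0: "cocycle_denom g z = 0"
  from arg_cong[OF 0, of Im] have "g$2$1 * Im z = 0" by (simp add: cocycle_denom_def)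
  then have c: "g$2$1 = 0" using z by (simp add: upper_def)
  from arg_cong[OF 0, of Re] c have "g$2$2 = 0" by (simp add: cocycle_denom_def)
  with c g show False by (simp add: SL2R_det)
qed

lemma mob_eq: "mob g z = (of_real (g$1$1) * z + of_real (g$1$2)) / cocycle_denom g z"
  by (simp add: mob_def moebius_def cocycle_denom_def)

lemma Im_mob:
  assumes g: "g \<in> SL2R" and z: "z \<in> upper"
  shows "Im (mob g z) = Im z / (cmod (cocycle_denom g z))\<^sup>2"
proof -
  have "Im (mob g z) = Im ((of_real (g$1$1) * z + of_real (g$1$2)) * cnj (cocycle_denom g z)) / (cmod (cocycle_denom g z))\<^sup>2"
    unfolding mob_eq by (subst complex_div_cnj) simp
  also have "Im ((of_real (g$1$1) * z + of_real (g$1$2)) * cnj (cocycle_denom g z)) = (g$1$1 * g$2$2 - g$1$2 * g$2$1) * Im z"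
    by (simp add: cocycle_denom_def algebra_simps)
  finally show ?thesis using g by (simp add: SL2R_det)
qed

lemma mob_upper:
  assumes g: "g \<in> SL2R" and z: "z \<in> upper"
  shows "mob g z \<in> upper"
  using Im_mob[OF assms] cocycle_denom_nonzero[OF assms] z by (simp add: upper_def)

text \<open>
  Every fractional linear map is composed of translations, dilations and at most one inversion.
\<close>

theorem nn_integral_mu_mob:
  assumes g: "g \<in> SL2R" and [measurable]: "G \<in> borel_measurable borel" and 0: "\<And>z. z \<notin> upper \<Longrightarrow> G z = 0"
  shows "(\<integral>\<^sup>+z. G (mob g z) \<partial>mu) = (\<integral>\<^sup>+z. G z \<partial>mu)"
proof -
  define a b c d where "a = g$1$1" and "b = g$1$2" and "c = g$2$1" and "d = g$2$2"
  have det: "a * d - b * c = 1" using g by (simp add: SL2R_det a_def b_def c_def d_def)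
  have mob: "mob g z = (of_real a * z + of_real b) / (of_real c * z + of_real d)" for z
    by (simp add: mob_eq cocycle_denom_def a_def b_def c_def d_def)
  show ?thesis
  proof (cases "c = 0")
    case True
    then have ad: "a * d = 1" using det by simp
    then have nz: "a \<noteq> 0" "d \<noteq> 0" by auto
    define G' where "G' z = G (z + of_real (a * b))" for z
    have "mob g z = of_real (a\<^sup>2) * z + of_real (a * b)" for z
    proof -
      have "complex_of_real a * of_real d = 1" using ad by (metis of_real_1 of_real_mult)
      then have "1 / complex_of_real d = of_real a" using nz by (simp add: field_simps)
      then have "mob g z = (of_real a * z + of_real b) * of_real a" unfolding mob True by (simp add: divide_inverse)
      then show ?thesis by (simp add: algebra_simps power2_eq_square)
    qed
    then have "(\<integral>\<^sup>+z. G (mob g z) \<partial>mu) = (\<integral>\<^sup>+z. G' (of_real (a\<^sup>2) * z) \<partial>mu)" by (simp only: G'_def)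
    also have "\<dots> = (\<integral>\<^sup>+z. G' z \<partial>mu)"
      by (rule nn_integral_mu_scale) (use nz in \<open>auto simp: G'_def[abs_def] upper_def intro!: 0\<close>)
    also have "\<dots> = (\<integral>\<^sup>+z. G z \<partial>mu)"
      unfolding G'_def by (rule nn_integral_mu_translate) (use 0 in auto)
    finally show ?thesis .
  next
    case False
    define G1 where "G1 w = G (w + of_real (a / c))" for w
    define G2 where "G2 w = G1 (- 1 / w)" for w
    define G3 where "G3 w = G2 (of_real (c\<^sup>2) * w)" for w
    have m [measurable]: "G1 \<in> borel_measurable borel" "G2 \<in> borel_measurable borel" "G3 \<in> borel_measurable borel"
      unfolding G1_def[abs_def] G2_def[abs_def] G3_def[abs_def] by measurable
    have G1: "G1 w = 0" if "w \<notin> upper" for w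
      unfolding G1_def by (rule 0) (use that in \<open>simp add: upper_def\<close>)
    have G2: "G2 w = 0" if "w \<notin> upper" for w
    proof -
      have "Im (- 1 / w) = Im w / (cmod w)\<^sup>2" by (simp add: Im_divide cmod_power2)
      moreover have "Im w / (cmod w)\<^sup>2 \<le> 0" using that by (simp add: upper_def divide_nonpos_nonneg)
      ultimately show ?thesis unfolding G2_def by (intro G1) (simp add: upper_def)
    qed
    have c2: "0 < c\<^sup>2" using False by simp
    have G3: "G3 w = 0" if "w \<notin> upper" for w
      unfolding G3_def by (rule G2) (use that c2 in \<open>simp add: upper_def zero_less_mult_iff\<close>)
    have "(\<integral>\<^sup>+z. G (mob g z) \<partial>mu) = (\<integral>\<^sup>+z. G3 (z + of_real (d / c)) \<partial>mu)"
    proof (intro nn_integral_cong)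
      fix z assume "z \<in> space mu"
      then have z: "z \<in> upper" by simp
      have nz: "of_real c * z + of_real d \<noteq> 0"
        using cocycle_denom_nonzero[OF g z] by (simp add: cocycle_denom_def c_def d_def)
      have cc: "complex_of_real c \<noteq> 0" using False by simp
      have e1: "complex_of_real (c\<^sup>2) * (z + of_real (d / c)) = of_real c * (of_real c * z + of_real d)"
        using cc by (simp add: field_simps power2_eq_square)
      have dc: "complex_of_real a * of_real d - of_real b * of_real c = 1"
        using det by (metis of_real_1 of_real_diff of_real_mult)
      have "- 1 / (of_real c * (of_real c * z + of_real d)) + of_real (a / c) =
         (of_real a * (of_real c * z + of_real d) - 1) / (of_real c * (of_real c * z + of_real d))"
        unfolding diff_divide_distrib using nz by simp
      also have "of_real a * (of_real c * z + of_real d) - 1 = of_real c * (of_real a * z + of_real b)"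
        using dc by (simp add: algebra_simps)
      also have "of_real c * (of_real a * z + of_real b) / (of_real c * (of_real c * z + of_real d)) = mob g z"
        using cc by (simp add: mob)
      finally show "G (mob g z) = G3 (z + of_real (d / c))"
        unfolding G3_def G2_def G1_def e1 by simp
    qed
    also have "\<dots> = (\<integral>\<^sup>+z. G3 z \<partial>mu)" by (rule nn_integral_mu_translate[OF m(3) G3])
    also have "\<dots> = (\<integral>\<^sup>+z. G2 z \<partial>mu)" unfolding G3_def by (rule nn_integral_mu_scale[OF m(2) G2 c2])
    also have "\<dots> = (\<integral>\<^sup>+z. G1 z \<partial>mu)" unfolding G2_def by (rule nn_integral_mu_inversion[OF m(1) G1])
    also have "\<dots> = (\<integral>\<^sup>+z. G z \<partial>mu)" unfolding G1_def by (rule nn_integral_mu_translate) (use 0 in auto)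
    finally show ?thesis .
  qed
qed

lemma mob_measurable: "mob g \<in> borel_measurable borel"
  unfolding mob_def[abs_def] moebius_def by measurable

lemma AE_mu_borel_null:
  assumes "AE z in mu. P z"
  obtains N where "N \<in> sets borel" "N \<subseteq> upper" "(\<integral>\<^sup>+z. indicator N z \<partial>mu) = 0" "\<And>z. z \<in> upper \<Longrightarrow> \<not> P z \<Longrightarrow> z \<in> N"
proof -
  obtain N where N: "{z \<in> space mu. \<not> P z} \<subseteq> N" "N \<in> sets mu" "emeasure mu N = 0"
    using AE_E[OF assms] by metis
  have sm: "sets mu = sets (restrict_space borel upper)"
    unfolding mu_def sets_density by (simp add: sets_restrict_space)
  then have "N \<in> sets (restrict_space borel upper)" using N(2) by simp
  then have Nb: "N \<in> sets borel" "N \<subseteq> upper"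
    using upper_borel by (auto simp: sets_restrict_space_iff[of upper borel])
  have "(\<integral>\<^sup>+z. indicator N z \<partial>mu) = 0" using N(2,3) by simp
  with Nb N(1) show ?thesis by (intro that[of N]) auto
qed

lemma AE_mu_mob:
  assumes g: "g \<in> SL2R" and P: "AE z in mu. P z"
  shows "AE z in mu. P (mob g z)"
proof -
  obtain N where N: "N \<in> sets borel" "N \<subseteq> upper" "(\<integral>\<^sup>+z. indicator N z \<partial>mu) = 0"
    "\<And>z. z \<in> upper \<Longrightarrow> \<not> P z \<Longrightarrow> z \<in> N" using AE_mu_borel_null[OF P] by metis
  have [measurable]: "N \<in> sets borel" "mob g \<in> borel_measurable borel" using N mob_measurable by auto
  have "(\<integral>\<^sup>+z. indicator N (mob g z) \<partial>mu) = (\<integral>\<^sup>+z. indicator N z \<partial>mu)"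
    by (rule nn_integral_mu_mob[OF g]) (use N in \<open>auto simp: indicator_def\<close>)
  then have "(\<integral>\<^sup>+z. indicator N (mob g z) \<partial>mu) = 0" using N(3) by simp
  then have "AE z in mu. indicator N (mob g z) = (0::ennreal)"
    by (subst (asm) nn_integral_0_iff_AE) (auto intro!: measurable_mu)
  then show ?thesis using AE_space[of mu]
  proof eventually_elim
    case (elim z)
    then show ?case using N(4)[OF mob_upper[OF g, of z]] by (auto simp: indicator_def split: if_splits)
  qed
qed

text \<open>
  The factor of \<^const>\<open>sigma\<close>. It has modulus one on the upper half-plane.
\<close>

definition jfac :: "real \<Rightarrow> real^2^2 \<Rightarrow> complex \<Rightarrow> complex" where
  "jfac s g z = (of_real (cmod (cocycle_denom g z)) / cocycle_denom g z) powr of_real s"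

lemma sigma_eq: "sigma s g F z = jfac s g z * F (mob g z)"
  by (simp add: sigma_def jfac_def)

lemma cmod_jfac:
  assumes g: "g \<in> SL2R" and z: "z \<in> upper"
  shows "cmod (jfac s g z) = 1"
proof -
  have nz: "cocycle_denom g z \<noteq> 0" by (rule cocycle_denom_nonzero[OF assms])
  define u where "u = of_real (cmod (cocycle_denom g z)) / cocycle_denom g z"
  have u: "cmod u = 1" "u \<noteq> 0" using nz by (auto simp: u_def norm_divide)
  have "cmod (u powr of_real s) = exp (s * Re (Ln u))"
    using u by (simp add: powr_def norm_exp_eq_Re)
  then show ?thesis using u by (simp add: jfac_def u_def[symmetric])
qed

lemma jfac_measurable: "jfac s g \<in> borel_measurable borel"
proof -
  have [measurable]: "cocycle_denom g \<in> borel_measurable borel"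
    unfolding cocycle_denom_def[abs_def] by measurable
  show ?thesis unfolding jfac_def[abs_def] by measurable
qed

lemma sigma_L2:
  assumes g: "g \<in> SL2R" and F: "F \<in> L2_space mu"
  shows "sigma s g F \<in> L2_space mu" "nrm2 mu (sigma s g F) = nrm2 mu F"
proof -
  define F0 where "F0 z = (if z \<in> upper then F z else 0)" for z
  have [measurable]: "F0 \<in> borel_measurable borel"
    using L2_measurable[OF F] unfolding F0_def[abs_def] measurable_mu_iff .
  have [measurable]: "mob g \<in> borel_measurable borel" "jfac s g \<in> borel_measurable borel"
    by (rule mob_measurable jfac_measurable)+
  have eq: "sigma s g F z = jfac s g z * F0 (mob g z)" if "z \<in> upper" for z
    using mob_upper[OF g that] by (simp add: sigma_eq F0_def)
  have m: "sigma s g F \<in> borel_measurable mu"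
  proof -
    have "(\<lambda>z. jfac s g z * F0 (mob g z)) \<in> borel_measurable mu"
      by (rule measurable_mu) measurable
    then show ?thesis by (subst measurable_cong[of mu _ "\<lambda>z. jfac s g z * F0 (mob g z)"]) (auto simp: eq)
  qed
  have "(\<integral>\<^sup>+z. ennreal ((cmod (sigma s g F z))\<^sup>2) \<partial>mu) = (\<integral>\<^sup>+z. ennreal ((cmod (F0 (mob g z)))\<^sup>2) \<partial>mu)"
    by (intro nn_integral_cong) (simp add: eq norm_mult cmod_jfac[OF g])
  also have "\<dots> = (\<integral>\<^sup>+z. ennreal ((cmod (F0 z))\<^sup>2) \<partial>mu)"
  proof (rule nn_integral_mu_mob[OF g, of "\<lambda>z. ennreal ((cmod (F0 z))\<^sup>2)"])
    show "ennreal ((cmod (F0 z))\<^sup>2) = 0" if "z \<notin> upper" for z using that by (simp add: F0_def)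
  qed measurable
  also have "\<dots> = (\<integral>\<^sup>+z. ennreal ((cmod (F z))\<^sup>2) \<partial>mu)"
    by (intro nn_integral_cong) (simp add: F0_def)
  also have "\<dots> = ennreal (nrm2 mu F)" by (rule L2_nn_integral[OF F])
  finally have n: "(\<integral>\<^sup>+z. ennreal ((cmod (sigma s g F z))\<^sup>2) \<partial>mu) = ennreal (nrm2 mu F)" .
  show "sigma s g F \<in> L2_space mu" by (rule L2_spaceI[OF m]) (simp add: n)
  show "nrm2 mu (sigma s g F) = nrm2 mu F" by (rule nrm2_eqI[OF n _ m]) simp
qed

section \<open>The wavelet transform is an isometry\<close>

text \<open>
  The admissibility constant as a function of the Fourier transform of the wavelet.
\<close>

definition admc :: "(real \<Rightarrow> complex) \<Rightarrow> ennreal" where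
  "admc h = (\<integral>\<^sup>+\<xi>. ennreal ((cmod (h \<xi>))\<^sup>2 / \<xi>) * indicator {0<..} \<xi> \<partial>lborel)"

lemma wt_eq_FT:
  assumes "0 < y"
  shows "wt h \<phi> (Complex x y) = of_real (1 / (2 * pi)) *
    FT (posp (\<lambda>\<xi>. of_real (sqrt y) * (\<phi> \<xi> * cnj (h (y * \<xi>))))) (- x)"
proof -
  have "FT (posp (\<lambda>\<xi>. of_real (sqrt y) * (\<phi> \<xi> * cnj (h (y * \<xi>))))) (- x) =
    integral\<^sup>L lborel (posp (\<lambda>\<xi>. of_real (sqrt y) * (\<phi> \<xi> * cnj (h (y * \<xi>)) * exp (\<i> * of_real (x * \<xi>)))))"
    unfolding FT_def by (intro Bochner_Integration.integral_cong) (auto simp: posp_def)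
  also have "\<dots> = of_real (sqrt y) * (LINT \<xi>|lpos. \<phi> \<xi> * cnj (h (y * \<xi>)) * exp (\<i> * of_real (x * \<xi>)))"
    unfolding integral_lpos[symmetric] by (rule integral_mult_right_zero)
  finally show ?thesis by (simp add: wt_def)
qed

lemma L2_lpos_scale:
  assumes h: "h \<in> L2_space lpos" and y: "0 < y"
  shows "(\<lambda>\<xi>. h (y * \<xi>)) \<in> L2_space lpos" "nrm2 lpos (\<lambda>\<xi>. h (y * \<xi>)) = nrm2 lpos h / y"
proof -
  have e: "posp (\<lambda>\<xi>. h (y * \<xi>)) = (\<lambda>\<xi>. posp h (0 + y * \<xi>))"
    using y by (auto simp: posp_def zero_less_mult_iff fun_eq_iff)
  have hL: "posp h \<in> L2_space lborel" using h by (simp only: posp_L2)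
  show 1: "(\<lambda>\<xi>. h (y * \<xi>)) \<in> L2_space lpos"
    using L2_affine(1)[OF hL y, of 0] unfolding posp_L2[symmetric] e .
  show "nrm2 lpos (\<lambda>\<xi>. h (y * \<xi>)) = nrm2 lpos h / y"
    unfolding nrm2_posp[OF 1, symmetric] nrm2_posp[OF h, symmetric] e by (rule L2_affine(2)[OF hL y])
qed

lemma wt_integrand_integrable:
  assumes "\<phi> \<in> L2_space lpos" "h \<in> L2_space lpos" "0 < y"
  shows "integrable lpos (\<lambda>\<xi>. \<phi> \<xi> * cnj (h (y * \<xi>)))"
  by (rule L2_integrable_ip[OF assms(1) L2_lpos_scale(1)[OF assms(2,3)]])

lemma wt_bound:
  assumes \<phi>: "\<phi> \<in> L2_space lpos" and h: "h \<in> L2_space lpos" and z: "0 < Im z"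
  shows "cmod (wt h \<phi> z) \<le> sqrt (nrm2 lpos \<phi> * nrm2 lpos h)"
proof -
  define y where "y = Im z"
  have y: "0 < y" using z by (simp add: y_def)
  define k where "k \<xi> = exp (- (\<i> * of_real (Re z * \<xi>))) * h (y * \<xi>)" for \<xi>
  have hy: "(\<lambda>\<xi>. h (y * \<xi>)) \<in> L2_space lpos" "nrm2 lpos (\<lambda>\<xi>. h (y * \<xi>)) = nrm2 lpos h / y"
    by (rule L2_lpos_scale[OF h y])+
  have kL: "k \<in> L2_space lpos" "nrm2 lpos k = nrm2 lpos h / y"
  proof -
    have m: "(\<lambda>\<xi>. exp (- (\<i> * complex_of_real (Re z * \<xi>)))) \<in> borel_measurable lpos"
      by (rule measurable_lpos) measurable
    show "k \<in> L2_space lpos" "nrm2 lpos k = nrm2 lpos h / y"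
      using L2_unimodular_mult[OF hy(1) m, of 1] hy(2) unfolding k_def[abs_def] by simp_all
  qed
  have "wt h \<phi> z = of_real (sqrt y / (2 * pi)) * ip lpos \<phi> k"
    by (simp add: wt_def ip_def k_def y_def exp_cnj mult_ac)
  then have "cmod (wt h \<phi> z) = sqrt y / (2 * pi) * cmod (ip lpos \<phi> k)"
    using y by (simp add: norm_mult norm_divide)
  also have "\<dots> \<le> sqrt y / (2 * pi) * sqrt (nrm2 lpos \<phi> * (nrm2 lpos h / y))"
    using L2_Cauchy_Schwarz[OF \<phi> kL(1)] y kL(2) by (intro mult_left_mono real_le_rsqrt) auto
  also have "\<dots> = sqrt (nrm2 lpos \<phi> * nrm2 lpos h) / (2 * pi)"
    using y by (simp add: real_sqrt_mult real_sqrt_divide)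
  also have "\<dots> \<le> sqrt (nrm2 lpos \<phi> * nrm2 lpos h) / 1"
    using pi_gt3 by (intro divide_left_mono) auto
  finally show ?thesis by simp
qed

lemma wt_add:
  assumes "\<phi> \<in> L2_space lpos" "\<eta> \<in> L2_space lpos" "h \<in> L2_space lpos" "0 < Im z"
  shows "wt h (\<lambda>\<xi>. \<phi> \<xi> + \<eta> \<xi>) z = wt h \<phi> z + wt h \<eta> z"
proof -
  have i: "integrable lpos (\<lambda>\<xi>. f \<xi> * cnj (h (Im z * \<xi>)) * exp (\<i> * of_real (Re z * \<xi>)))" if "f \<in> L2_space lpos" for f
  proof (rule Bochner_Integration.integrable_bound[OF wt_integrand_integrable[OF that assms(3,4)]])
    have [measurable]: "(\<lambda>\<xi>. f \<xi> * cnj (h (Im z * \<xi>))) \<in> borel_measurable lpos"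
      using wt_integrand_integrable[OF that assms(3,4)] by (rule borel_measurable_integrable)
    have [measurable]: "(\<lambda>\<xi>. exp (\<i> * complex_of_real (Re z * \<xi>))) \<in> borel_measurable lpos"
      by (rule measurable_lpos) measurable
    show "(\<lambda>\<xi>. f \<xi> * cnj (h (Im z * \<xi>)) * exp (\<i> * of_real (Re z * \<xi>))) \<in> borel_measurable lpos" by measurable
  qed (simp add: norm_mult del: of_real_mult)
  show ?thesis
    unfolding wt_def distrib_right Bochner_Integration.integral_add[OF i[OF assms(1)] i[OF assms(2)]] distrib_left ..
qed

lemma wt_cmult: "wt h (\<lambda>\<xi>. c * \<phi> \<xi>) z = c * wt h \<phi> z"
  unfolding wt_def by (simp add: mult.assoc mult.left_commute)

lemma wt_diff:
  assumes "\<phi> \<in> L2_space lpos" "\<eta> \<in> L2_space lpos" "h \<in> L2_space lpos" "0 < Im z"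
  shows "wt h (\<lambda>\<xi>. \<phi> \<xi> - \<eta> \<xi>) z = wt h \<phi> z - wt h \<eta> z"
  using wt_add[OF assms(1) L2_scale[OF assms(2), of "-1"] assms(3,4)] wt_cmult[of h "-1" \<eta> z] by simp

lemma power_le_exp:
  fixes x :: real
  assumes "0 \<le> x" "0 < n"
  shows "x ^ n \<le> real n ^ n * exp x"
proof -
  have "x / n \<le> exp (x / n)" using exp_ge_add_one_self[of "x / n"] by linarith
  then have "(x / n) ^ n \<le> exp (x / n) ^ n" using assms by (intro power_mono) auto
  also have "\<dots> = exp x" using assms by (simp add: exp_of_nat_mult[symmetric])
  finally show ?thesis using assms by (simp add: power_divide field_simps)
qed

lemma powr_exp_bounded:
  fixes r :: real
  assumes r: "0 \<le> r"
  obtains B where "0 \<le> B" "\<And>\<xi>::real. 0 < \<xi> \<Longrightarrow> \<xi> powr r * exp (- \<xi>) \<le> B"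
proof -
  obtain m :: nat where "r \<le> real m" using real_arch_simple by blast
  then have n: "r \<le> real (Suc m)" "0 < Suc m" by simp_all
  define n where "n = Suc m"
  note n = n[folded n_def]
  have "\<xi> powr r * exp (- \<xi>) \<le> 1 + real n ^ n" if "0 < \<xi>" for \<xi> :: real
  proof -
    have "\<xi> powr r \<le> 1 + \<xi> ^ n"
    proof (cases "\<xi> \<le> 1")
      case True
      have "\<xi> powr r \<le> 1 powr r" using True that r by (intro powr_mono2) auto
      moreover have "0 \<le> \<xi> ^ n" using that by simp
      ultimately show ?thesis by simp
    next
      case False
      have "\<xi> powr r \<le> \<xi> powr real n" using False n by (intro powr_mono) auto
      then show ?thesis using that by (simp add: powr_realpow)
    qed
    also have "\<dots> \<le> exp \<xi> + real n ^ n * exp \<xi>"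
      using power_le_exp[of \<xi> n] that n by (intro add_mono) auto
    finally have "\<xi> powr r * exp (- \<xi>) \<le> (exp \<xi> + real n ^ n * exp \<xi>) * exp (- \<xi>)"
      by (intro mult_right_mono) auto
    also have "\<dots> = 1 + real n ^ n" by (simp add: distrib_right mult.assoc flip: exp_add)
    finally show ?thesis .
  qed
  then show ?thesis by (intro that[of "1 + real n ^ n"]) auto
qed

text \<open>
  Orthogonality to all \<open>\<xi>\<^sup>r e\<^bsup>-(1+\<i>\<theta>)\<xi>\<^esup>\<close> says that the Fourier transform of \<open>g(\<xi>) \<xi>\<^sup>r e\<^bsup>-\<xi>\<^esup>\<close> vanishes.
\<close>

lemma lpos_exponentials_complete:
  assumes r: "0 \<le> r" and g: "g \<in> L2_space lpos"
    and 0: "\<And>\<theta>. ip lpos g (\<lambda>\<xi>. of_real \<xi> powr of_real r * exp (- ((1 + \<i> * of_real \<theta>) * of_real \<xi>))) = 0"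
  shows "AE \<xi> in lpos. g \<xi> = 0"
proof -
  obtain B where B: "0 \<le> B" "\<And>\<xi>::real. 0 < \<xi> \<Longrightarrow> \<xi> powr r * exp (- \<xi>) \<le> B"
    using powr_exp_bounded[OF r] by blast
  define w where "w \<xi> = complex_of_real (\<xi> powr r * exp (- \<xi>))" for \<xi> :: real
  have wL: "w \<in> L2_space lpos"
  proof (rule L2_cong_AE[OF power_exp_L2[of "of_real r" 1]])
    show "w \<in> borel_measurable lpos" unfolding w_def[abs_def] by (rule measurable_lpos) measurable
    show "AE \<xi> in lpos. complex_of_real \<xi> powr of_real r * exp (- (1 * of_real \<xi>)) = w \<xi>"
      by (rule AE_I2) (simp add: w_def powr_of_real flip: exp_of_real)
  qed (use r in auto)
  define G where "G \<xi> = g \<xi> * w \<xi>" for \<xi>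
  have Gi: "integrable lpos G" unfolding G_def[abs_def] by (rule L2_integrable_mult[OF g wL])
  have GL: "G \<in> L2_space lpos"
  proof (rule L2_spaceI_integrable[OF borel_measurable_integrable[OF Gi]])
    show "integrable lpos (\<lambda>\<xi>. (cmod (G \<xi>))\<^sup>2)"
    proof (rule Bochner_Integration.integrable_bound)
      show "integrable lpos (\<lambda>\<xi>. B\<^sup>2 * (cmod (g \<xi>))\<^sup>2)" using L2_integrable_square[OF g] by simp
      show "(\<lambda>\<xi>. (cmod (G \<xi>))\<^sup>2) \<in> borel_measurable lpos"
        using borel_measurable_integrable[OF Gi] by measurable
      show "AE \<xi> in lpos. norm ((cmod (G \<xi>))\<^sup>2) \<le> norm (B\<^sup>2 * (cmod (g \<xi>))\<^sup>2)"
      proof (rule AE_I2)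
        fix \<xi> assume "\<xi> \<in> space lpos"
        then have "\<bar>\<xi> powr r * exp (- \<xi>)\<bar> \<le> B" using B(2)[of \<xi>] by simp
        then have "cmod (G \<xi>) \<le> cmod (g \<xi>) * B"
          unfolding G_def w_def norm_mult norm_of_real by (intro mult_left_mono) auto
        then have "(cmod (G \<xi>))\<^sup>2 \<le> (cmod (g \<xi>) * B)\<^sup>2" by (intro power_mono) auto
        then show "norm ((cmod (G \<xi>))\<^sup>2) \<le> norm (B\<^sup>2 * (cmod (g \<xi>))\<^sup>2)"
          by (simp add: power_mult_distrib mult.commute)
      qed
    qed
  qed
  have "AE \<xi> in lpos. G \<xi> = 0"
  proof (rule lpos_Fourier_unique[OF GL Gi])
    fix \<theta> :: real
    have "(LINT \<xi>|lpos. G \<xi> * exp (- (\<i> * of_real (\<theta> * \<xi>)))) =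
      ip lpos g (\<lambda>\<xi>. of_real \<xi> powr of_real r * exp (- ((1 + \<i> * of_real (- \<theta>)) * of_real \<xi>)))"
      unfolding ip_def
    proof (intro Bochner_Integration.integral_cong refl)
      fix \<xi> assume "\<xi> \<in> space lpos"
      then have \<xi>: "0 < \<xi>" by simp
      have "cnj (exp (- ((1 + \<i> * of_real (- \<theta>)) * of_real \<xi>))) = exp (- (of_real \<xi> + \<i> * of_real (\<theta> * \<xi>)))"
      proof -
        have "cnj (- ((1 + \<i> * of_real (- \<theta>)) * of_real \<xi>)) = - (of_real \<xi> + \<i> * of_real (\<theta> * \<xi>))"
          by (simp add: complex_eq_iff)
        then show ?thesis by (simp only: exp_cnj)
      qed
      also have "\<dots> = of_real (exp (- \<xi>)) * exp (- (\<i> * of_real (\<theta> * \<xi>)))"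
        unfolding minus_add_distrib exp_add by (simp flip: exp_of_real)
      finally have e: "cnj (exp (- ((1 + \<i> * of_real (- \<theta>)) * of_real \<xi>))) = of_real (exp (- \<xi>)) * exp (- (\<i> * of_real (\<theta> * \<xi>)))" .
      have p: "complex_of_real \<xi> powr of_real r = of_real (\<xi> powr r)" using \<xi> by (simp add: powr_of_real)
      show "G \<xi> * exp (- (\<i> * of_real (\<theta> * \<xi>))) = g \<xi> * cnj (of_real \<xi> powr of_real r * exp (- ((1 + \<i> * of_real (- \<theta>)) * of_real \<xi>)))"
        unfolding complex_cnj_mult e p by (simp add: G_def w_def mult_ac)
    qed
    then show "(LINT \<xi>|lpos. G \<xi> * exp (- (\<i> * of_real (\<theta> * \<xi>)))) = 0" unfolding 0 .
  qed
  then show ?thesis using AE_space[of lpos]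
    by eventually_elim (auto simp: G_def w_def)
qed

lemma exponentials_L2:
  assumes "0 \<le> r"
  shows "(\<lambda>\<xi>. of_real \<xi> powr of_real r * exp (- ((1 + \<i> * of_real \<theta>) * of_real \<xi>))) \<in> L2_space lpos"
  by (rule power_exp_L2) (use assms in auto)

section \<open>Continuity of wavelet transforms\<close>

lemma Laplace_holomorphic:
  assumes "\<phi> \<in> L2_space lpos"
  shows "(\<lambda>p. LINT \<xi>|lpos. \<phi> \<xi> * exp (- (p * of_real \<xi>))) holomorphic_on {p. 0 < Re p}"
  by (rule holomorphic_exponential_integral[OF L2_measurable[OF assms] measurable_ident_lpos])
    (rule L2_integrable_mult[OF assms exp_L2])

lemma wt_exponential_continuous:
  assumes h: "h \<in> L2_space lpos"
  shows "continuous_on upper (wt h (\<lambda>\<xi>. exp (- ((1 + \<i> * of_real \<theta>) * of_real \<xi>))))"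
proof -
  define w where "w = 1 + \<i> * complex_of_real \<theta>"
  define \<Psi> where "\<Psi> p = (LINT \<xi>|lpos. cnj (h \<xi>) * exp (- (p * of_real \<xi>)))" for p
  have "\<Psi> holomorphic_on {p. 0 < Re p}"
    unfolding \<Psi>_def[abs_def] by (rule Laplace_holomorphic[OF L2_cnj[OF h]])
  then have c\<Psi>: "continuous_on {p. 0 < Re p} \<Psi>" by (rule holomorphic_on_imp_continuous_on)
  have eq: "wt h (\<lambda>\<xi>. exp (- (w * of_real \<xi>))) z =
      of_real (sqrt (Im z) / (2 * pi)) * (\<Psi> ((w - \<i> * of_real (Re z)) / of_real (Im z)) / of_real (Im z))" if "z \<in> upper" for z
  proof -
    define x y where "x = Re z" and "y = Im z"
    have y: "0 < y" using that by (simp add: y_def upper_def)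
    define p where "p = (w - \<i> * of_real x) / of_real y"
    have "integral\<^sup>L lborel (posp (\<lambda>\<xi>. cnj (h \<xi>) * exp (- (p * of_real \<xi>)))) =
      \<bar>y\<bar> *\<^sub>R (LINT \<xi>|lborel. posp (\<lambda>\<xi>. cnj (h \<xi>) * exp (- (p * of_real \<xi>))) (0 + y * \<xi>))"
      by (rule lborel_integral_real_affine) (use y in simp)
    also have "(LINT \<xi>|lborel. posp (\<lambda>\<xi>. cnj (h \<xi>) * exp (- (p * of_real \<xi>))) (0 + y * \<xi>)) =
      integral\<^sup>L lborel (posp (\<lambda>\<xi>. exp (- (w * of_real \<xi>)) * cnj (h (y * \<xi>)) * exp (\<i> * of_real (x * \<xi>))))"
    proof (intro Bochner_Integration.integral_cong refl)
      fix \<xi>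
      have "p * of_real (y * \<xi>) = w * of_real \<xi> - \<i> * of_real (x * \<xi>)"
      proof -
        have "p * of_real y = w - \<i> * of_real x" using y by (simp add: p_def)
        then have "(p * of_real y) * of_real \<xi> = (w - \<i> * of_real x) * of_real \<xi>" by (simp only:)
        then show ?thesis by (simp add: algebra_simps)
      qed
      then have "exp (- (p * of_real (y * \<xi>))) = exp (- (w * of_real \<xi>)) * exp (\<i> * of_real (x * \<xi>))"
        by (simp add: mult_exp_exp)
      then show "posp (\<lambda>\<xi>. cnj (h \<xi>) * exp (- (p * of_real \<xi>))) (0 + y * \<xi>) =
         posp (\<lambda>\<xi>. exp (- (w * of_real \<xi>)) * cnj (h (y * \<xi>)) * exp (\<i> * of_real (x * \<xi>))) \<xi>"
        using y by (simp add: posp_def zero_less_mult_iff)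
    qed
    finally have "\<Psi> p = of_real y * (LINT \<xi>|lpos. exp (- (w * of_real \<xi>)) * cnj (h (y * \<xi>)) * exp (\<i> * of_real (x * \<xi>)))"
      unfolding \<Psi>_def integral_lpos using y by (simp add: scaleR_conv_of_real)
    then show ?thesis using y by (simp add: wt_def x_def y_def p_def)
  qed
  have "continuous_on upper (\<lambda>z. of_real (sqrt (Im z) / (2 * pi)) * (\<Psi> ((w - \<i> * of_real (Re z)) / of_real (Im z)) / of_real (Im z)))"
  proof (intro continuous_intros continuous_on_compose2[OF c\<Psi>])
    show "(\<lambda>z. (w - \<i> * of_real (Re z)) / of_real (Im z)) ` upper \<subseteq> {p. 0 < Re p}"
      by (auto simp: upper_def w_def Re_divide_of_real)
  qed (auto simp: upper_def)
  then show ?thesis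
    unfolding w_def[symmetric] by (subst continuous_on_cong[OF refl eq]) auto
qed

text \<open>
  On exponentials the transform is a Laplace integral; in general, approximation by combinations of exponentials
  is uniform because of \<open>wt_bound\<close>.
\<close>

theorem wt_continuous:
  assumes \<phi>: "\<phi> \<in> L2_space lpos" and h: "h \<in> L2_space lpos"
  shows "continuous_on upper (wt h \<phi>)"
proof -
  define V where "V = {\<phi> \<in> L2_space lpos. continuous_on upper (wt h \<phi>)}"
  have "\<phi> \<in> V"
  proof (rule L2_closed_subspace[OF _ _ _ _ _ _ \<phi>])
    show "V \<subseteq> L2_space lpos" by (auto simp: V_def)
    have e: "(\<lambda>\<xi>. exp (- ((1 + \<i> * of_real \<theta>) * of_real \<xi>))) \<in> V" for \<theta>
      unfolding V_def by (auto intro!: exp_L2 wt_exponential_continuous[OF h])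
    then show "V \<noteq> {}" by blast
    show "(\<lambda>x. u x + v x) \<in> V" if "u \<in> V" "v \<in> V" for u v
    proof -
      have uv: "u \<in> L2_space lpos" "v \<in> L2_space lpos" using that by (auto simp: V_def)
      have "continuous_on upper (\<lambda>z. wt h u z + wt h v z)"
        using that by (intro continuous_intros) (auto simp: V_def)
      then have "continuous_on upper (wt h (\<lambda>x. u x + v x))"
        by (subst continuous_on_cong[OF refl wt_add[OF uv h]]) (auto simp: upper_def)
      then show ?thesis using L2_add[OF uv] by (simp add: V_def)
    qed
    show "(\<lambda>x. c * v x) \<in> V" if "v \<in> V" for c v
    proof -
      have "continuous_on upper (\<lambda>z. c * wt h v z)"
        using that by (intro continuous_intros) (auto simp: V_def)
      then show ?thesis using that by (simp add: V_def L2_scale wt_cmult[abs_def])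
    qed
    show "AE x in lpos. g x = 0" if g: "g \<in> L2_space lpos" and o: "\<And>v. v \<in> V \<Longrightarrow> ip lpos g v = 0" for g
    proof (rule lpos_exponentials_complete[of 0, OF _ g])
      fix \<theta> :: real
      have "ip lpos g (\<lambda>\<xi>. of_real \<xi> powr of_real 0 * exp (- ((1 + \<i> * of_real \<theta>) * of_real \<xi>))) =
          ip lpos g (\<lambda>\<xi>. exp (- ((1 + \<i> * of_real \<theta>) * of_real \<xi>)))"
        unfolding ip_def by (intro Bochner_Integration.integral_cong refl) simp
      then show "ip lpos g (\<lambda>\<xi>. of_real \<xi> powr of_real 0 * exp (- ((1 + \<i> * of_real \<theta>) * of_real \<xi>))) = 0"
        using o[OF e[of \<theta>]] by simp
    qed simp
    fix v f assume v: "\<And>k::nat. v k \<in> V" and f: "f \<in> L2_space lpos"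
      and lim: "(\<lambda>k. nrm2 lpos (\<lambda>x. v k x - f x)) \<longlonglongrightarrow> 0"
    have vL: "v k \<in> L2_space lpos" for k using v by (simp add: V_def)
    have "uniform_limit upper (\<lambda>k. wt h (v k)) (wt h f) sequentially"
    proof (rule uniform_limitI)
      fix e :: real assume "0 < e"
      have "(\<lambda>k. sqrt (nrm2 lpos (\<lambda>x. v k x - f x) * nrm2 lpos h)) \<longlonglongrightarrow> sqrt (0 * nrm2 lpos h)"
        by (intro tendsto_intros lim)
      then have "\<forall>\<^sub>F k in sequentially. sqrt (nrm2 lpos (\<lambda>x. v k x - f x) * nrm2 lpos h) < e"
        by (rule order_tendstoD) (use \<open>0 < e\<close> in simp)
      then show "\<forall>\<^sub>F k in sequentially. \<forall>z\<in>upper. dist (wt h (v k) z) (wt h f z) < e"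
      proof eventually_elim
        case (elim k)
        show ?case
        proof
          fix z assume "z \<in> upper"
          then have z: "0 < Im z" by (simp add: upper_def)
          have "dist (wt h (v k) z) (wt h f z) = cmod (wt h (\<lambda>x. v k x - f x) z)"
            by (simp add: dist_norm wt_diff[OF vL f h z])
          also have "\<dots> \<le> sqrt (nrm2 lpos (\<lambda>x. v k x - f x) * nrm2 lpos h)"
            by (rule wt_bound[OF L2_diff[OF vL f] h z])
          finally show "dist (wt h (v k) z) (wt h f z) < e" using elim by simp
        qed
      qed
    qed
    then have "continuous_on upper (wt h f)"
      by (rule uniform_limit_theorem[rotated]) (use v in \<open>auto simp: V_def\<close>)
    then show "f \<in> V" using f by (simp add: V_def)
  qed
  then show ?thesis by (simp add: V_def)
qed

lemma measurable_mu_continuous: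
  fixes F :: "complex \<Rightarrow> complex"
  assumes "continuous_on upper F"
  shows "F \<in> borel_measurable mu"
proof -
  have "F \<in> borel_measurable (restrict_space borel upper)"
    by (rule borel_measurable_continuous_on_restrict[OF assms])
  moreover have "borel_measurable mu = (borel_measurable (restrict_space borel upper) :: (complex \<Rightarrow> complex) set)"
    by (rule measurable_cong_sets) (simp_all add: mu_def sets_restrict_space)
  ultimately show ?thesis by simp
qed

lemma AE_mu: "(AE z in mu. P z) \<longleftrightarrow> (AE z in lborel. z \<in> upper \<longrightarrow> P z)"
proof -
  have "(AE z in mu. P z) \<longleftrightarrow> (AE z in restrict_space lborel upper. 0 < ennreal (1 / (Im z)\<^sup>2) \<longrightarrow> P z)"
    unfolding mu_def by (rule AE_density) (auto intro!: measurable_restrict_space1)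
  also have "\<dots> \<longleftrightarrow> (AE z in lborel. z \<in> upper \<longrightarrow> 0 < ennreal (1 / (Im z)\<^sup>2) \<longrightarrow> P z)"
    by (rule AE_restrict_space_iff) simp
  also have "\<dots> \<longleftrightarrow> (AE z in lborel. z \<in> upper \<longrightarrow> P z)"
    by (intro AE_cong) (auto simp: upper_def)
  finally show ?thesis .
qed

lemma continuous_AE_mu_eq:
  fixes F G :: "complex \<Rightarrow> complex"
  assumes F: "continuous_on upper F" and G: "continuous_on upper G" and eq: "AE z in mu. F z = G z"
    and z: "z \<in> upper"
  shows "F z = G z"
proof (rule ccontr)
  assume "F z \<noteq> G z"
  define S where "S = upper \<inter> (\<lambda>z. F z - G z) -` (- {0})"
  have "open S"
    unfolding S_def
  proof (rule continuous_open_preimage[OF _ open_upper])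
    show "continuous_on upper (\<lambda>z. F z - G z)" by (intro continuous_intros F G)
  qed auto
  moreover have "S \<noteq> {}" using \<open>F z \<noteq> G z\<close> z by (auto simp: S_def)
  moreover have "negligible S"
  proof -
    have "AE z in lborel. z \<notin> S" using eq unfolding AE_mu by eventually_elim (auto simp: S_def)
    then have "S \<in> null_sets lborel" using \<open>open S\<close> by (subst AE_iff_null_sets) auto
    then show ?thesis by (simp add: negligible_iff_null_sets null_sets_completionI)
  qed
  ultimately show False using open_not_negligible by blast
qed

lemma nn_integral_lpos_scale:
  fixes G :: "real \<Rightarrow> ennreal"
  assumes [measurable]: "G \<in> borel_measurable borel" and y: "0 < y"
  shows "(\<integral>\<^sup>+\<xi>. G (y * \<xi>) * ennreal (1 / \<xi>) * indicator {0<..} \<xi> \<partial>lborel) =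
      (\<integral>\<^sup>+\<xi>. G \<xi> * ennreal (1 / \<xi>) * indicator {0<..} \<xi> \<partial>lborel)"
proof -
  have "(\<integral>\<^sup>+t. G (exp t) \<partial>lborel) = ennreal \<bar>1\<bar> * (\<integral>\<^sup>+t. G (exp (ln y + 1 * t)) \<partial>lborel)"
    by (rule nn_integral_real_affine) simp_all
  also have "\<dots> = (\<integral>\<^sup>+t. G (y * exp t) \<partial>lborel)"
    using y by (simp add: exp_add)
  finally show ?thesis
    by (simp add: nn_integral_exp_substitution[of "\<lambda>\<xi>. G (y * \<xi>)"] nn_integral_exp_substitution)
qed

text \<open>
  For fixed height, Plancherel's theorem in the real part; the integration over the height then
  produces the admissibility constant.
\<close>

theorem wt_isometry:
  assumes \<phi>: "\<phi> \<in> L2_space lpos" and h: "h \<in> L2_space lpos" and C: "admc h = ennreal C" "0 \<le> C"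
  shows "wt h \<phi> \<in> L2_space mu" "nrm2 mu (wt h \<phi>) = C / (2 * pi) * nrm2 lpos \<phi>"
proof -
  define \<Phi> where "\<Phi> = posp \<phi>"
  define H where "H = posp h"
  have [measurable]: "\<Phi> \<in> borel_measurable borel" "H \<in> borel_measurable borel"
    using L2_measurable[OF \<phi>] L2_measurable[OF h] by (simp_all only: \<Phi>_def H_def posp_measurable)
  define N where "N y = (\<integral>\<^sup>+\<xi>. ennreal ((cmod (\<Phi> \<xi>))\<^sup>2 * (cmod (H (y * \<xi>)))\<^sup>2) \<partial>lborel)" for y
  have [measurable]: "N \<in> borel_measurable borel"
    unfolding N_def[abs_def] by measurable
  have total: "(\<integral>\<^sup>+y. N y * ennreal (1 / y) * indicator {0<..} y \<partial>lborel) = ennreal (C * nrm2 lpos \<phi>)"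
  proof -
    have "(\<integral>\<^sup>+y. N y * ennreal (1 / y) * indicator {0<..} y \<partial>lborel) =
       (\<integral>\<^sup>+y. (\<integral>\<^sup>+\<xi>. ennreal ((cmod (\<Phi> \<xi>))\<^sup>2) * (ennreal ((cmod (H (\<xi> * y)))\<^sup>2) * ennreal (1 / y) * indicator {0<..} y) \<partial>lborel) \<partial>lborel)"
    proof (rule nn_integral_cong)
      fix y :: real
      have "N y * ennreal (1 / y) * indicator {0<..} y = N y * (ennreal (1 / y) * indicator {0<..} y)"
        by (simp only: mult.assoc)
      also have "\<dots> = (\<integral>\<^sup>+\<xi>. ennreal ((cmod (\<Phi> \<xi>))\<^sup>2 * (cmod (H (y * \<xi>)))\<^sup>2) * (ennreal (1 / y) * indicator {0<..} y) \<partial>lborel)"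
        unfolding N_def by (rule nn_integral_multc[symmetric]) measurable
      also have "\<dots> = (\<integral>\<^sup>+\<xi>. ennreal ((cmod (\<Phi> \<xi>))\<^sup>2) * (ennreal ((cmod (H (\<xi> * y)))\<^sup>2) * ennreal (1 / y) * indicator {0<..} y) \<partial>lborel)"
        by (intro nn_integral_cong) (simp add: ennreal_mult mult_ac)
      finally show "N y * ennreal (1 / y) * indicator {0<..} y =
        (\<integral>\<^sup>+\<xi>. ennreal ((cmod (\<Phi> \<xi>))\<^sup>2) * (ennreal ((cmod (H (\<xi> * y)))\<^sup>2) * ennreal (1 / y) * indicator {0<..} y) \<partial>lborel)" .
    qed
    also have "\<dots> = (\<integral>\<^sup>+\<xi>. (\<integral>\<^sup>+y. ennreal ((cmod (\<Phi> \<xi>))\<^sup>2) * (ennreal ((cmod (H (\<xi> * y)))\<^sup>2) * ennreal (1 / y) * indicator {0<..} y) \<partial>lborel) \<partial>lborel)"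
      by (rule lborel_pair.Fubini') measurable
    also have "\<dots> = (\<integral>\<^sup>+\<xi>. ennreal ((cmod (\<Phi> \<xi>))\<^sup>2) * ennreal C \<partial>lborel)"
    proof (rule nn_integral_cong)
      fix \<xi> :: real
      show "(\<integral>\<^sup>+y. ennreal ((cmod (\<Phi> \<xi>))\<^sup>2) * (ennreal ((cmod (H (\<xi> * y)))\<^sup>2) * ennreal (1 / y) * indicator {0<..} y) \<partial>lborel) =
         ennreal ((cmod (\<Phi> \<xi>))\<^sup>2) * ennreal C"
      proof (cases "0 < \<xi>")
        case True
        have "(\<integral>\<^sup>+y. ennreal ((cmod (H (\<xi> * y)))\<^sup>2) * ennreal (1 / y) * indicator {0<..} y \<partial>lborel) =
            (\<integral>\<^sup>+y. ennreal ((cmod (H y))\<^sup>2) * ennreal (1 / y) * indicator {0<..} y \<partial>lborel)"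
          by (rule nn_integral_lpos_scale[of "\<lambda>y. ennreal ((cmod (H y))\<^sup>2)", OF _ True]) measurable
        also have "\<dots> = admc h"
          unfolding admc_def by (intro nn_integral_cong) (auto simp: H_def posp_def indicator_def simp flip: ennreal_mult)
        finally show ?thesis by (subst nn_integral_cmult) (simp_all add: C)
      next
        case False
        then show ?thesis by (simp add: \<Phi>_def posp_def)
      qed
    qed
    also have "\<dots> = (\<integral>\<^sup>+\<xi>. ennreal ((cmod (\<Phi> \<xi>))\<^sup>2) \<partial>lborel) * ennreal C"
      by (rule nn_integral_multc) measurable
    also have "(\<integral>\<^sup>+\<xi>. ennreal ((cmod (\<Phi> \<xi>))\<^sup>2) \<partial>lborel) = ennreal (nrm2 lpos \<phi>)"
      unfolding \<Phi>_def nn_integral_square_posp by (rule L2_nn_integral[OF \<phi>])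
    finally show ?thesis using C(2) by (simp add: ennreal_mult mult.commute)
  qed
  have "AE y in lborel. N y * ennreal (1 / y) * indicator {0<..} y \<noteq> \<infinity>"
  proof (rule nn_integral_noteq_infinite)
    show "(\<integral>\<^sup>+y. N y * ennreal (1 / y) * indicator {0<..} y \<partial>lborel) \<noteq> \<infinity>"
      unfolding total by simp
  qed measurable
  then have fin: "AE y in lborel. 0 < y \<longrightarrow> N y < \<infinity>"
  proof eventually_elim
    case (elim y)
    show ?case
    proof
      assume y: "0 < y"
      show "N y < \<infinity>"
      proof (rule ccontr)
        assume "\<not> N y < \<infinity>"
        then have "N y = \<infinity>" by (simp add: less_top[symmetric])
        with elim y show False by (simp add: ennreal_top_mult)
      qed
    qed
  qed
  have slice: "(\<integral>\<^sup>+x. ennreal ((cmod (wt h \<phi> (Complex x y)))\<^sup>2) \<partial>lborel) = ennreal (y / (2 * pi)) * N y"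
    if y: "0 < y" and Ny: "N y < \<infinity>" for y
  proof -
    define G where "G = posp (\<lambda>\<xi>. of_real (sqrt y) * (\<phi> \<xi> * cnj (h (y * \<xi>))))"
    have Gi: "integrable lborel G"
      unfolding G_def integrable_lpos_iff[symmetric]
      by (intro integrable_mult_right wt_integrand_integrable[OF \<phi> h y])
    have Gn: "(cmod (G \<xi>))\<^sup>2 = y * ((cmod (\<Phi> \<xi>))\<^sup>2 * (cmod (H (y * \<xi>)))\<^sup>2)" for \<xi>
      using y by (auto simp: G_def \<Phi>_def H_def posp_def norm_mult power_mult_distrib zero_less_mult_iff)
    have nG: "(\<integral>\<^sup>+\<xi>. ennreal ((cmod (G \<xi>))\<^sup>2) \<partial>lborel) = ennreal y * N y"
      unfolding Gn N_def using y by (subst nn_integral_cmult[symmetric]) (auto simp: ennreal_mult)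
    have GL: "G \<in> L2_space lborel"
      by (rule L2_spaceI[OF borel_measurable_integrable[OF Gi]]) (use nG Ny in \<open>simp add: ennreal_mult_less_top\<close>)
    have [measurable]: "FT G \<in> borel_measurable borel"
      using L2_measurable[OF FT_Plancherel(1)[OF GL Gi]] by simp
    have "(\<integral>\<^sup>+x. ennreal ((cmod (wt h \<phi> (Complex x y)))\<^sup>2) \<partial>lborel) =
       (\<integral>\<^sup>+x. ennreal (1 / (2 * pi)\<^sup>2) * ennreal ((cmod (FT G (- x)))\<^sup>2) \<partial>lborel)"
      unfolding wt_eq_FT[OF y] G_def[symmetric] norm_mult power_mult_distrib norm_of_real
      by (intro nn_integral_cong) (simp add: power_divide power_mult_distrib flip: ennreal_mult)
    also have "\<dots> = ennreal (1 / (2 * pi)\<^sup>2) * (\<integral>\<^sup>+x. ennreal ((cmod (FT G (- x)))\<^sup>2) \<partial>lborel)"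
      by (rule nn_integral_cmult) measurable
    also have "(\<integral>\<^sup>+x. ennreal ((cmod (FT G (- x)))\<^sup>2) \<partial>lborel) = (\<integral>\<^sup>+x. ennreal ((cmod (FT G x))\<^sup>2) \<partial>lborel)"
      by (subst (2) nn_integral_real_affine[where c = "-1" and t = 0]) simp_all
    also have "\<dots> = ennreal (2 * pi * nrm2 lborel G)"
      unfolding FT_Plancherel(2)[OF GL Gi, symmetric] by (rule L2_nn_integral[OF FT_Plancherel(1)[OF GL Gi]])
    also have "\<dots> = ennreal (2 * pi) * (ennreal y * N y)"
      unfolding nG[symmetric] L2_nn_integral[OF GL] by (rule ennreal_mult) simp_all
    finally have I: "(\<integral>\<^sup>+x. ennreal ((cmod (wt h \<phi> (Complex x y)))\<^sup>2) \<partial>lborel) =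
      ennreal (1 / (2 * pi)\<^sup>2) * ennreal (2 * pi) * ennreal y * N y" by (simp only: mult.assoc)
    have "ennreal (1 / (2 * pi)\<^sup>2) * ennreal (2 * pi) * ennreal y = ennreal (1 / (2 * pi)\<^sup>2 * (2 * pi) * y)"
    proof -
      have "ennreal (1 / (2 * pi)\<^sup>2) * ennreal (2 * pi) = ennreal (1 / (2 * pi)\<^sup>2 * (2 * pi))"
        by (rule ennreal_mult[symmetric]) simp_all
      moreover have "ennreal (1 / (2 * pi)\<^sup>2 * (2 * pi)) * ennreal y = ennreal (1 / (2 * pi)\<^sup>2 * (2 * pi) * y)"
        using y by (intro ennreal_mult[symmetric]) simp_all
      ultimately show ?thesis by (simp only:)
    qed
    also have "1 / (2 * pi)\<^sup>2 * (2 * pi) * y = y / (2 * pi)" by (simp add: power2_eq_square)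
    finally show ?thesis unfolding I by simp
  qed
  have m: "wt h \<phi> \<in> borel_measurable mu"
    by (rule measurable_mu_continuous[OF wt_continuous[OF \<phi> h]])
  have "(\<integral>\<^sup>+z. ennreal ((cmod (wt h \<phi> z))\<^sup>2) \<partial>mu) =
     (\<integral>\<^sup>+y. (\<integral>\<^sup>+x. ennreal ((cmod (wt h \<phi> (Complex x y)))\<^sup>2) * ennreal (1 / y\<^sup>2) \<partial>lborel) * indicator {0<..} y \<partial>lborel)"
    by (rule nn_integral_mu) (use m in measurable)
  also have "\<dots> = (\<integral>\<^sup>+y. ennreal (1 / (2 * pi)) * (N y * ennreal (1 / y) * indicator {0<..} y) \<partial>lborel)"
    using fin
  proof (intro nn_integral_cong_AE, eventually_elim)
    case (elim y)
    show ?case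
    proof (cases "0 < y")
      case True
      then have s: "(\<integral>\<^sup>+x. ennreal ((cmod (wt h \<phi> (Complex x y)))\<^sup>2) \<partial>lborel) = ennreal (y / (2 * pi)) * N y"
        using elim by (intro slice) auto
      have mx: "(\<lambda>x. ennreal ((cmod (wt h \<phi> (Complex x y)))\<^sup>2)) \<in> borel_measurable lborel"
      proof -
        have "FT (posp (\<lambda>\<xi>. of_real (sqrt y) * (\<phi> \<xi> * cnj (h (y * \<xi>))))) \<in> borel_measurable borel"
        proof (rule FT_measurable)
          have "integrable lpos (\<lambda>\<xi>. of_real (sqrt y) * (\<phi> \<xi> * cnj (h (y * \<xi>))))"
            by (intro integrable_mult_right wt_integrand_integrable[OF \<phi> h True])
          then show "posp (\<lambda>\<xi>. of_real (sqrt y) * (\<phi> \<xi> * cnj (h (y * \<xi>)))) \<in> borel_measurable borel"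
            unfolding posp_measurable by (rule borel_measurable_integrable)
        qed
        note [measurable] = this
        show ?thesis unfolding wt_eq_FT[OF True] by measurable
      qed
      have "(\<integral>\<^sup>+x. ennreal ((cmod (wt h \<phi> (Complex x y)))\<^sup>2) * ennreal (1 / y\<^sup>2) \<partial>lborel) =
         ennreal (y / (2 * pi)) * N y * ennreal (1 / y\<^sup>2)"
        unfolding s[symmetric] by (rule nn_integral_multc[OF mx])
      also have "\<dots> = ennreal (y / (2 * pi)) * ennreal (1 / y\<^sup>2) * N y" by (simp add: mult_ac)
      also have "ennreal (y / (2 * pi)) * ennreal (1 / y\<^sup>2) = ennreal (1 / (2 * pi)) * ennreal (1 / y)"
        using True by (simp add: power2_eq_square field_simps flip: ennreal_mult)
      finally show ?thesis using True by (simp add: mult_ac)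
    qed simp
  qed
  also have "\<dots> = ennreal (1 / (2 * pi)) * ennreal (C * nrm2 lpos \<phi>)"
    unfolding total[symmetric] by (rule nn_integral_cmult) measurable
  also have "\<dots> = ennreal (C / (2 * pi) * nrm2 lpos \<phi>)"
    using C(2) by (simp flip: ennreal_mult)
  finally have n: "(\<integral>\<^sup>+z. ennreal ((cmod (wt h \<phi> z))\<^sup>2) \<partial>mu) = ennreal (C / (2 * pi) * nrm2 lpos \<phi>)" .
  show "wt h \<phi> \<in> L2_space mu" by (rule L2_spaceI[OF m]) (simp add: n)
  show "nrm2 mu (wt h \<phi>) = C / (2 * pi) * nrm2 lpos \<phi>"
    by (rule nrm2_eqI[OF n _ m]) (use C(2) in simp)
qed

section \<open>The cocycle on exponentials\<close>

lemma SL2R_det_complex: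
  fixes g :: "real^2^2"
  assumes "g \<in> SL2R"
  shows "complex_of_real (g$1$1) * of_real (g$2$2) - of_real (g$1$2) * of_real (g$2$1) = 1"
proof -
  have "complex_of_real (g$1$1 * g$2$2 - g$1$2 * g$2$1) = of_real 1"
    using assms unfolding SL2R_det by (simp only:)
  then show ?thesis by simp
qed

lemma cocycle_Ln_cases:
  assumes g: "g \<in> SL2R" and z: "z \<in> upper" and w: "w \<in> upper"
  shows "\<bar>Im (Ln (cocycle_denom g w)) - Im (Ln (cocycle_denom g z))\<bar> < pi"
proof -
  have Im: "Im (cocycle_denom g z) = g$2$1 * Im z" for z by (simp add: cocycle_denom_def)
  consider "0 < g$2$1" | "g$2$1 < 0" | "g$2$1 = 0" by linarith
  then show ?thesis
  proof cases
    case 1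
    then have "0 < Im (cocycle_denom g z)" "0 < Im (cocycle_denom g w)"
      using z w unfolding Im by (auto simp: upper_def)
    then show ?thesis using Im_Ln_pos_lt_imp[of "cocycle_denom g z"] Im_Ln_pos_lt_imp[of "cocycle_denom g w"]
      by linarith
  next
    case 2
    have neg: "- pi < Im (Ln (cocycle_denom g v)) \<and> Im (Ln (cocycle_denom g v)) < 0" if "v \<in> upper" for v
    proof -
      have nz: "cocycle_denom g v \<noteq> 0" by (rule cocycle_denom_nonzero[OF g that])
      have "\<not> 0 \<le> Im (cocycle_denom g v)"
        using 2 that unfolding Im by (simp add: upper_def mult_neg_pos not_le)
      then show ?thesis
        using Im_Ln_pos_le[OF nz] mpi_less_Im_Ln[OF nz] Im_Ln_le_pi[OF nz] by linarith
    qed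
    show ?thesis using neg[OF z] neg[OF w] by linarith
  next
    case 3
    then have "cocycle_denom g z = cocycle_denom g w" by (simp add: cocycle_denom_def)
    then show ?thesis by simp
  qed
qed

lemma mob_diff_cnj:
  assumes g: "g \<in> SL2R" and z: "z \<in> upper" and w: "w \<in> upper"
  shows "mob g z - cnj (mob g w) = (z - cnj w) / (cocycle_denom g z * cnj (cocycle_denom g w))"
proof -
  have nz: "cocycle_denom g z \<noteq> 0" "cnj (cocycle_denom g w) \<noteq> 0"
    using cocycle_denom_nonzero[OF g] z w by auto
  note det = SL2R_det_complex[OF g]
  have "(of_real (g$1$1) * z + of_real (g$1$2)) * cnj (cocycle_denom g w) -
      (of_real (g$1$1) * cnj w + of_real (g$1$2)) * cocycle_denom g z =
      (complex_of_real (g$1$1) * of_real (g$2$2) - of_real (g$1$2) * of_real (g$2$1)) * (z - cnj w)"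
    by (simp add: cocycle_denom_def algebra_simps)
  then have num: "(of_real (g$1$1) * z + of_real (g$1$2)) * cnj (cocycle_denom g w) -
      (of_real (g$1$1) * cnj w + of_real (g$1$2)) * cocycle_denom g z = z - cnj w"
    unfolding det by (simp only: mult_1_left)
  have "mob g z - cnj (mob g w) = ((of_real (g$1$1) * z + of_real (g$1$2)) * cnj (cocycle_denom g w) -
      (of_real (g$1$1) * cnj w + of_real (g$1$2)) * cocycle_denom g z) / (cocycle_denom g z * cnj (cocycle_denom g w))"
    using nz by (simp add: mob_eq diff_frac_eq)
  then show ?thesis unfolding num .
qed

lemma mob_diff:
  assumes g: "g \<in> SL2R" and z: "z \<in> upper" and w: "w \<in> upper"
  shows "mob g z - mob g w = (z - w) / (cocycle_denom g z * cocycle_denom g w)"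
proof -
  have nz: "cocycle_denom g z \<noteq> 0" "cocycle_denom g w \<noteq> 0"
    using cocycle_denom_nonzero[OF g] z w by auto
  note det = SL2R_det_complex[OF g]
  have "(of_real (g$1$1) * z + of_real (g$1$2)) * cocycle_denom g w -
      (of_real (g$1$1) * w + of_real (g$1$2)) * cocycle_denom g z =
      (complex_of_real (g$1$1) * of_real (g$2$2) - of_real (g$1$2) * of_real (g$2$1)) * (z - w)"
    by (simp add: cocycle_denom_def algebra_simps)
  then have num: "(of_real (g$1$1) * z + of_real (g$1$2)) * cocycle_denom g w -
      (of_real (g$1$1) * w + of_real (g$1$2)) * cocycle_denom g z = z - w"
    unfolding det by (simp only: mult_1_left)
  have "mob g z - mob g w = ((of_real (g$1$1) * z + of_real (g$1$2)) * cocycle_denom g w -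
      (of_real (g$1$1) * w + of_real (g$1$2)) * cocycle_denom g z) / (cocycle_denom g z * cocycle_denom g w)"
    using nz by (simp add: mob_eq diff_frac_eq)
  then show ?thesis unfolding num .
qed

text \<open>
  The identity holds modulo \<open>2\<pi>\<i>\<close>, and each argument is confined to an interval that is short enough
  to exclude any other multiple.
\<close>

lemma Ln_mob:
  assumes g: "g \<in> SL2R" and z: "z \<in> upper" and w: "w \<in> upper"
  shows "Ln (- \<i> * (mob g z - cnj (mob g w))) =
    Ln (- \<i> * (z - cnj w)) - Ln (cocycle_denom g z) - cnj (Ln (cocycle_denom g w))"
proof (rule exp_complex_eqI)
  have Im_aux: "Im (a - b - cnj c) = Im a - Im b + Im c" for a b c by simp
  have nz: "cocycle_denom g z \<noteq> 0" "cocycle_denom g w \<noteq> 0"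
    using cocycle_denom_nonzero[OF g] z w by auto
  have p: "0 < Re (- \<i> * (z - cnj w))" using z w by (simp add: upper_def)
  have p': "0 < Re (- \<i> * (mob g z - cnj (mob g w)))"
    using mob_upper[OF g z] mob_upper[OF g w] by (simp add: upper_def)
  have n0: "- \<i> * (z - cnj w) \<noteq> 0" "- \<i> * (mob g z - cnj (mob g w)) \<noteq> 0"
    using p p' by (metis less_irrefl zero_complex.simps(1))+
  have "exp (Ln (- \<i> * (z - cnj w)) - Ln (cocycle_denom g z) - cnj (Ln (cocycle_denom g w))) =
    - \<i> * (z - cnj w) / cocycle_denom g z / cnj (cocycle_denom g w)"
    using n0(1) nz by (simp add: exp_diff flip: exp_cnj)
  also have "\<dots> = - \<i> * (mob g z - cnj (mob g w))"
    unfolding mob_diff_cnj[OF assms] by simp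
  finally show "exp (Ln (- \<i> * (mob g z - cnj (mob g w)))) =
    exp (Ln (- \<i> * (z - cnj w)) - Ln (cocycle_denom g z) - cnj (Ln (cocycle_denom g w)))"
    using n0(2) by simp
  have "\<bar>Im (Ln (- \<i> * (mob g z - cnj (mob g w))))\<bar> < pi / 2" "\<bar>Im (Ln (- \<i> * (z - cnj w)))\<bar> < pi / 2"
    using Re_Ln_pos_lt_imp p p' by auto
  moreover have "\<bar>Im (Ln (cocycle_denom g w)) - Im (Ln (cocycle_denom g z))\<bar> < pi"
    by (rule cocycle_Ln_cases[OF assms])
  ultimately show "\<bar>Im (Ln (- \<i> * (mob g z - cnj (mob g w)))) -
     Im (Ln (- \<i> * (z - cnj w)) - Ln (cocycle_denom g z) - cnj (Ln (cocycle_denom g w)))\<bar> < 2 * pi"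
    unfolding Im_aux by linarith
qed

lemma jfac_eq:
  fixes g :: "real^2^2"
  assumes g: "g \<in> SL2R" and c: "g$2$1 \<noteq> 0" and z: "z \<in> upper"
  shows "jfac s g z = exp (- (\<i> * of_real (s * Im (Ln (cocycle_denom g z)))))"
proof -
  define D where "D = cocycle_denom g z"
  have nz: "D \<noteq> 0" unfolding D_def by (rule cocycle_denom_nonzero[OF g z])
  have "Im D \<noteq> 0" using c z by (simp add: D_def cocycle_denom_def upper_def)
  then have "D \<notin> \<real>" by (simp add: complex_is_Real_iff)
  have "Im (Ln D) \<noteq> pi"
  proof
    assume "Im (Ln D) = pi"
    then have "Im (exp (Ln D)) = 0" unfolding Im_exp by simp
    then show False using \<open>Im D \<noteq> 0\<close> nz by simp
  qed
  then have im: "- pi < - Im (Ln D)" "- Im (Ln D) \<le> pi"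
    using mpi_less_Im_Ln[OF nz] Im_Ln_le_pi[OF nz] by linarith+
  have "exp (- (\<i> * of_real (Im (Ln D)))) = of_real (cmod D) / D"
  proof -
    have "- (\<i> * of_real (Im L)) = of_real (Re L) - L" for L
      by (simp add: complex_eq_iff)
    from this[of "Ln D"] have "- (\<i> * of_real (Im (Ln D))) = of_real (Re (Ln D)) - Ln D" .
    then have "exp (- (\<i> * of_real (Im (Ln D)))) = exp (of_real (Re (Ln D))) / D"
      using nz by (simp add: exp_diff)
    also have "exp (of_real (Re (Ln D))) = complex_of_real (cmod D)" using nz by (simp add: exp_of_real)
    finally show ?thesis .
  qed
  then have "Ln (of_real (cmod D) / D) = - (\<i> * of_real (Im (Ln D)))"
    by (rule Ln_unique) (use im in simp_all)
  moreover have "of_real (cmod D) / D \<noteq> 0" using nz by simp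
  ultimately show ?thesis by (simp add: jfac_def D_def[symmetric] powr_def mult_ac)
qed

lemma jfac_const_times:
  assumes g: "g \<in> SL2R"
  obtains \<kappa> where "\<And>z. z \<in> upper \<Longrightarrow> jfac s g z = \<kappa> * exp (- (\<i> * of_real (s * Im (Ln (cocycle_denom g z)))))"
proof (cases "g$2$1 = 0")
  case True
  then have "cocycle_denom g z = of_real (g$2$2)" for z by (simp add: cocycle_denom_def)
  then show ?thesis
    by (intro that[of "jfac s g \<i> * exp (\<i> * of_real (s * Im (Ln (of_real (g$2$2)))))"])
      (simp add: jfac_def mult.assoc flip: exp_add)
next
  case False
  then show ?thesis using jfac_eq[OF g False] by (intro that[of 1]) simp
qed

lemma jfac_continuous:
  assumes g: "g \<in> SL2R"
  shows "continuous_on upper (jfac s g)"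
proof (cases "g$2$1 = 0")
  case True
  then have "cocycle_denom g z = of_real (g$2$2)" for z by (simp add: cocycle_denom_def)
  then have "jfac s g = (\<lambda>z. (of_real (cmod (of_real (g$2$2))) / of_real (g$2$2)) powr of_real s)"
    unfolding jfac_def by (intro ext) (simp only:)
  then show ?thesis by (simp only: continuous_on_const)
next
  case False
  have "continuous_on upper (\<lambda>z. exp (- (\<i> * of_real (s * Im (Ln (cocycle_denom g z))))))"
    unfolding cocycle_denom_def
  proof (intro continuous_intros continuous_on_Ln)
    fix z assume "z \<in> upper"
    then have "Im (of_real (g$2$1) * z + of_real (g$2$2)) \<noteq> 0" using False by (simp add: upper_def)
    then show "of_real (g$2$1) * z + of_real (g$2$2) \<notin> \<real>\<^sub>\<le>\<^sub>0" by (auto simp: complex_nonpos_Reals_iff)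
  qed
  then show ?thesis by (subst continuous_on_cong[OF refl jfac_eq[OF g False]]) auto
qed

lemma mob_continuous:
  assumes g: "g \<in> SL2R"
  shows "continuous_on upper (mob g)"
  using cocycle_denom_nonzero[OF g] unfolding mob_eq[abs_def] cocycle_denom_def
  by (intro continuous_intros) auto

lemma mob_surj:
  assumes g: "g \<in> SL2R" and w: "w \<in> upper"
  obtains v where "v \<in> upper" "mob g v = w"
proof -
  define g' :: "real^2^2" where "g' = (\<chi> i j. if i = 1 then (if j = 1 then g$2$2 else - g$1$2) else (if j = 1 then - g$2$1 else g$1$1))"
  have e: "g'$1$1 = g$2$2" "g'$1$2 = - g$1$2" "g'$2$1 = - g$2$1" "g'$2$2 = g$1$1" by (simp_all add: g'_def)
  have g': "g' \<in> SL2R" using g unfolding SL2R_det e by (simp add: algebra_simps)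
  have v: "mob g' w \<in> upper" by (rule mob_upper[OF g' w])
  have nz: "cocycle_denom g' w \<noteq> 0" by (rule cocycle_denom_nonzero[OF g' w])
  note det = SL2R_det_complex[OF g]
  define D where "D = cocycle_denom g' w"
  have D: "D = - of_real (g$2$1) * w + of_real (g$1$1)" by (simp add: D_def cocycle_denom_def e)
  have m: "mob g' w = (of_real (g$2$2) * w - of_real (g$1$2)) / D" by (simp add: mob_eq D_def e)
  have "of_real (g$1$1) * (of_real (g$2$2) * w - of_real (g$1$2)) + of_real (g$1$2) * D =
     (complex_of_real (g$1$1) * of_real (g$2$2) - of_real (g$1$2) * of_real (g$2$1)) * w"
    unfolding D by (simp add: algebra_simps)
  then have n1: "of_real (g$1$1) * (of_real (g$2$2) * w - of_real (g$1$2)) + of_real (g$1$2) * D = w"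
    unfolding det by (simp only: mult_1_left)
  have "of_real (g$2$1) * (of_real (g$2$2) * w - of_real (g$1$2)) + of_real (g$2$2) * D =
     complex_of_real (g$1$1) * of_real (g$2$2) - of_real (g$1$2) * of_real (g$2$1)"
    unfolding D by (simp add: algebra_simps)
  then have n2: "of_real (g$2$1) * (of_real (g$2$2) * w - of_real (g$1$2)) + of_real (g$2$2) * D = 1"
    unfolding det .
  have Dnz: "D \<noteq> 0" using nz by (simp add: D_def)
  have frac: "a * (b / D) + c = (a * b + c * D) / D" for a b c
    using Dnz by (simp add: add_divide_distrib)
  have 1: "of_real (g$1$1) * mob g' w + of_real (g$1$2) = w / D"
    unfolding m frac n1 ..
  have 2: "cocycle_denom g (mob g' w) = 1 / D"
    unfolding cocycle_denom_def[of g] m frac n2 ..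
  have "mob g (mob g' w) = w"
    unfolding mob_eq[of g] 1 2 using nz by (simp add: D_def)
  with v show ?thesis by (rule that)
qed

section \<open>Invariance from invariance on exponentials\<close>

text \<open>
  The functions whose transforms are moved within the range of the transform form a subspace, which is
  closed because the transform is isometric and \<^const>\<open>sigma\<close> is unitary.
\<close>

theorem wt_range_invariant:
  assumes h: "h \<in> L2_space lpos" and C: "admc h = ennreal C" "0 < C" and g: "g \<in> SL2R" and r: "0 \<le> r"
    and gen: "\<And>\<theta>. \<exists>\<phi>'\<in>L2_space lpos. \<forall>z\<in>upper. wt h \<phi>' z = jfac s g z *
       wt h (\<lambda>\<xi>. of_real \<xi> powr of_real r * exp (- ((1 + \<i> * of_real \<theta>) * of_real \<xi>))) (mob g z)"
    and \<phi>: "\<phi> \<in> L2_space lpos"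
  shows "\<exists>\<phi>'\<in>L2_space lpos. \<forall>z\<in>upper. wt h \<phi>' z = jfac s g z * wt h \<phi> (mob g z)"
proof -
  define V where "V = {\<phi> \<in> L2_space lpos. \<exists>\<phi>'\<in>L2_space lpos. \<forall>z\<in>upper. wt h \<phi>' z = jfac s g z * wt h \<phi> (mob g z)}"
  have Im: "0 < Im z" "0 < Im (mob g z)" if "z \<in> upper" for z
    using that mob_upper[OF g that] by (simp_all add: upper_def)
  have C0: "0 \<le> C" using C by simp
  have "\<phi> \<in> V"
  proof (rule L2_closed_subspace[OF _ _ _ _ _ _ \<phi>])
    show "V \<subseteq> L2_space lpos" by (auto simp: V_def)
    have e: "(\<lambda>\<xi>. of_real \<xi> powr of_real r * exp (- ((1 + \<i> * of_real \<theta>) * of_real \<xi>))) \<in> V" for \<theta>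
      unfolding V_def using gen[of \<theta>] exponentials_L2[OF r, of \<theta>] by simp
    then show "V \<noteq> {}" by blast
    show "(\<lambda>x. u x + v x) \<in> V" if u: "u \<in> V" and v: "v \<in> V" for u v
    proof -
      obtain u' where u': "u \<in> L2_space lpos" "u' \<in> L2_space lpos" "\<And>z. z \<in> upper \<Longrightarrow> wt h u' z = jfac s g z * wt h u (mob g z)"
        using u by (auto simp: V_def)
      obtain v' where v': "v \<in> L2_space lpos" "v' \<in> L2_space lpos" "\<And>z. z \<in> upper \<Longrightarrow> wt h v' z = jfac s g z * wt h v (mob g z)"
        using v by (auto simp: V_def)
      have "\<forall>z\<in>upper. wt h (\<lambda>x. u' x + v' x) z = jfac s g z * wt h (\<lambda>x. u x + v x) (mob g z)"
        using wt_add[OF u'(2) v'(2) h Im(1)] wt_add[OF u'(1) v'(1) h Im(2)] u'(3) v'(3)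
        by (simp add: distrib_left)
      then show ?thesis using L2_add[OF u'(1) v'(1)] L2_add[OF u'(2) v'(2)] by (auto simp: V_def)
    qed
    show "(\<lambda>x. c * v x) \<in> V" if v: "v \<in> V" for c v
    proof -
      obtain v' where v': "v \<in> L2_space lpos" "v' \<in> L2_space lpos" "\<And>z. z \<in> upper \<Longrightarrow> wt h v' z = jfac s g z * wt h v (mob g z)"
        using v by (auto simp: V_def)
      have "\<forall>z\<in>upper. wt h (\<lambda>x. c * v' x) z = jfac s g z * wt h (\<lambda>x. c * v x) (mob g z)"
        using v'(3) by (simp add: wt_cmult)
      then show ?thesis using L2_scale[OF v'(1), of c] L2_scale[OF v'(2), of c] by (auto simp: V_def)
    qed
    show "AE x in lpos. f x = 0" if f: "f \<in> L2_space lpos" and o: "\<And>v. v \<in> V \<Longrightarrow> ip lpos f v = 0" for f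
      by (rule lpos_exponentials_complete[OF r f]) (rule o[OF e])
    fix v f assume v: "\<And>k::nat. v k \<in> V" and f: "f \<in> L2_space lpos"
      and lim: "(\<lambda>k. nrm2 lpos (\<lambda>x. v k x - f x)) \<longlonglongrightarrow> 0"
    have vL: "v k \<in> L2_space lpos" for k using v[of k] by (simp add: V_def)
    have "\<forall>k. \<exists>\<phi>'. \<phi>' \<in> L2_space lpos \<and> (\<forall>z\<in>upper. wt h \<phi>' z = jfac s g z * wt h (v k) (mob g z))"
      using v by (auto simp: V_def)
    then obtain v' where v': "\<And>k. v' k \<in> L2_space lpos" "\<And>k z. z \<in> upper \<Longrightarrow> wt h (v' k) z = jfac s g z * wt h (v k) (mob g z)"
      by metis
    have dist: "nrm2 lpos (\<lambda>x. v' m x - v' n x) = nrm2 lpos (\<lambda>x. v m x - v n x)" for m n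
    proof -
      have d: "(\<lambda>x. v m x - v n x) \<in> L2_space lpos" "(\<lambda>x. v' m x - v' n x) \<in> L2_space lpos"
        by (intro L2_diff vL v')+
      have eq: "wt h (\<lambda>x. v' m x - v' n x) z = sigma s g (wt h (\<lambda>x. v m x - v n x)) z" if "z \<in> upper" for z
        using wt_diff[OF v'(1) v'(1) h Im(1)[OF that], of m n] wt_diff[OF vL vL h Im(2)[OF that], of m n] v'(2)[OF that]
        by (simp add: sigma_eq right_diff_distrib)
      have "nrm2 mu (wt h (\<lambda>x. v' m x - v' n x)) = nrm2 mu (sigma s g (wt h (\<lambda>x. v m x - v n x)))"
        unfolding nrm2_def by (intro Bochner_Integration.integral_cong refl) (simp add: eq)
      also have "\<dots> = nrm2 mu (wt h (\<lambda>x. v m x - v n x))"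
        by (rule sigma_L2(2)[OF g wt_isometry(1)[OF d(1) h C(1) C0]])
      finally show ?thesis
        unfolding wt_isometry(2)[OF d(1) h C(1) C0] wt_isometry(2)[OF d(2) h C(1) C0] using C(2) by simp
    qed
    have "\<exists>N. \<forall>m\<ge>N. \<forall>n\<ge>N. nrm2 lpos (\<lambda>x. v' m x - v' n x) < e" if "0 < e" for e
      unfolding dist by (rule nrm2_Cauchy[OF vL f lim that])
    from Riesz_Fischer[of v' lpos, OF v'(1) this] obtain f' where
      f': "f' \<in> L2_space lpos" "(\<lambda>k. nrm2 lpos (\<lambda>x. v' k x - f' x)) \<longlonglongrightarrow> 0" by blast
    have conv: "(\<lambda>k. wt h (a k) z) \<longlonglongrightarrow> wt h b z"
      if ab: "\<And>k. a k \<in> L2_space lpos" "b \<in> L2_space lpos" "(\<lambda>k. nrm2 lpos (\<lambda>x. a k x - b x)) \<longlonglongrightarrow> 0" and z: "0 < Im z"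
      for a :: "nat \<Rightarrow> real \<Rightarrow> complex" and b z
    proof -
      have "(\<lambda>k. sqrt (nrm2 lpos (\<lambda>x. a k x - b x) * nrm2 lpos h)) \<longlonglongrightarrow> sqrt (0 * nrm2 lpos h)"
        by (intro tendsto_intros ab)
      then have l0: "(\<lambda>k. sqrt (nrm2 lpos (\<lambda>x. a k x - b x) * nrm2 lpos h)) \<longlonglongrightarrow> 0" by simp
      have "(\<lambda>k. wt h (a k) z - wt h b z) \<longlonglongrightarrow> 0"
      proof (rule Lim_null_comparison[OF _ l0], intro always_eventually allI)
        fix k show "norm (wt h (a k) z - wt h b z) \<le> sqrt (nrm2 lpos (\<lambda>x. a k x - b x) * nrm2 lpos h)"
          unfolding wt_diff[OF ab(1,2) h z, symmetric] by (rule wt_bound[OF L2_diff[OF ab(1,2)] h z])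
      qed
      then show ?thesis by (simp add: LIM_zero_iff)
    qed
    have "wt h f' z = jfac s g z * wt h f (mob g z)" if "z \<in> upper" for z
    proof (rule LIMSEQ_unique)
      show "(\<lambda>k. wt h (v' k) z) \<longlonglongrightarrow> wt h f' z"
        by (rule conv[OF v'(1) f' Im(1)[OF that]])
      show "(\<lambda>k. wt h (v' k) z) \<longlonglongrightarrow> jfac s g z * wt h f (mob g z)"
        unfolding v'(2)[OF that] by (intro tendsto_intros conv[OF vL f lim Im(2)[OF that]])
    qed
    then show "f \<in> V" using f f'(1) by (auto simp: V_def)
  qed
  then show ?thesis by (simp add: V_def)
qed

section \<open>Laguerre functions\<close>

definition lagf :: "nat \<Rightarrow> real \<Rightarrow> real \<Rightarrow> complex" where
  "lagf n \<alpha> \<xi> = of_real (\<xi> powr (\<alpha> / 2) * exp (- \<xi>) * laguerre n \<alpha> (2 * \<xi>))"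

lemma lagf_measurable [measurable]: "lagf n \<alpha> \<in> borel_measurable borel"
  unfolding lagf_def[abs_def] laguerre_def by measurable

definition lagc :: "nat \<Rightarrow> real \<Rightarrow> nat \<Rightarrow> real" where
  "lagc n \<alpha> k = (-1) ^ k * ((real n + \<alpha>) gchoose (n - k)) * 2 ^ k / fact k"

lemma lagf_sum:
  assumes "0 < \<xi>"
  shows "lagf n \<alpha> \<xi> = (\<Sum>k=0..n. of_real (lagc n \<alpha> k) * (of_real \<xi> powr of_real (\<alpha> / 2 + real k) * exp (- (1 * of_real \<xi>))))"
proof -
  have "\<xi> powr (\<alpha> / 2) * exp (- \<xi>) * laguerre n \<alpha> (2 * \<xi>) =
    (\<Sum>k=0..n. lagc n \<alpha> k * (\<xi> powr (\<alpha> / 2 + real k) * exp (- \<xi>)))"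
    unfolding laguerre_def sum_distrib_left
    using assms by (intro sum.cong refl) (simp add: lagc_def powr_add powr_realpow power_mult_distrib)
  then have "lagf n \<alpha> \<xi> = (\<Sum>k=0..n. of_real (lagc n \<alpha> k * (\<xi> powr (\<alpha> / 2 + real k) * exp (- \<xi>))))"
    by (simp add: lagf_def)
  also have "\<dots> = (\<Sum>k=0..n. of_real (lagc n \<alpha> k) * (of_real \<xi> powr of_real (\<alpha> / 2 + real k) * exp (- (1 * of_real \<xi>))))"
    using assms by (intro sum.cong refl) (simp add: powr_of_real del: of_real_add of_real_divide flip: exp_of_real)
  finally show ?thesis .
qed

lemma L2_sum:
  assumes "finite A" "\<And>k. k \<in> A \<Longrightarrow> f k \<in> L2_space M"
  shows "(\<lambda>x. \<Sum>k\<in>A. f k x) \<in> L2_space M"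
  using assms by (induction A rule: finite_induct) (auto intro: L2_zero L2_add)

lemma lagf_L2:
  assumes "-1 < \<alpha>"
  shows "lagf n \<alpha> \<in> L2_space lpos"
proof (rule L2_cong_AE)
  show "(\<lambda>\<xi>. \<Sum>k=0..n. of_real (lagc n \<alpha> k) * (of_real \<xi> powr of_real (\<alpha> / 2 + real k) * exp (- (1 * of_real \<xi>)))) \<in> L2_space lpos"
    using assms by (intro L2_sum L2_scale power_exp_L2) (auto simp: add_strict_increasing2)
  show "AE \<xi> in lpos. (\<Sum>k=0..n. of_real (lagc n \<alpha> k) * (of_real \<xi> powr of_real (\<alpha> / 2 + real k) * exp (- (1 * of_real \<xi>)))) = lagf n \<alpha> \<xi>"
    by (rule AE_I2) (simp add: lagf_sum)
qed (rule measurable_lpos[OF lagf_measurable])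

lemma laguerre_0: "laguerre n \<alpha> 0 = ((real n + \<alpha>) gchoose n)"
proof -
  have "laguerre n \<alpha> 0 = (\<Sum>k=0..n. if k = 0 then ((real n + \<alpha>) gchoose n) else 0)"
    unfolding laguerre_def by (intro sum.cong refl) auto
  then show ?thesis by simp
qed

lemma laguerre_continuous: "continuous_on UNIV (laguerre n \<alpha>)"
  unfolding laguerre_def[abs_def] by (intro continuous_intros) auto

text \<open>
  Dividing by \<open>\<surd>\<xi>\<close> only lowers the exponent of the power of \<open>\<xi>\<close>, which stays square-integrable at \<open>0\<close> as long
  as \<open>\<alpha> > 0\<close>.
\<close>

lemma lagf_admissible:
  assumes \<alpha>: "0 < \<alpha>"
  obtains C where "admc (lagf n \<alpha>) = ennreal C" "0 < C"
proof -
  define k where "k \<xi> = (\<Sum>j=0..n. complex_of_real (lagc n \<alpha> j) * (of_real \<xi> powr of_real (\<alpha> / 2 - 1 / 2 + real j) * exp (- (1 * of_real \<xi>))))" for \<xi> :: real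
  have kL: "k \<in> L2_space lpos"
    unfolding k_def[abs_def] using \<alpha> by (intro L2_sum L2_scale power_exp_L2) auto
  have k2: "(cmod (k \<xi>))\<^sup>2 = (cmod (lagf n \<alpha> \<xi>))\<^sup>2 / \<xi>" if \<xi>: "0 < \<xi>" for \<xi>
  proof -
    have "lagf n \<alpha> \<xi> = of_real (sqrt \<xi>) * k \<xi>"
      unfolding lagf_sum[OF \<xi>] k_def sum_distrib_left
    proof (intro sum.cong refl)
      fix j
      have "\<xi> powr (\<alpha> / 2 + real j) = sqrt \<xi> * \<xi> powr (\<alpha> / 2 - 1 / 2 + real j)"
        using \<xi> by (simp add: powr_half_sqrt[symmetric] flip: powr_add)
      then have "complex_of_real \<xi> powr of_real (\<alpha> / 2 + real j) = of_real (sqrt \<xi>) * of_real \<xi> powr of_real (\<alpha> / 2 - 1 / 2 + real j)"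
        using \<xi> by (simp only: powr_of_real[OF less_imp_le] of_real_mult)
      then show "complex_of_real (lagc n \<alpha> j) * (of_real \<xi> powr of_real (\<alpha> / 2 + real j) * exp (- (1 * of_real \<xi>))) =
        of_real (sqrt \<xi>) * (of_real (lagc n \<alpha> j) * (of_real \<xi> powr of_real (\<alpha> / 2 - 1 / 2 + real j) * exp (- (1 * of_real \<xi>))))"
        by (simp only: mult_ac)
    qed
    then show ?thesis using \<xi> by (simp add: norm_mult power_mult_distrib)
  qed
  have "admc (lagf n \<alpha>) = (\<integral>\<^sup>+\<xi>. ennreal ((cmod (k \<xi>))\<^sup>2) \<partial>lpos)"
    unfolding admc_def nn_integral_lpos by (intro nn_integral_cong) (auto simp: indicator_def k2)
  also have "\<dots> = ennreal (nrm2 lpos k)" by (rule L2_nn_integral[OF kL])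
  finally have adm: "admc (lagf n \<alpha>) = ennreal (nrm2 lpos k)" .
  have "nrm2 lpos k \<noteq> 0"
  proof
    assume "nrm2 lpos k = 0"
    then have "AE \<xi> in lpos. k \<xi> = 0" by (rule nrm2_eq_0[OF kL])
    then have ae: "AE \<xi> in lborel. 0 < \<xi> \<longrightarrow> laguerre n \<alpha> (2 * \<xi>) = 0"
      unfolding AE_lpos
    proof eventually_elim
      case (elim \<xi>)
      show ?case
      proof
        assume \<xi>: "0 < \<xi>"
        with elim have "k \<xi> = 0" by simp
        with k2[OF \<xi>] have "lagf n \<alpha> \<xi> = 0" using \<xi> by simp
        then show "laguerre n \<alpha> (2 * \<xi>) = 0" using \<xi> by (simp add: lagf_def)
      qed
    qed
    have "0 < ((real n + \<alpha>) gchoose n)"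
      unfolding gbinomial_prod_rev using \<alpha> by (intro divide_pos_pos prod_pos) auto
    then have "0 < laguerre n \<alpha> (2 * 0)" by (simp add: laguerre_0)
    moreover have "continuous_on UNIV (\<lambda>\<xi>. laguerre n \<alpha> (2 * \<xi>))"
      by (intro continuous_on_compose2[OF laguerre_continuous] continuous_intros) auto
    then have "isCont (\<lambda>\<xi>. laguerre n \<alpha> (2 * \<xi>)) 0" by (simp add: continuous_on_eq_continuous_at)
    ultimately have "\<forall>\<^sub>F \<xi> in at 0. 0 < laguerre n \<alpha> (2 * \<xi>)"
      unfolding isCont_def by (intro order_tendstoD(1))
    then obtain d where d: "0 < d" "\<And>\<xi>. \<xi> \<noteq> 0 \<Longrightarrow> \<bar>\<xi>\<bar> < d \<Longrightarrow> 0 < laguerre n \<alpha> (2 * \<xi>)"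
      unfolding eventually_at by (auto simp: dist_real_def)
    from ae have "AE \<xi> in lborel. \<xi> \<notin> {0<..<d}"
    proof eventually_elim
      case (elim \<xi>)
      show ?case
      proof
        assume "\<xi> \<in> {0<..<d}"
        then show False using elim d(2)[of \<xi>] by simp
      qed
    qed
    then have "emeasure lborel {0<..<d} = 0"
      by (subst (asm) AE_iff_null_sets[symmetric]) auto
    then show False using d(1) by simp
  qed
  then have "0 < nrm2 lpos k" by (simp add: order_less_le)
  with adm show ?thesis by (rule that)
qed

lemma gbinomial_Gamma_ratio:
  assumes \<alpha>: "-1 < \<alpha>" and k: "k \<le> n"
  shows "((real n + \<alpha>) gchoose (n - k)) * Gamma (\<alpha> + real k + 1) = Gamma (\<alpha> + real n + 1) / fact (n - k)"
proof -
  have "real n + \<alpha> + 1 \<notin> \<int>\<^sub>\<le>\<^sub>0" using \<alpha> by (auto elim!: nonpos_Ints_cases)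
  then have "((real n + \<alpha>) gchoose (n - k)) = Gamma (real n + \<alpha> + 1) / (fact (n - k) * Gamma (real n + \<alpha> - real (n - k) + 1))"
    by (rule gbinomial_Gamma)
  moreover have "real n + \<alpha> - real (n - k) + 1 = \<alpha> + real k + 1" using k by (simp add: of_nat_diff)
  moreover have "Gamma (\<alpha> + real k + 1) \<noteq> 0"
  proof -
    have "0 < Gamma (\<alpha> + real k + 1)"
      by (rule Gamma_real_pos) (use \<alpha> of_nat_0_le_iff[of k, where ?'a = real] in linarith)
    then show ?thesis by simp
  qed
  ultimately show ?thesis by (simp add: add_ac)
qed

text \<open>
  The Laplace transform of a Laguerre polynomial is elementary: the binomial coefficients in the
  definition turn the Gamma factors into those of the binomial theorem.
\<close>

lemma wt_lagf_exponential:
  assumes \<alpha>: "0 < \<alpha>" and z: "z \<in> upper" and w: "w \<in> upper"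
  defines "p \<equiv> - \<i> * (z - cnj w)"
  shows "wt (lagf n \<alpha>) (\<lambda>\<xi>. of_real \<xi> powr of_real (\<alpha> / 2) * exp (- (\<i> * cnj w * of_real \<xi>))) z =
    of_real (Gamma (\<alpha> + real n + 1) / (2 * pi * fact n)) *
    (of_real (Im z powr ((\<alpha> + 1) / 2)) * (- \<i> * cnj (z - w) / p) ^ n * exp (- (of_real (\<alpha> + 1) * Ln p)))"
proof -
  define x y where "x = Re z" and "y = Im z"
  have y: "0 < y" using z by (simp add: y_def upper_def)
  have p: "0 < Re p" using z w by (simp add: p_def upper_def)
  then have p0: "p \<noteq> 0" by auto
  have p_eq: "\<i> * cnj w + of_real y - \<i> * of_real x = p"
    by (simp add: p_def x_def y_def complex_eq_iff)
  have p2: "p - 2 * of_real y = - \<i> * cnj (z - w)"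
    by (simp add: p_def y_def complex_eq_iff)
  define G where "G k \<xi> = of_real \<xi> powr (of_real (\<alpha> + real k + 1) - 1) * exp (- (p * of_real \<xi>))" for k and \<xi> :: real
  have G: "integrable lpos (G k)" "integral\<^sup>L lpos (G k) = Gamma (of_real (\<alpha> + real k + 1)) / p powr of_real (\<alpha> + real k + 1)" for k
    unfolding G_def[abs_def] using \<alpha> p by (auto intro!: Gamma_integral_lpos simp del: of_real_add)
  have "(LINT \<xi>|lpos. of_real \<xi> powr of_real (\<alpha> / 2) * exp (- (\<i> * cnj w * of_real \<xi>)) * cnj (lagf n \<alpha> (y * \<xi>)) * exp (\<i> * of_real (x * \<xi>)))
     = (LINT \<xi>|lpos. (\<Sum>k=0..n. of_real (lagc n \<alpha> k * y powr (\<alpha> / 2 + real k)) * G k \<xi>))"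
  proof (intro Bochner_Integration.integral_cong refl)
    fix \<xi> assume "\<xi> \<in> space lpos"
    then have \<xi>: "0 < \<xi>" by simp
    have yx: "0 < y * \<xi>" using y \<xi> by simp
    have l: "cnj (lagf n \<alpha> (y * \<xi>)) = (\<Sum>k=0..n. of_real (lagc n \<alpha> k * y powr (\<alpha> / 2 + real k)) * (of_real (\<xi> powr (\<alpha> / 2 + real k)) * exp (- (of_real y * of_real \<xi>))))"
    proof -
      have "cnj (lagf n \<alpha> (y * \<xi>)) = lagf n \<alpha> (y * \<xi>)" by (simp add: lagf_def)
      also have "\<dots> = (\<Sum>k=0..n. of_real (lagc n \<alpha> k * y powr (\<alpha> / 2 + real k)) * (of_real (\<xi> powr (\<alpha> / 2 + real k)) * exp (- (of_real y * of_real \<xi>))))"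
        unfolding lagf_sum[OF yx]
      proof (intro sum.cong refl)
        fix k
        have "complex_of_real (y * \<xi>) powr of_real (\<alpha> / 2 + real k) = of_real (y powr (\<alpha> / 2 + real k) * \<xi> powr (\<alpha> / 2 + real k))"
          using y \<xi> by (simp only: powr_of_real[OF less_imp_le[OF yx]] powr_mult less_imp_le)
        then show "of_real (lagc n \<alpha> k) * (complex_of_real (y * \<xi>) powr of_real (\<alpha> / 2 + real k) * exp (- (1 * of_real (y * \<xi>)))) =
           of_real (lagc n \<alpha> k * y powr (\<alpha> / 2 + real k)) * (of_real (\<xi> powr (\<alpha> / 2 + real k)) * exp (- (of_real y * of_real \<xi>)))"
          by (simp only: of_real_mult mult_1_left mult_ac)
      qed
      finally show ?thesis .
    qed
    have E: "exp (- (\<i> * cnj w * of_real \<xi>)) * exp (- (of_real y * of_real \<xi>)) * exp (\<i> * of_real (x * \<xi>)) = exp (- (p * of_real \<xi>))"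
    proof -
      have "- (\<i> * cnj w * of_real \<xi>) + - (of_real y * of_real \<xi>) + \<i> * of_real (x * \<xi>) = - (p * of_real \<xi>)"
        unfolding p_eq[symmetric] by (simp add: algebra_simps)
      then show ?thesis by (simp only: exp_add[symmetric])
    qed
    have P: "complex_of_real \<xi> powr of_real (\<alpha> / 2) * of_real (\<xi> powr (\<alpha> / 2 + real k)) = of_real \<xi> powr (of_real (\<alpha> + real k + 1) - 1)" for k
    proof -
      have "\<xi> powr (\<alpha> / 2) * \<xi> powr (\<alpha> / 2 + real k) = \<xi> powr (\<alpha> + real k)"
        by (simp flip: powr_add)
      moreover have "complex_of_real (\<alpha> + real k + 1) - 1 = of_real (\<alpha> + real k)" by simp
      ultimately show ?thesis
        using \<xi> by (simp only: powr_of_real[OF less_imp_le] of_real_mult[symmetric])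
    qed
    show "of_real \<xi> powr of_real (\<alpha> / 2) * exp (- (\<i> * cnj w * of_real \<xi>)) * cnj (lagf n \<alpha> (y * \<xi>)) * exp (\<i> * of_real (x * \<xi>))
      = (\<Sum>k=0..n. of_real (lagc n \<alpha> k * y powr (\<alpha> / 2 + real k)) * G k \<xi>)"
      unfolding l sum_distrib_left sum_distrib_right G_def P[symmetric] E[symmetric]
      by (intro sum.cong refl) (simp only: mult_ac)
  qed
  also have "\<dots> = (\<Sum>k=0..n. of_real (lagc n \<alpha> k * y powr (\<alpha> / 2 + real k)) * integral\<^sup>L lpos (G k))"
    by (subst Bochner_Integration.integral_sum) (auto intro!: integrable_mult_right G simp del: of_real_mult)
  also have "\<dots> = (\<Sum>k=0..n. of_real (Gamma (\<alpha> + real n + 1) / fact n * y powr (\<alpha> / 2)) * exp (- (of_real (\<alpha> + 1) * Ln p)) *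
      (of_nat (n choose k) * (- 2 * of_real y / p) ^ k * 1 ^ (n - k)))"
  proof (intro sum.cong refl)
    fix k assume "k \<in> {0..n}"
    then have k: "k \<le> n" by simp
    have pp: "p powr of_real (\<alpha> + real k + 1) = p ^ k / exp (- (of_real (\<alpha> + 1) * Ln p))"
    proof -
      have "p powr of_real (\<alpha> + real k + 1) = exp (of_real (\<alpha> + 1) * Ln p + of_nat k * Ln p)"
        using p0 by (simp add: powr_def algebra_simps)
      also have "\<dots> = exp (of_real (\<alpha> + 1) * Ln p) * p ^ k"
        using p0 by (simp add: exp_add exp_of_nat_mult)
      finally show ?thesis by (simp only: exp_minus divide_inverse inverse_inverse_eq mult.commute)
    qed
    have c: "lagc n \<alpha> k * Gamma (\<alpha> + real k + 1) = Gamma (\<alpha> + real n + 1) / fact n * (of_nat (n choose k) * (-2) ^ k)"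
    proof -
      have "lagc n \<alpha> k * Gamma (\<alpha> + real k + 1) =
         (((real n + \<alpha>) gchoose (n - k)) * Gamma (\<alpha> + real k + 1)) * ((-1) ^ k * 2 ^ k / fact k)"
        by (simp add: lagc_def)
      also have "\<dots> = Gamma (\<alpha> + real n + 1) * ((-2) ^ k / (fact (n - k) * fact k))"
        using \<alpha> k by (subst gbinomial_Gamma_ratio) (auto simp: power_mult_distrib[symmetric] mult.commute)
      also have "(-2) ^ k / (fact (n - k) * fact k) = (of_nat (n choose k) * (-2) ^ k) / (fact n :: real)"
        using k by (simp add: binomial_fact mult.commute)
      finally show ?thesis by simp
    qed
    have yk: "y powr (\<alpha> / 2 + real k) = y powr (\<alpha> / 2) * y ^ k"
      using y by (simp add: powr_add powr_realpow)
    have "of_real (lagc n \<alpha> k * y powr (\<alpha> / 2 + real k)) * integral\<^sup>L lpos (G k) =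
      of_real (lagc n \<alpha> k * Gamma (\<alpha> + real k + 1)) * of_real (y powr (\<alpha> / 2)) * of_real y ^ k / p ^ k * exp (- (of_real (\<alpha> + 1) * Ln p))"
      unfolding G pp yk Gamma_complex_of_real by (simp add: mult_ac)
    also have "\<dots> = of_real (Gamma (\<alpha> + real n + 1) / fact n * y powr (\<alpha> / 2)) * exp (- (of_real (\<alpha> + 1) * Ln p)) *
      (of_nat (n choose k) * (- 2 * of_real y / p) ^ k * 1 ^ (n - k))"
    proof -
      have pw: "(- 2 * complex_of_real y / p) ^ k = (- 2) ^ k * of_real y ^ k / p ^ k"
        by (simp only: power_mult_distrib power_divide)
      show ?thesis unfolding c pw by (simp add: mult_ac)
    qed
    finally show "of_real (lagc n \<alpha> k * y powr (\<alpha> / 2 + real k)) * integral\<^sup>L lpos (G k) =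
      of_real (Gamma (\<alpha> + real n + 1) / fact n * y powr (\<alpha> / 2)) * exp (- (of_real (\<alpha> + 1) * Ln p)) *
      (of_nat (n choose k) * (- 2 * of_real y / p) ^ k * 1 ^ (n - k))" .
  qed
  also have "\<dots> = of_real (Gamma (\<alpha> + real n + 1) / fact n * y powr (\<alpha> / 2)) * exp (- (of_real (\<alpha> + 1) * Ln p)) * (- 2 * of_real y / p + 1) ^ n"
    unfolding sum_distrib_left[symmetric] binomial_ring by (simp add: atMost_atLeast0)
  also have "- 2 * of_real y / p + 1 = - \<i> * cnj (z - w) / p"
    unfolding p2[symmetric] using p0 by (simp add: diff_divide_distrib)
  finally have I: "(LINT \<xi>|lpos. of_real \<xi> powr of_real (\<alpha> / 2) * exp (- (\<i> * cnj w * of_real \<xi>)) * cnj (lagf n \<alpha> (y * \<xi>)) * exp (\<i> * of_real (x * \<xi>)))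
     = of_real (Gamma (\<alpha> + real n + 1) / fact n * y powr (\<alpha> / 2)) * exp (- (of_real (\<alpha> + 1) * Ln p)) * (- \<i> * cnj (z - w) / p) ^ n" .
  have yy: "y powr ((\<alpha> + 1) / 2) = sqrt y * y powr (\<alpha> / 2)"
    using y by (simp add: powr_half_sqrt[symmetric] add_divide_distrib powr_add mult.commute)
  show ?thesis
    unfolding wt_def x_def[symmetric] y_def[symmetric] I yy by (simp add: mult_ac)
qed

text \<open>
  In the explicit formula for the transform, \<open>mob_diff\<close>, \<open>mob_diff_cnj\<close> and \<open>Im_mob\<close> show how each factor changes.
  The factors depending on \<open>z\<close> cancel against the cocycle because of the value of its exponent; the
  principal branches are compared by \<open>Ln_mob\<close>.
\<close>

theorem wt_lagf_exponential_covariant: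
  assumes \<alpha>: "0 < \<alpha>" and g: "g \<in> SL2R" and w: "w \<in> upper"
  obtains \<kappa> where "\<And>z. z \<in> upper \<Longrightarrow>
    jfac (2 * real n + \<alpha> + 1) g z *
      wt (lagf n \<alpha>) (\<lambda>\<xi>. of_real \<xi> powr of_real (\<alpha> / 2) * exp (- (\<i> * cnj (mob g w) * of_real \<xi>))) (mob g z) =
    \<kappa> * wt (lagf n \<alpha>) (\<lambda>\<xi>. of_real \<xi> powr of_real (\<alpha> / 2) * exp (- (\<i> * cnj w * of_real \<xi>))) z"
proof -
  define s where "s = 2 * real n + \<alpha> + 1"
  obtain \<kappa>0 where \<kappa>0: "\<And>z. z \<in> upper \<Longrightarrow> jfac s g z = \<kappa>0 * exp (- (\<i> * of_real (s * Im (Ln (cocycle_denom g z)))))"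
    using jfac_const_times[OF g] by metis
  define E where "E = cocycle_denom g w"
  have "jfac s g z *
      wt (lagf n \<alpha>) (\<lambda>\<xi>. of_real \<xi> powr of_real (\<alpha> / 2) * exp (- (\<i> * cnj (mob g w) * of_real \<xi>))) (mob g z) =
    (\<kappa>0 * exp (of_real (\<alpha> + 1) * cnj (Ln E))) * wt (lagf n \<alpha>) (\<lambda>\<xi>. of_real \<xi> powr of_real (\<alpha> / 2) * exp (- (\<i> * cnj w * of_real \<xi>))) z"
    if z: "z \<in> upper" for z
  proof -
    define D where "D = cocycle_denom g z"
    have nz: "D \<noteq> 0" "E \<noteq> 0" unfolding D_def E_def by (rule cocycle_denom_nonzero[OF g] z w)+
    define u v where "u = Re (Ln D)" and "v = Im (Ln D)"
    have LnD: "Ln D = of_real u + \<i> * of_real v" unfolding u_def v_def by (rule complex_eq)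
    have D: "D = exp (of_real u + \<i> * of_real v)" using nz LnD by (metis exp_Ln)
    have cD: "cnj D = exp (of_real u - \<i> * of_real v)" unfolding D by (simp add: exp_cnj)
    have nD: "cmod D = exp u" unfolding D by (simp add: norm_exp_eq_Re)
    define p where "p = - \<i> * (z - cnj w)"
    define p' where "p' = - \<i> * (mob g z - cnj (mob g w))"
    have Lp: "Ln p' = Ln p - Ln D - cnj (Ln E)"
      unfolding p_def p'_def D_def E_def by (rule Ln_mob[OF g z w])
    have p': "p' = p / (D * cnj E)"
      unfolding p_def p'_def mob_diff_cnj[OF g z w] D_def E_def by simp
    have q': "- \<i> * cnj (mob g z - mob g w) = - \<i> * cnj (z - w) / (cnj D * cnj E)"
      unfolding mob_diff[OF g z w] D_def E_def by simp
    have ratio: "- \<i> * cnj (mob g z - mob g w) / p' = (- \<i> * cnj (z - w) / p) * exp (2 * \<i> * of_real v)"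
    proof -
      have "- \<i> * cnj (mob g z - mob g w) / p' = (- \<i> * cnj (z - w) / p) * (D / cnj D)"
        unfolding q' p' using nz by (simp add: mult_ac)
      also have "D / cnj D = exp (2 * \<i> * of_real v)"
        unfolding cD unfolding D by (simp add: mult.assoc flip: exp_diff)
      finally show ?thesis .
    qed
    have y': "Im (mob g z) powr ((\<alpha> + 1) / 2) = Im z powr ((\<alpha> + 1) / 2) * exp (- ((\<alpha> + 1) * u))"
    proof -
      have "Im (mob g z) = Im z * exp (- (2 * u))"
      proof -
        have "(exp u)\<^sup>2 = exp (2 * u)" by (simp add: power2_eq_square flip: exp_add)
        then show ?thesis
          unfolding Im_mob[OF g z] D_def[symmetric] nD by (simp add: exp_minus divide_inverse)
      qed
      moreover have "exp (- (2 * u)) powr ((\<alpha> + 1) / 2) = exp (- ((\<alpha> + 1) * u))"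
      proof -
        have "(\<alpha> + 1) / 2 * (- (2 * u)) = - ((\<alpha> + 1) * u)" by simp
        then show ?thesis by (simp only: powr_def exp_not_eq_zero if_False ln_exp)
      qed
      ultimately show ?thesis using z by (simp add: powr_mult upper_def)
    qed
    have phase: "exp (- (\<i> * of_real (s * v))) * (of_real (exp (- ((\<alpha> + 1) * u))) * exp (2 * \<i> * of_real v) ^ n *
        exp (- (of_real (\<alpha> + 1) * Ln p'))) = exp (of_real (\<alpha> + 1) * cnj (Ln E)) * exp (- (of_real (\<alpha> + 1) * Ln p))"
    proof -
      have "- (\<i> * of_real (s * v)) + (of_real (- ((\<alpha> + 1) * u)) + of_nat n * (2 * \<i> * of_real v) + - (of_real (\<alpha> + 1) * Ln p')) =
        of_real (\<alpha> + 1) * cnj (Ln E) + - (of_real (\<alpha> + 1) * Ln p)"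
        unfolding Lp LnD s_def by (simp add: algebra_simps)
      then show ?thesis by (simp only: exp_add[symmetric] exp_of_real[symmetric] exp_of_nat_mult[symmetric])
    qed
    have "jfac s g z * wt (lagf n \<alpha>) (\<lambda>\<xi>. of_real \<xi> powr of_real (\<alpha> / 2) * exp (- (\<i> * cnj (mob g w) * of_real \<xi>))) (mob g z) =
      \<kappa>0 * of_real (Gamma (\<alpha> + real n + 1) / (2 * pi * fact n)) * of_real (Im z powr ((\<alpha> + 1) / 2)) * (- \<i> * cnj (z - w) / p) ^ n *
      (exp (- (\<i> * of_real (s * v))) * (of_real (exp (- ((\<alpha> + 1) * u))) * exp (2 * \<i> * of_real v) ^ n *
        exp (- (of_real (\<alpha> + 1) * Ln p'))))"
      unfolding wt_lagf_exponential[OF \<alpha> mob_upper[OF g z] mob_upper[OF g w]] p'_def[symmetric] ratio y'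
        \<kappa>0[OF z] D_def[symmetric] v_def[symmetric] power_mult_distrib of_real_mult
      by (simp only: mult_ac)
    also have "\<dots> = (\<kappa>0 * exp (of_real (\<alpha> + 1) * cnj (Ln E))) * wt (lagf n \<alpha>) (\<lambda>\<xi>. of_real \<xi> powr of_real (\<alpha> / 2) * exp (- (\<i> * cnj w * of_real \<xi>))) z"
      unfolding phase wt_lagf_exponential[OF \<alpha> z w] p_def[symmetric] by (simp only: mult_ac)
    finally show ?thesis .
  qed
  then show ?thesis unfolding s_def by (rule that)
qed

lemma wt_cong_wavelet:
  assumes eq: "AE \<xi> in lpos. h \<xi> = h' \<xi>" and [measurable]: "h \<in> borel_measurable borel" "h' \<in> borel_measurable borel"
    and \<phi>: "\<phi> \<in> borel_measurable lpos" and z: "z \<in> upper"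
  shows "wt h \<phi> z = wt h' \<phi> z"
proof -
  have y: "0 < Im z" using z by (simp add: upper_def)
  have "AE \<xi> in lborel. 0 < \<xi> \<longrightarrow> h \<xi> = h' \<xi>" using eq unfolding AE_lpos .
  then have "AE \<xi> in lborel. 0 < (0 + Im z * \<xi>) \<longrightarrow> h (0 + Im z * \<xi>) = h' (0 + Im z * \<xi>)"
    by (rule AE_borel_affine[rotated 2]) (use y in simp_all)
  then have ae: "AE \<xi> in lpos. h (Im z * \<xi>) = h' (Im z * \<xi>)"
    unfolding AE_lpos by eventually_elim (use y in simp)
  note [measurable] = \<phi> measurable_ident_lpos
  have "(LINT \<xi>|lpos. \<phi> \<xi> * cnj (h (Im z * \<xi>)) * exp (\<i> * of_real (Re z * \<xi>))) =
     (LINT \<xi>|lpos. \<phi> \<xi> * cnj (h' (Im z * \<xi>)) * exp (\<i> * of_real (Re z * \<xi>)))"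
    by (rule integral_cong_AE) (measurable, use ae in auto)
  then show ?thesis by (simp add: wt_def)
qed

lemma is_psi_psi:
  assumes "-1 < \<alpha>"
  shows "is_psi n \<alpha> (psi n \<alpha>)"
proof -
  obtain f where f: "f \<in> H2" "is_fourier f (posp (lagf n \<alpha>))" using H2_surjective[OF lagf_L2[OF assms]] .
  have "AE \<xi> in lborel. 0 < \<xi> \<longrightarrow> fourier f \<xi> = lagf n \<alpha> \<xi>"
    using is_fourier_AE_unique[OF H2_L2[OF f(1)] is_fourier_fourier[OF H2_L2[OF f(1)]] f(2)]
    by eventually_elim (simp add: posp_def)
  then have "is_psi n \<alpha> f" using f(1) by (simp add: is_psi_def lagf_def)
  then show ?thesis unfolding psi_def by (rule someI[of "is_psi n \<alpha>"])
qed

text \<open>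
  The exponentials \<open>\<xi>\<^bsup>\<alpha>/2\<^esup> e\<^bsup>-(1+i\<theta>)\<xi>\<^esup>\<close> are already complete; they belong to the points \<open>\<theta> + i\<close>,
  which are therefore the only values of \<open>g(w)\<close> that have to be considered.
\<close>

theorem tau_invariant:
  assumes \<alpha>: "0 < \<alpha>" and F: "F \<in> wavelet_space (psi n \<alpha>)" and g: "g \<in> SL2R"
  shows "tau n \<alpha> g F \<in> wavelet_space (psi n \<alpha>)"
proof -
  have \<alpha>1: "-1 < \<alpha>" using \<alpha> by simp
  define s where "s = 2 * real n + \<alpha> + 1"
  define h where "h = lagf n \<alpha>"
  define h' where "h' = fourier (psi n \<alpha>)"
  have psi: "psi n \<alpha> \<in> H2" "AE \<xi> in lpos. h' \<xi> = h \<xi>"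
    using is_psi_psi[OF \<alpha>1, of n] by (auto simp: is_psi_def AE_lpos h_def h'_def lagf_def)
  note psiL = H2_L2[OF psi(1)]
  have hL: "h \<in> L2_space lpos" unfolding h_def by (rule lagf_L2[OF \<alpha>1])
  have hm: "h \<in> borel_measurable borel" "h' \<in> borel_measurable borel"
    using L2_measurable[OF fourier_L2[OF psiL]] by (simp_all add: h_def h'_def lagf_measurable)
  obtain C where C: "admc h = ennreal C" "0 < C" unfolding h_def using lagf_admissible[OF \<alpha>] by blast
  have wt_eq: "wt h' \<phi> z = wt h \<phi> z" if "\<phi> \<in> L2_space lpos" "z \<in> upper" for \<phi> z
    by (rule wt_cong_wavelet[OF psi(2) hm(2,1) L2_measurable[OF that(1)] that(2)])
  have FL: "F \<in> L2_space mu" and "\<exists>\<phi>\<in>L2_space lpos. AE z in mu. F z = wt h' \<phi> z"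
    using F unfolding wavelet_space_eq[OF psiL] h'_def by auto
  then obtain \<phi> where \<phi>: "\<phi> \<in> L2_space lpos" "AE z in mu. F z = wt h' \<phi> z" by blast
  have "\<exists>\<phi>'\<in>L2_space lpos. \<forall>z\<in>upper. wt h \<phi>' z = jfac s g z * wt h \<phi> (mob g z)"
  proof (rule wt_range_invariant[OF hL C g _ _ \<phi>(1)])
    show "0 \<le> \<alpha> / 2" using \<alpha> by simp
    fix \<theta> :: real
    define v' where "v' = Complex \<theta> 1"
    have v': "v' \<in> upper" "\<i> * cnj v' = 1 + \<i> * of_real \<theta>" by (auto simp: v'_def upper_def complex_eq_iff)
    obtain w where w: "w \<in> upper" "mob g w = v'" using mob_surj[OF g v'(1)] .
    obtain \<kappa> where \<kappa>: "\<And>z. z \<in> upper \<Longrightarrow> jfac s g z *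
        wt h (\<lambda>\<xi>. of_real \<xi> powr of_real (\<alpha> / 2) * exp (- (\<i> * cnj (mob g w) * of_real \<xi>))) (mob g z) =
        \<kappa> * wt h (\<lambda>\<xi>. of_real \<xi> powr of_real (\<alpha> / 2) * exp (- (\<i> * cnj w * of_real \<xi>))) z"
      using wt_lagf_exponential_covariant[OF \<alpha> g w(1), of n] unfolding s_def h_def by blast
    define \<phi>' where "\<phi>' \<xi> = \<kappa> * (of_real \<xi> powr of_real (\<alpha> / 2) * exp (- (\<i> * cnj w * of_real \<xi>)))" for \<xi> :: real
    have "\<phi>' \<in> L2_space lpos"
      unfolding \<phi>'_def[abs_def] using \<alpha> w(1) by (intro L2_scale power_exp_L2) (auto simp: upper_def)
    moreover have "wt h \<phi>' z = jfac s g z * wt h (\<lambda>\<xi>. of_real \<xi> powr of_real (\<alpha> / 2) * exp (- ((1 + \<i> * of_real \<theta>) * of_real \<xi>))) (mob g z)"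
      if "z \<in> upper" for z
      using \<kappa>[OF that] unfolding w(2) v'(2) \<phi>'_def[abs_def] wt_cmult by simp
    ultimately show "\<exists>\<phi>'\<in>L2_space lpos. \<forall>z\<in>upper. wt h \<phi>' z = jfac s g z *
       wt h (\<lambda>\<xi>. of_real \<xi> powr of_real (\<alpha> / 2) * exp (- ((1 + \<i> * of_real \<theta>) * of_real \<xi>))) (mob g z)" by blast
  qed
  then obtain \<phi>' where \<phi>': "\<phi>' \<in> L2_space lpos" "\<And>z. z \<in> upper \<Longrightarrow> wt h \<phi>' z = jfac s g z * wt h \<phi> (mob g z)" by blast
  have "AE z in mu. sigma s g F z = wt h' \<phi>' z"
    using AE_mu_mob[OF g \<phi>(2)] AE_space[of mu]
  proof eventually_elim
    case (elim z)
    then have z: "z \<in> upper" by simp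
    show ?case
      using elim(1) \<phi>'(2)[OF z] wt_eq[OF \<phi>'(1) z] wt_eq[OF \<phi>(1) mob_upper[OF g z]] by (simp add: sigma_eq)
  qed
  then have "sigma s g F \<in> wavelet_space (psi n \<alpha>)"
    unfolding wavelet_space_eq[OF psiL] h'_def[symmetric] using sigma_L2(1)[OF g FL] \<phi>'(1) by blast
  then show ?thesis by (simp add: tau_def s_def)
qed

section \<open>Rotations\<close>

definition rot :: "real \<Rightarrow> real^2^2" where
  "rot \<theta> = (\<chi> i j. if i = 1 then (if j = 1 then cos \<theta> else - sin \<theta>) else (if j = 1 then sin \<theta> else cos \<theta>))"

lemma rot_entries [simp]:
  "rot \<theta> $ 1 $ 1 = cos \<theta>" "rot \<theta> $ 1 $ 2 = - sin \<theta>" "rot \<theta> $ 2 $ 1 = sin \<theta>" "rot \<theta> $ 2 $ 2 = cos \<theta>"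
  by (simp_all add: rot_def)

lemma rot_SL2R: "rot \<theta> \<in> SL2R"
  by (simp add: SL2R_det power2_eq_square[symmetric])

lemma i_upper [simp]: "\<i> \<in> upper"
  by (simp add: upper_def)

lemma cocycle_rot_i: "cocycle_denom (rot \<theta>) \<i> = exp (\<i> * of_real \<theta>)"
  by (simp add: cocycle_denom_def complex_eq_iff Re_exp Im_exp)

lemma mob_rot_i: "mob (rot \<theta>) \<i> = \<i>"
proof -
  have "of_real (rot \<theta> $ 1 $ 1) * \<i> + of_real (rot \<theta> $ 1 $ 2) = \<i> * cocycle_denom (rot \<theta>) \<i>"
    by (simp add: cocycle_denom_def complex_eq_iff)
  then show ?thesis
    unfolding mob_eq using cocycle_denom_nonzero[OF rot_SL2R i_upper, of \<theta>] by simp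
qed

text \<open>The Cayley transform turns the rotations about \<open>\<i>\<close> into those about \<open>0\<close>.\<close>

definition cayley :: "complex \<Rightarrow> complex" where
  "cayley z = (z - \<i>) / (z + \<i>)"

lemma upper_plus_i: "z \<in> upper \<Longrightarrow> z + \<i> \<noteq> 0"
  by (auto simp: upper_def complex_eq_iff)

lemma cayley_rot:
  assumes z: "z \<in> upper"
  shows "cayley (mob (rot \<theta>) z) = exp (- (2 * \<i> * of_real \<theta>)) * cayley z"
proof -
  define D where "D = cocycle_denom (rot \<theta>) z"
  define E where "E = exp (\<i> * complex_of_real \<theta>)"
  have nz: "D \<noteq> 0" "E \<noteq> 0" unfolding D_def E_def using cocycle_denom_nonzero[OF rot_SL2R z] by auto
  have 1: "mob (rot \<theta>) z - \<i> = (z - \<i>) / (D * E)"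
    using mob_diff[OF rot_SL2R z i_upper, of \<theta>] unfolding mob_rot_i cocycle_rot_i D_def[symmetric] E_def[symmetric] .
  have 2: "mob (rot \<theta>) z + \<i> = (z + \<i>) / (D * cnj E)"
    using mob_diff_cnj[OF rot_SL2R z i_upper, of \<theta>] unfolding mob_rot_i cocycle_rot_i D_def[symmetric] E_def[symmetric] by simp
  have cE: "cnj E = exp (- (\<i> * complex_of_real \<theta>))" unfolding E_def by (simp add: exp_cnj)
  have 3: "cnj E / E = exp (- (2 * \<i> * of_real \<theta>))"
  proof -
    have "- (\<i> * complex_of_real \<theta>) - \<i> * of_real \<theta> = - (2 * \<i> * of_real \<theta>)" by simp
    then show ?thesis unfolding cE unfolding E_def exp_diff[symmetric] by (simp only:)
  qed
  have "cayley (mob (rot \<theta>) z) = (cnj E / E) * cayley z"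
    unfolding cayley_def 1 2 using nz by (simp add: mult_ac)
  then show ?thesis unfolding 3 .
qed

lemma cayley_inj:
  assumes "z \<in> upper" "w \<in> upper" "cayley z = cayley w"
  shows "z = w"
proof -
  have "(z - \<i>) * (w + \<i>) = (w - \<i>) * (z + \<i>)"
    using assms upper_plus_i[OF assms(1)] upper_plus_i[OF assms(2)] by (simp add: cayley_def frac_eq_eq)
  then have "2 * \<i> * (z - w) = 0" by (simp add: algebra_simps)
  then show ?thesis by simp
qed

text \<open>
  The value of \<open>qf\<close> is \<open>4 cosh\<^sup>2(d/2)\<close>, where \<open>d\<close> is the hyperbolic distance from \<open>z\<close> to \<open>\<i>\<close>.
\<close>

definition qf :: "complex \<Rightarrow> real" where
  "qf z = (cmod (z + \<i>))\<^sup>2 / Im z"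

lemma cmod_cayley:
  assumes "z \<in> upper"
  shows "(cmod (cayley z))\<^sup>2 = 1 - 4 / qf z"
proof -
  have "(cmod (z + \<i>))\<^sup>2 \<noteq> 0" using upper_plus_i[OF assms] by simp
  moreover have "(cmod (z - \<i>))\<^sup>2 = (cmod (z + \<i>))\<^sup>2 - 4 * Im z"
    unfolding cmod_power2 by (simp add: power2_eq_square algebra_simps)
  ultimately show ?thesis
    unfolding cayley_def norm_divide power_divide qf_def by (simp add: diff_divide_distrib)
qed

text \<open>
  The Cayley transforms of the two points have equal modulus. The rotations with \<open>sin \<theta> = 0\<close> are set
  apart because they fix every point, while the branch computation in \<open>jfac_eq\<close> requires a nonzero
  lower left entry.
\<close>

lemma rot_transitive:
  assumes z: "z \<in> upper" and w: "w \<in> upper" and eq: "qf z = qf w"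
  shows "z = w \<or> (\<exists>\<theta>. sin \<theta> \<noteq> 0 \<and> mob (rot \<theta>) z = w)"
proof -
  have "(cmod (cayley z))\<^sup>2 = (cmod (cayley w))\<^sup>2" unfolding cmod_cayley[OF z] cmod_cayley[OF w] eq ..
  then have n: "cmod (cayley z) = cmod (cayley w)" by (simp add: power2_eq_iff_nonneg)
  show ?thesis
  proof (cases "cayley z = 0")
    case True
    then have "cayley w = 0" using n by simp
    then have "z = w" using cayley_inj[OF z w] True by simp
    then show ?thesis ..
  next
    case False
    define c where "c = cayley w / cayley z"
    have "cmod (cayley z) \<noteq> 0" using False by simp
    then have c: "cmod c = 1" using n by (simp add: c_def norm_divide)
    define \<theta> where "\<theta> = - Im (Ln c) / 2"
    have c0: "c \<noteq> 0" using c by auto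
    have "Ln c = \<i> * of_real (Im (Ln c))" using c c0 by (simp add: complex_eq_iff)
    then have "exp (- (2 * \<i> * of_real \<theta>)) = exp (Ln c)" unfolding \<theta>_def by simp
    then have e: "exp (- (2 * \<i> * of_real \<theta>)) = c" using c0 by simp
    have "cayley (mob (rot \<theta>) z) = cayley w"
      unfolding cayley_rot[OF z] e using False by (simp add: c_def)
    then have m: "mob (rot \<theta>) z = w" by (rule cayley_inj[OF mob_upper[OF rot_SL2R z] w])
    show ?thesis
    proof (cases "sin \<theta> = 0")
      case True
      have "cocycle_denom (rot \<theta>) z = of_real (cos \<theta>)" "cos \<theta> \<noteq> 0"
        using True sin_cos_squared_add[of \<theta>] by (auto simp: cocycle_denom_def)
      then have "mob (rot \<theta>) z = z" using True by (simp add: mob_eq)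
      then show ?thesis using m by simp
    next
      case False
      then show ?thesis using m by blast
    qed
  qed
qed

text \<open>
  An isometry that fixes \<open>\<i>\<close> sends the reproducing vector at \<open>\<i>\<close>, which is the wavelet itself, to a
  multiple of itself: the value at \<open>\<i>\<close> is the inner product with \<open>h\<close>, and equality holds in the
  Cauchy--Schwarz inequality.
\<close>

lemma stabilizer_eigenvector:
  assumes h: "h \<in> L2_space lpos" "h \<in> borel_measurable borel" and C: "admc h = ennreal C" "0 < C"
    and g: "g \<in> SL2R" "mob g \<i> = \<i>"
    and \<phi>: "\<phi> \<in> L2_space lpos" "\<And>z. z \<in> upper \<Longrightarrow> wt h \<phi> z = jfac s g z * wt h h (mob g z)"
    and z: "z \<in> upper"
  shows "jfac s g z * wt h h (mob g z) = jfac s g \<i> * wt h h z"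
proof -
  have C0: "0 \<le> C" using C by simp
  define J where "J = jfac s g \<i>"
  have J: "cmod J = 1" unfolding J_def by (rule cmod_jfac[OF g(1) i_upper])
  have "nrm2 mu (wt h \<phi>) = nrm2 mu (sigma s g (wt h h))"
    unfolding nrm2_def by (intro Bochner_Integration.integral_cong refl) (simp add: \<phi>(2) sigma_eq)
  also have "\<dots> = nrm2 mu (wt h h)"
    by (rule sigma_L2(2)[OF g(1) wt_isometry(1)[OF h(1) h(1) C(1) C0]])
  finally have n: "nrm2 lpos \<phi> = nrm2 lpos h"
    unfolding wt_isometry(2)[OF h(1) h(1) C(1) C0] wt_isometry(2)[OF \<phi>(1) h(1) C(1) C0] using C(2) by simp
  have at_i: "wt h f \<i> = of_real (1 / (2 * pi)) * ip lpos f h" for f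
    by (simp add: wt_def ip_def)
  have "ip lpos \<phi> h = J * ip lpos h h"
    using \<phi>(2)[OF i_upper] unfolding g(2) at_i J_def[symmetric] by simp
  then have "ip lpos \<phi> (\<lambda>\<xi>. J * h \<xi>) = (cnj J * J) * of_real (nrm2 lpos h)"
    by (simp add: ip_scale_right ip_self)
  also have "cnj J * J = 1" using J complex_norm_square[of J] by (simp add: mult.commute)
  finally have ip: "Re (ip lpos \<phi> (\<lambda>\<xi>. J * h \<xi>)) = nrm2 lpos h" by simp
  have "nrm2 lpos (\<lambda>\<xi>. \<phi> \<xi> - J * h \<xi>) = 0"
    unfolding nrm2_diff[OF \<phi>(1) L2_scale[OF h(1)]] ip nrm2_scale n J by simp
  then have "AE \<xi> in lpos. \<phi> \<xi> = J * h \<xi>"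
    by (rule nrm2_diff_eq_0[OF \<phi>(1) L2_scale[OF h(1)]])
  then have "wt h \<phi> z = wt h (\<lambda>\<xi>. J * h \<xi>) z"
    by (rule wt_cong[OF _ L2_measurable[OF \<phi>(1)] L2_measurable[OF L2_scale[OF h(1)]] h(2)])
  then show ?thesis unfolding wt_cmult \<phi>(2)[OF z] J_def .
qed

text \<open>
  The factor compensates the phase by which an eigenvector of the rotations changes along their orbits.
\<close>

definition unphase :: "real \<Rightarrow> (complex \<Rightarrow> complex) \<Rightarrow> complex \<Rightarrow> complex" where
  "unphase s F z = F z * exp (\<i> * of_real (s * Im (Ln (1 - \<i> * z))))"

lemma Re_one_minus_i: "z \<in> upper \<Longrightarrow> 0 < Re (1 - \<i> * z)"
  by (simp add: upper_def)

text \<open>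
  By \<open>Ln_mob\<close> with \<open>w = \<i>\<close>, the change of \<open>Im (Ln (1 - \<i> * z))\<close> under a rotation is the difference of the arguments
  of the two cocycle factors.
\<close>

lemma unphase_rot:
  assumes g: "g \<in> SL2R" "mob g \<i> = \<i>" "g$2$1 \<noteq> 0" and z: "z \<in> upper"
    and F: "jfac s g z * F (mob g z) = jfac s g \<i> * F z"
  shows "unphase s F (mob g z) = unphase s F z"
proof -
  define a b where "a = Im (Ln (cocycle_denom g z))" and "b = Im (Ln (cocycle_denom g \<i>))"
  have e: "- \<i> * (w - cnj \<i>) = 1 - \<i> * w" for w by (simp add: algebra_simps)
  have "Ln (1 - \<i> * mob g z) = Ln (1 - \<i> * z) - Ln (cocycle_denom g z) - cnj (Ln (cocycle_denom g \<i>))"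
    using Ln_mob[OF g(1) z i_upper] unfolding g(2) e .
  then have L: "Im (Ln (1 - \<i> * mob g z)) = Im (Ln (1 - \<i> * z)) - a + b" by (simp add: a_def b_def)
  have "exp (- (\<i> * of_real (s * a))) * F (mob g z) = exp (- (\<i> * of_real (s * b))) * F z"
    using F unfolding jfac_eq[OF g(1,3) z] jfac_eq[OF g(1,3) i_upper] a_def b_def .
  then have "exp (\<i> * of_real (s * a)) * (exp (- (\<i> * of_real (s * a))) * F (mob g z)) =
     exp (\<i> * of_real (s * a)) * (exp (- (\<i> * of_real (s * b))) * F z)" by (simp only:)
  then have Fg: "F (mob g z) = exp (\<i> * of_real (s * a)) * exp (- (\<i> * of_real (s * b))) * F z"
    by (simp add: mult.assoc[symmetric] mult_exp_exp del: of_real_mult)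
  have "\<i> * of_real (s * a) + - (\<i> * of_real (s * b)) + \<i> * of_real (s * (Im (Ln (1 - \<i> * z)) - a + b)) =
     \<i> * of_real (s * Im (Ln (1 - \<i> * z)))" by (simp add: algebra_simps)
  then have "exp (\<i> * of_real (s * a)) * exp (- (\<i> * of_real (s * b))) * exp (\<i> * of_real (s * (Im (Ln (1 - \<i> * z)) - a + b))) =
     exp (\<i> * of_real (s * Im (Ln (1 - \<i> * z))))" by (simp only: exp_add[symmetric])
  then show ?thesis
    unfolding unphase_def L Fg by (metis mult.assoc mult.commute)
qed

lemma unphase_continuous:
  assumes "continuous_on upper F"
  shows "continuous_on upper (unphase s F)"
  unfolding unphase_def
proof (intro continuous_intros assms continuous_on_Ln)
  fix z assume "z \<in> upper"
  then show "1 - \<i> * z \<notin> \<real>\<^sub>\<le>\<^sub>0" using Re_one_minus_i[of z] by (auto simp: complex_nonpos_Reals_iff)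
qed

text \<open>
  The curve \<open>w\<close> of points of height \<open>1\<close> meets every level set of \<open>qf\<close>, and rotations are transitive on
  such a set; the profile is the restriction of the function to this curve. Below \<open>4\<close>, the value of
  \<open>qf\<close> at \<open>\<i>\<close> and its minimum, the profile is constant.
\<close>

lemma radial_profile:
  fixes S :: "complex \<Rightarrow> complex"
  assumes c: "continuous_on upper S"
    and inv: "\<And>\<theta> z. sin \<theta> \<noteq> 0 \<Longrightarrow> z \<in> upper \<Longrightarrow> S (mob (rot \<theta>) z) = S z"
  obtains R where "continuous_on UNIV R" "\<And>z. z \<in> upper \<Longrightarrow> S z = R (qf z)" "\<And>t. \<exists>z\<in>upper. R t = S z"
proof -
  define w where "w t = Complex (sqrt (max 0 (t - 4))) 1" for t
  have wu: "w t \<in> upper" for t by (simp add: w_def upper_def)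
  have "continuous_on UNIV w"
    unfolding w_def Complex_eq by (intro continuous_intros)
  then have 1: "continuous_on UNIV (\<lambda>t. S (w t))"
    by (intro continuous_on_compose2[OF c]) (auto simp: wu)
  have 2: "S z = S (w (qf z))" if z: "z \<in> upper" for z
  proof -
    have y: "0 < Im z" using z by (simp add: upper_def)
    have "(cmod (z + \<i>))\<^sup>2 - 4 * Im z = (cmod (z - \<i>))\<^sup>2"
      unfolding cmod_power2 by (simp add: power2_eq_square algebra_simps)
    then have "4 * Im z \<le> (cmod (z + \<i>))\<^sup>2" using zero_le_power2[of "cmod (z - \<i>)"] by linarith
    then have "4 \<le> qf z" using y by (simp add: qf_def field_simps)
    then have "qf (w (qf z)) = qf z"
      unfolding qf_def[of "w (qf z)"] unfolding cmod_power2 w_def by simp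
    then consider "z = w (qf z)" | \<theta> where "sin \<theta> \<noteq> 0" "mob (rot \<theta>) z = w (qf z)"
      using rot_transitive[OF z wu, of "qf z"] by auto
    then show ?thesis
    proof cases
      case 1
      then show ?thesis by (rule arg_cong)
    next
      case 2
      then show ?thesis using inv[OF 2(1) z] by simp
    qed
  qed
  show ?thesis by (rule that[OF 1 2]) (use wu in auto)
qed

section \<open>A divergence theorem on hyperbolic discs\<close>

text \<open>
  The vector field \<open>(1 + x\<^sup>2 - y\<^sup>2) \<partial>\<^sub>x + 2xy \<partial>\<^sub>y\<close> generates the rotations about \<open>\<i>\<close> and therefore annihilates
  \<open>qf\<close>. Hence functions of \<open>qf\<close> are orthogonal to divergences along this field.
\<close>

definition qxy :: "real \<Rightarrow> real \<Rightarrow> real" where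
  "qxy x y = ((1 + y)\<^sup>2 + x\<^sup>2) / y"

definition pm :: "real \<Rightarrow> real \<Rightarrow> complex" where
  "pm x y = 1 + of_real y - \<i> * of_real x"

definition pp :: "real \<Rightarrow> real \<Rightarrow> complex" where
  "pp x y = 1 + of_real y + \<i> * of_real x"

text \<open>
  With \<open>pp\<close> and its conjugate \<open>pm\<close>, which is \<open>1 - iz\<close>, the densities \<open>Ef\<close> have the shape \<open>pm\<^sup>A pp\<^sup>B y\<^sup>c\<close>, with
  principal branches. The divergence of \<open>Ef\<close> times the rotation field is \<open>Ef\<close> times \<open>Kf\<close>, which is
  a polynomial of degree one in \<open>x\<close> and \<open>y\<close>.
\<close>

definition Ef :: "real \<Rightarrow> real \<Rightarrow> real \<Rightarrow> real \<Rightarrow> real \<Rightarrow> complex" where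
  "Ef A B c x y = exp (of_real A * Ln (pm x y) + of_real B * Ln (pp x y)) * of_real (y powr c)"

definition Kf :: "real \<Rightarrow> real \<Rightarrow> real \<Rightarrow> real \<Rightarrow> real \<Rightarrow> complex" where
  "Kf A B c x y = of_real (4 * x) - \<i> * of_real A * (2 - pm x y) + \<i> * of_real B * (2 - pp x y) + of_real (2 * x * c)"

lemma qf_Complex: "qf (Complex x y) = qxy x y"
  by (simp add: qf_def qxy_def cmod_power2 add.commute)

lemma pm_pp_not_nonpos:
  assumes "0 < y"
  shows "pm x y \<notin> \<real>\<^sub>\<le>\<^sub>0" "pp x y \<notin> \<real>\<^sub>\<le>\<^sub>0" "pm x y \<noteq> 0" "pp x y \<noteq> 0"
  using assms by (auto simp: pm_def pp_def complex_nonpos_Reals_iff complex_eq_iff)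

lemma Ef_deriv_x:
  assumes y: "0 < y"
  shows "((\<lambda>x. Ef A B c x y) has_vector_derivative
    Ef A B c x y * (of_real B * \<i> / pp x y - of_real A * \<i> / pm x y)) (at x)"
proof -
  define f where "f X = exp (of_real A * Ln (1 + of_real y - \<i> * X) + of_real B * Ln (1 + of_real y + \<i> * X)) * complex_of_real (y powr c)" for X
  have n: "1 + of_real y - \<i> * of_real x \<notin> \<real>\<^sub>\<le>\<^sub>0" "1 + of_real y + \<i> * of_real x \<notin> \<real>\<^sub>\<le>\<^sub>0"
    using pm_pp_not_nonpos(1,2)[OF y, of x] by (simp_all add: pm_def pp_def)
  have "(f has_field_derivative
     f (of_real x) * (of_real A * (- \<i> / pm x y) + of_real B * (\<i> / pp x y))) (at (of_real x))"
    unfolding f_def pm_def pp_def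
    by (rule derivative_eq_intros refl n | simp add: divide_inverse mult_ac)+
  then have "((\<lambda>x. f (of_real x)) has_vector_derivative
     f (of_real x) * (of_real A * (- \<i> / pm x y) + of_real B * (\<i> / pp x y))) (at x)"
    by (rule has_vector_derivative_real_field)
  moreover have "f (of_real x) = Ef A B c x y" for x by (simp add: f_def Ef_def pm_def pp_def)
  ultimately show ?thesis by (simp add: algebra_simps)
qed

lemma Ef_deriv_y:
  assumes y: "0 < y"
  shows "((\<lambda>y. Ef A B c x y) has_vector_derivative
    Ef A B c x y * (of_real A / pm x y + of_real B / pp x y + of_real (c / y))) (at y)"
proof -
  define f where "f Y = exp (of_real A * Ln (1 + Y - \<i> * of_real x) + of_real B * Ln (1 + Y + \<i> * of_real x))" for Y
  have n: "1 + of_real y - \<i> * of_real x \<notin> \<real>\<^sub>\<le>\<^sub>0" "1 + of_real y + \<i> * of_real x \<notin> \<real>\<^sub>\<le>\<^sub>0"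
    using pm_pp_not_nonpos(1,2)[OF y, of x] by (simp_all add: pm_def pp_def)
  have "(f has_field_derivative
     f (of_real y) * (of_real A * (1 / pm x y) + of_real B * (1 / pp x y))) (at (of_real y))"
    unfolding f_def pm_def pp_def
    by (rule derivative_eq_intros refl n | simp add: divide_inverse mult_ac)+
  then have 1: "((\<lambda>y. f (of_real y)) has_vector_derivative
     f (of_real y) * (of_real A * (1 / pm x y) + of_real B * (1 / pp x y))) (at y)"
    by (rule has_vector_derivative_real_field)
  have "((\<lambda>y. y powr c) has_real_derivative c * y powr (c - 1)) (at y)"
    using y by (auto intro!: derivative_eq_intros)
  then have 2: "((\<lambda>y. complex_of_real (y powr c)) has_vector_derivative of_real (c * y powr (c - 1))) (at y)"
    by (rule has_vector_derivative_of_real[unfolded has_real_derivative_iff_has_vector_derivative[symmetric]])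
  have "y powr (c - 1) = y powr c / y" using y by (simp add: powr_diff)
  then have e: "complex_of_real (c * y powr (c - 1)) = of_real (y powr c) * of_real (c / y)" by simp
  have "((\<lambda>y. f (of_real y) * complex_of_real (y powr c)) has_vector_derivative
     (f (of_real y) * of_real (c * y powr (c - 1)) + f (of_real y) * (of_real A * (1 / pm x y) + of_real B * (1 / pp x y)) * of_real (y powr c))) (at y)"
    by (rule has_vector_derivative_mult[OF 1 2])
  moreover have "f (of_real y) * complex_of_real (y powr c) = Ef A B c x y" for y by (simp add: f_def Ef_def pm_def pp_def)
  moreover have "f (of_real y) * of_real (c * y powr (c - 1)) + f (of_real y) * (of_real A * (1 / pm x y) + of_real B * (1 / pp x y)) * of_real (y powr c)
    = (f (of_real y) * complex_of_real (y powr c)) * (of_real A / pm x y + of_real B / pp x y + of_real (c / y))"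
    unfolding e by (simp add: algebra_simps)
  ultimately show ?thesis by (simp only:)
qed

lemma qxy_deriv_x:
  assumes "0 < y"
  shows "((\<lambda>x. qxy x y) has_real_derivative 2 * x / y) (at x)"
  unfolding qxy_def using assms by (auto intro!: derivative_eq_intros)

lemma qxy_deriv_y:
  assumes "0 < y"
  shows "((\<lambda>y. qxy x y) has_real_derivative (y\<^sup>2 - 1 - x\<^sup>2) / y\<^sup>2) (at y)"
  unfolding qxy_def using assms
  by (auto intro!: derivative_eq_intros simp: power2_eq_square field_simps)

text \<open>
  The rotation field maps \<open>pm\<close> and \<open>pp\<close> to multiples of themselves, by factors that are polynomials; so the denominators cancel.
\<close>

lemma Kf_identity:
  assumes y: "0 < y"
  shows "of_real (4 * x) + of_real (1 + x\<^sup>2 - y\<^sup>2) * (of_real B * \<i> / pp x y - of_real A * \<i> / pm x y) +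
    of_real (2 * x * y) * (of_real A / pm x y + of_real B / pp x y + of_real (c / y)) = Kf A B c x y"
proof -
  note nz = pm_pp_not_nonpos(3,4)[OF y, of x]
  have 1: "complex_of_real (2 * x * y) - of_real (1 + x\<^sup>2 - y\<^sup>2) * \<i> = - \<i> * (2 - pm x y) * pm x y"
    by (simp add: pm_def complex_eq_iff power2_eq_square algebra_simps)
  have 2: "complex_of_real (2 * x * y) + of_real (1 + x\<^sup>2 - y\<^sup>2) * \<i> = \<i> * (2 - pp x y) * pp x y"
    by (simp add: pp_def complex_eq_iff power2_eq_square algebra_simps)
  have "of_real (1 + x\<^sup>2 - y\<^sup>2) * (of_real B * \<i> / pp x y - of_real A * \<i> / pm x y) +
    of_real (2 * x * y) * (of_real A / pm x y + of_real B / pp x y + of_real (c / y)) =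
    of_real A * (complex_of_real (2 * x * y) - of_real (1 + x\<^sup>2 - y\<^sup>2) * \<i>) / pm x y +
    of_real B * (complex_of_real (2 * x * y) + of_real (1 + x\<^sup>2 - y\<^sup>2) * \<i>) / pp x y + of_real (2 * x * y * (c / y))"
    by (simp add: algebra_simps add_divide_distrib diff_divide_distrib)
  also have "\<dots> = - \<i> * of_real A * (2 - pm x y) + \<i> * of_real B * (2 - pp x y) + of_real (2 * x * c)"
    unfolding 1 2 using nz y by simp
  finally show ?thesis unfolding Kf_def by (simp only: add.assoc)  (simp add: algebra_simps)
qed

lemma hvd_of_real:
  assumes "(f has_vector_derivative f') (at x)"
  shows "((\<lambda>x. complex_of_real (f x)) has_vector_derivative of_real f') (at x)"
  using bounded_linear.has_vector_derivative[OF bounded_linear_of_real assms] .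

lemma continuous_on_box:
  assumes "0 < e"
  shows "continuous_on ({a..b} \<times> {e..d}) (\<lambda>p. Ef A B c (fst p) (snd p))"
    "continuous_on ({a..b} \<times> {e..d}) (\<lambda>p. inverse (pm (fst p) (snd p)))"
    "continuous_on ({a..b} \<times> {e..d}) (\<lambda>p. inverse (pp (fst p) (snd p)))"
    "continuous_on ({a..b} \<times> {e..d}) (\<lambda>p. qxy (fst p) (snd p))"
proof -
  have s: "0 < snd p" if "p \<in> {a..b} \<times> {e..d}" for p using that assms by auto
  have cp: "continuous_on X (\<lambda>p. pm (fst p) (snd p))" "continuous_on X (\<lambda>p. pp (fst p) (snd p))" for X
    unfolding pm_def pp_def by (intro continuous_intros)+
  show "continuous_on ({a..b} \<times> {e..d}) (\<lambda>p. Ef A B c (fst p) (snd p))"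
    unfolding Ef_def
  proof (intro continuous_intros cp continuous_on_Ln)
    fix p assume "p \<in> {a..b} \<times> {e..d}"
    note p = s[OF this]
    show "pm (fst p) (snd p) \<notin> \<real>\<^sub>\<le>\<^sub>0" "pp (fst p) (snd p) \<notin> \<real>\<^sub>\<le>\<^sub>0"
      by (rule pm_pp_not_nonpos[OF p])+
  qed (use s in fastforce)
  show "continuous_on ({a..b} \<times> {e..d}) (\<lambda>p. inverse (pm (fst p) (snd p)))"
    "continuous_on ({a..b} \<times> {e..d}) (\<lambda>p. inverse (pp (fst p) (snd p)))"
    by (intro continuous_intros cp; use s pm_pp_not_nonpos in fastforce)+
  show "continuous_on ({a..b} \<times> {e..d}) (\<lambda>p. qxy (fst p) (snd p))"
    unfolding qxy_def by (intro continuous_intros) (use s in fastforce)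
qed

text \<open>
  The sublevel sets of \<open>qf\<close> are compact, hence contained in boxes.
\<close>

lemma qxy_ge:
  assumes "0 < y" "1 \<le> M" "\<not> (\<bar>x\<bar> < M \<and> 1 / M < y \<and> y < M)"
  shows "M \<le> qxy x y"
proof -
  have q: "qxy x y = 1 / y + 2 + y + x\<^sup>2 / y"
    using assms(1) by (simp add: qxy_def power2_eq_square field_simps)
  have nn: "0 \<le> x\<^sup>2 / y" "0 < 1 / y" using assms(1) by auto
  consider "M \<le> y" | "y \<le> 1 / M" | "M \<le> \<bar>x\<bar>" "y < M" using assms(3) by linarith
  then show ?thesis
  proof cases
    case 1
    then show ?thesis using q nn assms(1) by linarith
  next
    case 2
    then have "M \<le> 1 / y" using assms by (simp add: field_simps)
    then show ?thesis using q nn assms(1) by linarith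
  next
    case 3
    have "M * y \<le> M * M" using 3 assms by (intro mult_left_mono) auto
    also have "\<dots> \<le> x\<^sup>2" using 3 assms by (metis abs_ge_zero mult_mono order_trans power2_abs power2_eq_square zero_le_one)
    finally have "M \<le> x\<^sup>2 / y" using assms(1) by (simp add: field_simps)
    then show ?thesis using q nn assms(1) by linarith
  qed
qed

text \<open>
  The divergence of \<open>T(q) E X\<close>, where \<open>X\<close> is the rotation field, has no term with \<open>T'\<close>, because \<open>X\<close> annihilates
  \<open>q\<close>. Its two partial derivatives integrate to zero separately, since \<open>T(q)\<close> vanishes at the boundary.
\<close>

theorem radial_divergence_box:
  fixes T T' :: "real \<Rightarrow> complex"
  assumes dT: "\<And>t. (T has_vector_derivative T' t) (at t)" and cT': "continuous_on UNIV T'"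
    and M: "1 \<le> M" and T0: "\<And>t. M \<le> t \<Longrightarrow> T t = 0"
  shows "(LINT p|(lborel \<Otimes>\<^sub>M lborel). indicator ({-M..M} \<times> {1/M..M}) p *\<^sub>R
     (T (qxy (fst p) (snd p)) * (Ef A B c (fst p) (snd p) * Kf A B c (fst p) (snd p)))) = 0"
proof -
  define \<Omega> where "\<Omega> = {-M..M} \<times> {1/M..M}"
  have M0: "0 < M" "0 < 1 / M" using M by auto
  have comp: "compact \<Omega>" unfolding \<Omega>_def by (intro compact_Times compact_Icc)
  have cT: "continuous_on UNIV T"
    using dT by (intro continuous_at_imp_continuous_on ballI has_vector_derivative_continuous)
  define E where "E = Ef A B c"
  define D1 where "D1 x y = of_real (2 * x) * (T (qxy x y) * E x y) + of_real (1 + x\<^sup>2 - y\<^sup>2) *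
     (T (qxy x y) * (E x y * (of_real B * \<i> / pp x y - of_real A * \<i> / pm x y)) + (2 * x / y) *\<^sub>R T' (qxy x y) * E x y)" for x y
  define D2 where "D2 x y = of_real (2 * x) * (T (qxy x y) * E x y) + of_real (2 * x * y) *
     (T (qxy x y) * (E x y * (of_real A / pm x y + of_real B / pp x y + of_real (c / y))) + ((y\<^sup>2 - 1 - x\<^sup>2) / y\<^sup>2) *\<^sub>R T' (qxy x y) * E x y)" for x y
  have d1: "((\<lambda>x. of_real (1 + x\<^sup>2 - y\<^sup>2) * (T (qxy x y) * E x y)) has_vector_derivative D1 x y) (at x)" if y: "0 < y" for x y
  proof -
    have "((\<lambda>x. T (qxy x y)) has_vector_derivative (2 * x / y) *\<^sub>R T' (qxy x y)) (at x)"
      using vector_diff_chain_at[OF qxy_deriv_x[OF y, unfolded has_real_derivative_iff_has_vector_derivative] dT]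
      by (simp add: o_def)
    from has_vector_derivative_mult[OF this Ef_deriv_x[OF y, of A B c x]]
    have TE: "((\<lambda>x. T (qxy x y) * E x y) has_vector_derivative
      T (qxy x y) * (E x y * (of_real B * \<i> / pp x y - of_real A * \<i> / pm x y)) + (2 * x / y) *\<^sub>R T' (qxy x y) * E x y) (at x)"
      by (simp add: E_def)
    have "((\<lambda>x. 1 + x\<^sup>2 - y\<^sup>2) has_vector_derivative 2 * x) (at x)"
      unfolding has_real_derivative_iff_has_vector_derivative[symmetric] by (auto intro!: derivative_eq_intros)
    then have "((\<lambda>x. complex_of_real (1 + x\<^sup>2 - y\<^sup>2)) has_vector_derivative of_real (2 * x)) (at x)"
      by (rule hvd_of_real)
    from has_vector_derivative_mult[OF this TE] show ?thesis
      unfolding D1_def by (simp add: add.commute)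
  qed
  have d2: "((\<lambda>y. of_real (2 * x * y) * (T (qxy x y) * E x y)) has_vector_derivative D2 x y) (at y)" if y: "0 < y" for x y
  proof -
    have "((\<lambda>y. T (qxy x y)) has_vector_derivative ((y\<^sup>2 - 1 - x\<^sup>2) / y\<^sup>2) *\<^sub>R T' (qxy x y)) (at y)"
      using vector_diff_chain_at[OF qxy_deriv_y[OF y, unfolded has_real_derivative_iff_has_vector_derivative] dT]
      by (simp add: o_def)
    from has_vector_derivative_mult[OF this Ef_deriv_y[OF y, of A B c x]]
    have TE: "((\<lambda>y. T (qxy x y) * E x y) has_vector_derivative
      T (qxy x y) * (E x y * (of_real A / pm x y + of_real B / pp x y + of_real (c / y))) + ((y\<^sup>2 - 1 - x\<^sup>2) / y\<^sup>2) *\<^sub>R T' (qxy x y) * E x y) (at y)"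
      by (simp add: E_def)
    have "((\<lambda>y. 2 * x * y) has_vector_derivative 2 * x) (at y)"
      unfolding has_real_derivative_iff_has_vector_derivative[symmetric] by (auto intro!: derivative_eq_intros)
    then have "((\<lambda>y. complex_of_real (2 * x * y)) has_vector_derivative of_real (2 * x)) (at y)"
      by (rule hvd_of_real)
    from has_vector_derivative_mult[OF this TE] show ?thesis
      unfolding D2_def by (simp add: add.commute)
  qed
  note cb = continuous_on_box[OF M0(2), of "-M" M M, folded \<Omega>_def]
  have cq: "continuous_on \<Omega> (\<lambda>p. T (qxy (fst p) (snd p)))" "continuous_on \<Omega> (\<lambda>p. T' (qxy (fst p) (snd p)))"
    by (rule continuous_on_compose2[OF cT cb(4)] continuous_on_compose2[OF cT' cb(4)], simp)+
  have sn: "snd p \<noteq> 0" if "p \<in> \<Omega>" for p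
  proof -
    have "1 / M \<le> snd p" using that by (auto simp: \<Omega>_def)
    then show ?thesis using M0 by linarith
  qed
  have cD1: "continuous_on \<Omega> (\<lambda>p. D1 (fst p) (snd p))"
    unfolding D1_def E_def divide_inverse by (intro continuous_intros cb cq ballI sn)
  have cD2: "continuous_on \<Omega> (\<lambda>p. D2 (fst p) (snd p))"
    unfolding D2_def E_def divide_inverse by (intro continuous_intros cb cq ballI sn) (use sn in auto)
  have i: "integrable (lborel \<Otimes>\<^sub>M lborel) (\<lambda>p. indicator \<Omega> p *\<^sub>R D1 (fst p) (snd p))"
    "integrable (lborel \<Otimes>\<^sub>M lborel) (\<lambda>p. indicator \<Omega> p *\<^sub>R D2 (fst p) (snd p))"
    unfolding lborel_prod by (rule borel_integrable_compact[OF comp cD1] borel_integrable_compact[OF comp cD2])+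
  have ind: "indicator \<Omega> (x, y) = indicator {-M..M} x * (indicator {1/M..M} y :: real)" for x y
    by (auto simp: \<Omega>_def indicator_def)
  have z1: "(LINT p|(lborel \<Otimes>\<^sub>M lborel). indicator \<Omega> p *\<^sub>R D1 (fst p) (snd p)) = 0"
  proof -
    have i1: "integrable (lborel \<Otimes>\<^sub>M lborel) (\<lambda>(x, y). indicator \<Omega> (x, y) *\<^sub>R D1 x y)"
      using i(1) by (simp add: split_def)
    have "(LINT p|(lborel \<Otimes>\<^sub>M lborel). indicator \<Omega> p *\<^sub>R D1 (fst p) (snd p)) =
       (LINT y|lborel. LINT x|lborel. indicator \<Omega> (x, y) *\<^sub>R D1 x y)"
      using lborel_pair.integral_snd[OF i1] by (simp add: split_def)
    also have "\<dots> = (LINT y::real|lborel. 0)"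
    proof (intro Bochner_Integration.integral_cong refl)
      fix y :: real
      show "(LINT x|lborel. indicator \<Omega> (x, y) *\<^sub>R D1 x y) = 0"
      proof (cases "y \<in> {1/M..M}")
        case True
        then have "1 / M \<le> y" by simp
        then have y: "0 < y" using M0(2) by linarith
        have "(LINT x|lborel. indicator {-M..M} x *\<^sub>R D1 x y) =
          of_real (1 + M\<^sup>2 - y\<^sup>2) * (T (qxy M y) * E M y) - of_real (1 + (-M)\<^sup>2 - y\<^sup>2) * (T (qxy (-M) y) * E (-M) y)"
        proof (rule integral_FTC_atLeastAtMost)
          show "- M \<le> M" using M0 by simp
          show "((\<lambda>x. of_real (1 + x\<^sup>2 - y\<^sup>2) * (T (qxy x y) * E x y)) has_vector_derivative D1 x y) (at x within {-M..M})" for x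
            by (rule has_vector_derivative_at_within[OF d1[OF y]])
          have "continuous_on {-M..M} (\<lambda>x. (\<lambda>p. D1 (fst p) (snd p)) (x, y))"
            by (rule continuous_on_compose2[OF cD1]) (use True in \<open>auto simp: \<Omega>_def intro!: continuous_intros\<close>)
          then show "continuous_on {-M..M} (\<lambda>x. D1 x y)" by simp
        qed
        moreover have "T (qxy M y) = 0" "T (qxy (-M) y) = 0"
          by (rule T0, rule qxy_ge[OF y M], use M0 in simp)+
        ultimately show ?thesis using True by (simp add: ind)
      next
        case False
        then show ?thesis by (simp add: ind)
      qed
    qed
    finally show ?thesis by simp
  qed
  have z2: "(LINT p|(lborel \<Otimes>\<^sub>M lborel). indicator \<Omega> p *\<^sub>R D2 (fst p) (snd p)) = 0"
  proof -
    have i2: "integrable (lborel \<Otimes>\<^sub>M lborel) (\<lambda>(x, y). indicator \<Omega> (x, y) *\<^sub>R D2 x y)"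
      using i(2) by (simp add: split_def)
    have "(LINT p|(lborel \<Otimes>\<^sub>M lborel). indicator \<Omega> p *\<^sub>R D2 (fst p) (snd p)) =
       (LINT x|lborel. LINT y|lborel. indicator \<Omega> (x, y) *\<^sub>R D2 x y)"
      using lborel_pair.integral_fst[OF i2] by (simp add: split_def)
    also have "\<dots> = (LINT x::real|lborel. 0)"
    proof (intro Bochner_Integration.integral_cong refl)
      fix x :: real
      show "(LINT y|lborel. indicator \<Omega> (x, y) *\<^sub>R D2 x y) = 0"
      proof (cases "x \<in> {-M..M}")
        case True
        have "(LINT y|lborel. indicator {1/M..M} y *\<^sub>R D2 x y) =
          of_real (2 * x * M) * (T (qxy x M) * E x M) - of_real (2 * x * (1/M)) * (T (qxy x (1/M)) * E x (1/M))"
        proof (rule integral_FTC_atLeastAtMost)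
          show "1 / M \<le> M" using M by (simp add: divide_le_eq mult_ge1_I)
          show "((\<lambda>y. of_real (2 * x * y) * (T (qxy x y) * E x y)) has_vector_derivative D2 x y) (at y within {1/M..M})"
            if "1 / M \<le> y" for y
            by (rule has_vector_derivative_at_within[OF d2]) (use that M0 in linarith)
          have "continuous_on {1/M..M} (\<lambda>y. (\<lambda>p. D2 (fst p) (snd p)) (x, y))"
            by (rule continuous_on_compose2[OF cD2]) (use True in \<open>auto simp: \<Omega>_def intro!: continuous_intros\<close>)
          then show "continuous_on {1/M..M} (\<lambda>y. D2 x y)" by simp
        qed
        moreover have "T (qxy x M) = 0" by (rule T0, rule qxy_ge[OF M0(1) M]) simp
        moreover have "T (qxy x (1/M)) = 0" by (rule T0, rule qxy_ge[OF M0(2) M]) simp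
        ultimately show ?thesis using True by (simp add: ind)
      next
        case False
        then show ?thesis by (simp add: ind)
      qed
    qed
    finally show ?thesis by simp
  qed
  have sum: "D1 x y + D2 x y = T (qxy x y) * (E x y * Kf A B c x y)" if y: "0 < y" for x y
  proof -
    have r: "complex_of_real (1 + x\<^sup>2 - y\<^sup>2) * of_real (2 * x / y) + of_real (2 * x * y) * of_real ((y\<^sup>2 - 1 - x\<^sup>2) / y\<^sup>2) = 0"
    proof -
      have "(1 + x\<^sup>2 - y\<^sup>2) * (2 * x / y) + (2 * x * y) * ((y\<^sup>2 - 1 - x\<^sup>2) / y\<^sup>2) = 0"
        using y by (simp add: power2_eq_square field_simps)
      then have "complex_of_real ((1 + x\<^sup>2 - y\<^sup>2) * (2 * x / y) + (2 * x * y) * ((y\<^sup>2 - 1 - x\<^sup>2) / y\<^sup>2)) = of_real 0"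
        by (simp only:)
      then show ?thesis by (simp only: of_real_add of_real_mult of_real_0)
    qed
    define U where "U = of_real B * \<i> / pp x y - of_real A * \<i> / pm x y"
    define V where "V = of_real A / pm x y + of_real B / pp x y + complex_of_real (c / y)"
    define t t' e where "t = T (qxy x y)" and "t' = T' (qxy x y)" and "e = E x y"
    define X1 X2 r1 r2 where "X1 = complex_of_real (1 + x\<^sup>2 - y\<^sup>2)" and "X2 = complex_of_real (2 * x * y)"
      and "r1 = complex_of_real (2 * x / y)" and "r2 = complex_of_real ((y\<^sup>2 - 1 - x\<^sup>2) / y\<^sup>2)"
    have K: "of_real (4 * x) + X1 * U + X2 * V = Kf A B c x y"
      unfolding X1_def X2_def U_def V_def by (rule Kf_identity[OF y])
    have r0: "X1 * r1 + X2 * r2 = 0" using r unfolding X1_def X2_def r1_def r2_def .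
    have "D1 x y + D2 x y = of_real (2 * x) * (t * e) + X1 * (t * (e * U) + r1 * t' * e) +
        (of_real (2 * x) * (t * e) + X2 * (t * (e * V) + r2 * t' * e))"
      unfolding D1_def D2_def scaleR_conv_of_real U_def V_def t_def t'_def e_def X1_def X2_def r1_def r2_def ..
    also have "\<dots> = t * (e * (of_real (4 * x) + X1 * U + X2 * V)) + (X1 * r1 + X2 * r2) * (t' * e)"
      by (simp add: algebra_simps)
    finally show ?thesis unfolding K r0 by (simp add: t_def e_def)
  qed
  have "(LINT p|(lborel \<Otimes>\<^sub>M lborel). indicator \<Omega> p *\<^sub>R (T (qxy (fst p) (snd p)) * (E (fst p) (snd p) * Kf A B c (fst p) (snd p)))) =
     (LINT p|(lborel \<Otimes>\<^sub>M lborel). indicator \<Omega> p *\<^sub>R D1 (fst p) (snd p) + indicator \<Omega> p *\<^sub>R D2 (fst p) (snd p))"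
  proof (intro Bochner_Integration.integral_cong refl)
    fix p :: "real \<times> real"
    show "indicator \<Omega> p *\<^sub>R (T (qxy (fst p) (snd p)) * (E (fst p) (snd p) * Kf A B c (fst p) (snd p))) =
       indicator \<Omega> p *\<^sub>R D1 (fst p) (snd p) + indicator \<Omega> p *\<^sub>R D2 (fst p) (snd p)"
    proof (cases "p \<in> \<Omega>")
      case True
      then have "1 / M \<le> snd p" by (auto simp: \<Omega>_def)
      then have "0 < snd p" using M0 by linarith
      then show ?thesis using sum[of "snd p" "fst p"] True by simp
    qed simp
  qed
  also have "\<dots> = 0"
    unfolding Bochner_Integration.integral_add[OF i] z1 z2 by simp
  finally show ?thesis unfolding \<Omega>_def E_def .
qed

text \<open>
  The square makes the cut-off at \<open>M\<close> continuously differentiable, as the divergence theorem demands.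
\<close>

lemma deriv_max_square:
  "((\<lambda>t. (max 0 (M - t))\<^sup>2) has_real_derivative - 2 * max 0 (M - t)) (at t)"
proof -
  have *: "((\<lambda>u::real. (max 0 u)\<^sup>2) has_real_derivative 2 * max 0 u) (at u)" for u
  proof -
    consider "u < 0" | "u = 0" | "0 < u" by linarith
    then show ?thesis
    proof cases
      case 1
      have "((\<lambda>u::real. (max 0 u)\<^sup>2) has_real_derivative 0) (at u)"
        by (rule has_field_derivative_transform_within_open[of "\<lambda>u. 0" _ _ "{..<0}"]) (use 1 in auto)
      then show ?thesis using 1 by simp
    next
      case 2
      have "((\<lambda>u::real. (max 0 u)\<^sup>2) has_real_derivative 0) (at 0)"
        unfolding CARAT_DERIV
        by (intro exI[of _ "\<lambda>u. max 0 u"] conjI allI continuous_intros) (auto simp: max_def power2_eq_square)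
      then show ?thesis using 2 by simp
    next
      case 3
      have "((\<lambda>u::real. (max 0 u)\<^sup>2) has_real_derivative 2 * u) (at u)"
        by (rule has_field_derivative_transform_within_open[of "\<lambda>u. u\<^sup>2" _ _ "{0<..}"])
          (use 3 in \<open>auto intro!: derivative_eq_intros\<close>)
      then show ?thesis using 3 by simp
    qed
  qed
  have "((\<lambda>t. M - t) has_real_derivative - 1) (at t)"
    by (auto intro!: derivative_eq_intros)
  from DERIV_chain2[OF * this] show ?thesis by simp
qed

lemma qxy_measurable [measurable]:
  "(\<lambda>p. qxy (fst p) (snd p)) \<in> borel_measurable (lborel \<Otimes>\<^sub>M lborel)"
  unfolding qxy_def by measurable

text \<open>
  The profile \<open>R\<close> is merely continuous. On \<open>[0,M]\<close> it is approximated by polynomials, to which the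
  divergence theorem applies after multiplication by the cut-off \<open>(M - q)\<^sub>+\<^sup>2\<close>; then \<open>M\<close> tends to infinity.
\<close>

theorem radial_orthogonal:
  fixes R :: "real \<Rightarrow> complex" and A B c :: real
  defines "W \<equiv> (\<lambda>p. indicator {0<..} (snd p) *\<^sub>R (Ef A B c (fst p) (snd p) * Kf A B c (fst p) (snd p)))"
  assumes R: "continuous_on UNIV R" "\<And>t. cmod (R t) \<le> Bd"
    and W: "integrable (lborel \<Otimes>\<^sub>M lborel) W"
  shows "(LINT p|(lborel \<Otimes>\<^sub>M lborel). R (qxy (fst p) (snd p)) * W p) = 0"
proof -
  let ?L = "lborel \<Otimes>\<^sub>M lborel :: (real \<times> real) measure"
  define Q where "Q p = qxy (fst p) (snd p)" for p
  define k where "k M t = (max 0 (M - t))\<^sup>2" for M t :: real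
  have [measurable]: "R \<in> borel_measurable borel" "W \<in> borel_measurable ?L" "Q \<in> borel_measurable ?L"
    using R(1) W qxy_measurable by (auto intro: borel_measurable_continuous_onI simp: Q_def[abs_def])
  have km [measurable]: "k M \<in> borel_measurable borel" for M unfolding k_def by measurable
  have Qpos: "0 \<le> Q p" if "W p \<noteq> 0" for p
    using that by (auto simp: W_def Q_def qxy_def indicator_def split: if_splits)
  have kb: "0 \<le> k M t" "0 \<le> t \<Longrightarrow> 0 \<le> M \<Longrightarrow> k M t \<le> M\<^sup>2" for M t
    unfolding k_def by (auto intro!: power_mono)
  have Bd: "0 \<le> Bd" using R(2)[of 0] norm_ge_zero order_trans by blast
  define N where "N = (LINT p|?L. cmod (W p))"
  have N0: "0 \<le> N" unfolding N_def by simp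
  have iRk: "integrable ?L (\<lambda>p. f (Q p) * (of_real (k M (Q p)) * W p))"
    if f [measurable]: "f \<in> borel_measurable borel" and fb: "\<And>t. 0 \<le> t \<Longrightarrow> t \<le> M \<Longrightarrow> cmod (f t) \<le> D" and M: "1 \<le> M"
    for f :: "real \<Rightarrow> complex" and M D
  proof (rule Bochner_Integration.integrable_bound)
    show "integrable ?L (\<lambda>p. (D * M\<^sup>2) *\<^sub>R W p)" using W by simp
    have "cmod (f (Q p) * (of_real (k M (Q p)) * W p)) \<le> cmod ((D * M\<^sup>2) *\<^sub>R W p)" for p
    proof (cases "W p = 0 \<or> M < Q p")
      case True
      then show ?thesis by (auto simp: k_def)
    next
      case False
      then have "0 \<le> Q p" "Q p \<le> M" using Qpos by auto
      then have "cmod (f (Q p)) * k M (Q p) \<le> D * M\<^sup>2"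
        using fb[of "Q p"] kb[of M "Q p"] kb(2)[of "Q p" M] M norm_ge_zero[of "f (Q p)"]
        by (intro mult_mono) (auto intro: order_trans[OF norm_ge_zero])
      then have "cmod (f (Q p)) * k M (Q p) * cmod (W p) \<le> \<bar>D * M\<^sup>2\<bar> * cmod (W p)"
        by (intro mult_right_mono) auto
      then show ?thesis using kb(1)[of M "Q p"] by (simp add: norm_mult mult.assoc)
    qed
    then show "AE p in ?L. cmod (f (Q p) * (of_real (k M (Q p)) * W p)) \<le> cmod ((D * M\<^sup>2) *\<^sub>R W p)" by simp
  qed measurable
  have fin: "(LINT p|?L. R (Q p) * (of_real (k M (Q p)) * W p)) = 0" (is "?I = 0") if M: "1 \<le> M" for M
  proof -
    have "cmod ?I \<le> e * (M\<^sup>2 * N)" if e: "0 < e" for e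
    proof -
      obtain P where P: "polynomial_function P" "\<And>t. t \<in> {0..M} \<Longrightarrow> cmod (R t - P t) < e"
        using Stone_Weierstrass_polynomial_function[OF compact_Icc continuous_on_subset[OF R(1)] e, of 0 M] by auto
      obtain P' where P': "polynomial_function P'" "\<And>t. (P has_vector_derivative P' t) (at t)"
        using has_vector_derivative_polynomial_function[OF P(1)] by blast
      have cP: "continuous_on UNIV P" "continuous_on UNIV P'"
        using P P' continuous_on_polymonial_function by blast+
      have [measurable]: "P \<in> borel_measurable borel" by (rule borel_measurable_continuous_onI[OF cP(1)])
      define T where "T t = P t * of_real (k M t)" for t
      define T' where "T' t = P t * of_real (- 2 * max 0 (M - t)) + P' t * of_real (k M t)" for t
      have "(LINT p|?L. indicator ({-M..M} \<times> {1/M..M}) p *\<^sub>R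
         (T (qxy (fst p) (snd p)) * (Ef A B c (fst p) (snd p) * Kf A B c (fst p) (snd p)))) = 0"
      proof (rule radial_divergence_box[OF _ _ M])
        show "(T has_vector_derivative T' t) (at t)" for t
          unfolding T_def T'_def k_def
          by (rule has_vector_derivative_mult[OF P'(2) hvd_of_real[OF
                deriv_max_square[unfolded has_real_derivative_iff_has_vector_derivative]]])
        show "continuous_on UNIV T'" unfolding T'_def k_def by (intro continuous_intros cP)
        show "T t = 0" if "M \<le> t" for t using that by (simp add: T_def k_def)
      qed
      moreover have "indicator ({-M..M} \<times> {1/M..M}) p *\<^sub>R
         (T (qxy (fst p) (snd p)) * (Ef A B c (fst p) (snd p) * Kf A B c (fst p) (snd p))) = P (Q p) * (of_real (k M (Q p)) * W p)" for p
      proof (cases "0 < snd p")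
        case y: True
        show ?thesis
        proof (cases "p \<in> {-M..M} \<times> {1/M..M}")
          case True
          then show ?thesis using y by (simp add: T_def W_def Q_def)
        next
          case False
          then have "M \<le> qxy (fst p) (snd p)"
            by (intro qxy_ge[OF y M]) (auto simp: mem_Times_iff)
          then show ?thesis using False by (simp add: Q_def k_def)
        qed
      next
        case False
        then have "\<not> 1 / M \<le> snd p" using M by (smt (verit) divide_pos_pos)
        then have "p \<notin> {-M..M} \<times> {1/M..M}" by (auto simp: mem_Times_iff)
        then show ?thesis using False by (simp add: W_def)
      qed
      ultimately have P0: "(LINT p|?L. P (Q p) * (of_real (k M (Q p)) * W p)) = 0" by simp
      have "compact (P ` {0..M})" by (rule compact_continuous_image[OF continuous_on_subset[OF cP(1)] compact_Icc]) simp
      then obtain D where D: "\<And>t. t \<in> {0..M} \<Longrightarrow> cmod (P t) \<le> D"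
        using compact_imp_bounded bounded_iff by (metis imageI)
      have iP: "integrable ?L (\<lambda>p. P (Q p) * (of_real (k M (Q p)) * W p))"
        by (rule iRk[of P M D]) (use D M in auto)
      have iR: "integrable ?L (\<lambda>p. R (Q p) * (of_real (k M (Q p)) * W p))"
        by (rule iRk[of R M Bd]) (use R M in auto)
      have "?I = (LINT p|?L. (R (Q p) - P (Q p)) * (of_real (k M (Q p)) * W p))"
        unfolding left_diff_distrib Bochner_Integration.integral_diff[OF iR iP] P0 by simp
      also have "cmod \<dots> \<le> (LINT p|?L. (e * M\<^sup>2) * cmod (W p))"
      proof (rule Bochner_Integration.integral_norm_bound_integral)
        show "integrable ?L (\<lambda>p. (R (Q p) - P (Q p)) * (of_real (k M (Q p)) * W p))"
          unfolding left_diff_distrib by (rule Bochner_Integration.integrable_diff[OF iR iP])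
        show "integrable ?L (\<lambda>p. (e * M\<^sup>2) * cmod (W p))" using W by simp
        fix p
        show "cmod ((R (Q p) - P (Q p)) * (of_real (k M (Q p)) * W p)) \<le> (e * M\<^sup>2) * cmod (W p)"
        proof (cases "W p = 0 \<or> M < Q p")
          case True
          then show ?thesis using e by (auto simp: k_def)
        next
          case False
          then have q: "0 \<le> Q p" "Q p \<le> M" using Qpos by auto
          then have "cmod (R (Q p) - P (Q p)) * k M (Q p) \<le> e * M\<^sup>2"
            using P(2)[of "Q p"] kb(1)[of M "Q p"] kb(2)[of "Q p" M] M e by (intro mult_mono) (auto intro: less_imp_le)
          then have "cmod (R (Q p) - P (Q p)) * k M (Q p) * cmod (W p) \<le> (e * M\<^sup>2) * cmod (W p)"
            by (intro mult_right_mono) auto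
          then show ?thesis using kb(1)[of M "Q p"] by (simp add: norm_mult mult.assoc)
        qed
      qed
      finally show ?thesis by (simp add: N_def mult.assoc)
    qed
    then have *: "cmod ?I \<le> e * (M\<^sup>2 * N)" if "0 < e" for e using that by blast
    have "cmod ?I \<le> 0"
    proof (rule field_le_epsilon)
      fix e :: real assume e: "0 < e"
      define K where "K = M\<^sup>2 * N + 1"
      have K: "0 < K" unfolding K_def using N0 by (simp add: add_nonneg_pos)
      have "cmod ?I \<le> e / K * (M\<^sup>2 * N)" using e K by (intro *) simp
      also have "\<dots> \<le> e / K * K" using e K by (intro mult_left_mono) (auto simp: K_def)
      finally show "cmod ?I \<le> 0 + e" using K by simp
    qed
    then show ?thesis by simp
  qed
  have "(\<lambda>n. LINT p|?L. of_real (k (real (Suc n)) (Q p) / (real (Suc n))\<^sup>2) * (R (Q p) * W p)) \<longlonglongrightarrow> (LINT p|?L. R (Q p) * W p)"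
  proof (rule integral_dominated_convergence[where w = "\<lambda>p. Bd * cmod (W p)"])
    show "integrable ?L (\<lambda>p. Bd * cmod (W p))" using W by simp
    have "(\<lambda>n. of_real (k (real (Suc n)) (Q p) / (real (Suc n))\<^sup>2) * (R (Q p) * W p)) \<longlonglongrightarrow> of_real 1 * (R (Q p) * W p)" for p
    proof (intro tendsto_mult tendsto_const tendsto_of_real)
      have "(\<lambda>n. (max 0 (1 - Q p * (1 / real (Suc n))))\<^sup>2) \<longlonglongrightarrow> (max 0 (1 - Q p * 0))\<^sup>2"
        using LIMSEQ_inverse_real_of_nat by (intro tendsto_intros) (simp add: inverse_eq_divide)
      moreover have "(max 0 (1 - Q p * (1 / real (Suc n))))\<^sup>2 = k (real (Suc n)) (Q p) / (real (Suc n))\<^sup>2" for n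
      proof -
        have "max 0 (real (Suc n) - Q p) = real (Suc n) * max 0 (1 - Q p * (1 / real (Suc n)))"
          by (simp add: max_mult_distrib_left right_diff_distrib)
        then show ?thesis unfolding k_def by (simp only: power_mult_distrib) simp
      qed
      ultimately show "(\<lambda>n. k (real (Suc n)) (Q p) / (real (Suc n))\<^sup>2) \<longlonglongrightarrow> 1" by simp
    qed
    then show "AE p in ?L. (\<lambda>n. of_real (k (real (Suc n)) (Q p) / (real (Suc n))\<^sup>2) * (R (Q p) * W p)) \<longlonglongrightarrow> R (Q p) * W p" by simp
    fix n
    have "cmod (of_real (k (real (Suc n)) (Q p) / (real (Suc n))\<^sup>2) * (R (Q p) * W p)) \<le> Bd * cmod (W p)" for p
    proof (cases "W p = 0")
      case False
      then have "k (real (Suc n)) (Q p) / (real (Suc n))\<^sup>2 \<le> 1" "0 \<le> k (real (Suc n)) (Q p) / (real (Suc n))\<^sup>2"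
        using kb(2)[OF Qpos[OF False], of "real (Suc n)"] kb(1)[of "real (Suc n)" "Q p"] by (auto simp: divide_le_eq)
      then have "\<bar>k (real (Suc n)) (Q p) / (real (Suc n))\<^sup>2\<bar> \<le> 1" by (simp only: abs_of_nonneg)
      then have "\<bar>k (real (Suc n)) (Q p) / (real (Suc n))\<^sup>2\<bar> * (cmod (R (Q p)) * cmod (W p)) \<le> 1 * (Bd * cmod (W p))"
        using Bd by (intro mult_mono mult_right_mono R mult_nonneg_nonneg norm_ge_zero) simp_all
      then show ?thesis unfolding norm_mult norm_of_real by simp
    qed simp
    then show "AE p in ?L. cmod (of_real (k (real (Suc n)) (Q p) / (real (Suc n))\<^sup>2) * (R (Q p) * W p)) \<le> Bd * cmod (W p)" by simp
  qed measurable
  moreover have "(LINT p|?L. of_real (k (real (Suc n)) (Q p) / (real (Suc n))\<^sup>2) * (R (Q p) * W p)) = 0" for n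
  proof -
    have "of_real (k (real (Suc n)) (Q p) / (real (Suc n))\<^sup>2) * (R (Q p) * W p) =
       of_real (1 / (real (Suc n))\<^sup>2) * (R (Q p) * (of_real (k (real (Suc n)) (Q p)) * W p))" for p
      by simp
    moreover have "1 \<le> real (Suc n)" by simp
    ultimately show ?thesis using fin[of "real (Suc n)"] by (simp only: integral_mult_right_zero mult_zero_right)
  qed
  ultimately have "(\<lambda>n::nat. 0) \<longlonglongrightarrow> (LINT p|?L. R (Q p) * W p)" by (simp only:)
  then show ?thesis unfolding Q_def using LIMSEQ_unique tendsto_const by blast
qed

section \<open>Integrals against products of powers\<close>

text \<open>
  The powers are those for which the integral against \<open>wt h h\<close> splits into a product, see \<open>Jint_wt\<close>.
\<close>

definition Jf :: "real \<Rightarrow> real \<Rightarrow> real \<Rightarrow> real \<Rightarrow> complex" where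
  "Jf a b x y = of_real (y powr (b - 3 / 2)) * exp (- (of_real (a + b) * Ln (pp x y)))"

lemma cmod_pp: "(cmod (pp x y))\<^sup>2 = (1 + y)\<^sup>2 + x\<^sup>2"
  by (simp add: pp_def cmod_power2)

lemma cmod_pp_ge:
  assumes "0 < y"
  shows "1 + y \<le> cmod (pp x y)"
proof -
  have "(1 + y)\<^sup>2 \<le> (cmod (pp x y))\<^sup>2" unfolding cmod_pp by simp
  then show ?thesis using assms by (simp add: power2_le_iff_abs_le)
qed

text \<open>
  Since \<open>\<bar>pp\<bar>\<close> is at least \<open>y\<close>, the power of \<open>y\<close> costs no more than the same power of \<open>\<bar>pp\<bar>\<close>. This leaves
  \<open>\<bar>pp\<bar>\<close> to the exponent \<open>-(a + 3/2)\<close>; an exponent of at most \<open>-4\<close> is what the right-hand side takes.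
\<close>

lemma cmod_Jf_le:
  assumes y: "0 < y" and ab: "3 \<le> a" "3 \<le> b"
  shows "cmod (Jf a b x y) \<le> inverse (1 + x\<^sup>2) * inverse (1 + y\<^sup>2)"
proof -
  define r where "r = cmod (pp x y)"
  have r: "1 + y \<le> r" "1 \<le> r" "0 < r" using cmod_pp_ge[OF y, of x] y by (auto simp: r_def)
  have "cmod (Jf a b x y) = y powr (b - 3 / 2) * r powr (- (a + b))"
    using r y unfolding Jf_def norm_mult norm_exp_eq_Re
    by (simp add: r_def powr_def pm_pp_not_nonpos(4)[OF y] algebra_simps)
  also have "\<dots> \<le> r powr (b - 3 / 2) * r powr (- (a + b))"
    using r y ab by (intro mult_right_mono powr_mono2) auto
  also have "\<dots> = r powr (- (a + 3 / 2))" unfolding powr_add[symmetric] by (simp add: algebra_simps)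
  also have "\<dots> \<le> r powr (- 4)" using ab r by (intro powr_mono) auto
  also have "\<dots> = inverse (r\<^sup>2 * r\<^sup>2)" using r by (simp add: powr_minus flip: power_add)
  also have "\<dots> \<le> inverse ((1 + x\<^sup>2) * (1 + y\<^sup>2))"
  proof (intro le_imp_inverse_le mult_mono)
    have *: "1 \<le> (1 + y)\<^sup>2" "1 + y\<^sup>2 \<le> (1 + y)\<^sup>2" using y by (auto simp: power2_eq_square algebra_simps)
    show "1 + x\<^sup>2 \<le> r\<^sup>2" "1 + y\<^sup>2 \<le> r\<^sup>2"
      unfolding r_def cmod_pp using * zero_le_power2[of x] by linarith+
    show "0 < (1 + x\<^sup>2) * (1 + y\<^sup>2)" by (intro mult_pos_pos) (simp_all add: add_pos_nonneg)
  qed auto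
  finally show ?thesis by simp
qed

lemma pp_measurable [measurable]:
  "(\<lambda>p. pp (fst p) (snd p)) \<in> borel_measurable (lborel \<Otimes>\<^sub>M lborel)"
  "(\<lambda>p. pm (fst p) (snd p)) \<in> borel_measurable (lborel \<Otimes>\<^sub>M lborel)"
  unfolding pp_def pm_def by measurable

lemma Jf_measurable [measurable]:
  "(\<lambda>p. Jf a b (fst p) (snd p)) \<in> borel_measurable (lborel \<Otimes>\<^sub>M lborel)"
  unfolding Jf_def by measurable

lemma inverse_1_plus_square_integrable:
  "integrable lborel (\<lambda>x::real. inverse (1 + x\<^sup>2))"
  using integrable_inverse_1_plus_square by (simp add: set_integrable_def)

lemma Jf_integrable:
  fixes F :: "real \<times> real \<Rightarrow> complex"
  assumes ab: "3 \<le> a" "3 \<le> b" and F [measurable]: "F \<in> borel_measurable (lborel \<Otimes>\<^sub>M lborel)"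
    and Bd: "\<And>p. cmod (F p) \<le> Bd" and F0: "\<And>p. snd p \<le> 0 \<Longrightarrow> F p = 0"
  shows "integrable (lborel \<Otimes>\<^sub>M lborel) (\<lambda>p. F p * Jf a b (fst p) (snd p))"
proof (rule Bochner_Integration.integrable_bound)
  have B0: "0 \<le> Bd" using Bd norm_ge_zero order_trans by blast
  show "integrable (lborel \<Otimes>\<^sub>M lborel) (\<lambda>p::real \<times> real. Bd * (inverse (1 + (fst p)\<^sup>2) * inverse (1 + (snd p)\<^sup>2)))"
  proof (intro integrable_mult_right lborel_pair.Fubini_integrable)
    show "integrable lborel (\<lambda>x. LINT y|lborel. norm (inverse (1 + (fst (x, y :: real))\<^sup>2) * inverse (1 + (snd (x, y))\<^sup>2) :: real))"
      using inverse_1_plus_square_integrable by (simp add: norm_mult abs_mult)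
    show "AE x in lborel. integrable lborel (\<lambda>y. inverse (1 + (fst (x, y))\<^sup>2) * inverse (1 + (snd (x, y))\<^sup>2) :: real)"
      using inverse_1_plus_square_integrable by simp
  qed measurable
  have "cmod (F p * Jf a b (fst p) (snd p)) \<le> Bd * (inverse (1 + (fst p)\<^sup>2) * inverse (1 + (snd p)\<^sup>2))" for p
  proof (cases "0 < snd p")
    case True
    show ?thesis unfolding norm_mult
      by (rule mult_mono[OF Bd cmod_Jf_le[OF True ab] B0]) simp
  next
    case False
    then show ?thesis using F0[of p] B0 by simp
  qed
  then show "AE p in lborel \<Otimes>\<^sub>M lborel. cmod (F p * Jf a b (fst p) (snd p)) \<le>
     norm (Bd * (inverse (1 + (fst p)\<^sup>2) * inverse (1 + (snd p)\<^sup>2)))"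
    by (intro AE_I2) (smt (verit) real_norm_def)
qed measurable

definition hp :: "(complex \<Rightarrow> complex) \<Rightarrow> real \<times> real \<Rightarrow> complex" where
  "hp F p = (if 0 < snd p then F (Complex (fst p) (snd p)) else 0)"

lemma hp_measurable:
  assumes "continuous_on upper F"
  shows "hp F \<in> borel_measurable (lborel \<Otimes>\<^sub>M lborel)"
proof -
  have [measurable]: "(\<lambda>z. if z \<in> upper then F z else 0) \<in> borel_measurable borel"
    using measurable_mu_continuous[OF assms] unfolding measurable_mu_iff .
  have "hp F = (\<lambda>p. (\<lambda>z. if z \<in> upper then F z else 0) (Complex (fst p) (snd p)))"
    by (auto simp: hp_def upper_def)
  then show ?thesis by simp
qed

text \<open>
  The exponents are chosen so that the phase turns \<open>pm\<^sup>A pp\<^sup>B\<close> into a power of \<open>pp\<close> alone; the linear function \<open>Kf\<close>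
  is then expressed through \<open>pp\<close>, \<open>y\<close> and \<open>1\<close>, which lead to the three pairs of exponents.
\<close>

lemma phase_Ef_Kf:
  fixes s a b :: real
  assumes y: "0 < y"
  defines "A \<equiv> - s / 2" and "B \<equiv> s / 2 - a - b - 1" and "c \<equiv> b - 3 / 2"
  shows "exp (\<i> * of_real (s * Im (Ln (pm x y)))) * (Ef A B c x y * Kf A B c x y) =
    \<i> * (of_real (a - b) * Jf a b x y - of_real (s - 2 * b - 1) * Jf a (b + 1) x y + of_real (s - 2 * a - 1) * Jf (a + 1) b x y)"
proof -
  define L where "L = Ln (pp x y)"
  have Lm: "Ln (pm x y) = cnj L"
    unfolding L_def cnj_Ln[OF pm_pp_not_nonpos(2)[OF y]] by (simp add: pm_def pp_def)
  define E where "E = exp (- (of_real (a + b + 1) * L))"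
  have "\<i> * of_real (s * Im (cnj L)) + (of_real A * cnj L + of_real B * L) = - (of_real (a + b + 1) * L)"
    by (simp add: A_def B_def complex_eq_iff algebra_simps)
  then have 1: "exp (\<i> * of_real (s * Im (Ln (pm x y)))) * Ef A B c x y = E * of_real (y powr c)"
    unfolding Ef_def Lm L_def[symmetric] E_def mult.assoc[symmetric] exp_add[symmetric] by (simp only:)
  have eL: "exp L = pp x y" unfolding L_def using pm_pp_not_nonpos(4)[OF y] by simp
  have J1: "Jf a b x y = of_real (y powr c) * (E * pp x y)"
    unfolding Jf_def L_def[symmetric] E_def c_def unfolding eL[symmetric] exp_add[symmetric] by (simp add: algebra_simps)
  have "b + 1 - 3 / 2 = c + 1" by (simp add: c_def)
  then have yc: "y powr (b + 1 - 3 / 2) = y powr c * y"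
    using y by (simp add: powr_add)
  have J2: "Jf a (b + 1) x y = of_real (y powr c) * (E * of_real y)"
    unfolding Jf_def L_def[symmetric] E_def yc by (simp add: algebra_simps)
  have J3: "Jf (a + 1) b x y = of_real (y powr c) * E"
    unfolding Jf_def L_def[symmetric] E_def c_def by (simp add: algebra_simps)
  have K: "Kf A B c x y = \<i> * (of_real (a - b) * pp x y - of_real (s - 2 * b - 1) * of_real y + of_real (s - 2 * a - 1))"
    by (simp add: Kf_def A_def B_def c_def pm_def pp_def complex_eq_iff algebra_simps)
  show ?thesis
    unfolding mult.assoc[symmetric] 1 unfolding J1 J2 J3 K by (simp add: algebra_simps)
qed

definition Jint :: "(complex \<Rightarrow> complex) \<Rightarrow> real \<Rightarrow> real \<Rightarrow> complex" where
  "Jint F a b = (LINT p|(lborel \<Otimes>\<^sub>M lborel). hp F p * Jf a b (fst p) (snd p))"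

text \<open>
  Without its phase \<open>F\<close> is a function of \<open>qf\<close>, so \<open>radial_orthogonal\<close> applies to the density that contains
  the phase.
\<close>

theorem Jint_relation:
  assumes F: "continuous_on upper F" "\<And>z. z \<in> upper \<Longrightarrow> cmod (F z) \<le> Bd"
    and inv: "\<And>\<theta> z. sin \<theta> \<noteq> 0 \<Longrightarrow> z \<in> upper \<Longrightarrow> jfac s (rot \<theta>) z * F (mob (rot \<theta>) z) = jfac s (rot \<theta>) \<i> * F z"
    and ab: "3 \<le> a" "3 \<le> b"
  shows "of_real (a - b) * Jint F a b - of_real (s - 2 * b - 1) * Jint F a (b + 1) + of_real (s - 2 * a - 1) * Jint F (a + 1) b = 0"
proof -
  let ?L = "lborel \<Otimes>\<^sub>M lborel :: (real \<times> real) measure"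
  define S where "S = unphase s F"
  have cS: "continuous_on upper S" unfolding S_def by (rule unphase_continuous[OF F(1)])
  have iS: "S (mob (rot \<theta>) z) = S z" if "sin \<theta> \<noteq> 0" "z \<in> upper" for \<theta> z
    unfolding S_def by (rule unphase_rot[OF rot_SL2R mob_rot_i _ that(2) inv[OF that]]) (simp add: that)
  obtain R where R: "continuous_on UNIV R" "\<And>z. z \<in> upper \<Longrightarrow> S z = R (qf z)" "\<And>t. \<exists>z\<in>upper. R t = S z"
    using radial_profile[OF cS iS] by blast
  have "cmod (S z) \<le> Bd" if "z \<in> upper" for z
    using F(2)[OF that] by (simp add: S_def unphase_def norm_mult)
  then have Rb: "cmod (R t) \<le> Bd" for t using R(3)[of t] by auto
  define A B c where "A = - s / 2" and "B = s / 2 - a - b - 1" and "c = b - 3 / 2"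
  define W where "W = (\<lambda>p. indicator {0<..} (snd p) *\<^sub>R (Ef A B c (fst p) (snd p) * Kf A B c (fst p) (snd p)))"
  define J where "J G p = of_real (a - b) * (G p * Jf a b (fst p) (snd p)) -
    of_real (s - 2 * b - 1) * (G p * Jf a (b + 1) (fst p) (snd p)) + of_real (s - 2 * a - 1) * (G p * Jf (a + 1) b (fst p) (snd p))"
    for G :: "real \<times> real \<Rightarrow> complex" and p
  define u where "u p = exp (\<i> * of_real (s * Im (Ln (pm (fst p) (snd p)))))" for p
  have u: "cmod (u p) = 1" "u p \<noteq> 0" for p by (simp_all add: u_def)
  have ab': "3 \<le> a + 1" "3 \<le> b + 1" using ab by auto
  define Y where "Y = (\<lambda>p :: real \<times> real. complex_of_real (indicator {0<..} (snd p)))"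
  have Ym: "Y \<in> borel_measurable ?L" unfolding Y_def by measurable
  have Yb: "cmod (Y p) \<le> 1" "snd p \<le> 0 \<Longrightarrow> Y p = 0" for p by (auto simp: Y_def indicator_def)
  have JY: "integrable ?L (J Y)"
    unfolding J_def
    by (intro Bochner_Integration.integrable_add Bochner_Integration.integrable_diff integrable_mult_right
      Jf_integrable[OF _ _ Ym Yb] ab ab')
  have uW: "u p * W p = \<i> * J Y p" for p
  proof (cases "0 < snd p")
    case True
    then show ?thesis
      using phase_Ef_Kf[OF True, of s "fst p" a b] unfolding A_def[symmetric] B_def[symmetric] c_def[symmetric]
      by (simp add: u_def W_def J_def Y_def)
  next
    case False
    then show ?thesis by (simp add: W_def J_def Y_def)
  qed
  have um: "u \<in> borel_measurable ?L" unfolding u_def by measurable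
  have W: "integrable ?L W"
  proof (rule Bochner_Integration.integrable_bound[OF JY])
    show "W \<in> borel_measurable ?L" unfolding W_def Ef_def Kf_def by measurable
    have "cmod (W p) = cmod (J Y p)" for p using arg_cong[OF uW[of p], of cmod] by (simp add: norm_mult u)
    then show "AE p in ?L. cmod (W p) \<le> cmod (J Y p)" by simp
  qed
  have 0: "(LINT p|?L. R (qxy (fst p) (snd p)) * W p) = 0"
    using radial_orthogonal[OF R(1) Rb W[unfolded W_def]] unfolding W_def .
  have eq: "R (qxy (fst p) (snd p)) * W p = \<i> * J (hp F) p" for p
  proof (cases "0 < snd p")
    case True
    define z where "z = Complex (fst p) (snd p)"
    have z: "z \<in> upper" using True by (simp add: z_def upper_def)
    have "1 - \<i> * z = pm (fst p) (snd p)" by (simp add: z_def pm_def complex_eq_iff)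
    then have "R (qxy (fst p) (snd p)) = F z * u p"
      using R(2)[OF z] by (simp add: qf_Complex[symmetric] z_def[symmetric] S_def unphase_def u_def)
    then have "R (qxy (fst p) (snd p)) * W p = F z * (\<i> * J Y p)" by (simp only: mult.assoc uW)
    also have "\<dots> = \<i> * J (hp F) p" using True by (simp add: J_def Y_def hp_def z_def algebra_simps)
    finally show ?thesis .
  next
    case False
    then show ?thesis by (simp add: W_def J_def hp_def)
  qed
  have Bd0: "0 \<le> Bd" using Rb[of 0] norm_ge_zero order_trans by blast
  have hb: "cmod (hp F p) \<le> Bd" "snd p \<le> 0 \<Longrightarrow> hp F p = 0" for p
    using Bd0 by (auto simp: hp_def upper_def intro!: F(2))
  note i = Jf_integrable[OF _ _ hp_measurable[OF F(1)] hb]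
  have "(LINT p|?L. J (hp F) p) = 0" using 0 unfolding eq by simp
  moreover have "(LINT p|?L. J (hp F) p) = of_real (a - b) * Jint F a b - of_real (s - 2 * b - 1) * Jint F a (b + 1) + of_real (s - 2 * a - 1) * Jint F (a + 1) b"
    unfolding J_def Jint_def using i[OF ab] i[OF ab(1) ab'(2)] i[OF ab'(1) ab(2)]
    by (simp add: Bochner_Integration.integral_add Bochner_Integration.integral_diff del: of_real_add of_real_diff)
  ultimately show ?thesis by simp
qed

section \<open>Moments\<close>

text \<open>
  For fixed \<open>\<xi>\<close> substitute \<open>\<eta> = \<xi>y\<close>, then exchange the integrals.
\<close>

lemma multiplicative_convolution:
  fixes u v :: "real \<Rightarrow> complex"
  assumes u: "integrable lborel u" and v: "integrable lborel v" and u0: "\<And>\<xi>. \<xi> \<le> 0 \<Longrightarrow> u \<xi> = 0"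
  shows "(LINT y|lborel. LINT \<xi>|lborel. u \<xi> * of_real \<xi> * v (\<xi> * y)) = (LINT \<xi>|lborel. u \<xi>) * (LINT \<eta>|lborel. v \<eta>)"
proof -
  have [measurable]: "u \<in> borel_measurable borel" "v \<in> borel_measurable borel" using u v by auto
  define f where "f = (\<lambda>(\<xi>, y). u \<xi> * of_real \<xi> * v (\<xi> * y))"
  have aff: "integrable lborel (\<lambda>y. w (\<xi> * y))" "\<xi> * (LINT y|lborel. w (\<xi> * y)) = (LINT y|lborel. w y)"
    if "0 < \<xi>" "integrable lborel w" for \<xi> and w :: "real \<Rightarrow> real"
    using lborel_integrable_real_affine[OF that(2), of \<xi> 0] lborel_integral_real_affine[of \<xi> w 0] that by auto
  have affc: "integrable lborel (\<lambda>y. v (\<xi> * y))" "of_real \<xi> * (LINT y|lborel. v (\<xi> * y)) = (LINT y|lborel. v y)"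
    if "0 < \<xi>" for \<xi> :: real
    using lborel_integrable_real_affine[OF v, of \<xi> 0] lborel_integral_real_affine[of \<xi> v 0] that
    by (auto simp: scaleR_conv_of_real)
  have int: "integrable (lborel \<Otimes>\<^sub>M lborel) f"
  proof (rule lborel_pair.Fubini_integrable)
    show "f \<in> borel_measurable (lborel \<Otimes>\<^sub>M lborel)" unfolding f_def by measurable
    have "(LINT y|lborel. norm (f (\<xi>, y))) = cmod (u \<xi>) * (LINT y|lborel. cmod (v y))" for \<xi>
    proof (cases "0 < \<xi>")
      case True
      have "(LINT y|lborel. norm (f (\<xi>, y))) = cmod (u \<xi>) * (\<xi> * (LINT y|lborel. cmod (v (\<xi> * y))))"
        using True by (simp add: f_def norm_mult)
      then show ?thesis using aff(2)[OF True, of "\<lambda>y. cmod (v y)"] v by simp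
    next
      case False
      then show ?thesis using u0[of \<xi>] by (simp add: f_def)
    qed
    then show "integrable lborel (\<lambda>\<xi>. LINT y|lborel. norm (f (\<xi>, y)))" using u by simp
    have "integrable lborel (\<lambda>y. f (\<xi>, y))" for \<xi>
    proof (cases "0 < \<xi>")
      case True
      then show ?thesis unfolding f_def using affc(1)[OF True] by simp
    next
      case False
      then show ?thesis using u0[of \<xi>] by (simp add: f_def)
    qed
    then show "AE \<xi> in lborel. integrable lborel (\<lambda>y. f (\<xi>, y))" by simp
  qed
  have "(LINT y|lborel. LINT \<xi>|lborel. u \<xi> * of_real \<xi> * v (\<xi> * y)) = (LINT y|lborel. LINT \<xi>|lborel. f (\<xi>, y))"
    by (simp add: f_def)
  also have "\<dots> = (LINT \<xi>|lborel. LINT y|lborel. f (\<xi>, y))"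
    using lborel_pair.Fubini_integral[of "\<lambda>\<xi> y. f (\<xi>, y)"] int by simp
  also have "\<dots> = (LINT \<xi>|lborel. u \<xi> * (LINT \<eta>|lborel. v \<eta>))"
  proof (rule Bochner_Integration.integral_cong[OF refl])
    fix \<xi> :: real
    show "(LINT y|lborel. f (\<xi>, y)) = u \<xi> * (LINT \<eta>|lborel. v \<eta>)"
    proof (cases "0 < \<xi>")
      case True
      have "(LINT y|lborel. f (\<xi>, y)) = u \<xi> * (of_real \<xi> * (LINT y|lborel. v (\<xi> * y)))"
        by (simp add: f_def mult.assoc)
      then show ?thesis unfolding affc(2)[OF True] .
    next
      case False
      then show ?thesis using u0[of \<xi>] by (simp add: f_def)
    qed
  qed
  also have "\<dots> = (LINT \<xi>|lborel. u \<xi>) * (LINT \<eta>|lborel. v \<eta>)" by simp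
  finally show ?thesis .
qed

text \<open>
  The Gamma density, whose Fourier transform is a multiple of the power \<open>(q + ix)\<^bsup>-N\<^esup>\<close>.
\<close>

definition gker :: "real \<Rightarrow> real \<Rightarrow> real \<Rightarrow> complex" where
  "gker N q = posp (\<lambda>\<xi>. of_real (\<xi> powr (N - 1) * exp (- (q * \<xi>))))"

lemma gker_eq:
  "gker N q = posp (\<lambda>\<xi>. of_real \<xi> powr (of_real N - 1) * exp (- (of_real q * of_real \<xi>)))"
proof
  fix \<xi> :: real
  show "gker N q \<xi> = posp (\<lambda>\<xi>. of_real \<xi> powr (of_real N - 1) * exp (- (of_real q * of_real \<xi>))) \<xi>"
    using powr_of_real[of \<xi> "N - 1"] by (simp add: gker_def posp_def flip: exp_of_real)
qed

lemma gker_L2: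
  assumes "1 < N" "0 < q"
  shows "gker N q \<in> L2_space lborel" "integrable lborel (gker N q)"
  unfolding gker_eq posp_L2 integrable_lpos_iff[symmetric]
  using power_exp_L2[of "of_real N - 1" "of_real q"] Gamma_integral_lpos(1)[of "of_real N" "of_real q"] assms
  by auto

lemma FT_gker:
  assumes "1 < N" "0 < q"
  shows "FT (gker N q) x = Gamma (of_real N) * exp (- (of_real N * Ln (of_real q + \<i> * of_real x)))"
proof -
  define p where "p = of_real q + \<i> * complex_of_real x"
  have p: "0 < Re p" "p \<noteq> 0" using assms by (auto simp: p_def complex_eq_iff)
  have "FT (gker N q) x = (LINT \<xi>|lpos. of_real \<xi> powr (of_real N - 1) * exp (- (p * of_real \<xi>)))"
    unfolding FT_def integral_lpos gker_eq
    by (rule Bochner_Integration.integral_cong[OF refl])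
      (auto simp: posp_def p_def mult.assoc algebra_simps exp_add[symmetric] simp flip: exp_add)
  also have "\<dots> = Gamma (of_real N) / p powr of_real N"
    using assms p by (intro Gamma_integral_lpos) auto
  also have "\<dots> = Gamma (of_real N) * exp (- (of_real N * Ln p))"
    using p by (simp add: powr_def exp_minus divide_inverse)
  finally show ?thesis unfolding p_def .
qed

lemma FT_gker_integrable:
  assumes N: "2 \<le> N" and q: "1 \<le> q"
  shows "integrable lborel (FT (gker N q))"
proof (rule Bochner_Integration.integrable_bound)
  show "integrable lborel (\<lambda>x::real. cmod (Gamma (of_real N)) * inverse (1 + x\<^sup>2))"
    using inverse_1_plus_square_integrable by simp
  show "FT (gker N q) \<in> borel_measurable lborel"
    using FT_measurable[of "gker N q"] gker_L2(2)[of N q] N q by simp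
  have "cmod (FT (gker N q) x) \<le> norm (cmod (Gamma (of_real N)) * inverse (1 + x\<^sup>2))" for x
  proof -
    define p where "p = of_real q + \<i> * complex_of_real x"
    have sq: "(cmod p)\<^sup>2 = q\<^sup>2 + x\<^sup>2" by (simp add: p_def cmod_power2)
    have q2: "1 \<le> q\<^sup>2" using q by simp
    have "1 \<le> (cmod p)\<^sup>2" using sq q2 zero_le_power2[of x] by linarith
    then have p: "1 \<le> cmod p" using power2_le_imp_le[of 1 "cmod p"] by simp
    have p0: "p \<noteq> 0" using p by auto
    have "cmod (exp (- (of_real N * Ln p))) = cmod p powr (- N)"
      unfolding norm_exp_eq_Re using p0 by (simp add: powr_def)
    also have "\<dots> \<le> cmod p powr (- 2)" using N p by (intro powr_mono) auto
    also have "\<dots> = inverse ((cmod p)\<^sup>2)" using p by (simp add: powr_minus)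
    also have "\<dots> \<le> inverse (1 + x\<^sup>2)"
      unfolding sq using q2 by (intro le_imp_inverse_le) (auto simp: add_pos_nonneg)
    finally have "cmod (Gamma (of_real N)) * cmod (exp (- (of_real N * Ln p))) \<le> cmod (Gamma (of_real N)) * inverse (1 + x\<^sup>2)"
      by (intro mult_left_mono) auto
    moreover have "FT (gker N q) x = Gamma (of_real N) * exp (- (of_real N * Ln p))"
      unfolding p_def using N q by (intro FT_gker) auto
    ultimately show ?thesis by (simp add: norm_mult)
  qed
  then show "AE x in lborel. cmod (FT (gker N q) x) \<le> norm (cmod (Gamma (of_real N)) * inverse (1 + x\<^sup>2))" by simp
qed

text \<open>
  Inversion in \<open>L\<^sup>2\<close>; since the transform is also integrable, the inverse transform is the plain integral.
\<close>

lemma FT_FT_gker: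
  assumes N: "2 \<le> N" and q: "1 \<le> q"
  shows "AE \<xi> in lborel. FT (\<lambda>x. cnj (FT (gker N q) x)) \<xi> = of_real (2 * pi) * gker N q \<xi>"
proof -
  have Nq: "1 < N" "0 < q" using assms by auto
  define k where "k = FT (gker N q)"
  note g = gker_L2[OF Nq]
  have real: "(\<lambda>\<xi>. cnj (gker N q \<xi>)) = gker N q" by (auto simp: gker_def posp_def)
  have k: "k \<in> L2_space lborel" "integrable lborel k"
    unfolding k_def using FT_Plancherel(1)[OF g] FT_gker_integrable[OF assms] by auto
  define w where "w = (\<lambda>x. of_real (1 / (2 * pi)) * cnj (k x))"
  have w: "w \<in> L2_space lborel" unfolding w_def by (rule L2_scale[OF L2_cnj[OF k(1)]])
  have wi: "integrable lborel w" unfolding w_def using k by simp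
  have "is_fourier w (gker N q)"
    unfolding w_def by (rule fourier_inversion[OF g(1)]) (use is_fourier_FT[OF g] real in \<open>simp add: k_def\<close>)
  then have "AE \<xi> in lborel. FT w \<xi> = gker N q \<xi>"
    using is_fourier_AE_unique[OF w is_fourier_FT[OF w wi]] by blast
  moreover have "FT (\<lambda>x. cnj (FT (gker N q) x)) \<xi> = of_real (2 * pi) * FT w \<xi>" for \<xi>
    unfolding w_def FT_scale k_def by simp
  ultimately show ?thesis by simp
qed

text \<open>
  The Mellin transform of \<open>\<phi>(\<xi>) e\<^bsup>-\<xi>\<^esup>\<close>.
\<close>

definition mom :: "(real \<Rightarrow> complex) \<Rightarrow> complex \<Rightarrow> complex" where
  "mom \<phi> a = (LINT \<xi>|lpos. \<phi> \<xi> * (of_real \<xi> powr (a - 1) * exp (- of_real \<xi>)))"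

lemma mom_kernel_L2:
  assumes "1 / 2 < Re a"
  shows "(\<lambda>\<xi>. of_real \<xi> powr (a - 1) * exp (- of_real \<xi>)) \<in> L2_space lpos"
  using power_exp_L2[of "a - 1" 1] assms by simp

lemma mom_integrable:
  assumes "\<phi> \<in> L2_space lpos" "1 / 2 < Re a"
  shows "integrable lpos (\<lambda>\<xi>. \<phi> \<xi> * (of_real \<xi> powr (a - 1) * exp (- of_real \<xi>)))"
  by (rule L2_integrable_mult[OF assms(1) mom_kernel_L2[OF assms(2)]])

text \<open>
  On a horizontal line \<open>wt h h\<close> is a Fourier transform and the power of \<open>pp\<close> is one too; the multiplication
  formula moves the transform from one to the other.
\<close>

lemma wt_Jf_fibre:
  assumes h: "h \<in> L2_space lpos" "h \<in> borel_measurable borel" and y: "0 < y" and N: "2 \<le> N"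
  shows "Gamma (of_real N) * (LINT x|lborel. wt h h (Complex x y) * exp (- (of_real N * Ln (pp x y)))) =
     of_real (sqrt y) * (LINT \<xi>|lpos. h \<xi> * cnj (h (y * \<xi>)) * of_real (\<xi> powr (N - 1) * exp (- ((1 + y) * \<xi>))))"
proof -
  define q where "q = 1 + y"
  have q: "1 \<le> q" "0 < q" using y by (auto simp: q_def)
  have N1: "1 < N" using N by simp
  define \<kappa> where "\<kappa> = gker N q"
  note g = gker_L2[OF N1 q(2), folded \<kappa>_def]
  have km [measurable]: "\<kappa> \<in> borel_measurable borel" using g by simp
  define G where "G = posp (\<lambda>\<xi>. of_real (sqrt y) * (h \<xi> * cnj (h (y * \<xi>))))"
  have G: "integrable lborel G"
    unfolding G_def integrable_lpos_iff[symmetric]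
    using wt_integrand_integrable[OF h(1) h(1) y] by simp
  have kr: "FT \<kappa> (- x) = cnj (FT \<kappa> x)" for x
  proof -
    have "cnj (\<kappa> t) = \<kappa> t" for t by (simp add: \<kappa>_def gker_def posp_def)
    then show ?thesis unfolding FT_def Bochner_Integration.integral_cnj[symmetric]
      by (intro Bochner_Integration.integral_cong refl) (simp add: exp_cnj)
  qed
  have E: "Gamma (of_real N) * exp (- (of_real N * Ln (pp x y))) = FT \<kappa> x" for x
    unfolding \<kappa>_def FT_gker[OF N1 q(2)] by (simp add: pp_def q_def)
  have "Gamma (of_real N) * (LINT x|lborel. wt h h (Complex x y) * exp (- (of_real N * Ln (pp x y)))) =
      (LINT x|lborel. of_real (1 / (2 * pi)) * (FT G (- x) * FT \<kappa> x))"
    unfolding integral_mult_right_zero[symmetric]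
  proof (rule Bochner_Integration.integral_cong[OF refl])
    fix x
    show "Gamma (of_real N) * (wt h h (Complex x y) * exp (- (of_real N * Ln (pp x y)))) = of_real (1 / (2 * pi)) * (FT G (- x) * FT \<kappa> x)"
      unfolding wt_eq_FT[OF y] G_def[symmetric] E[symmetric] by simp
  qed
  also have "\<dots> = of_real (1 / (2 * pi)) * (LINT x|lborel. FT G (- x) * FT \<kappa> x)" by simp
  also have "(LINT x|lborel. FT G (- x) * FT \<kappa> x) = (LINT x|lborel. FT G x * cnj (FT \<kappa> x))"
    using lborel_integral_real_affine[of "-1" "\<lambda>x. FT G x * cnj (FT \<kappa> x)" 0] by (simp add: kr)
  also have "\<dots> = (LINT t|lborel. G t * FT (\<lambda>x. cnj (FT \<kappa> x)) t)"
    by (rule FT_multiplication_formula[OF G]) (use FT_gker_integrable[OF N q(1)] in \<open>simp add: \<kappa>_def\<close>)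
  also have "\<dots> = (LINT t|lborel. of_real (2 * pi) * (G t * \<kappa> t))"
  proof (rule integral_cong_AE)
    have cFm: "(\<lambda>x. cnj (FT \<kappa> x)) \<in> borel_measurable borel"
      using FT_measurable[OF km] by simp
    have [measurable]: "G \<in> borel_measurable borel" "FT (\<lambda>x. cnj (FT \<kappa> x)) \<in> borel_measurable borel"
      using G FT_measurable[OF cFm] by auto
    show "(\<lambda>t. G t * FT (\<lambda>x. cnj (FT \<kappa> x)) t) \<in> borel_measurable lborel" "(\<lambda>t. of_real (2 * pi) * (G t * \<kappa> t)) \<in> borel_measurable lborel"
      by measurable
    show "AE t in lborel. G t * FT (\<lambda>x. cnj (FT \<kappa> x)) t = of_real (2 * pi) * (G t * \<kappa> t)"
      using FT_FT_gker[OF N q(1)] by (auto simp: \<kappa>_def)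
  qed
  also have "of_real (1 / (2 * pi)) * \<dots> = (LINT t|lborel. G t * \<kappa> t)" by simp
  also have "\<dots> = (LINT \<xi>|lpos. of_real (sqrt y) * (h \<xi> * cnj (h (y * \<xi>)) * of_real (\<xi> powr (N - 1) * exp (- ((1 + y) * \<xi>)))))"
    unfolding integral_lpos
    by (rule Bochner_Integration.integral_cong[OF refl]) (simp add: G_def \<kappa>_def gker_def posp_def q_def)
  also have "\<dots> = of_real (sqrt y) * (LINT \<xi>|lpos. h \<xi> * cnj (h (y * \<xi>)) * of_real (\<xi> powr (N - 1) * exp (- ((1 + y) * \<xi>))))"
    by simp
  finally show ?thesis .
qed

text \<open>
  After integration in \<open>x\<close> the integrand is \<open>h(\<xi>) h(y\<xi>)\<^sup>* y\<^bsup>b-1\<^esup> \<xi>\<^bsup>a+b-1\<^esup> e\<^bsup>-(1+y)\<xi>\<^esup>\<close>, which separates in the variables \<open>\<xi>\<close> and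
  \<open>\<eta> = y\<xi>\<close>.
\<close>

theorem Jint_wt:
  assumes h: "h \<in> L2_space lpos" "h \<in> borel_measurable borel" and ab: "3 \<le> a" "3 \<le> b"
  shows "Gamma (of_real (a + b)) * Jint (wt h h) a b = mom h (of_real a) * cnj (mom h (of_real b))"
proof -
  let ?L = "lborel \<Otimes>\<^sub>M lborel :: (real \<times> real) measure"
  define F where "F = wt h h"
  define N where "N = a + b"
  have N: "2 \<le> N" using ab by (simp add: N_def)
  have hb: "cmod (hp F p) \<le> sqrt (nrm2 lpos h * nrm2 lpos h)" "snd p \<le> 0 \<Longrightarrow> hp F p = 0" for p
    using wt_bound[OF h(1) h(1), of "Complex (fst p) (snd p)"]
    by (auto simp: hp_def F_def simp del: real_sqrt_mult real_sqrt_mult_self)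
  have i: "integrable ?L (\<lambda>(x, y). hp F (x, y) * Jf a b x y)"
    using Jf_integrable[OF ab hp_measurable hb] wt_continuous[OF h(1) h(1)] by (simp add: split_def F_def)
  define u where "u = posp (\<lambda>\<xi>. h \<xi> * (of_real \<xi> powr (of_real a - 1) * exp (- of_real \<xi>)))"
  define v where "v = posp (\<lambda>\<xi>. cnj (h \<xi> * (of_real \<xi> powr (of_real b - 1) * exp (- of_real \<xi>))))"
  have uv: "integrable lborel u" "integrable lborel v"
    unfolding u_def v_def integrable_lpos_iff[symmetric] complex_integrable_cnj
    using ab by (intro mom_integrable[OF h(1)]; simp)+
  have Iu: "(LINT \<xi>|lborel. u \<xi>) = mom h (of_real a)" "(LINT \<xi>|lborel. v \<xi>) = cnj (mom h (of_real b))"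
    unfolding u_def v_def mom_def integral_lpos[symmetric] Bochner_Integration.integral_cnj by simp_all
  have fib: "Gamma (of_real N) * (LINT x|lborel. hp F (x, y) * Jf a b x y) = (LINT \<xi>|lborel. u \<xi> * of_real \<xi> * v (\<xi> * y))" for y
  proof (cases "0 < y")
    case True
    have "Gamma (of_real N) * (LINT x|lborel. hp F (x, y) * Jf a b x y) =
       of_real (y powr (b - 3 / 2)) * (Gamma (of_real N) * (LINT x|lborel. F (Complex x y) * exp (- (of_real N * Ln (pp x y)))))"
      using True by (simp add: hp_def Jf_def N_def mult_ac flip: integral_mult_right_zero)
    also have "\<dots> = of_real (y powr (b - 3 / 2)) * (of_real (sqrt y) * (LINT \<xi>|lpos. h \<xi> * cnj (h (y * \<xi>)) * of_real (\<xi> powr (N - 1) * exp (- ((1 + y) * \<xi>)))))"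
      unfolding F_def wt_Jf_fibre[OF h True N] ..
    finally have fib1: "Gamma (of_real N) * (LINT x|lborel. hp F (x, y) * Jf a b x y) =
      of_real (y powr (b - 3 / 2)) * (of_real (sqrt y) * (LINT \<xi>|lpos. h \<xi> * cnj (h (y * \<xi>)) * of_real (\<xi> powr (N - 1) * exp (- ((1 + y) * \<xi>)))))" .
    have main: "posp (\<lambda>\<xi>. of_real (y powr (b - 3 / 2)) * (of_real (sqrt y) * (h \<xi> * cnj (h (y * \<xi>)) * of_real (\<xi> powr (N - 1) * exp (- ((1 + y) * \<xi>)))))) = (\<lambda>\<xi>. u \<xi> * of_real \<xi> * v (\<xi> * y))"
    proof
      fix \<xi> :: real
      show "posp (\<lambda>\<xi>. of_real (y powr (b - 3 / 2)) * (of_real (sqrt y) * (h \<xi> * cnj (h (y * \<xi>)) * of_real (\<xi> powr (N - 1) * exp (- ((1 + y) * \<xi>)))))) \<xi> = u \<xi> * of_real \<xi> * v (\<xi> * y)"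
      proof (cases "0 < \<xi>")
        case \<xi>: True
        have p1: "of_real \<xi> powr (of_real a - 1 :: complex) = of_real (\<xi> powr (a - 1))"
          using powr_of_real[of \<xi> "a - 1"] \<xi> by simp
        have p2: "of_real (\<xi> * y) powr (of_real b - 1 :: complex) = of_real ((\<xi> * y) powr (b - 1))"
          using powr_of_real[of "\<xi> * y" "b - 1"] \<xi> True by simp
        have e: "exp (- of_real t :: complex) = of_real (exp (- t))" for t by (simp flip: exp_of_real)
        have r: "y powr (b - 3 / 2) * sqrt y * (\<xi> powr (N - 1) * exp (- ((1 + y) * \<xi>))) =
          \<xi> powr (a - 1) * exp (- \<xi>) * \<xi> * ((\<xi> * y) powr (b - 1) * exp (- (\<xi> * y)))"
        proof -
          have "y powr (b - 1) = y powr (b - 3 / 2) * y powr (1 / 2)" unfolding powr_add[symmetric] by simp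
          then have 1: "y powr (b - 1) = y powr (b - 3 / 2) * sqrt y" using True by (simp add: powr_half_sqrt)
          have "\<xi> powr (N - 1) = \<xi> powr (a - 1) * \<xi> powr 1 * \<xi> powr (b - 1)"
            unfolding powr_add[symmetric] by (simp add: N_def algebra_simps)
          then have 2: "\<xi> powr (N - 1) = \<xi> powr (a - 1) * \<xi> * \<xi> powr (b - 1)" using \<xi> by simp
          have 3: "exp (- ((1 + y) * \<xi>)) = exp (- \<xi>) * exp (- (\<xi> * y))"
            unfolding exp_add[symmetric] by (simp add: algebra_simps)
          show ?thesis unfolding powr_mult[of \<xi> y] 1 2 3 using \<xi> True by (simp add: mult_ac powr_mult 1)
        qed
        have "posp (\<lambda>\<xi>. of_real (y powr (b - 3 / 2)) * (of_real (sqrt y) * (h \<xi> * cnj (h (y * \<xi>)) * of_real (\<xi> powr (N - 1) * exp (- ((1 + y) * \<xi>)))))) \<xi> =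
           h \<xi> * cnj (h (\<xi> * y)) * of_real (y powr (b - 3 / 2) * sqrt y * (\<xi> powr (N - 1) * exp (- ((1 + y) * \<xi>))))"
          using \<xi> by (simp add: posp_def mult.commute[of y] del: of_real_exp)
        also have "\<dots> = u \<xi> * of_real \<xi> * v (\<xi> * y)"
          unfolding r u_def v_def posp_def p1 p2 e using \<xi> True by simp
        finally show ?thesis .
      next
        case False
        then show ?thesis by (simp add: posp_def u_def)
      qed
    qed
    have "of_real (y powr (b - 3 / 2)) * (of_real (sqrt y) * (LINT \<xi>|lpos. h \<xi> * cnj (h (y * \<xi>)) * of_real (\<xi> powr (N - 1) * exp (- ((1 + y) * \<xi>)))))
      = (LINT \<xi>|lpos. of_real (y powr (b - 3 / 2)) * (of_real (sqrt y) * (h \<xi> * cnj (h (y * \<xi>)) * of_real (\<xi> powr (N - 1) * exp (- ((1 + y) * \<xi>))))))"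
      by (simp only: integral_mult_right_zero)
    also have "\<dots> = (LINT \<xi>|lborel. u \<xi> * of_real \<xi> * v (\<xi> * y))"
      unfolding integral_lpos main ..
    finally show ?thesis unfolding fib1 .
  next
    case False
    have "u \<xi> * of_real \<xi> * v (\<xi> * y) = 0" for \<xi>
    proof (cases "0 < \<xi>")
      case True
      then have "\<not> 0 < \<xi> * y" using False by (simp add: zero_less_mult_iff)
      then show ?thesis by (simp add: v_def posp_def)
    qed (simp add: u_def posp_def)
    then have "(LINT \<xi>|lborel. u \<xi> * of_real \<xi> * v (\<xi> * y)) = (LINT \<xi>::real|lborel. 0)" by (simp only:)
    moreover have "(LINT x|lborel. hp F (x, y) * Jf a b x y) = 0" using False by (simp add: hp_def)
    ultimately show ?thesis by (simp only: Bochner_Integration.integral_zero mult_zero_right)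
  qed
  have "Jint F a b = (LINT y|lborel. LINT x|lborel. hp F (x, y) * Jf a b x y)"
    unfolding Jint_def using lborel_pair.integral_snd[OF i] by (simp add: split_def)
  then have "Gamma (of_real N) * Jint F a b = (LINT y|lborel. LINT \<xi>|lborel. u \<xi> * of_real \<xi> * v (\<xi> * y))"
    unfolding fib[symmetric] by simp
  also have "\<dots> = mom h (of_real a) * cnj (mom h (of_real b))"
    using multiplicative_convolution[OF uv] unfolding Iu by (simp add: u_def posp_def)
  finally show ?thesis unfolding F_def N_def .
qed

section \<open>Completeness of moments\<close>

text \<open>
  The Laplace transform of \<open>g(\<xi>) \<xi>\<^sup>\<beta>\<close> is holomorphic in the right half-plane. In the disc of radius \<open>1\<close> about \<open>1\<close> it
  equals its Taylor series, by dominated convergence, and the coefficients are the given moments; so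
  it vanishes identically, in particular on the line through \<open>1\<close>. The imaginary part of \<open>\<beta>\<close> contributes
  only the unimodular factor \<open>u\<close>.
\<close>

theorem moments_complete:
  assumes g: "g \<in> L2_space lpos" and \<beta>: "0 \<le> Re \<beta>"
    and 0: "\<And>j. mom g (\<beta> + of_nat j + 1) = 0"
  shows "AE \<xi> in lpos. g \<xi> = 0"
proof -
  define r where "r = Re \<beta>"
  \<comment> \<open>splits off the imaginary part of the exponent, as completeness is known for real powers\<close>
  define u where "u \<xi> = (of_real \<xi> powr (\<i> * of_real (Im \<beta>)) :: complex)" for \<xi> :: real
  have gm [measurable]: "g \<in> borel_measurable lpos" using g by (rule L2_measurable)
  have im [measurable]: "(\<lambda>\<xi>. \<xi>) \<in> borel_measurable lpos" by (rule measurable_ident_lpos)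
  have um: "u \<in> borel_measurable lpos" unfolding u_def by measurable
  have u1: "cmod (u \<xi>) = 1" if "0 < \<xi>" for \<xi> unfolding u_def norm_powr_real_base[OF that] using that by simp
  have split: "of_real \<xi> powr \<beta> = u \<xi> * of_real \<xi> powr of_real r" for \<xi> :: real
  proof -
    have "\<beta> = \<i> * of_real (Im \<beta>) + of_real r" by (simp add: r_def complex_eq_iff)
    then show ?thesis unfolding u_def by (metis powr_add)
  qed
  define G where "G \<xi> = u \<xi> * g \<xi>" for \<xi>
  have G: "G \<in> L2_space lpos"
  proof (rule L2_spaceI)
    show "G \<in> borel_measurable lpos" unfolding G_def using um by measurable
    have "(\<integral>\<^sup>+\<xi>. ennreal ((cmod (G \<xi>))\<^sup>2) \<partial>lpos) = (\<integral>\<^sup>+\<xi>. ennreal ((cmod (g \<xi>))\<^sup>2) \<partial>lpos)"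
      by (rule nn_integral_cong) (simp add: G_def norm_mult u1)
    then show "(\<integral>\<^sup>+\<xi>. ennreal ((cmod (G \<xi>))\<^sup>2) \<partial>lpos) < \<infinity>" using L2_nn_integral[OF g] by simp
  qed
  define g\<beta> where "g\<beta> \<xi> = g \<xi> * of_real \<xi> powr \<beta>" for \<xi>
  have g\<beta>m: "g\<beta> \<in> borel_measurable lpos" unfolding g\<beta>_def by measurable
  have int: "integrable lpos (\<lambda>\<xi>. g\<beta> \<xi> * exp (- (p * of_real \<xi>)))" if "0 < Re p" for p
    unfolding g\<beta>_def mult.assoc
    by (rule L2_integrable_mult[OF g power_exp_L2]) (use that \<beta> in auto)
  define L where "L p = (LINT \<xi>|lpos. g\<beta> \<xi> * exp (- (p * of_real \<xi>)))" for p
  have hol: "L holomorphic_on {p. 0 < Re p}"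
    unfolding L_def by (rule holomorphic_exponential_integral[OF g\<beta>m im int])
  have mj: "(LINT \<xi>|lpos. g\<beta> \<xi> * exp (- of_real \<xi>) * of_real \<xi> ^ j) = 0" for j
  proof -
    have "(LINT \<xi>|lpos. g\<beta> \<xi> * exp (- of_real \<xi>) * of_real \<xi> ^ j) = mom g (\<beta> + of_nat j + 1)"
      unfolding mom_def
    proof (rule Bochner_Integration.integral_cong[OF refl])
      fix \<xi> assume "\<xi> \<in> space lpos"
      then have "of_real \<xi> powr (\<beta> + of_nat j + 1 - 1) = of_real \<xi> powr \<beta> * complex_of_real \<xi> ^ j"
        by (simp add: powr_add powr_nat)
      then show "g\<beta> \<xi> * exp (- of_real \<xi>) * of_real \<xi> ^ j = g \<xi> * (of_real \<xi> powr (\<beta> + of_nat j + 1 - 1) * exp (- of_real \<xi>))"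
        by (simp add: g\<beta>_def mult_ac)
    qed
    then show ?thesis using 0 by simp
  qed
  have ij: "integrable lpos (\<lambda>\<xi>. g\<beta> \<xi> * exp (- of_real \<xi>) * of_real \<xi> ^ j)" for j
  proof (rule Bochner_Integration.integrable_cong[THEN iffD1, OF refl])
    show "integrable lpos (\<lambda>\<xi>. g \<xi> * (of_real \<xi> powr (\<beta> + of_nat j) * exp (- (1 * of_real \<xi>))))"
      by (rule L2_integrable_mult[OF g power_exp_L2]) (use \<beta> in auto)
    fix \<xi> assume "\<xi> \<in> space lpos"
    then have "of_real \<xi> powr (\<beta> + of_nat j) = of_real \<xi> powr \<beta> * complex_of_real \<xi> ^ j"
      by (simp add: powr_add powr_nat)
    then show "g \<xi> * (of_real \<xi> powr (\<beta> + of_nat j) * exp (- (1 * of_real \<xi>))) = g\<beta> \<xi> * exp (- of_real \<xi>) * of_real \<xi> ^ j"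
      by (simp add: g\<beta>_def mult_ac)
  qed
  have near: "L (1 + t) = 0" if t: "cmod t < 1" for t
  proof -
    define s where "s n \<xi> = (\<Sum>j<n. (- t * of_real \<xi>) ^ j / fact j)" for n and \<xi> :: real
    have z: "(LINT \<xi>|lpos. g\<beta> \<xi> * exp (- of_real \<xi>) * s n \<xi>) = 0" for n
    proof -
      have "g\<beta> \<xi> * exp (- of_real \<xi>) * s n \<xi> = (\<Sum>j<n. ((- t) ^ j / fact j) * (g\<beta> \<xi> * exp (- of_real \<xi>) * of_real \<xi> ^ j))" for \<xi>
        unfolding s_def sum_distrib_left by (intro sum.cong refl) (subst power_mult_distrib, simp add: mult_ac)
      then have "(LINT \<xi>|lpos. g\<beta> \<xi> * exp (- of_real \<xi>) * s n \<xi>) =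
        (\<Sum>j<n. ((- t) ^ j / fact j) * (LINT \<xi>|lpos. g\<beta> \<xi> * exp (- of_real \<xi>) * of_real \<xi> ^ j))"
        using ij by (simp add: Bochner_Integration.integral_sum)
      then show ?thesis unfolding mj by simp
    qed
    have "(\<lambda>n. LINT \<xi>|lpos. g\<beta> \<xi> * exp (- of_real \<xi>) * s n \<xi>) \<longlonglongrightarrow> L (1 + t)"
      unfolding L_def
    proof (rule integral_dominated_convergence[where w = "\<lambda>\<xi>. cmod (g\<beta> \<xi> * exp (- (of_real (1 - cmod t) * of_real \<xi>)))"])
      show "(\<lambda>\<xi>. g\<beta> \<xi> * exp (- ((1 + t) * of_real \<xi>))) \<in> borel_measurable lpos"
        "\<And>n. (\<lambda>\<xi>. g\<beta> \<xi> * exp (- of_real \<xi>) * s n \<xi>) \<in> borel_measurable lpos"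
        unfolding s_def using g\<beta>m by measurable
      show "integrable lpos (\<lambda>\<xi>. cmod (g\<beta> \<xi> * exp (- (of_real (1 - cmod t) * of_real \<xi>))))"
        by (intro integrable_norm int) (use t in simp)
      have "(\<lambda>n. g\<beta> \<xi> * exp (- of_real \<xi>) * s n \<xi>) \<longlonglongrightarrow> g\<beta> \<xi> * exp (- of_real \<xi>) * exp (- t * of_real \<xi>)" for \<xi>
        unfolding s_def using exp_converges[of "- t * of_real \<xi>"]
        by (intro tendsto_intros) (simp add: sums_def scaleR_conv_of_real divide_inverse mult.commute)
      moreover have "g\<beta> \<xi> * exp (- of_real \<xi>) * exp (- t * of_real \<xi>) = g\<beta> \<xi> * exp (- ((1 + t) * of_real \<xi>))" for \<xi>
        unfolding mult.assoc exp_add[symmetric] by (simp add: algebra_simps)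
      ultimately have "(\<lambda>n. g\<beta> \<xi> * exp (- of_real \<xi>) * s n \<xi>) \<longlonglongrightarrow> g\<beta> \<xi> * exp (- ((1 + t) * of_real \<xi>))" for \<xi>
        by (simp only:)
      then show "AE \<xi> in lpos. (\<lambda>n. g\<beta> \<xi> * exp (- of_real \<xi>) * s n \<xi>) \<longlonglongrightarrow> g\<beta> \<xi> * exp (- ((1 + t) * of_real \<xi>))"
        by (intro AE_I2)
      fix n
      show "AE \<xi> in lpos. cmod (g\<beta> \<xi> * exp (- of_real \<xi>) * s n \<xi>) \<le> cmod (g\<beta> \<xi> * exp (- (of_real (1 - cmod t) * of_real \<xi>)))"
      proof (rule AE_I2)
        fix \<xi> assume "\<xi> \<in> space lpos"
        then have \<xi>: "0 < \<xi>" by simp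
        have "cmod (s n \<xi>) \<le> (\<Sum>j<n. (cmod t * \<xi>) ^ j / fact j)"
          unfolding s_def using \<xi> by (intro sum_norm_le) (simp add: norm_divide norm_mult norm_power)
        also have "\<dots> \<le> exp (cmod t * \<xi>)"
          unfolding exp_def using \<xi> summable_exp[of "cmod t * \<xi>"]
          by (simp add: divide_inverse mult.commute) (intro sum_le_suminf; simp)
        finally have "cmod (g\<beta> \<xi>) * exp (- \<xi>) * cmod (s n \<xi>) \<le> cmod (g\<beta> \<xi>) * exp (- \<xi>) * exp (cmod t * \<xi>)"
          by (intro mult_left_mono) auto
        also have "\<dots> = cmod (g\<beta> \<xi>) * exp (- ((1 - cmod t) * \<xi>))"
          unfolding mult.assoc exp_add[symmetric] by (simp add: algebra_simps)
        finally show "cmod (g\<beta> \<xi> * exp (- of_real \<xi>) * s n \<xi>) \<le> cmod (g\<beta> \<xi> * exp (- (of_real (1 - cmod t) * of_real \<xi>)))"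
          by (simp add: norm_mult norm_exp_eq_Re)
      qed
    qed
    then have "(\<lambda>n::nat. 0) \<longlonglongrightarrow> L (1 + t)" unfolding z .
    then show ?thesis using LIMSEQ_unique tendsto_const by blast
  qed
  have L0: "L p = 0" if p: "0 < Re p" for p
  proof (rule analytic_continuation_open[of "ball 1 1" "{p. 0 < Re p}" L "\<lambda>_. 0"])
    show "open {p. 0 < Re p}" by (rule open_halfspace_Re_gt)
    show "connected {p. 0 < Re p}" by (intro convex_connected convex_halfspace_Re_gt)
    show "ball 1 1 \<subseteq> {p. 0 < Re p}"
    proof
      fix p :: complex assume "p \<in> ball 1 1"
      then have "cmod (1 - p) < 1" by (simp add: dist_norm)
      then show "p \<in> {p. 0 < Re p}" using abs_Re_le_cmod[of "1 - p"] by simp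
    qed
    show "L p = 0" if "p \<in> ball 1 1" for p
      using near[of "p - 1"] that by (simp add: dist_norm norm_minus_commute)
  qed (use hol p in auto)
  have "AE \<xi> in lpos. G \<xi> = 0"
  proof (rule lpos_exponentials_complete[of r])
    show "0 \<le> r" using \<beta> by (simp add: r_def)
    show "G \<in> L2_space lpos" by (rule G)
    fix \<theta> :: real
    have "ip lpos G (\<lambda>\<xi>. of_real \<xi> powr of_real r * exp (- ((1 + \<i> * of_real \<theta>) * of_real \<xi>))) = L (1 - \<i> * of_real \<theta>)"
      unfolding ip_def L_def
    proof (rule Bochner_Integration.integral_cong[OF refl])
      fix \<xi> assume "\<xi> \<in> space lpos"
      then have "cnj (of_real \<xi> powr of_real r) = (of_real \<xi> powr of_real r :: complex)"
        using powr_of_real[of \<xi> r] by simp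
      then show "G \<xi> * cnj (of_real \<xi> powr of_real r * exp (- ((1 + \<i> * of_real \<theta>) * of_real \<xi>))) = g\<beta> \<xi> * exp (- ((1 - \<i> * of_real \<theta>) * of_real \<xi>))"
        by (simp add: G_def g\<beta>_def split exp_cnj mult_ac)
    qed
    then show "ip lpos G (\<lambda>\<xi>. of_real \<xi> powr of_real r * exp (- ((1 + \<i> * of_real \<theta>) * of_real \<xi>))) = 0"
      using L0[of "1 - \<i> * of_real \<theta>"] by simp
  qed
  then show ?thesis
  proof (rule AE_mp[OF _ AE_I2], intro impI)
    fix \<xi> assume "\<xi> \<in> space lpos" "G \<xi> = 0"
    then show "g \<xi> = 0" using u1[of \<xi>] by (auto simp: G_def)
  qed
qed

section \<open>Moments of the Laguerre functions\<close>

text \<open>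
  Integrating term by term gives Gamma factors \<open>\<Gamma>(\<alpha> + j + k)/k!\<close>, which are multiples of the binomial coefficients of
  \<open>-(\<alpha> + j)\<close> over \<open>k\<close>; Vandermonde's convolution sums them against those in the Laguerre polynomial.
\<close>

theorem mom_lagf:
  fixes \<alpha> :: real
  assumes \<alpha>: "0 \<le> \<alpha>" and j: "1 \<le> j"
  shows "mom (lagf n \<alpha>) (of_real (\<alpha> / 2 + real j)) =
    of_real (Gamma (\<alpha> + real j) / 2 powr (\<alpha> + real j) * ((real n - real j) gchoose n))"
proof -
  define a where "a = \<alpha> + real j"
  have a: "0 < a" using \<alpha> j by (simp add: a_def)
  define K where "K k \<xi> = (of_real \<xi> powr (of_real (a + real k) - 1) * exp (- (of_real 2 * of_real \<xi>)) :: complex)" for k \<xi>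
  have K: "integrable lpos (K k)" "(LINT \<xi>|lpos. K k \<xi>) = of_real (Gamma (a + real k) / 2 powr (a + real k))" for k
  proof -
    have ak: "0 < Re (of_real (a + real k))" using a by simp
    show "integrable lpos (K k)" unfolding K_def by (rule Gamma_integral_lpos_real(1)[OF ak]) simp
    have "(LINT \<xi>|lpos. K k \<xi>) = Gamma (of_real (a + real k)) / of_real 2 powr of_real (a + real k)"
      unfolding K_def by (rule Gamma_integral_lpos_real(2)[OF ak]) simp
    also have "\<dots> = of_real (Gamma (a + real k) / 2 powr (a + real k))"
      using powr_of_real[of 2 "a + real k"] by (simp add: Gamma_complex_of_real del: of_real_add)
    finally show "(LINT \<xi>|lpos. K k \<xi>) = of_real (Gamma (a + real k) / 2 powr (a + real k))" .
  qed
  have "mom (lagf n \<alpha>) (of_real (\<alpha> / 2 + real j)) = (LINT \<xi>|lpos. (\<Sum>k=0..n. of_real (lagc n \<alpha> k) * K k \<xi>))"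
    unfolding mom_def
  proof (rule Bochner_Integration.integral_cong[OF refl])
    fix \<xi> assume "\<xi> \<in> space lpos"
    then have \<xi>: "0 < \<xi>" by simp
    have "of_real \<xi> powr of_real (\<alpha> / 2 + real k) * exp (- (1 * of_real \<xi>)) *
       (of_real \<xi> powr (of_real (\<alpha> / 2 + real j) - 1) * exp (- of_real \<xi>)) = K k \<xi>" for k
    proof -
      have e: "exp (- (of_real 2 * of_real \<xi>)) = exp (- (1 * of_real \<xi>)) * exp (- complex_of_real \<xi>)"
        unfolding exp_add[symmetric] by simp
      have p: "of_real (a + real k) - 1 = complex_of_real (\<alpha> / 2 + real k) + (of_real (\<alpha> / 2 + real j) - 1)"
        by (simp add: a_def)
      show ?thesis unfolding K_def e p powr_add by (simp only: mult_ac)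
    qed
    then show "lagf n \<alpha> \<xi> * (of_real \<xi> powr (of_real (\<alpha> / 2 + real j) - 1) * exp (- of_real \<xi>)) = (\<Sum>k=0..n. of_real (lagc n \<alpha> k) * K k \<xi>)"
      unfolding lagf_sum[OF \<xi>] sum_distrib_right by (intro sum.cong refl) (simp only: mult.assoc)
  qed
  also have "\<dots> = (\<Sum>k=0..n. of_real (lagc n \<alpha> k) * of_real (Gamma (a + real k) / 2 powr (a + real k)))"
    using K(1) unfolding K(2)[symmetric] by (subst Bochner_Integration.integral_sum) auto
  also have "\<dots> = of_real (\<Sum>k=0..n. lagc n \<alpha> k * (Gamma (a + real k) / 2 powr (a + real k)))" by simp
  also have "(\<Sum>k=0..n. lagc n \<alpha> k * (Gamma (a + real k) / 2 powr (a + real k))) =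
     (\<Sum>k=0..n. Gamma a / 2 powr a * ((- a gchoose k) * ((real n + \<alpha>) gchoose (n - k))))"
  proof (intro sum.cong refl)
    fix k
    have "pochhammer a k = Gamma (a + real k) / Gamma a"
      using a by (intro pochhammer_Gamma) (auto elim!: nonpos_Ints_cases)
    then have G: "Gamma (a + real k) = Gamma a * pochhammer a k"
      using Gamma_real_pos[OF a] by simp
    have P: "pochhammer a k = (-1) ^ k * fact k * (- a gchoose k)"
      unfolding gbinomial_pochhammer by simp
    show "lagc n \<alpha> k * (Gamma (a + real k) / 2 powr (a + real k)) = Gamma a / 2 powr a * ((- a gchoose k) * ((real n + \<alpha>) gchoose (n - k)))"
      unfolding lagc_def G P powr_add powr_realpow[OF zero_less_numeral] by (simp add: field_simps)
  qed
  also have "\<dots> = Gamma a / 2 powr a * ((- a + (real n + \<alpha>)) gchoose n)"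
    unfolding sum_distrib_left[symmetric] gbinomial_Vandermonde ..
  also have "- a + (real n + \<alpha>) = real n - real j" by (simp add: a_def)
  finally show ?thesis unfolding a_def .
qed

lemma mom_lagf_zero:
  assumes "0 \<le> \<alpha>" "1 \<le> j" "j \<le> n"
  shows "mom (lagf n \<alpha>) (of_real (\<alpha> / 2 + real j)) = 0"
proof -
  have "real n - real j = real (n - j)" using assms by (simp add: of_nat_diff)
  then have "(real n - real j) gchoose n = real ((n - j) choose n)" by (simp only: binomial_gbinomial)
  also have "\<dots> = 0" using assms by simp
  finally show ?thesis unfolding mom_lagf[OF assms(1,2)] by simp
qed

lemma gbinomial_neg_choose:
  assumes "1 \<le> j"
  shows "(real n - real j) gchoose n = (-1) ^ n * real ((j - 1) choose n)"
  using assms by (simp add: gbinomial_negated_upper[of "real n - real j"] of_nat_diff binomial_gbinomial)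

lemma mom_lagf_nonzero:
  assumes "0 \<le> \<alpha>"
  shows "mom (lagf n \<alpha>) (of_real (\<alpha> / 2 + real (n + 1))) \<noteq> 0"
proof -
  have "0 < \<alpha> + real (n + 1)" using assms by simp
  then have "0 < Gamma (\<alpha> + real (n + 1))" by (rule Gamma_real_pos)
  then have "Gamma (\<alpha> + real (n + 1)) \<noteq> 0" by simp
  then show ?thesis
    unfolding mom_lagf[OF assms le_add2] gbinomial_neg_choose[OF le_add2] by simp
qed

lemma mom_lagf_recurrence:
  assumes \<alpha>: "0 \<le> \<alpha>" and j: "1 \<le> j"
  shows "of_real (2 * (real j - real n)) * mom (lagf n \<alpha>) (of_real (\<alpha> / 2 + real (j + 1))) =
    of_real (real j * (\<alpha> + real j)) * mom (lagf n \<alpha>) (of_real (\<alpha> / 2 + real j))"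
proof -
  have a: "0 < \<alpha> + real j" using \<alpha> j by simp
  have G: "Gamma (\<alpha> + real (j + 1)) = (\<alpha> + real j) * Gamma (\<alpha> + real j)"
  proof -
    have "\<alpha> + real j \<notin> \<int>\<^sub>\<le>\<^sub>0" using a nonpos_Ints_nonpos by (meson not_le)
    from Gamma_plus1[OF this] show ?thesis by (simp add: add_ac)
  qed
  have P: "2 powr (\<alpha> + real (j + 1)) = 2 * 2 powr (\<alpha> + real j)" by (simp add: powr_add)
  have B: "(real j - real n) * real (j choose n) = real j * real ((j - 1) choose n)"
  proof (cases "n \<le> j")
    case True
    then show ?thesis using arg_cong[OF binomial_absorb_comp[of j n], of real] by (simp add: of_nat_diff)
  next
    case False
    then show ?thesis by (simp add: binomial_eq_0)
  qed
  have "2 * (real j - real n) * (Gamma (\<alpha> + real (j + 1)) / 2 powr (\<alpha> + real (j + 1)) * ((real n - real (j + 1)) gchoose n)) =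
     ((real j - real n) * real (j choose n)) * ((\<alpha> + real j) * Gamma (\<alpha> + real j) / 2 powr (\<alpha> + real j) * (-1) ^ n)"
    unfolding gbinomial_neg_choose[OF le_add2] G P by (simp add: field_simps)
  also have "\<dots> = real j * (\<alpha> + real j) * (Gamma (\<alpha> + real j) / 2 powr (\<alpha> + real j) * ((real n - real j) gchoose n))"
    unfolding B gbinomial_neg_choose[OF j] by simp
  finally show ?thesis
    unfolding mom_lagf[OF \<alpha> j] mom_lagf[OF \<alpha> le_add2] of_real_mult[symmetric] by (simp only:)
qed

section \<open>The recurrence for the moments\<close>

context
  fixes \<phi> :: "real \<Rightarrow> complex"
  assumes \<phi>m: "\<phi> \<in> borel_measurable lpos" and K: "(\<lambda>\<xi>. \<phi> \<xi> / of_real (sqrt \<xi>)) \<in> L2_space lpos"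
begin

lemma mom_kernel_split:
  assumes "0 < \<xi>"
  shows "\<phi> \<xi> * (of_real \<xi> powr (a - 1) * exp (- of_real \<xi>)) =
    \<phi> \<xi> / of_real (sqrt \<xi>) * (of_real \<xi> powr (a - 1 / 2) * exp (- (1 * of_real \<xi>)))"
proof -
  have "complex_of_real \<xi> powr (1 / 2) = of_real (sqrt \<xi>)"
    using powr_of_real[of \<xi> "1 / 2"] assms by (simp add: powr_half_sqrt)
  moreover have "a - 1 / 2 = (a - 1) + 1 / 2" by simp
  ultimately have "of_real \<xi> powr (a - 1 / 2) = of_real \<xi> powr (a - 1) * complex_of_real (sqrt \<xi>)"
    by (simp only: powr_add)
  then show ?thesis using assms by simp
qed

lemma mom_integrable_weighted:
  assumes "0 < Re a"
  shows "integrable lpos (\<lambda>\<xi>. \<phi> \<xi> * (of_real \<xi> powr (a - 1) * exp (- of_real \<xi>)))"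
proof (rule Bochner_Integration.integrable_cong[THEN iffD1, OF refl])
  show "integrable lpos (\<lambda>\<xi>. \<phi> \<xi> / of_real (sqrt \<xi>) * (of_real \<xi> powr (a - 1 / 2) * exp (- (1 * of_real \<xi>))))"
    by (rule L2_integrable_mult[OF K power_exp_L2]) (use assms in auto)
qed (simp add: mom_kernel_split)

text \<open>
  In the variable \<open>- ln \<xi>\<close> the Mellin transform is a Laplace transform.
\<close>

lemma mom_holomorphic: "mom \<phi> holomorphic_on {a. 0 < Re a}"
proof -
  have im [measurable]: "(\<lambda>\<xi>. \<xi>) \<in> borel_measurable lpos" by (rule measurable_ident_lpos)
  define g where "g \<xi> = \<phi> \<xi> * exp (- of_real \<xi>) / of_real \<xi>" for \<xi> :: real
  define u where "u \<xi> = - ln \<xi>" for \<xi> :: real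
  have gm: "g \<in> borel_measurable lpos" "u \<in> borel_measurable lpos"
    unfolding g_def u_def using \<phi>m by measurable
  have k: "\<phi> \<xi> * (of_real \<xi> powr (a - 1) * exp (- of_real \<xi>)) = g \<xi> * exp (- (a * of_real (u \<xi>)))" if \<xi>: "0 < \<xi>" for \<xi> a
  proof -
    have "of_real \<xi> powr (a - 1) = exp (a * of_real (ln \<xi>)) / complex_of_real \<xi>"
      using \<xi> by (simp add: powr_diff powr_def[of _ a] Ln_of_real mult.commute)
    then show ?thesis by (simp add: g_def u_def mult_ac)
  qed
  have "(\<lambda>a. LINT \<xi>|lpos. g \<xi> * exp (- (a * of_real (u \<xi>)))) holomorphic_on {a. 0 < Re a}"
  proof (rule holomorphic_exponential_integral[OF gm])
    fix a :: complex assume a: "0 < Re a"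
    show "integrable lpos (\<lambda>\<xi>. g \<xi> * exp (- (a * of_real (u \<xi>))))"
      by (rule Bochner_Integration.integrable_cong[THEN iffD1, OF refl _ mom_integrable_weighted[OF a]]) (simp add: k)
  qed
  moreover have "mom \<phi> = (\<lambda>a. LINT \<xi>|lpos. g \<xi> * exp (- (a * of_real (u \<xi>))))"
    unfolding mom_def by (intro ext Bochner_Integration.integral_cong refl) (simp add: k)
  ultimately show ?thesis by simp
qed

text \<open>
  The Cauchy--Schwarz inequality. The bound for the square grows only like the inverse of \<open>Re a\<close> at the imaginary
  axis, so that \<open>\<epsilon> m(\<nu> + \<epsilon>)\<close> still tends to zero there.
\<close>

lemma mom_growth:
  assumes a: "0 < Re a"
  shows "(cmod (mom \<phi> a))\<^sup>2 \<le> nrm2 lpos (\<lambda>\<xi>. \<phi> \<xi> / of_real (sqrt \<xi>)) * Gamma (2 * Re a)"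
proof -
  define k where "k \<xi> = (of_real \<xi> powr (a - 1 / 2) * exp (- (1 * of_real \<xi>)) :: complex)" for \<xi> :: real
  define r where "r = Re a"
  have k: "k \<in> L2_space lpos" unfolding k_def by (rule power_exp_L2) (use a in auto)
  have "complex_of_real (nrm2 lpos k) = (LINT \<xi>|lpos. of_real ((cmod (k \<xi>))\<^sup>2))"
    unfolding nrm2_def integral_complex_of_real ..
  also have "\<dots> = (LINT \<xi>|lpos. of_real \<xi> powr (of_real (2 * r) - 1) * exp (- (of_real 2 * of_real \<xi>)))"
  proof (rule Bochner_Integration.integral_cong[OF refl])
    fix \<xi> assume "\<xi> \<in> space lpos"
    then have \<xi>: "0 < \<xi>" by simp
    have "cmod (k \<xi>) = \<xi> powr (r - 1 / 2) * exp (- \<xi>)"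
      unfolding k_def norm_mult norm_powr_real_base[OF \<xi>] by (simp add: r_def norm_exp_eq_Re)
    then have "(cmod (k \<xi>))\<^sup>2 = \<xi> powr ((r - 1 / 2) + (r - 1 / 2)) * exp (- \<xi> + - \<xi>)"
      unfolding powr_add exp_add by (simp add: power2_eq_square)
    also have "\<dots> = \<xi> powr (2 * r - 1) * exp (- (2 * \<xi>))" by (simp add: algebra_simps)
    finally show "of_real ((cmod (k \<xi>))\<^sup>2) = of_real \<xi> powr (of_real (2 * r) - 1) * exp (- (of_real 2 * complex_of_real \<xi>))"
      using powr_of_real[of \<xi> "2 * r - 1"] \<xi> by (simp flip: exp_of_real)
  qed
  also have "\<dots> = Gamma (of_real (2 * r)) / of_real 2 powr of_real (2 * r)"
    by (rule Gamma_integral_lpos_real(2)) (use a in \<open>auto simp: r_def\<close>)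
  also have "\<dots> = of_real (Gamma (2 * r) / 2 powr (2 * r))"
    using powr_of_real[of 2 "2 * r"] by (simp only: Gamma_complex_of_real of_real_divide)
  finally have n: "nrm2 lpos k = Gamma (2 * r) / 2 powr (2 * r)" by (simp only: of_real_eq_iff)
  have G: "0 < Gamma (2 * r)" using a by (intro Gamma_real_pos) (simp add: r_def)
  have "1 \<le> (2::real) powr (2 * r)" using a by (intro ge_one_powr_ge_zero) (auto simp: r_def)
  then have n': "nrm2 lpos k \<le> Gamma (2 * r)" unfolding n using G by (simp add: divide_le_eq mult_le_cancel_left1)
  have "mom \<phi> a = ip lpos (\<lambda>\<xi>. \<phi> \<xi> / of_real (sqrt \<xi>)) (\<lambda>\<xi>. cnj (k \<xi>))"
    unfolding mom_def ip_def k_def by (rule Bochner_Integration.integral_cong[OF refl]) (simp add: mom_kernel_split)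
  then have "(cmod (mom \<phi> a))\<^sup>2 \<le> nrm2 lpos (\<lambda>\<xi>. \<phi> \<xi> / of_real (sqrt \<xi>)) * nrm2 lpos k"
    using L2_Cauchy_Schwarz[OF K L2_cnj[OF k]] by simp
  also have "\<dots> \<le> nrm2 lpos (\<lambda>\<xi>. \<phi> \<xi> / of_real (sqrt \<xi>)) * Gamma (2 * r)"
    by (intro mult_left_mono n') simp
  finally show ?thesis unfolding r_def .
qed

lemma recurrence_extends:
  assumes rec: "\<And>a. 3 \<le> a \<Longrightarrow> ((of_real a)\<^sup>2 - \<kappa>) * mom \<phi> (of_real a) + (of_real s - 2 * of_real a - 1) * mom \<phi> (of_real a + 1) = 0"
    and a: "0 < Re a"
  shows "(a\<^sup>2 - \<kappa>) * mom \<phi> a + (of_real s - 2 * a - 1) * mom \<phi> (a + 1) = 0"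
proof -
  define f where "f a = (a\<^sup>2 - \<kappa>) * mom \<phi> a + (of_real s - 2 * a - 1) * mom \<phi> (a + 1)" for a
  have "(\<lambda>a. mom \<phi> (a + 1)) holomorphic_on {a. 0 < Re a}"
    by (rule holomorphic_on_compose_gen[OF _ mom_holomorphic, of "\<lambda>a. a + 1", unfolded o_def])
      (auto intro!: holomorphic_intros)
  then have hol: "f holomorphic_on {a. 0 < Re a}"
    unfolding f_def by (intro holomorphic_intros mom_holomorphic)
  have "f a = 0"
  proof (rule analytic_continuation[OF hol, of "of_real ` {3..}" 4])
    show "open {a. 0 < Re a}" by (rule open_halfspace_Re_gt)
    show "connected {a. 0 < Re a}" by (intro convex_connected convex_halfspace_Re_gt)
    show "4 islimpt complex_of_real ` {3..}"
      unfolding islimpt_approachable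
    proof (intro allI impI)
      fix e :: real assume "0 < e"
      then show "\<exists>x'\<in>complex_of_real ` {3..}. x' \<noteq> 4 \<and> dist x' 4 < e"
        by (intro bexI[of _ "of_real (4 + e / 2)"]) (auto simp: dist_norm complex_eq_iff)
    qed
    show "f z = 0" if "z \<in> complex_of_real ` {3..}" for z using that rec by (auto simp: f_def)
  qed (use a in auto)
  then show ?thesis unfolding f_def .
qed

text \<open>
  For \<open>Re \<nu> > 0\<close> insert \<open>a = \<nu>\<close>. On the imaginary axis, where \<open>m\<close> may be singular, take \<open>a = \<nu> + \<epsilon>\<close>: the
  coefficient \<open>a\<^sup>2 - \<nu>\<^sup>2\<close> is of order \<open>\<epsilon>\<close> and \<open>m(a)\<close> of order at most \<open>\<epsilon>\<^bsup>-1/2\<^esup>\<close>.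
\<close>

lemma recurrence_at_exponent:
  assumes rec: "\<And>a. 0 < Re a \<Longrightarrow> (a\<^sup>2 - \<nu>\<^sup>2) * mom \<phi> a + (of_real s - 2 * a - 1) * mom \<phi> (a + 1) = 0"
    and \<nu>: "0 \<le> Re \<nu>"
  shows "(of_real s - 2 * \<nu> - 1) * mom \<phi> (\<nu> + 1) = 0"
proof (cases "0 < Re \<nu>")
  case True
  then show ?thesis using rec[of \<nu>] by simp
next
  case False
  then have \<nu>0: "Re \<nu> = 0" using \<nu> by simp
  define D where "D = nrm2 lpos (\<lambda>\<xi>. \<phi> \<xi> / of_real (sqrt \<xi>))"
  define e where "e n = 1 / real (Suc n)" for n
  have e0: "0 < e n" for n by (simp add: e_def)
  have elim: "e \<longlonglongrightarrow> 0" unfolding e_def using LIMSEQ_inverse_real_of_nat by (simp add: inverse_eq_divide)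
  define A where "A n = \<nu> + of_real (e n)" for n
  have A: "0 < Re (A n)" "Re (A n) = e n" for n using \<nu>0 e0[of n] by (simp_all add: A_def)
  have Alim: "A \<longlonglongrightarrow> \<nu> + of_real 0" unfolding A_def by (intro tendsto_intros elim)
  have bound: "(cmod (((A n)\<^sup>2 - \<nu>\<^sup>2) * mom \<phi> (A n)))\<^sup>2 \<le> e n * (cmod (2 * \<nu> + of_real (e n)))\<^sup>2 * (D * Gamma (1 + 2 * e n) / 2)" for n
  proof -
    have G: "2 * e n * Gamma (2 * e n) = Gamma (1 + 2 * e n)"
      using Gamma_plus1[of "2 * e n"] e0[of n] nonpos_Ints_nonpos[of "2 * e n"] by (force simp: add.commute)
    have "(A n)\<^sup>2 - \<nu>\<^sup>2 = of_real (e n) * (2 * \<nu> + of_real (e n))"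
      by (simp add: A_def power2_eq_square algebra_simps)
    then have "(cmod (((A n)\<^sup>2 - \<nu>\<^sup>2) * mom \<phi> (A n)))\<^sup>2 = (e n)\<^sup>2 * (cmod (2 * \<nu> + of_real (e n)))\<^sup>2 * (cmod (mom \<phi> (A n)))\<^sup>2"
      by (simp add: norm_mult power_mult_distrib)
    also have "\<dots> \<le> (e n)\<^sup>2 * (cmod (2 * \<nu> + of_real (e n)))\<^sup>2 * (D * Gamma (2 * e n))"
      using mom_growth[OF A(1)[of n]] unfolding A(2) D_def by (intro mult_left_mono) auto
    also have "\<dots> = e n * (cmod (2 * \<nu> + of_real (e n)))\<^sup>2 * (D * (2 * e n * Gamma (2 * e n)) / 2)"
      by (simp add: power2_eq_square)
    finally show ?thesis unfolding G .
  qed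
  have "(\<lambda>n. e n * (cmod (2 * \<nu> + of_real (e n)))\<^sup>2 * (D * Gamma (1 + 2 * e n) / 2)) \<longlonglongrightarrow>
     0 * (cmod (2 * \<nu> + of_real 0))\<^sup>2 * (D * Gamma (1 + 2 * 0) / 2)"
    by (intro tendsto_intros elim) simp_all
  then have lim: "(\<lambda>n. e n * (cmod (2 * \<nu> + of_real (e n)))\<^sup>2 * (D * Gamma (1 + 2 * e n) / 2)) \<longlonglongrightarrow> 0"
    by (simp only: mult_zero_left)
  have "(\<lambda>n. (cmod (((A n)\<^sup>2 - \<nu>\<^sup>2) * mom \<phi> (A n)))\<^sup>2) \<longlonglongrightarrow> 0"
    by (rule tendsto_sandwich[OF always_eventually always_eventually tendsto_const lim, OF allI allI[OF bound]])
      (rule zero_le_power2)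
  then have "(\<lambda>n. sqrt ((cmod (((A n)\<^sup>2 - \<nu>\<^sup>2) * mom \<phi> (A n)))\<^sup>2)) \<longlonglongrightarrow> sqrt 0"
    by (rule tendsto_real_sqrt)
  then have "(\<lambda>n. cmod (((A n)\<^sup>2 - \<nu>\<^sup>2) * mom \<phi> (A n))) \<longlonglongrightarrow> 0" by simp
  then have 1: "(\<lambda>n. ((A n)\<^sup>2 - \<nu>\<^sup>2) * mom \<phi> (A n)) \<longlonglongrightarrow> 0" by (rule tendsto_norm_zero_cancel)
  have "isCont (mom \<phi>) (\<nu> + of_real 0 + 1)"
    using holomorphic_on_imp_continuous_on[OF mom_holomorphic] \<nu>0
    by (intro continuous_on_interior[of "{a. 0 < Re a}"]) (auto simp: interior_open open_halfspace_Re_gt)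
  then have "(\<lambda>n. mom \<phi> (A n + 1)) \<longlonglongrightarrow> mom \<phi> (\<nu> + of_real 0 + 1)"
    by (rule isCont_tendsto_compose) (intro tendsto_intros Alim)
  then have "(\<lambda>n. ((A n)\<^sup>2 - \<nu>\<^sup>2) * mom \<phi> (A n) + (of_real s - 2 * A n - 1) * mom \<phi> (A n + 1)) \<longlonglongrightarrow>
     0 + (of_real s - 2 * (\<nu> + of_real 0) - 1) * mom \<phi> (\<nu> + of_real 0 + 1)"
    by (intro tendsto_intros 1 Alim)
  then show ?thesis unfolding rec[OF A(1)] using LIMSEQ_unique[OF tendsto_const] by fastforce
qed

end

text \<open>
  Along \<open>\<nu> + 1, \<nu> + 2, \<dots>\<close> the recurrence starts with zero, and it can leave zero only at a step where the coefficient of the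
  next moment vanishes. This must happen, for otherwise \<open>\<phi> = 0\<close>; it happens after \<open>n\<close> steps exactly when
  \<open>s = 2\<nu> + 2n + 1\<close>, which forces \<open>\<nu>\<close> to be real.
\<close>

theorem Laguerre_if_recurrence:
  fixes \<phi> :: "real \<Rightarrow> complex" and s :: real
  assumes \<phi>: "\<phi> \<in> L2_space lpos" and K: "(\<lambda>\<xi>. \<phi> \<xi> / of_real (sqrt \<xi>)) \<in> L2_space lpos" and nz: "\<not> (AE \<xi> in lpos. \<phi> \<xi> = 0)"
    and rec3: "\<And>a. 3 \<le> a \<Longrightarrow> ((of_real a)\<^sup>2 - \<kappa>) * mom \<phi> (of_real a) + (of_real s - 2 * of_real a - 1) * mom \<phi> (of_real a + 1) = 0"
  obtains n C where "0 \<le> s - 2 * real n - 1" "C \<noteq> 0" "AE \<xi> in lpos. \<phi> \<xi> = C * lagf n (s - 2 * real n - 1) \<xi>"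
proof -
  have \<phi>m: "\<phi> \<in> borel_measurable lpos" by (rule L2_measurable[OF \<phi>])
  define \<nu> where "\<nu> = csqrt \<kappa>"
  have \<nu>: "\<nu>\<^sup>2 = \<kappa>" "0 \<le> Re \<nu>" unfolding \<nu>_def by (rule power2_csqrt Re_csqrt)+
  have rec: "(a\<^sup>2 - \<kappa>) * mom \<phi> a + (of_real s - 2 * a - 1) * mom \<phi> (a + 1) = 0" if "0 < Re a" for a
    by (rule recurrence_extends[OF \<phi>m K rec3 that])
  define m where "m j = mom \<phi> (\<nu> + of_nat j)" for j
  \<comment> \<open>the case \<open>j = 0\<close> is the limit of the recurrence at \<open>\<nu>\<close>\<close>
  have mrec: "of_nat j * (2 * \<nu> + of_nat j) * m j = (2 * \<nu> + 2 * of_nat j + 1 - of_real s) * m (Suc j)" for j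
  proof (cases "j = 0")
    case True
    have "(of_real s - 2 * \<nu> - 1) * mom \<phi> (\<nu> + 1) = 0"
      by (rule recurrence_at_exponent[OF \<phi>m K _ \<nu>(2)]) (use rec \<nu>(1) in simp)
    moreover have "2 * \<nu> + 1 - of_real s = - (of_real s - 2 * \<nu> - 1)" by simp
    ultimately have "(2 * \<nu> + 1 - of_real s) * mom \<phi> (\<nu> + 1) = 0"
      by (simp only: mult_minus_left minus_zero)
    then show ?thesis using True by (simp add: m_def)
  next
    case False
    then have "0 < Re (\<nu> + of_nat j)" using \<nu>(2) by simp
    from rec[OF this] have "((\<nu> + of_nat j)\<^sup>2 - \<nu>\<^sup>2) * m j + (of_real s - 2 * (\<nu> + of_nat j) - 1) * m (Suc j) = 0"
      unfolding \<nu>(1) m_def by (simp add: add_ac)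
    moreover have "(\<nu> + of_nat j)\<^sup>2 - \<nu>\<^sup>2 = of_nat j * (2 * \<nu> + of_nat j)" by (simp add: power2_eq_square algebra_simps)
    ultimately show ?thesis by (simp add: algebra_simps)
  qed
  have vanish: "m (Suc j) = 0" if "\<And>i. i \<le> j \<Longrightarrow> of_real s \<noteq> 2 * \<nu> + 2 * of_nat i + 1" for j
    using that
  proof (induction j)
    case 0
    then show ?case using mrec[of 0] 0[of 0] by auto
  next
    case (Suc j)
    have "m (Suc j) = 0" by (rule Suc.IH) (use Suc.prems in auto)
    then show ?case using mrec[of "Suc j"] Suc.prems[of "Suc j"] by auto
  qed
  have "\<exists>n. of_real s = 2 * \<nu> + 2 * of_nat n + 1"
  proof (rule ccontr)
    assume "\<not> ?thesis"
    then have "m (Suc j) = 0" for j by (intro vanish) blast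
    then have "mom \<phi> (\<nu> + of_nat j + 1) = 0" for j by (simp add: m_def add_ac)
    then show False using moments_complete[OF \<phi> \<nu>(2)] nz by blast
  qed
  then obtain n where n: "of_real s = 2 * \<nu> + 2 * of_nat n + 1" ..
  define \<alpha> where "\<alpha> = s - 2 * real n - 1"
  have \<nu>\<alpha>: "\<nu> = of_real (\<alpha> / 2)" using n by (simp add: \<alpha>_def complex_eq_iff)
  have \<alpha>: "0 \<le> \<alpha>" "-1 < \<alpha>" using \<nu>(2) unfolding \<nu>\<alpha> by simp_all
  define l where "l j = mom (lagf n \<alpha>) (of_real (\<alpha> / 2 + real j))" for j
  have s': "2 * \<nu> + 2 * of_nat j + 1 - of_real s = of_real (2 * (real j - real n))" for j
    unfolding n by (simp add: algebra_simps)
  have c: "of_nat j * (2 * \<nu> + of_nat j) = of_real (real j * (\<alpha> + real j))" for j unfolding \<nu>\<alpha> by simp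
  \<comment> \<open>the first moment of the Laguerre function that is not zero\<close>
  define C where "C = m (Suc n) / l (Suc n)"
  have lnz: "l (Suc n) \<noteq> 0" unfolding l_def using mom_lagf_nonzero[OF \<alpha>(1), of n] by simp
  have eq: "m (Suc j) = C * l (Suc j)" for j
  proof (cases "n \<le> j")
    case False
    have "m (Suc j) = 0"
    proof (rule vanish)
      fix i assume "i \<le> j"
      then have "real i \<noteq> real n" using False by simp
      then have "of_real (2 * (real i - real n)) \<noteq> (0::complex)" by simp
      then show "of_real s \<noteq> 2 * \<nu> + 2 * of_nat i + 1" using s'[of i] by auto
    qed
    moreover have "l (Suc j) = 0" unfolding l_def by (rule mom_lagf_zero[OF \<alpha>(1)]) (use False in auto)
    ultimately show ?thesis by simp
  next
    case True
    then show ?thesis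
    proof (induction j rule: dec_induct)
      case base
      show ?case using lnz by (simp add: C_def)
    next
      case (step j)
      have "2 * (real (Suc j) - real n) \<noteq> 0" using step.hyps by simp
      then have nz2: "of_real (2 * (real (Suc j) - real n)) \<noteq> (0::complex)" by (simp only: of_real_eq_0_iff not_False_eq_True)
      have "of_real (2 * (real (Suc j) - real n)) * m (Suc (Suc j)) = of_real (real (Suc j) * (\<alpha> + real (Suc j))) * m (Suc j)"
        using mrec[of "Suc j"] unfolding s' c by (simp only:)
      also have "\<dots> = C * (of_real (real (Suc j) * (\<alpha> + real (Suc j))) * l (Suc j))" unfolding step.IH by (simp only: mult_ac)
      also have "\<dots> = C * (of_real (2 * (real (Suc j) - real n)) * l (Suc (Suc j)))"
        using mom_lagf_recurrence[OF \<alpha>(1), of "Suc j" n] unfolding l_def by (simp only: Suc_eq_plus1 le_add2)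
      also have "\<dots> = of_real (2 * (real (Suc j) - real n)) * (C * l (Suc (Suc j)))" by (simp only: mult_ac)
      finally show ?case using nz2 by (simp only: mult_cancel_left) simp
    qed
  qed
  have lag: "lagf n \<alpha> \<in> L2_space lpos" by (rule lagf_L2[OF \<alpha>(2)])
  define g where "g = (\<lambda>\<xi>. \<phi> \<xi> - C * lagf n \<alpha> \<xi>)"
  have g: "g \<in> L2_space lpos" unfolding g_def by (rule L2_diff[OF \<phi> L2_scale[OF lag]])
  have "AE \<xi> in lpos. g \<xi> = 0"
  proof (rule moments_complete[OF g \<nu>(2)])
    fix j
    have a: "1 / 2 < Re (\<nu> + of_nat j + 1)" using \<nu>(2) by simp
    have "mom g (\<nu> + of_nat j + 1) = mom \<phi> (\<nu> + of_nat j + 1) - C * mom (lagf n \<alpha>) (\<nu> + of_nat j + 1)"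
      using mom_integrable[OF \<phi> a] mom_integrable[OF lag a]
      unfolding mom_def g_def left_diff_distrib mult.assoc by (subst Bochner_Integration.integral_diff) auto
    also have "\<dots> = m (Suc j) - C * l (Suc j)" by (simp add: m_def l_def \<nu>\<alpha> add_ac)
    finally show "mom g (\<nu> + of_nat j + 1) = 0" unfolding eq by simp
  qed
  then have AE: "AE \<xi> in lpos. \<phi> \<xi> = C * lagf n \<alpha> \<xi>" by (simp add: g_def)
  have "C \<noteq> 0" using AE nz by auto
  then show ?thesis using that AE \<alpha>(1) unfolding \<alpha>_def by blast
qed

section \<open>Invariance under rotations forces a Laguerre function\<close>

text \<open>
  The relation between the integrals \<open>Jint\<close>, multiplied by \<open>\<Gamma>(a + b + 1)\<close>. The moments of a real function at real
  arguments are real, which removes the conjugation in \<open>Jint_wt\<close>.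
\<close>

lemma rot_eigenvector_moments:
  assumes H: "H \<in> L2_space lpos" "H \<in> borel_measurable borel" and real: "\<And>\<xi>. cnj (H \<xi>) = H \<xi>"
    and inv: "\<And>\<theta> z. sin \<theta> \<noteq> 0 \<Longrightarrow> z \<in> upper \<Longrightarrow>
      jfac s (rot \<theta>) z * wt H H (mob (rot \<theta>) z) = jfac s (rot \<theta>) \<i> * wt H H z"
    and ab: "3 \<le> a" "3 \<le> b"
  shows "of_real (a\<^sup>2 - b\<^sup>2) * (mom H (of_real a) * mom H (of_real b)) -
      of_real (s - 2 * b - 1) * (mom H (of_real a) * mom H (of_real (b + 1))) +
      of_real (s - 2 * a - 1) * (mom H (of_real (a + 1)) * mom H (of_real b)) = 0"
proof -
  have cm: "cnj (mom H (of_real r)) = mom H (of_real r)" for r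
    unfolding mom_def Bochner_Integration.integral_cnj[symmetric]
  proof (rule Bochner_Integration.integral_cong[OF refl])
    fix \<xi> assume "\<xi> \<in> space lpos"
    then have "of_real \<xi> powr (of_real r - 1) = complex_of_real (\<xi> powr (r - 1))"
      using powr_of_real[of \<xi> "r - 1"] by simp
    then show "cnj (H \<xi> * (of_real \<xi> powr (of_real r - 1) * exp (- of_real \<xi>))) = H \<xi> * (of_real \<xi> powr (of_real r - 1) * exp (- of_real \<xi>))"
      by (simp add: real exp_cnj)
  qed
  have F: "continuous_on upper (wt H H)" by (rule wt_continuous[OF H(1) H(1)])
  have Fb: "cmod (wt H H z) \<le> sqrt (nrm2 lpos H * nrm2 lpos H)" if "z \<in> upper" for z
    by (rule wt_bound[OF H(1) H(1)]) (use that in \<open>simp add: upper_def\<close>)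
  define G where "G = complex_of_real (Gamma (a + b))"
  define J1 J2 J3 where "J1 = Jint (wt H H) a b" and "J2 = Jint (wt H H) a (b + 1)" and "J3 = Jint (wt H H) (a + 1) b"
  have rel: "of_real (a - b) * J1 - of_real (s - 2 * b - 1) * J2 + of_real (s - 2 * a - 1) * J3 = 0"
    unfolding J1_def J2_def J3_def by (rule Jint_relation[OF F Fb inv ab])
  have ab': "3 \<le> a + 1" "3 \<le> b + 1" using ab by auto
  have "0 < a + b" using ab by linarith
  then have "a + b \<notin> \<int>\<^sub>\<le>\<^sub>0" using nonpos_Ints_nonpos by (meson not_le)
  from Gamma_plus1[OF this] have G1: "complex_of_real (Gamma (a + b + 1)) = of_real (a + b) * G"
    by (simp add: G_def)
  have M1: "G * J1 = mom H (of_real a) * mom H (of_real b)"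
    using Jint_wt[OF H ab] unfolding cm G_def J1_def by (simp only: Gamma_complex_of_real)
  have M2: "of_real (a + b) * G * J2 = mom H (of_real a) * mom H (of_real (b + 1))"
    using Jint_wt[OF H ab(1) ab'(2)] unfolding cm G1[symmetric] J2_def by (simp only: Gamma_complex_of_real add.assoc)
  have M3: "of_real (a + b) * G * J3 = mom H (of_real (a + 1)) * mom H (of_real b)"
  proof -
    have "a + 1 + b = a + b + 1" by simp
    then show ?thesis
      using Jint_wt[OF H ab'(1) ab(2)] unfolding cm G1[symmetric] J3_def by (simp only: Gamma_complex_of_real)
  qed
  have "complex_of_real (a\<^sup>2 - b\<^sup>2) = of_real (a + b) * of_real (a - b)"
    by (simp add: power2_eq_square algebra_simps)
  then have "of_real (a\<^sup>2 - b\<^sup>2) * (G * J1) - of_real (s - 2 * b - 1) * (of_real (a + b) * G * J2) +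
      of_real (s - 2 * a - 1) * (of_real (a + b) * G * J3) =
      of_real (a + b) * G * (of_real (a - b) * J1 - of_real (s - 2 * b - 1) * J2 + of_real (s - 2 * a - 1) * J3)"
    by (simp only: ring_distribs mult_ac)
  then show ?thesis unfolding M1 M2 M3 rel by simp
qed

text \<open>
  In the bilinear relation between the moments one argument \<open>b\<close> is fixed; the value of \<open>\<kappa>\<close> is what separating
  the variables yields. Some \<open>b\<close> with a nonzero moment exists by completeness.
\<close>

theorem rot_eigenvector_Laguerre:
  assumes H: "H \<in> L2_space lpos" "H \<in> borel_measurable borel" and real: "\<And>\<xi>. cnj (H \<xi>) = H \<xi>"
    and K: "(\<lambda>\<xi>. H \<xi> / of_real (sqrt \<xi>)) \<in> L2_space lpos" and nz: "\<not> (AE \<xi> in lpos. H \<xi> = 0)"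
    and inv: "\<And>\<theta> z. sin \<theta> \<noteq> 0 \<Longrightarrow> z \<in> upper \<Longrightarrow>
      jfac s (rot \<theta>) z * wt H H (mob (rot \<theta>) z) = jfac s (rot \<theta>) \<i> * wt H H z"
  obtains n C where "0 \<le> s - 2 * real n - 1" "C \<noteq> 0" "AE \<xi> in lpos. H \<xi> = C * lagf n (s - 2 * real n - 1) \<xi>"
proof -
  have "\<exists>j. mom H (2 + of_nat j + 1) \<noteq> 0" using moments_complete[OF H(1), of 2] nz by auto
  then obtain j where j: "mom H (2 + of_nat j + 1) \<noteq> 0" ..
  define b where "b = 3 + real j"
  have b: "3 \<le> b" by (simp add: b_def)
  define mb where "mb = mom H (of_real b)"
  have "complex_of_real b = 2 + of_nat j + 1" by (simp add: b_def)
  then have mb: "mb \<noteq> 0" using j unfolding mb_def by (simp only:) simp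
  define \<kappa> where "\<kappa> = (of_real (b\<^sup>2) * mb + of_real (s - 2 * b - 1) * mom H (of_real (b + 1))) / mb"
  have \<kappa>: "\<kappa> * mb = of_real (b\<^sup>2) * mb + of_real (s - 2 * b - 1) * mom H (of_real (b + 1))"
    using mb by (simp add: \<kappa>_def)
  show ?thesis
  proof (rule Laguerre_if_recurrence[OF H(1) K nz, of \<kappa> s])
    fix a :: real assume a: "3 \<le> a"
    define ma ma1 where "ma = mom H (of_real a)" and "ma1 = mom H (of_real (a + 1))"
    have "(((of_real a)\<^sup>2 - \<kappa>) * ma + (of_real s - 2 * of_real a - 1) * ma1) * mb =
      (of_real a)\<^sup>2 * (ma * mb) - ma * (\<kappa> * mb) + of_real (s - 2 * a - 1) * (ma1 * mb)"
      by (simp add: algebra_simps)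
    also have "\<dots> = of_real (a\<^sup>2 - b\<^sup>2) * (ma * mb) - of_real (s - 2 * b - 1) * (ma * mom H (of_real (b + 1))) +
      of_real (s - 2 * a - 1) * (ma1 * mb)"
      unfolding \<kappa> by (simp add: algebra_simps)
    also have "\<dots> = 0"
      unfolding ma_def ma1_def mb_def by (rule rot_eigenvector_moments[OF H real inv a b])
    finally have "((of_real a)\<^sup>2 - \<kappa>) * ma + (of_real s - 2 * of_real a - 1) * ma1 = 0" using mb by simp
    then show "((of_real a)\<^sup>2 - \<kappa>) * mom H (of_real a) + (of_real s - 2 * of_real a - 1) * mom H (of_real a + 1) = 0"
      by (simp add: ma_def ma1_def)
  qed (rule that)
qed

text \<open>
  The function \<open>wt H H\<close> belongs to the wavelet space, and so does its image under a rotation; both are continuous, so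
  that the almost everywhere identity becomes an identity and the eigenvector argument applies.
\<close>

theorem sigma_invariant_imp_psi:
  assumes A: "\<psi> \<in> class_A" and nz: "\<not> (AE t in lborel. \<psi> t = 0)" and adm: "admissible \<psi>"
    and inv: "sigma_invariant s (wavelet_space \<psi>)"
  shows "\<exists>(n::nat) (C::complex) (\<alpha>::real). C \<noteq> 0 \<and> \<alpha> = s - 2 * of_nat n - 1 \<and>
    is_psi n \<alpha> (psi n \<alpha>) \<and> (AE t in lborel. \<psi> t = C * psi n \<alpha> t)"
proof -
  have \<psi>H: "\<psi> \<in> H2" using A by (simp add: class_A_def)
  note \<psi>L = H2_L2[OF \<psi>H]
  note fo = is_fourier_fourier[OF \<psi>L]
  obtain h where h: "AE \<xi> in lborel. 0 < \<xi> \<longrightarrow> fourier \<psi> \<xi> = complex_of_real (h \<xi>)"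
    using A by (auto simp: class_A_def)
  have fm: "fourier \<psi> \<in> borel_measurable borel" by (rule fourier_measurable[OF \<psi>L])
  define H where "H \<xi> = complex_of_real (Re (fourier \<psi> \<xi>))" for \<xi>
  have Hm: "H \<in> borel_measurable borel" unfolding H_def using fm by measurable
  have eq: "AE \<xi> in lpos. fourier \<psi> \<xi> = H \<xi>"
    unfolding AE_lpos using h by eventually_elim (simp add: H_def)
  have HL: "H \<in> L2_space lpos"
    by (rule L2_cong_AE[OF L2_lpos_if_L2_lborel[OF fourier_L2[OF \<psi>L]] measurable_lpos[OF Hm] eq])
  have wt_eq: "wt (fourier \<psi>) \<phi> z = wt H \<phi> z" if "\<phi> \<in> L2_space lpos" "z \<in> upper" for \<phi> z
    by (rule wt_cong_wavelet[OF eq fm Hm L2_measurable[OF that(1)] that(2)])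
  have neg: "AE \<xi> in lborel. \<not> 0 < \<xi> \<longrightarrow> fourier f \<xi> = 0" if "f \<in> H2" for f
    using H2_fourier_posp[OF that] by eventually_elim (metis posp_def)
  have nzH: "\<not> (AE \<xi> in lpos. H \<xi> = 0)"
  proof
    assume "AE \<xi> in lpos. H \<xi> = 0"
    then have "AE \<xi> in lborel. fourier \<psi> \<xi> = 0"
      using eq neg[OF \<psi>H] unfolding AE_lpos by eventually_elim auto
    moreover have "is_fourier (\<lambda>t. 0 * \<psi> t) (\<lambda>\<xi>. 0 * fourier \<psi> \<xi>)" by (rule is_fourier_scale[OF \<psi>L fo])
    ultimately have "AE t in lborel. \<psi> t = 0"
      using is_fourier_injective[OF \<psi>L fo L2_zero, of "\<lambda>_. 0"] by simp
    then show False using nz by simp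
  qed
  define K where "K \<xi> = H \<xi> / of_real (sqrt \<xi>)" for \<xi>
  have im [measurable]: "(\<lambda>\<xi>. \<xi>) \<in> borel_measurable lpos" by (rule measurable_ident_lpos)
  have Km: "K \<in> borel_measurable lpos" unfolding K_def using measurable_lpos[OF Hm] by measurable
  have admK: "admc H = (\<integral>\<^sup>+\<xi>. ennreal ((cmod (K \<xi>))\<^sup>2) \<partial>lpos)"
    unfolding admc_def nn_integral_lpos
    by (rule nn_integral_cong) (simp add: K_def norm_divide power_divide indicator_def)
  have "admc H = admissibility_const \<psi>"
    unfolding admc_def admissibility_const_def
  proof (rule nn_integral_cong_AE)
    show "AE \<xi> in lborel. ennreal ((cmod (H \<xi>))\<^sup>2 / \<xi>) * indicator {0<..} \<xi> = ennreal ((cmod (fourier \<psi> \<xi>))\<^sup>2 / \<xi>) * indicator {0<..} \<xi>"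
      using eq unfolding AE_lpos by eventually_elim (auto simp: indicator_def)
  qed
  then have "admc H < \<infinity>" using adm by (simp add: admissible_def)
  then have KL: "K \<in> L2_space lpos" using Km unfolding admK by (rule L2_spaceI[rotated])
  define C where "C = nrm2 lpos K"
  have C: "admc H = ennreal C" unfolding admK C_def by (rule L2_nn_integral[OF KL])
  have C0: "0 < C"
  proof (rule ccontr)
    assume "\<not> 0 < C"
    then have "nrm2 lpos K = 0" using nrm2_nonneg[of lpos K] unfolding C_def by linarith
    then have "AE \<xi> in lpos. K \<xi> = 0" by (rule nrm2_eq_0[OF KL])
    then have "AE \<xi> in lpos. H \<xi> = 0"
      using AE_space[of lpos] by eventually_elim (auto simp: K_def)
    then show False using nzH by simp
  qed
  have FL: "wt H H \<in> L2_space mu" by (rule wt_isometry(1)[OF HL HL C less_imp_le[OF C0]])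
  have Fin: "wt H H \<in> wavelet_space \<psi>"
    unfolding wavelet_space_eq[OF \<psi>L] using FL HL AE_space[of mu] wt_eq[OF HL] by (auto intro!: bexI[of _ H])
  have cF: "continuous_on upper (wt H \<phi>)" if "\<phi> \<in> L2_space lpos" for \<phi> by (rule wt_continuous[OF that HL])
  have eig: "jfac s (rot \<theta>) z * wt H H (mob (rot \<theta>) z) = jfac s (rot \<theta>) \<i> * wt H H z" if z: "z \<in> upper" for \<theta> z
  proof -
    have "sigma s (rot \<theta>) (wt H H) \<in> wavelet_space \<psi>"
      using inv Fin rot_SL2R unfolding sigma_invariant_def by blast
    then obtain \<phi> where \<phi>: "\<phi> \<in> L2_space lpos" "AE z in mu. sigma s (rot \<theta>) (wt H H) z = wt (fourier \<psi>) \<phi> z"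
      unfolding wavelet_space_eq[OF \<psi>L] by blast
    have ae: "AE z in mu. wt H \<phi> z = jfac s (rot \<theta>) z * wt H H (mob (rot \<theta>) z)"
      using \<phi>(2) AE_space[of mu] by eventually_elim (simp add: sigma_eq wt_eq[OF \<phi>(1)])
    have cont: "continuous_on upper (\<lambda>z. jfac s (rot \<theta>) z * wt H H (mob (rot \<theta>) z))"
      using mob_upper[OF rot_SL2R]
      by (intro continuous_intros jfac_continuous[OF rot_SL2R] continuous_on_compose2[OF cF[OF HL] mob_continuous[OF rot_SL2R]]) auto
    have "wt H \<phi> w = jfac s (rot \<theta>) w * wt H H (mob (rot \<theta>) w)" if "w \<in> upper" for w
      by (rule continuous_AE_mu_eq[OF cF[OF \<phi>(1)] cont ae that])
    then show ?thesis by (rule stabilizer_eigenvector[OF HL Hm C C0 rot_SL2R mob_rot_i \<phi>(1) _ z])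
  qed
  obtain n c where n: "0 \<le> s - 2 * real n - 1" "c \<noteq> 0" "AE \<xi> in lpos. H \<xi> = c * lagf n (s - 2 * real n - 1) \<xi>"
    by (rule rot_eigenvector_Laguerre[OF HL Hm _ KL[unfolded K_def] nzH eig]) (simp add: H_def)
  define \<alpha> where "\<alpha> = s - 2 * real n - 1"
  have P: "is_psi n \<alpha> (psi n \<alpha>)" by (rule is_psi_psi) (use n(1) in \<open>simp add: \<alpha>_def\<close>)
  then have pH: "psi n \<alpha> \<in> H2" and pf: "AE \<xi> in lborel. 0 < \<xi> \<longrightarrow> fourier (psi n \<alpha>) \<xi> = lagf n \<alpha> \<xi>"
    by (auto simp: is_psi_def lagf_def)
  note pL = H2_L2[OF pH]
  have "AE \<xi> in lborel. fourier \<psi> \<xi> = c * fourier (psi n \<alpha>) \<xi>"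
    using eq[unfolded AE_lpos] n(3)[unfolded AE_lpos] pf neg[OF \<psi>H] neg[OF pH]
    by eventually_elim (auto simp: \<alpha>_def)
  then have "AE t in lborel. \<psi> t = c * psi n \<alpha> t"
    by (rule is_fourier_injective[OF \<psi>L fo L2_scale[OF pL] is_fourier_scale[OF pL is_fourier_fourier[OF pL]]])
  then show ?thesis using n(2) P \<alpha>_def by auto
qed

theorem theorem2p5:
  shows "(\<forall>(n::nat) (\<alpha>::real). 0 < \<alpha> \<longrightarrow>
            (\<forall>F \<in> wavelet_space (psi n \<alpha>). \<forall>g \<in> SL2R. tau n \<alpha> g F \<in> wavelet_space (psi n \<alpha>))) \<and>
         (\<forall>(s::real) (\<psi>::real \<Rightarrow> complex).
            \<psi> \<in> class_A \<and> \<not> (AE t in lborel. \<psi> t = 0) \<and> admissible \<psi> \<and>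
            sigma_invariant s (wavelet_space \<psi>) \<longrightarrow>
            (\<exists>(n::nat) (C::complex) (\<alpha>::real). C \<noteq> 0 \<and> \<alpha> = s - 2 * of_nat n - 1 \<and>
               is_psi n \<alpha> (psi n \<alpha>) \<and> (AE t in lborel. \<psi> t = C * psi n \<alpha> t)))"
  using tau_invariant sigma_invariant_imp_psi by blast

end
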